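(* Let $H$ be a closed subspace of $L^2(G\times Y)$ that is invariant under the translation representation $\rho_{G\times Y}$ of $G$, and suppose that $d_\xi=\dim(\widehat{H}_\xi)$ is finite for every $\xi$ in $\Omega$. Let $\mathcal{Z}=\int^\oplus_\Omega\mathbb{C}^{d_\xi\times d_\xi}\,\mathrm{d}\widehat{\nu}(\xi)$ and define $\Lambda\colon\mathcal{Z}\to\mathcal{V}$ by $\Lambda(\sigma)=R^\ast M_\sigma R$. Then $\Lambda$ is an isometric isomorphism of the W*-algebras $\mathcal{Z}$ and $\mathcal{V}$.
   Context: $G$ is a locally compact abelian group (written additively) with a Haar measure $\nu$, and $Y$ is a measure space with a measure $\lambda$. It is assumed that $G$ is $\sigma$-compact and metrizable, $\lambda$ is $\sigma$-finite, and $L^2(G,\nu)$ and $L^2(Y,\lambda)$ are separable. $G\times Y$ carries the product measure. $\widehat{G}$ is the dual group; $\widehat{\nu}$ is the dual Haar measure, so that the Fourier transform $(F_1f)(\xi)=\int_G\overline{\xi(x)}f(x)\,\mathrm{d}\nu(x)$ extends from $L^1(G)\cap L^2(G)$ to a unitary operator $F\colon L^2(G)\to L^2(\widehat{G},\widehat{\nu})$; $F\otimes I=F\otimes I_{L^2(Y)}\colon L^2(G\times Y)\to L^2(\widehat{G}\times Y)$. $(\rho_{G\times Y}(a)f)(u,v)=f(u-a,v)$; $P$ is the orthogonal projection of $L^2(G\times Y)$ onto $H$ (it commutes with all $\rho_{G\times Y}(a)$). $\rho_H(a)$ is the compression of $\rho_{G\times Y}(a)$ to $H$ and $\mathcal{V}=\{S\in\mathcal{B}(H)\colon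 \rho_H(a)S=S\rho_H(a)\ \forall a\in G\}$. $\widehat{H}=(F\otimes I)(H)$ and $\Phi\colon H\to\widehat{H}$, $\Phi f=(F\otimes I)f$. The projection $\widehat{P}=(F\otimes I)P(F\otimes I)^\ast$ decomposes as $\widehat{P}=\int^\oplus_{\widehat{G}}\widehat{P}_\xi\,\mathrm{d}\widehat{\nu}(\xi)$ with respect to $L^2(\widehat{G}\times Y)=\int^\oplus_{\widehat{G}}L^2(Y)\,\mathrm{d}\widehat{\nu}(\xi)$, for a (measurable) family $(\widehat{P}_\xi)_{\xi\in\widehat{G}}$ of orthogonal projections in $L^2(Y)$; such a family is fixed. $\widehat{H}_\xi=\widehat{P}_\xi(L^2(Y))$, $d_\xi=\dim(\widehat{H}_\xi)$, $\Omega=\{\xi\in\widehat{G}\colon d_\xi>0\}$. A family $(q_{j,\xi})_{j\in\mathbb{N},\xi\in\Omega}$ is fixed such that $(q_{j,\xi})_{j=1}^{d_\xi}$ is an orthonormal basis of $\widehat{H}_\xi$, $q_{j,\xi}=0$ for $j>d_\xi$, and $(\xi,v)\mapsto q_{j,\xi}(v)$ is measurable on $\Omega\times Y$ for each $j$. $\mathcal{X}=\int^\oplus_\Omega\mathbb{C}^{d_\xi}\,\mathrm{d}\widehat{\nu}(\xi)$ (square-integrable vector families, component-wise measurable on each set $\{\xi\in\Omega\colon d_\xi=m\}$, modulo a.e. equality). $N\colon\widehat{H}\to\mathcal{X}$ is the unitary operator $(Ng)(\xi)=\bigl[\int_Y\overline{q_{j,\xi}(v)}\,g(\xi,v)\,\mathrm{d}\lambda(v)\bigr]_{j=1}^{d_\xi}$,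 and $R=N\Phi\colon H\to\mathcal{X}$ (unitary). $\mathcal{Z}$ is the direct integral of the matrix algebras $\mathbb{C}^{d_\xi\times d_\xi}$ (essentially bounded measurable matrix families, norm $=\operatorname{ess\,sup}$ of operator norms), and for $\sigma\in\mathcal{Z}$, $M_\sigma$ acts in $\mathcal{X}$ by $(M_\sigma h)(\xi)=\sigma(\xi)h(\xi)$. *)

theory Defs
  imports
    "HOL-Analysis.Analysis"
    "HOL-Library.Extended_Nat"
    "Jordan_Normal_Form.Schur_Decomposition"
begin

hide_const (open) Inner_Product.inner

no_notation Finite_Cartesian_Product.vec_nth (infixl "$" 90)
no_notation Finite_Cartesian_Product.vec_lambda (binder "\<chi>" 10)

section \<open>Hilbert spaces and operators on carrier sets\<close>

text \<open>
  Whether an L2 space, a closed subspace, or a direct integral is meant depends on measures,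
  i.e. on values, so all spaces are records with an explicit carrier.
  Inner products are linear in the first argument.
\<close>

record 'v cspace =
  pts :: "'v set"
  vadd :: "'v \<Rightarrow> 'v \<Rightarrow> 'v"
  vzero :: 'v
  vscale :: "complex \<Rightarrow> 'v \<Rightarrow> 'v"

record 'v hspace = "'v cspace" +
  inner :: "'v \<Rightarrow> 'v \<Rightarrow> complex"

definition vdiff :: "('v, 'm) cspace_scheme \<Rightarrow> 'v \<Rightarrow> 'v \<Rightarrow> 'v" where
  "vdiff E x y = vadd E x (vscale E (-1) y)"

definition hnorm :: "('v, 'm) hspace_scheme \<Rightarrow> 'v \<Rightarrow> real" where
  "hnorm E x = sqrt (Re (inner E x x))"

definition separable_hspace :: "('v, 'm) hspace_scheme \<Rightarrow> bool" where
  "separable_hspace E \<longleftrightarrow>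
     (\<exists>D. countable D \<and> D \<subseteq> pts E \<and>
        (\<forall>x\<in>pts E. \<forall>e>0. \<exists>y\<in>D. hnorm E (vdiff E x y) < e))"

definition linear_map ::
  "('v, 'm) cspace_scheme \<Rightarrow> ('w, 'n) cspace_scheme \<Rightarrow> ('v \<Rightarrow> 'w) \<Rightarrow> bool" where
  "linear_map E K T \<longleftrightarrow>
     (\<forall>x\<in>pts E. T x \<in> pts K) \<and>
     (\<forall>x\<in>pts E. \<forall>y\<in>pts E. T (vadd E x y) = vadd K (T x) (T y)) \<and>
     (\<forall>c. \<forall>x\<in>pts E. T (vscale E c x) = vscale K c (T x))"

definition bounded_op ::
  "('v, 'm) hspace_scheme \<Rightarrow> ('w, 'n) hspace_scheme \<Rightarrow> ('v \<Rightarrow> 'w) \<Rightarrow> bool" where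
  "bounded_op E K T \<longleftrightarrow>
     linear_map E K T \<and> (\<exists>C. \<forall>x\<in>pts E. hnorm K (T x) \<le> C * hnorm E x)"

definition op_norm ::
  "('v, 'm) hspace_scheme \<Rightarrow> ('w, 'n) hspace_scheme \<Rightarrow> ('v \<Rightarrow> 'w) \<Rightarrow> real" where
  "op_norm E K T = Sup {hnorm K (T x) | x. x \<in> pts E \<and> hnorm E x \<le> 1}"

definition unitary_op ::
  "('v, 'm) hspace_scheme \<Rightarrow> ('w, 'n) hspace_scheme \<Rightarrow> ('v \<Rightarrow> 'w) \<Rightarrow> bool" where
  "unitary_op E K T \<longleftrightarrow>
     linear_map E K T \<and> T ` pts E = pts K \<and>
     (\<forall>x\<in>pts E. \<forall>y\<in>pts E. inner K (T x) (T y) = inner E x y)"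

definition adjoint ::
  "('v, 'm) hspace_scheme \<Rightarrow> ('w, 'n) hspace_scheme \<Rightarrow> ('v \<Rightarrow> 'w) \<Rightarrow> 'w \<Rightarrow> 'v" where
  "adjoint E K T =
     (\<lambda>y\<in>pts K. THE x. x \<in> pts E \<and> (\<forall>z\<in>pts E. inner K (T z) y = inner E z x))"

definition closed_subspace :: "('v, 'm) hspace_scheme \<Rightarrow> 'v set \<Rightarrow> bool" where
  "closed_subspace E W \<longleftrightarrow>
     W \<subseteq> pts E \<and> vzero E \<in> W \<and>
     (\<forall>x\<in>W. \<forall>y\<in>W. vadd E x y \<in> W) \<and>
     (\<forall>c. \<forall>x\<in>W. vscale E c x \<in> W) \<and>
     (\<forall>s. \<forall>x\<in>pts E. (\<forall>n. s n \<in> W) \<longrightarrow>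
        (\<lambda>n::nat. hnorm E (vdiff E (s n) x)) \<longlonglongrightarrow> 0 \<longrightarrow> x \<in> W)"

abbreviation subsp :: "('v, 'm) cspace_scheme \<Rightarrow> 'v set \<Rightarrow> ('v, 'm) cspace_scheme" where
  "subsp E W \<equiv> E\<lparr>pts := W\<rparr>"

definition projection_onto :: "('v, 'm) hspace_scheme \<Rightarrow> 'v set \<Rightarrow> 'v \<Rightarrow> 'v" where
  "projection_onto E W =
     (\<lambda>x\<in>pts E. THE w. w \<in> W \<and> (\<forall>z\<in>W. inner E (vdiff E x w) z = 0))"

definition is_orthogonal_projection :: "('v, 'm) hspace_scheme \<Rightarrow> ('v \<Rightarrow> 'v) \<Rightarrow> bool" where
  "is_orthogonal_projection E T \<longleftrightarrow>
     bounded_op E E T \<and> (\<forall>x\<in>pts E. T (T x) = T x) \<and>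
     (\<forall>x\<in>pts E. \<forall>y\<in>pts E. inner E (T x) y = inner E x (T y))"

definition orthonormal_basis ::
  "('v, 'm) hspace_scheme \<Rightarrow> 'v set \<Rightarrow> 'i set \<Rightarrow> ('i \<Rightarrow> 'v) \<Rightarrow> bool" where
  "orthonormal_basis E W J e \<longleftrightarrow>
     (\<forall>j\<in>J. e j \<in> W) \<and>
     (\<forall>i\<in>J. \<forall>j\<in>J. inner E (e i) (e j) = (if i = j then 1 else 0)) \<and>
     (\<forall>w\<in>W. (\<forall>j\<in>J. inner E w (e j) = 0) \<longrightarrow> w = vzero E)"

text \<open>Hilbert space dimension of a closed subspace, with all infinite cardinals identified.\<close>

definition hdim :: "('v, 'm) hspace_scheme \<Rightarrow> 'v set \<Rightarrow> enat" where
  "hdim E W = Sup {enat (card B) | B. finite B \<and> B \<subseteq> W \<and>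
     (\<forall>x\<in>B. \<forall>y\<in>B. inner E x y = (if x = y then 1 else 0))}"


section \<open>W*-algebras\<close>

record 'v nstar = "'v cspace" +
  mult :: "'v \<Rightarrow> 'v \<Rightarrow> 'v"
  unit :: 'v
  star :: "'v \<Rightarrow> 'v"
  nrm :: "'v \<Rightarrow> real"

locale complex_space =
  fixes A :: "('v, 'm) cspace_scheme"
  assumes add_closed: "\<lbrakk>x \<in> pts A; y \<in> pts A\<rbrakk> \<Longrightarrow> vadd A x y \<in> pts A"
    and zero_closed: "vzero A \<in> pts A"
    and scale_closed: "x \<in> pts A \<Longrightarrow> vscale A c x \<in> pts A"
    and add_assoc: "\<lbrakk>x \<in> pts A; y \<in> pts A; z \<in> pts A\<rbrakk> \<Longrightarrow>
      vadd A (vadd A x y) z = vadd A x (vadd A y z)"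
    and add_commute: "\<lbrakk>x \<in> pts A; y \<in> pts A\<rbrakk> \<Longrightarrow> vadd A x y = vadd A y x"
    and add_zero: "x \<in> pts A \<Longrightarrow> vadd A x (vzero A) = x"
    and add_inverse: "x \<in> pts A \<Longrightarrow> vadd A x (vscale A (-1) x) = vzero A"
    and scale_one: "x \<in> pts A \<Longrightarrow> vscale A 1 x = x"
    and scale_scale: "x \<in> pts A \<Longrightarrow> vscale A a (vscale A b x) = vscale A (a * b) x"
    and scale_add_left: "x \<in> pts A \<Longrightarrow>
      vscale A (a + b) x = vadd A (vscale A a x) (vscale A b x)"
    and scale_add_right: "\<lbrakk>x \<in> pts A; y \<in> pts A\<rbrakk> \<Longrightarrow>
      vscale A c (vadd A x y) = vadd A (vscale A c x) (vscale A c y)"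

text \<open>The zero algebra (in which the unit is zero) is allowed.\<close>

locale cstar_algebra = complex_space A for A :: "('v, 'm) nstar_scheme" +
  assumes mult_closed: "\<lbrakk>x \<in> pts A; y \<in> pts A\<rbrakk> \<Longrightarrow> mult A x y \<in> pts A"
    and mult_assoc: "\<lbrakk>x \<in> pts A; y \<in> pts A; z \<in> pts A\<rbrakk> \<Longrightarrow>
      mult A (mult A x y) z = mult A x (mult A y z)"
    and mult_add_left: "\<lbrakk>x \<in> pts A; y \<in> pts A; z \<in> pts A\<rbrakk> \<Longrightarrow>
      mult A (vadd A x y) z = vadd A (mult A x z) (mult A y z)"
    and mult_add_right: "\<lbrakk>x \<in> pts A; y \<in> pts A; z \<in> pts A\<rbrakk> \<Longrightarrow>
      mult A x (vadd A y z) = vadd A (mult A x y) (mult A x z)"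
    and mult_scale_left: "\<lbrakk>x \<in> pts A; y \<in> pts A\<rbrakk> \<Longrightarrow>
      mult A (vscale A c x) y = vscale A c (mult A x y)"
    and mult_scale_right: "\<lbrakk>x \<in> pts A; y \<in> pts A\<rbrakk> \<Longrightarrow>
      mult A x (vscale A c y) = vscale A c (mult A x y)"
    and unit_closed: "unit A \<in> pts A"
    and unit_left: "x \<in> pts A \<Longrightarrow> mult A (unit A) x = x"
    and unit_right: "x \<in> pts A \<Longrightarrow> mult A x (unit A) = x"
    and star_closed: "x \<in> pts A \<Longrightarrow> star A x \<in> pts A"
    and star_star: "x \<in> pts A \<Longrightarrow> star A (star A x) = x"
    and star_add: "\<lbrakk>x \<in> pts A; y \<in> pts A\<rbrakk> \<Longrightarrow> star A (vadd A x y) = vadd A (star A x) (star A y)"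
    and star_scale: "x \<in> pts A \<Longrightarrow> star A (vscale A c x) = vscale A (cnj c) (star A x)"
    and star_mult: "\<lbrakk>x \<in> pts A; y \<in> pts A\<rbrakk> \<Longrightarrow> star A (mult A x y) = mult A (star A y) (star A x)"
    and nrm_nonneg: "x \<in> pts A \<Longrightarrow> 0 \<le> nrm A x"
    and nrm_eq_zero: "x \<in> pts A \<Longrightarrow> nrm A x = 0 \<longleftrightarrow> x = vzero A"
    and nrm_triangle: "\<lbrakk>x \<in> pts A; y \<in> pts A\<rbrakk> \<Longrightarrow> nrm A (vadd A x y) \<le> nrm A x + nrm A y"
    and nrm_scale: "x \<in> pts A \<Longrightarrow> nrm A (vscale A c x) = cmod c * nrm A x"
    and nrm_mult: "\<lbrakk>x \<in> pts A; y \<in> pts A\<rbrakk> \<Longrightarrow> nrm A (mult A x y) \<le> nrm A x * nrm A y"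
    and cstar_identity: "x \<in> pts A \<Longrightarrow> nrm A (mult A (star A x) x) = (nrm A x)\<^sup>2"
    and complete: "\<lbrakk>\<And>n::nat. s n \<in> pts A;
        \<And>e. e > 0 \<Longrightarrow> \<exists>n0. \<forall>m\<ge>n0. \<forall>n\<ge>n0. nrm A (vdiff A (s m) (s n)) < e\<rbrakk> \<Longrightarrow>
      \<exists>x\<in>pts A. (\<lambda>n. nrm A (vdiff A (s n) x)) \<longlonglongrightarrow> 0"

definition bounded_functional :: "('v, 'm) nstar_scheme \<Rightarrow> ('v \<Rightarrow> complex) \<Rightarrow> bool" where
  "bounded_functional A f \<longleftrightarrow>
     (\<forall>x\<in>pts A. \<forall>y\<in>pts A. f (vadd A x y) = f x + f y) \<and>
     (\<forall>c. \<forall>x\<in>pts A. f (vscale A c x) = c * f x) \<and>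
     (\<exists>C. \<forall>x\<in>pts A. cmod (f x) \<le> C * nrm A x)"

definition functional_norm :: "('v, 'm) nstar_scheme \<Rightarrow> ('v \<Rightarrow> complex) \<Rightarrow> real" where
  "functional_norm A f = Sup {cmod (f x) | x. x \<in> pts A \<and> nrm A x \<le> 1}"

text \<open>
  A predual of a Banach space, realised through its canonical embedding in the dual: a norm-closed
  space of bounded functionals such that evaluation is an isometric isomorphism onto its dual.
  Functionals are total functions of which only the values on the carrier matter.
\<close>

definition is_predual :: "('v, 'm) nstar_scheme \<Rightarrow> ('v \<Rightarrow> complex) set \<Rightarrow> bool" where
  "is_predual A D \<longleftrightarrow>
     D \<noteq> {} \<and> (\<forall>f\<in>D. bounded_functional A f) \<and>
     (\<forall>f\<in>D. \<forall>g\<in>D. (\<lambda>x. f x + g x) \<in> D) \<and>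
     (\<forall>c. \<forall>f\<in>D. (\<lambda>x. c * f x) \<in> D) \<and>
     (\<forall>s f. (\<forall>n. s n \<in> D) \<longrightarrow> bounded_functional A f \<longrightarrow>
        (\<lambda>n::nat. functional_norm A (\<lambda>x. s n x - f x)) \<longlonglongrightarrow> 0 \<longrightarrow> f \<in> D) \<and>
     (\<forall>x\<in>pts A. nrm A x = Sup {cmod (f x) | f. f \<in> D \<and> functional_norm A f \<le> 1}) \<and>
     (\<forall>L :: ('v \<Rightarrow> complex) \<Rightarrow> complex.
        (\<forall>f\<in>D. \<forall>g\<in>D. L (\<lambda>x. f x + g x) = L f + L g) \<longrightarrow>
        (\<forall>c. \<forall>f\<in>D. L (\<lambda>x. c * f x) = c * L f) \<longrightarrow>
        (\<exists>C. \<forall>f\<in>D. cmod (L f) \<le> C * functional_norm A f) \<longrightarrow>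
        (\<exists>x\<in>pts A. \<forall>f\<in>D. L f = f x))"

text \<open>Sakai's abstract definition.\<close>

locale wstar_algebra = cstar_algebra A for A :: "('v, 'm) nstar_scheme" +
  assumes has_predual: "\<exists>D. is_predual A D"

definition isometric_star_isomorphism ::
  "('v, 'm) nstar_scheme \<Rightarrow> ('w, 'n) nstar_scheme \<Rightarrow> ('v \<Rightarrow> 'w) \<Rightarrow> bool" where
  "isometric_star_isomorphism A B h \<longleftrightarrow>
     linear_map A B h \<and> bij_betw h (pts A) (pts B) \<and>
     (\<forall>x\<in>pts A. \<forall>y\<in>pts A. h (mult A x y) = mult B (h x) (h y)) \<and>
     h (unit A) = unit B \<and>
     (\<forall>x\<in>pts A. h (star A x) = star B (h x)) \<and>
     (\<forall>x\<in>pts A. nrm B (h x) = nrm A x)"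

definition isometric_wstar_isomorphism ::
  "('v, 'm) nstar_scheme \<Rightarrow> ('w, 'n) nstar_scheme \<Rightarrow> ('v \<Rightarrow> 'w) \<Rightarrow> bool" where
  "isometric_wstar_isomorphism A B h \<longleftrightarrow>
     wstar_algebra A \<and> wstar_algebra B \<and> isometric_star_isomorphism A B h"

definition bounded_operators :: "('v, 'm) hspace_scheme \<Rightarrow> ('v \<Rightarrow> 'v) nstar" where
  "bounded_operators E =
     \<lparr>pts = {T \<in> extensional (pts E). bounded_op E E T},
      vadd = (\<lambda>S T. \<lambda>x\<in>pts E. vadd E (S x) (T x)),
      vzero = (\<lambda>x\<in>pts E. vzero E),
      vscale = (\<lambda>c T. \<lambda>x\<in>pts E. vscale E c (T x)),
      mult = compose (pts E),
      unit = (\<lambda>x\<in>pts E. x),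
      star = adjoint E E,
      nrm = op_norm E E\<rparr>"

definition commutant ::
  "('v, 'm) hspace_scheme \<Rightarrow> ('v \<Rightarrow> 'v) set \<Rightarrow> ('v \<Rightarrow> 'v) nstar" where
  "commutant E X = subsp (bounded_operators E)
     {S \<in> pts (bounded_operators E). \<forall>T\<in>X. compose (pts E) T S = compose (pts E) S T}"


section \<open>L2 spaces and direct integrals\<close>

text \<open>Elements are classes, modulo almost everywhere equality, within a set \<open>F\<close> of functions.\<close>

definition ae_class :: "'x measure \<Rightarrow> ('x \<Rightarrow> 'b) set \<Rightarrow> ('x \<Rightarrow> 'b) \<Rightarrow> ('x \<Rightarrow> 'b) set" where
  "ae_class M F f = {g \<in> F. AE x in M. g x = f x}"

definition rep :: "('x \<Rightarrow> 'b) set \<Rightarrow> 'x \<Rightarrow> 'b" where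
  "rep c = (SOME f. f \<in> c)"

definition sq_int :: "'x measure \<Rightarrow> ('x \<Rightarrow> complex) set" where
  "sq_int M = {f \<in> borel_measurable M. integrable M (\<lambda>x. (cmod (f x))\<^sup>2)}"

abbreviation L2_class :: "'x measure \<Rightarrow> ('x \<Rightarrow> complex) \<Rightarrow> ('x \<Rightarrow> complex) set" where
  "L2_class M \<equiv> ae_class M (sq_int M)"

definition L2 :: "'x measure \<Rightarrow> ('x \<Rightarrow> complex) set hspace" where
  "L2 M =
     \<lparr>pts = L2_class M ` sq_int M,
      vadd = (\<lambda>a b. L2_class M (\<lambda>x. rep a x + rep b x)),
      vzero = L2_class M (\<lambda>x. 0),
      vscale = (\<lambda>c a. L2_class M (\<lambda>x. c * rep a x)),
      inner = (\<lambda>a b. \<integral>x. rep a x * cnj (rep b x) \<partial>M)\<rparr>"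

text \<open>
  Direct integrals over \<open>M\<close> of the spaces of complex vectors, and of the algebras of complex
  square matrices, of dimension \<open>d x\<close>.
\<close>

definition vec_fields :: "'x measure \<Rightarrow> ('x \<Rightarrow> nat) \<Rightarrow> ('x \<Rightarrow> complex Matrix.vec) set" where
  "vec_fields M d = {h.
     (\<forall>x\<in>space M. h x \<in> carrier_vec (d x)) \<and>
     (\<forall>m. \<forall>j<m. (\<lambda>x. h x $ j) \<in> borel_measurable (restrict_space M {x \<in> space M. d x = m})) \<and>
     integrable M (\<lambda>x. Re (h x \<bullet>c h x))}"

abbreviation vec_class ::
  "'x measure \<Rightarrow> ('x \<Rightarrow> nat) \<Rightarrow> ('x \<Rightarrow> complex Matrix.vec) \<Rightarrow> ('x \<Rightarrow> complex Matrix.vec) set" where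
  "vec_class M d \<equiv> ae_class M (vec_fields M d)"

definition vec_direct_integral ::
  "'x measure \<Rightarrow> ('x \<Rightarrow> nat) \<Rightarrow> ('x \<Rightarrow> complex Matrix.vec) set hspace" where
  "vec_direct_integral M d =
     \<lparr>pts = vec_class M d ` vec_fields M d,
      vadd = (\<lambda>a b. vec_class M d (\<lambda>x. rep a x + rep b x)),
      vzero = vec_class M d (\<lambda>x. 0\<^sub>v (d x)),
      vscale = (\<lambda>c a. vec_class M d (\<lambda>x. c \<cdot>\<^sub>v rep a x)),
      inner = (\<lambda>a b. \<integral>x. rep a x \<bullet>c rep b x \<partial>M)\<rparr>"

definition mat_norm :: "complex Matrix.mat \<Rightarrow> real" where
  "mat_norm A = Sup {sqrt (Re ((A *\<^sub>v u) \<bullet>c (A *\<^sub>v u))) | u.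
     u \<in> carrier_vec (dim_col A) \<and> Re (u \<bullet>c u) \<le> 1}"

definition mat_fields :: "'x measure \<Rightarrow> ('x \<Rightarrow> nat) \<Rightarrow> ('x \<Rightarrow> complex Matrix.mat) set" where
  "mat_fields M d = {s.
     (\<forall>x\<in>space M. s x \<in> carrier_mat (d x) (d x)) \<and>
     (\<forall>m. \<forall>i<m. \<forall>j<m.
        (\<lambda>x. s x $$ (i, j)) \<in> borel_measurable (restrict_space M {x \<in> space M. d x = m})) \<and>
     (\<exists>C. AE x in M. mat_norm (s x) \<le> C)}"

abbreviation mat_class ::
  "'x measure \<Rightarrow> ('x \<Rightarrow> nat) \<Rightarrow> ('x \<Rightarrow> complex Matrix.mat) \<Rightarrow> ('x \<Rightarrow> complex Matrix.mat) set" where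
  "mat_class M d \<equiv> ae_class M (mat_fields M d)"

definition mat_direct_integral ::
  "'x measure \<Rightarrow> ('x \<Rightarrow> nat) \<Rightarrow> ('x \<Rightarrow> complex Matrix.mat) set nstar" where
  "mat_direct_integral M d =
     \<lparr>pts = mat_class M d ` mat_fields M d,
      vadd = (\<lambda>a b. mat_class M d (\<lambda>x. rep a x + rep b x)),
      vzero = mat_class M d (\<lambda>x. 0\<^sub>m (d x) (d x)),
      vscale = (\<lambda>c a. mat_class M d (\<lambda>x. c \<cdot>\<^sub>m rep a x)),
      mult = (\<lambda>a b. mat_class M d (\<lambda>x. rep a x * rep b x)),
      unit = mat_class M d (\<lambda>x. 1\<^sub>m (d x)),
      star = (\<lambda>a. mat_class M d (\<lambda>x. mat_adjoint (rep a x))),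
      nrm = (\<lambda>a. Inf {C. 0 \<le> C \<and> (AE x in M. mat_norm (rep a x) \<le> C)})\<rparr>"

definition mult_op ::
  "'x measure \<Rightarrow> ('x \<Rightarrow> nat) \<Rightarrow> ('x \<Rightarrow> complex Matrix.mat) set \<Rightarrow>
   ('x \<Rightarrow> complex Matrix.vec) set \<Rightarrow> ('x \<Rightarrow> complex Matrix.vec) set" where
  "mult_op M d s h = vec_class M d (\<lambda>x. rep s x *\<^sub>v rep h x)"


section \<open>Harmonic analysis on the group\<close>

definition sigma_compact_space :: "'x topology \<Rightarrow> bool" where
  "sigma_compact_space T \<longleftrightarrow>
     (\<exists>K :: nat \<Rightarrow> 'x set. (\<forall>n. compactin T (K n)) \<and> (\<Union>n. K n) = topspace T)"

text \<open>
  A Haar measure for the group operation \<open>op\<close> on \<open>topspace T\<close>: a nonzero translation-invariant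
  Radon measure on the Borel sets of \<open>T\<close>.
\<close>

definition haar_measure :: "'x topology \<Rightarrow> ('x \<Rightarrow> 'x \<Rightarrow> 'x) \<Rightarrow> 'x measure \<Rightarrow> bool" where
  "haar_measure T op M \<longleftrightarrow>
     space M = topspace T \<and> sets M = sigma_sets (topspace T) {U. openin T U} \<and>
     emeasure M (space M) \<noteq> 0 \<and>
     (\<forall>a\<in>topspace T. \<forall>B\<in>sets M. emeasure M (op a ` B) = emeasure M B) \<and>
     (\<forall>K. compactin T K \<longrightarrow> emeasure M K < \<infinity>) \<and>
     (\<forall>B\<in>sets M. emeasure M B = (INF U\<in>{U. openin T U \<and> B \<subseteq> U}. emeasure M U)) \<and>
     (\<forall>U. openin T U \<longrightarrow> emeasure M U = (SUP K\<in>{K. compactin T K \<and> K \<subseteq> U}. emeasure M K))"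

definition dual_group :: "('g::topological_ab_group_add \<Rightarrow> complex) set" where
  "dual_group = {\<xi>. continuous_on UNIV \<xi> \<and> (\<forall>x. cmod (\<xi> x) = 1) \<and>
     (\<forall>x y. \<xi> (x + y) = \<xi> x * \<xi> y)}"

definition dual_topology :: "('g::topological_ab_group_add \<Rightarrow> complex) topology" where
  "dual_topology = topology_generated_by
     {{\<xi> \<in> dual_group. \<xi> ` K \<subseteq> U} | K U. compact K \<and> open U}"

definition dual_mult :: "('g \<Rightarrow> complex) \<Rightarrow> ('g \<Rightarrow> complex) \<Rightarrow> 'g \<Rightarrow> complex" where
  "dual_mult \<xi> \<eta> = (\<lambda>x. \<xi> x * \<eta> x)"

definition fourier1 :: "'g measure \<Rightarrow> ('g \<Rightarrow> complex) \<Rightarrow> ('g \<Rightarrow> complex) \<Rightarrow> complex" where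
  "fourier1 \<nu> f \<xi> = (\<integral>x. cnj (\<xi> x) * f x \<partial>\<nu>)"

text \<open>The existence of such an \<open>F\<close> is the normalisation of \<open>\<nu>'\<close> as the measure dual to \<open>\<nu>\<close>.\<close>

definition fourier_plancherel ::
  "'g measure \<Rightarrow> ('g \<Rightarrow> complex) measure \<Rightarrow>
   (('g \<Rightarrow> complex) set \<Rightarrow> (('g \<Rightarrow> complex) \<Rightarrow> complex) set) \<Rightarrow> bool" where
  "fourier_plancherel \<nu> \<nu>' F \<longleftrightarrow>
     unitary_op (L2 \<nu>) (L2 \<nu>') F \<and>
     (\<forall>f \<in> sq_int \<nu>. integrable \<nu> f \<longrightarrow>
        fourier1 \<nu> f \<in> sq_int \<nu>' \<and> F (L2_class \<nu> f) = L2_class \<nu>' (fourier1 \<nu> f))"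

text \<open>\<open>W\<close> is the bounded operator \<open>T \<otimes> S\<close>, characterised by its values on elementary tensors.\<close>

definition elem_tensor ::
  "'x measure \<Rightarrow> 'y measure \<Rightarrow> ('x \<Rightarrow> complex) set \<Rightarrow> ('y \<Rightarrow> complex) set \<Rightarrow>
   ('x \<times> 'y \<Rightarrow> complex) set" where
  "elem_tensor M N a b = L2_class (M \<Otimes>\<^sub>M N) (\<lambda>(x, y). rep a x * rep b y)"

definition is_tensor_op where
  "is_tensor_op M N M' N' T S W \<longleftrightarrow>
     bounded_op (L2 (M \<Otimes>\<^sub>M N)) (L2 (M' \<Otimes>\<^sub>M N')) W \<and>
     (\<forall>a\<in>pts (L2 M). \<forall>b\<in>pts (L2 N).
        W (elem_tensor M N a b) = elem_tensor M' N' (T a) (S b))"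

definition slice :: "'y measure \<Rightarrow> ('x \<times> 'y \<Rightarrow> complex) set \<Rightarrow> 'x \<Rightarrow> ('y \<Rightarrow> complex) set" where
  "slice N a x = L2_class N (\<lambda>y. rep a (x, y))"

text \<open>
  \<open>T\<close> is the direct integral of the measurable operator field \<open>t\<close>, where the L2 space of the
  product is the direct integral of copies of \<open>L2 N\<close>. The slice of an L2 function is square
  integrable for almost every \<open>x\<close>.
\<close>

definition is_direct_integral_of ::
  "'x measure \<Rightarrow> 'y measure \<Rightarrow> (('x \<times> 'y \<Rightarrow> complex) set \<Rightarrow> ('x \<times> 'y \<Rightarrow> complex) set) \<Rightarrow>
   ('x \<Rightarrow> ('y \<Rightarrow> complex) set \<Rightarrow> ('y \<Rightarrow> complex) set) \<Rightarrow> bool" where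
  "is_direct_integral_of M N T t \<longleftrightarrow>
     (\<forall>a\<in>pts (L2 N). \<forall>b\<in>pts (L2 N). (\<lambda>x. inner (L2 N) (t x a) b) \<in> borel_measurable M) \<and>
     (\<forall>a\<in>pts (L2 (M \<Otimes>\<^sub>M N)). AE x in M. slice N (T a) x = t x (slice N a x))"


section \<open>The translation representation and its commutant\<close>

definition translation ::
  "'g::topological_ab_group_add measure \<Rightarrow> 'y measure \<Rightarrow> 'g \<Rightarrow>
   ('g \<times> 'y \<Rightarrow> complex) set \<Rightarrow> ('g \<times> 'y \<Rightarrow> complex) set" where
  "translation \<nu> lam a f = L2_class (\<nu> \<Otimes>\<^sub>M lam) (\<lambda>(u, v). rep f (u - a, v))"

definition compressed_translation where
  "compressed_translation \<nu> lam H a =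
     (\<lambda>f\<in>H. projection_onto (L2 (\<nu> \<Otimes>\<^sub>M lam)) H (translation \<nu> lam a f))"

definition translation_invariant_operators where
  "translation_invariant_operators \<nu> lam H =
     commutant (subsp (L2 (\<nu> \<Otimes>\<^sub>M lam)) H) (range (compressed_translation \<nu> lam H))"

definition hat_projection where
  "hat_projection \<nu> lam \<nu>' FI H f =
     FI (projection_onto (L2 (\<nu> \<Otimes>\<^sub>M lam)) H
       (adjoint (L2 (\<nu> \<Otimes>\<^sub>M lam)) (L2 (\<nu>' \<Otimes>\<^sub>M lam)) FI f))"

definition fiber where
  "fiber lam Phat \<xi> = Phat \<xi> ` pts (L2 lam)"

definition fiber_dim where
  "fiber_dim lam Phat \<xi> = hdim (L2 lam) (fiber lam Phat \<xi>)"

definition Omega where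
  "Omega \<nu>' lam Phat = {\<xi> \<in> space \<nu>'. fiber_dim lam Phat \<xi> > 0}"

text \<open>Indices start at 0.\<close>

definition is_fiber_basis where
  "is_fiber_basis \<nu>' lam Phat q \<longleftrightarrow>
     (\<forall>j. (\<lambda>(\<xi>, v). q j \<xi> v)
        \<in> borel_measurable (restrict_space \<nu>' (Omega \<nu>' lam Phat) \<Otimes>\<^sub>M lam)) \<and>
     (\<forall>\<xi>\<in>Omega \<nu>' lam Phat.
        (\<forall>j. q j \<xi> \<in> sq_int lam) \<and>
        orthonormal_basis (L2 lam) (fiber lam Phat \<xi>)
          {j. enat j < fiber_dim lam Phat \<xi>} (\<lambda>j. L2_class lam (q j \<xi>)) \<and>
        (\<forall>j. fiber_dim lam Phat \<xi> \<le> enat j \<longrightarrow> L2_class lam (q j \<xi>) = vzero (L2 lam)))"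

text \<open>The measure space \<open>\<Omega>\<close> and, for finite-dimensional fibers, the dimensions as naturals.\<close>

abbreviation OmegaM where
  "OmegaM \<nu>' lam Phat \<equiv> restrict_space \<nu>' (Omega \<nu>' lam Phat)"

abbreviation fdim where
  "fdim lam Phat \<xi> \<equiv> the_enat (fiber_dim lam Phat \<xi>)"

definition Xspace where
  "Xspace \<nu>' lam Phat = vec_direct_integral (OmegaM \<nu>' lam Phat) (fdim lam Phat)"

definition Zalgebra where
  "Zalgebra \<nu>' lam Phat = mat_direct_integral (OmegaM \<nu>' lam Phat) (fdim lam Phat)"

definition coefficient_map where
  "coefficient_map \<nu>' lam Phat q g =
     vec_class (OmegaM \<nu>' lam Phat) (fdim lam Phat)
       (\<lambda>\<xi>. Matrix.vec (fdim lam Phat \<xi>) (\<lambda>j. \<integral>v. cnj (q j \<xi> v) * rep g (\<xi>, v) \<partial>lam))"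

definition Rmap where
  "Rmap \<nu>' lam Phat q FI H = (\<lambda>f\<in>H. coefficient_map \<nu>' lam Phat q (FI f))"

definition Lambda_map where
  "Lambda_map \<nu> lam \<nu>' Phat q FI H s =
     (\<lambda>f\<in>H. adjoint (subsp (L2 (\<nu> \<Otimes>\<^sub>M lam)) H) (Xspace \<nu>' lam Phat) (Rmap \<nu>' lam Phat q FI H)
        (mult_op (OmegaM \<nu>' lam Phat) (fdim lam Phat) s (Rmap \<nu>' lam Phat q FI H f)))"

end

theory Submission
  imports Defs
begin

text \<open>
  The map \<open>R\<close> is unitary and turns translation by \<open>a\<close> into multiplication by the conjugate of the
  evaluation \<open>\<xi> \<mapsto> \<xi> a\<close>, so \<open>\<Lambda>\<close> is an isometric *-homomorphism into the commutant of the
  translations as soon as the norm of a multiplication operator is the essential supremum of the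
  norms of its matrices. For surjectivity, let \<open>T\<close> be the operator on the direct integral that
  corresponds to some \<open>S\<close> in the commutant. For bounded fields \<open>u\<close> and \<open>w\<close>, the function
  \<open>(T u)(\<xi>) \<bullet> w(\<xi>) - u(\<xi>) \<bullet> (T* w)(\<xi>)\<close> is integrable and square integrable, and all its character
  integrals vanish; since the Fourier transforms of indicator functions are total, it is zero almost
  everywhere. Hence \<open>T\<close> commutes with every bounded scalar multiplication, and it is decomposable: its
  matrices are read off from its values on weighted unit vector fields. Finally, the commutant of an
  adjoint-closed family is a W*-algebra whose predual is the norm-closed span of the vector
  functionals, and its structure is carried over to the matrix fields along \<open>\<Lambda>\<close>.
\<close>

section \<open>Hilbert spaces on carrier sets\<close>

text \<open>The difference tested against characters is a combination of products of
  square-integrable functions, hence a priori only integrable. Fubini against a Fourier transform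
  needs no more, but totality of the transforms is a statement about L2. Bounded fields supply the
  missing square integrability; the boundedness of \<open>u\<close> is removed afterwards by moving
  the scalar function onto the test field and exchanging the operator with its adjoint. The exchange
  of integrals rests on two further facts: the dual Haar measure is sigma-finite, which Plancherel
  yields, and the pairing of group and dual is measurable for the product sigma-algebra, which
  follows from countably-valued approximations of the group variable. Elements of all spaces are
  classes with arbitrarily chosen representatives, so pointwise identities hold almost everywhere
  only. A bound for the norm of a matrix field, which concerns uncountably many vectors at each
  point, is therefore assembled from countably many rational ones.\<close>

locale hilbert =
  fixes E :: "('v, 'm) hspace_scheme"
  assumes add_mem [simp, intro]: "\<lbrakk>x \<in> pts E; y \<in> pts E\<rbrakk> \<Longrightarrow> vadd E x y \<in> pts E"
    and zero_mem [simp, intro]: "vzero E \<in> pts E"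
    and scale_mem [simp, intro]: "x \<in> pts E \<Longrightarrow> vscale E c x \<in> pts E"
    and inner_add_left [simp]: "\<lbrakk>x \<in> pts E; y \<in> pts E; z \<in> pts E\<rbrakk> \<Longrightarrow>
      inner E (vadd E x y) z = inner E x z + inner E y z"
    and inner_scale_left [simp]: "\<lbrakk>x \<in> pts E; z \<in> pts E\<rbrakk> \<Longrightarrow>
      inner E (vscale E c x) z = c * inner E x z"
    and inner_zero_left [simp]: "z \<in> pts E \<Longrightarrow> inner E (vzero E) z = 0"
    and inner_commute: "\<lbrakk>x \<in> pts E; y \<in> pts E\<rbrakk> \<Longrightarrow> inner E x y = cnj (inner E y x)"
    and inner_nonneg: "x \<in> pts E \<Longrightarrow> 0 \<le> Re (inner E x x)"
    and definite: "\<lbrakk>x \<in> pts E; y \<in> pts E; inner E (vdiff E x y) (vdiff E x y) = 0\<rbrakk> \<Longrightarrow> x = y"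
    and cauchy_converges: "\<lbrakk>\<And>n::nat. s n \<in> pts E;
        \<And>e. e > 0 \<Longrightarrow> \<exists>n0. \<forall>m\<ge>n0. \<forall>n\<ge>n0. hnorm E (vdiff E (s m) (s n)) < e\<rbrakk> \<Longrightarrow>
      \<exists>x\<in>pts E. (\<lambda>n. hnorm E (vdiff E (s n) x)) \<longlonglongrightarrow> 0"
begin

lemma diff_mem [simp, intro]: "\<lbrakk>x \<in> pts E; y \<in> pts E\<rbrakk> \<Longrightarrow> vdiff E x y \<in> pts E"
  by (simp add: vdiff_def)

lemma inner_diff_left [simp]: "\<lbrakk>x \<in> pts E; y \<in> pts E; z \<in> pts E\<rbrakk> \<Longrightarrow>
    inner E (vdiff E x y) z = inner E x z - inner E y z"
  by (simp add: vdiff_def)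

lemma inner_add_right [simp]: "\<lbrakk>x \<in> pts E; y \<in> pts E; z \<in> pts E\<rbrakk> \<Longrightarrow>
    inner E z (vadd E x y) = inner E z x + inner E z y"
  by (subst (1 2 3) inner_commute) auto

lemma inner_scale_right [simp]: "\<lbrakk>x \<in> pts E; z \<in> pts E\<rbrakk> \<Longrightarrow>
    inner E z (vscale E c x) = cnj c * inner E z x"
  by (subst (1 2) inner_commute) auto

lemma inner_zero_right [simp]: "z \<in> pts E \<Longrightarrow> inner E z (vzero E) = 0"
  by (subst inner_commute) auto

lemma inner_diff_right [simp]: "\<lbrakk>x \<in> pts E; y \<in> pts E; z \<in> pts E\<rbrakk> \<Longrightarrow>
    inner E z (vdiff E x y) = inner E z x - inner E z y"
  by (simp add: vdiff_def)

text \<open>The locale assumes no vector space laws; they come out of this criterion, because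
  \<open>definite\<close> separates vectors by inner products alone. Equations between vectors are
  therefore tested against an arbitrary \<open>z\<close>.\<close>

lemma vec_eqI:
  assumes "x \<in> pts E" "y \<in> pts E" "\<And>z. z \<in> pts E \<Longrightarrow> inner E x z = inner E y z"
  shows "x = y"
  using assms by (intro definite) auto

lemma eq_zeroI:
  assumes "x \<in> pts E" "inner E x x = 0"
  shows "x = vzero E"
  using assms by (intro definite) auto

lemma inner_self: "x \<in> pts E \<Longrightarrow> inner E x x = of_real ((hnorm E x)\<^sup>2)"
  using inner_commute[of x x] inner_nonneg[of x]
  by (auto simp: hnorm_def complex_eq_iff)

lemma norm_nonneg [simp]: "x \<in> pts E \<Longrightarrow> 0 \<le> hnorm E x"
  using inner_nonneg[of x] by (simp add: hnorm_def)

lemma norm_zero [simp]: "hnorm E (vzero E) = 0"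
  by (simp add: hnorm_def)

lemma norm_eq_zero: "x \<in> pts E \<Longrightarrow> hnorm E x = 0 \<longleftrightarrow> x = vzero E"
  using eq_zeroI[of x] inner_self[of x] by auto

lemma norm_square: "x \<in> pts E \<Longrightarrow> (hnorm E x)\<^sup>2 = Re (inner E x x)"
  by (simp add: hnorm_def inner_nonneg)

lemma norm_scale [simp]: "x \<in> pts E \<Longrightarrow> hnorm E (vscale E c x) = cmod c * hnorm E x"
proof (rule power2_eq_imp_eq)
  assume x: "x \<in> pts E"
  have "inner E (vscale E c x) (vscale E c x) = (c * cnj c) * of_real ((hnorm E x)\<^sup>2)"
    using x by (simp add: inner_self[OF x] del: of_real_power)
  also have "\<dots> = of_real ((cmod c * hnorm E x)\<^sup>2)"
    by (simp add: power_mult_distrib flip: complex_norm_square)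
  finally show "(hnorm E (vscale E c x))\<^sup>2 = (cmod c * hnorm E x)\<^sup>2"
    using x by (simp only: norm_square scale_mem) simp
qed auto

lemma cauchy_schwarz:
  assumes x: "x \<in> pts E" and y: "y \<in> pts E"
  shows "cmod (inner E x y) \<le> hnorm E x * hnorm E y"
proof (cases "hnorm E y = 0")
  case True
  then show ?thesis using x y norm_eq_zero by auto
next
  case False
  let ?t = "inner E x y" let ?a = "(hnorm E x)\<^sup>2" let ?b = "(hnorm E y)\<^sup>2"
  \<comment> \<open>The component of \<open>x\<close> orthogonal to \<open>y\<close>, multiplied by
    \<open>(hnorm E y)\<^sup>2\<close> to avoid a division.\<close>
  let ?z = "vdiff E (vscale E (of_real ?b) x) (vscale E ?t y)"
  have "inner E ?z ?z = of_real ?b * (of_real ?b * inner E x x - ?t * cnj ?t)"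
    using x y inner_commute[OF y x] by (simp add: inner_self[OF y] algebra_simps)
  also have "\<dots> = of_real (?b * (?a * ?b - (cmod ?t)\<^sup>2))"
    unfolding inner_self[OF x] complex_norm_square[symmetric]
    by (simp only: of_real_mult of_real_diff mult.commute[of "of_real ?b" "of_real ?a"])
  finally have "inner E ?z ?z = of_real (?b * (?a * ?b - (cmod ?t)\<^sup>2))" .
  hence "0 \<le> ?b * (?a * ?b - (cmod ?t)\<^sup>2)"
    using inner_nonneg[of ?z] x y by simp
  moreover have "?b > 0" using False by simp
  ultimately have "(cmod ?t)\<^sup>2 \<le> (hnorm E x * hnorm E y)\<^sup>2"
    by (simp add: zero_le_mult_iff power_mult_distrib)
  thus ?thesis by (rule power2_le_imp_le) (use x y in simp)
qed

lemma norm_add_square: "\<lbrakk>x \<in> pts E; y \<in> pts E\<rbrakk> \<Longrightarrow>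
    (hnorm E (vadd E x y))\<^sup>2 = (hnorm E x)\<^sup>2 + (hnorm E y)\<^sup>2 + 2 * Re (inner E x y)"
  using inner_self[of "vadd E x y"] inner_self[of x] inner_self[of y] inner_commute[of y x]
  by (simp add: complex_eq_iff)

lemma norm_diff_square: "\<lbrakk>x \<in> pts E; y \<in> pts E\<rbrakk> \<Longrightarrow>
    (hnorm E (vdiff E x y))\<^sup>2 = (hnorm E x)\<^sup>2 + (hnorm E y)\<^sup>2 - 2 * Re (inner E x y)"
  using inner_self[of "vdiff E x y"] inner_self[of x] inner_self[of y] inner_commute[of y x]
  by (simp add: complex_eq_iff)

lemma norm_triangle:
  assumes x: "x \<in> pts E" and y: "y \<in> pts E"
  shows "hnorm E (vadd E x y) \<le> hnorm E x + hnorm E y"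
proof (rule power2_le_imp_le)
  have "Re (inner E x y) \<le> hnorm E x * hnorm E y"
    using cauchy_schwarz[OF x y] complex_Re_le_cmod[of "inner E x y"] by linarith
  thus "(hnorm E (vadd E x y))\<^sup>2 \<le> (hnorm E x + hnorm E y)\<^sup>2"
    using x y by (simp add: norm_add_square power2_sum)
qed (use x y in simp)

lemma diff_swap: "\<lbrakk>x \<in> pts E; y \<in> pts E\<rbrakk> \<Longrightarrow> hnorm E (vdiff E x y) = hnorm E (vdiff E y x)"
  by (rule power2_eq_imp_eq) (simp_all add: norm_diff_square inner_commute[of x y])

lemma norm_le_diff:
  assumes x: "x \<in> pts E" and y: "y \<in> pts E"
  shows "hnorm E x \<le> hnorm E (vdiff E x y) + hnorm E y"
proof -
  have "x = vadd E (vdiff E x y) y"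
    using x y by (intro vec_eqI) auto
  thus ?thesis using norm_triangle[of "vdiff E x y" y] x y by auto
qed

lemma tendsto_inner:
  assumes s: "\<And>n. s n \<in> pts E" and x: "x \<in> pts E" and y: "y \<in> pts E"
    and lim: "(\<lambda>n. hnorm E (vdiff E (s n) x)) \<longlonglongrightarrow> 0"
  shows "(\<lambda>n. inner E (s n) y) \<longlonglongrightarrow> inner E x y" "(\<lambda>n. inner E y (s n)) \<longlonglongrightarrow> inner E y x"
proof -
  show 1: "(\<lambda>n. inner E (s n) y) \<longlonglongrightarrow> inner E x y"
  proof (rule Lim_transform2[OF tendsto_const], rule Lim_null_comparison)
    show "\<forall>\<^sub>F n in sequentially. norm (inner E x y - inner E (s n) y) \<le> hnorm E (vdiff E (s n) x) * hnorm E y"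
    proof (rule always_eventually, rule allI)
      fix n
      have "norm (inner E x y - inner E (s n) y) = cmod (inner E (vdiff E (s n) x) y)"
        using s x y by (simp add: norm_minus_commute)
      thus "norm (inner E x y - inner E (s n) y) \<le> hnorm E (vdiff E (s n) x) * hnorm E y"
        using cauchy_schwarz[of "vdiff E (s n) x" y] s x y by simp
    qed
    show "(\<lambda>n. hnorm E (vdiff E (s n) x) * hnorm E y) \<longlonglongrightarrow> 0"
      using tendsto_mult_left_zero[OF lim] by simp
  qed
  have "(\<lambda>n. cnj (inner E (s n) y)) \<longlonglongrightarrow> cnj (inner E x y)"
    using 1 by (rule tendsto_cnj)
  thus "(\<lambda>n. inner E y (s n)) \<longlonglongrightarrow> inner E y x"
    using s x y by (simp flip: inner_commute)
qed

text \<open>The representing vector minimises \<open>\<parallel>z\<parallel>\<^sup>2 - 2 Re (\<phi> z)\<close>; minimising sequences are Cauchy by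
  the parallelogram law. Applied to a closed subspace, this also yields orthogonal projections.\<close>

lemma riesz:
  assumes add: "\<And>x y. \<lbrakk>x \<in> pts E; y \<in> pts E\<rbrakk> \<Longrightarrow> \<phi> (vadd E x y) = \<phi> x + \<phi> y"
    and scale: "\<And>c x. x \<in> pts E \<Longrightarrow> \<phi> (vscale E c x) = c * \<phi> x"
    and bd: "\<And>x. x \<in> pts E \<Longrightarrow> cmod (\<phi> x) \<le> C * hnorm E x"
  shows "\<exists>z\<in>pts E. \<forall>x\<in>pts E. \<phi> x = inner E x z"
proof -
  define J where "J z = (hnorm E z)\<^sup>2 - 2 * Re (\<phi> z)" for z
  have lower: "- C\<^sup>2 \<le> J z" if "z \<in> pts E" for z
  proof -
    have "Re (\<phi> z) \<le> C * hnorm E z"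
      using bd[OF that] complex_Re_le_cmod[of "\<phi> z"] by linarith
    moreover have "0 \<le> (hnorm E z - C)\<^sup>2" by simp
    ultimately show ?thesis by (simp add: J_def power2_diff mult.commute)
  qed
  define m where "m = Inf (J ` pts E)"
  have bb: "bdd_below (J ` pts E)" using lower by (auto intro!: bdd_belowI)
  have mle: "m \<le> J z" if "z \<in> pts E" for z
    unfolding m_def using that bb by (intro cInf_lower) auto
  have "\<exists>z\<in>pts E. J z < m + 1 / real (Suc n)" for n
    using cInf_lessD[of "J ` pts E" "m + 1 / real (Suc n)"] zero_mem
    by (auto simp: m_def)
  then obtain s where s: "\<And>n. s n \<in> pts E" and sJ: "\<And>n. J (s n) < m + 1 / real (Suc n)"
    by metis
  have par: "(hnorm E (vdiff E x y))\<^sup>2 \<le> 2 * (J x - m) + 2 * (J y - m)"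
    if x: "x \<in> pts E" and y: "y \<in> pts E" for x y
  proof -
    let ?h = "vscale E (1/2) (vadd E x y)"
    have "(hnorm E ?h)\<^sup>2 = ((hnorm E x)\<^sup>2 + (hnorm E y)\<^sup>2 + 2 * Re (inner E x y)) / 4"
      using x y by (simp add: power_divide norm_add_square)
    hence "4 * J ?h = (hnorm E x)\<^sup>2 + (hnorm E y)\<^sup>2 + 2 * Re (inner E x y) - 4 * Re (\<phi> x) - 4 * Re (\<phi> y)"
      using x y by (simp add: J_def scale add power_divide field_simps)
    moreover have "4 * m \<le> 4 * J ?h" using mle[of ?h] x y by simp
    ultimately show ?thesis using x y by (simp add: J_def norm_diff_square)
  qed
  have "\<exists>z\<in>pts E. (\<lambda>n. hnorm E (vdiff E (s n) z)) \<longlonglongrightarrow> 0"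
  proof (rule cauchy_converges[OF s])
    fix e :: real assume "e > 0"
    then obtain n0 :: nat where n0: "4 / e\<^sup>2 < real n0"
      using reals_Archimedean2 by blast
    have "hnorm E (vdiff E (s m') (s n)) < e" if "m' \<ge> n0" "n \<ge> n0" for m' n
    proof -
      have pos: "0 < 4 / e\<^sup>2" using \<open>e > 0\<close> by simp
      hence n0pos: "0 < real n0" using n0 by linarith
      have "1 / real (Suc m') \<le> 1 / real n0" "1 / real (Suc n) \<le> 1 / real n0"
        using that n0pos by (auto intro!: divide_left_mono)
      hence "(hnorm E (vdiff E (s m') (s n)))\<^sup>2 < 4 * (1 / real n0)"
        using par[OF s s, of m' n] less_le_trans[OF sJ[of m'] add_left_mono] less_le_trans[OF sJ[of n] add_left_mono]
        by fastforce
      also have "\<dots> < e\<^sup>2" using n0 n0pos \<open>e > 0\<close> by (simp add: field_simps)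
      finally show ?thesis using \<open>e > 0\<close> by (auto intro: power2_less_imp_less)
    qed
    thus "\<exists>n0. \<forall>m\<ge>n0. \<forall>n\<ge>n0. hnorm E (vdiff E (s m) (s n)) < e" by blast
  qed
  then obtain z where z: "z \<in> pts E" and lim: "(\<lambda>n. hnorm E (vdiff E (s n) z)) \<longlonglongrightarrow> 0" by blast
  have re: "Re (\<phi> h) = Re (inner E h z)" if h: "h \<in> pts E" for h
  proof -
    define r where "r = Re (inner E h z) - Re (\<phi> h)"
    define k where "k = (hnorm E h)\<^sup>2"
    \<comment> \<open>Compares \<open>J\<close> at \<open>s n\<close> shifted by \<open>t\<close>
      times \<open>h\<close> with the lower bound \<open>m\<close>, which \<open>J (s n)\<close>
      exceeds by less than \<open>1 / (n + 1)\<close>, and lets \<open>n\<close> tend to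
      infinity.\<close>
    have ineq: "0 \<le> 2 * t * r + t\<^sup>2 * k" for t :: real
    proof -
      have "- (1 / real (Suc n)) \<le> 2 * t * (Re (inner E h (s n)) - Re (\<phi> h)) + t\<^sup>2 * k" for n
      proof -
        let ?y = "vadd E (s n) (vscale E (of_real t) h)"
        have "J ?y = J (s n) + 2 * t * (Re (inner E h (s n)) - Re (\<phi> h)) + t\<^sup>2 * k"
          using s[of n] h inner_commute[OF s[of n] h]
          by (simp add: J_def norm_add_square add scale k_def power_mult_distrib algebra_simps)
        thus ?thesis using mle[of ?y] sJ[of n] s[of n] h by simp
      qed
      moreover have "(\<lambda>n. - (1 / real (Suc n))) \<longlonglongrightarrow> - 0"
        by (intro tendsto_minus LIMSEQ_Suc[OF lim_1_over_n])
      moreover have "(\<lambda>n. 2 * t * (Re (inner E h (s n)) - Re (\<phi> h)) + t\<^sup>2 * k) \<longlonglongrightarrow> 2 * t * r + t\<^sup>2 * k"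
        unfolding r_def by (intro tendsto_intros tendsto_inner[OF s z h lim])
      ultimately show ?thesis by (intro LIMSEQ_le[of _ "0::real"]) auto
    qed
    have "k \<ge> 0" by (simp add: k_def)
    \<comment> \<open>Nearly the minimiser \<open>- r / k\<close> of the quadratic. The shift to
      \<open>k + 1\<close> covers \<open>k = 0\<close>, and for \<open>r \<noteq> 0\<close> the
      value at this \<open>t\<close> would be negative.\<close>
    define t where "t = - r / (k + 1)"
    have tk: "t * (k + 1) = - r" using \<open>k \<ge> 0\<close> by (simp add: t_def)
    have "0 \<le> (2 * t * r + t\<^sup>2 * k) * (k + 1)\<^sup>2"
      using ineq[of t] by (rule mult_nonneg_nonneg) simp
    also have "\<dots> = 2 * (t * (k + 1)) * r * (k + 1) + (t * (k + 1))\<^sup>2 * k"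
      by (simp add: power2_eq_square algebra_simps)
    also have "\<dots> = - (r\<^sup>2 * (k + 2))"
      unfolding tk by (simp add: power2_eq_square algebra_simps)
    finally have "r = 0" using \<open>k \<ge> 0\<close> by (simp add: mult_le_0_iff)
    thus ?thesis by (simp add: r_def)
  qed
  \<comment> \<open>Real parts agree for all vectors; passing to \<open>- \<i>\<close> times
    \<open>h\<close> turns the imaginary part into a real part.\<close>
  have "\<phi> h = inner E h z" if h: "h \<in> pts E" for h
    using re[OF h] re[of "vscale E (- \<i>) h"] h z by (simp add: scale complex_eq_iff)
  with z show ?thesis by blast
qed

end

lemma closed_subspaceD:
  assumes "closed_subspace E W"
  shows "W \<subseteq> pts E" "vzero E \<in> W"
    "\<lbrakk>x \<in> W; y \<in> W\<rbrakk> \<Longrightarrow> vadd E x y \<in> W" "x \<in> W \<Longrightarrow> vscale E c x \<in> W"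
  using assms[unfolded closed_subspace_def, THEN conjunct1]
    assms[unfolded closed_subspace_def, THEN conjunct2, THEN conjunct1]
    assms[unfolded closed_subspace_def, THEN conjunct2, THEN conjunct2, THEN conjunct1]
    assms[unfolded closed_subspace_def, THEN conjunct2, THEN conjunct2, THEN conjunct2, THEN conjunct1]
  by blast+

lemma closed_subspace_limit:
  assumes "closed_subspace E W" "\<And>n. s n \<in> W" "x \<in> pts E"
    "(\<lambda>n::nat. hnorm E (vdiff E (s n) x)) \<longlonglongrightarrow> 0"
  shows "x \<in> W"
  using assms(1)[unfolded closed_subspace_def, THEN conjunct2, THEN conjunct2, THEN conjunct2, THEN conjunct2,
    THEN spec[of _ s], THEN bspec[OF _ assms(3)]] assms(2,4) by simp

text \<open>A Cauchy sequence of the subspace converges in \<open>E\<close>, and closedness puts its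
  limit into \<open>W\<close>.\<close>

lemma hilbert_subspace:
  assumes "hilbert E" and W: "closed_subspace E W"
  shows "hilbert (subsp E W)"
proof -
  interpret hilbert E by fact
  have WE: "W \<subseteq> pts E" by (rule closed_subspaceD(1)[OF W])
  have sub: "vdiff (subsp E W) x y = vdiff E x y" "hnorm (subsp E W) x = hnorm E x" for x y
    by (simp_all add: vdiff_def hnorm_def)
  show ?thesis
  proof
    fix s :: "nat \<Rightarrow> _"
    assume s: "\<And>n. s n \<in> pts (subsp E W)"
      and c: "\<And>e. e > 0 \<Longrightarrow> \<exists>n0. \<forall>m\<ge>n0. \<forall>n\<ge>n0. hnorm (subsp E W) (vdiff (subsp E W) (s m) (s n)) < e"
    have "\<exists>x\<in>pts E. (\<lambda>n. hnorm E (vdiff E (s n) x)) \<longlonglongrightarrow> 0"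
      using s WE c by (intro cauchy_converges) (auto simp: sub)
    then obtain x where x: "x \<in> pts E" and lim: "(\<lambda>n. hnorm E (vdiff E (s n) x)) \<longlonglongrightarrow> 0" by blast
    moreover have "x \<in> W" using closed_subspace_limit[OF W _ x lim] s by simp
    ultimately show "\<exists>x\<in>pts (subsp E W). (\<lambda>n. hnorm (subsp E W) (vdiff (subsp E W) (s n) x)) \<longlonglongrightarrow> 0"
      by (auto simp: sub)
  next
    fix x y assume "x \<in> pts (subsp E W)" "y \<in> pts (subsp E W)"
      "inner (subsp E W) (vdiff (subsp E W) x y) (vdiff (subsp E W) x y) = 0"
    thus "x = y" using WE by (intro definite) (auto simp: sub)
  next
    fix x y assume "x \<in> pts (subsp E W)" "y \<in> pts (subsp E W)"
    thus "inner (subsp E W) x y = cnj (inner (subsp E W) y x)"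
      using WE inner_commute[of x y] by auto
  qed (use WE in \<open>auto simp: subset_iff inner_nonneg closed_subspaceD[OF W]\<close>)
qed

context hilbert
begin

text \<open>The Riesz vector of the functional \<open>y \<mapsto> inner E y x\<close> in the Hilbert
  space \<open>subsp E W\<close> is the projection of \<open>x\<close>.\<close>

lemma ex_projection:
  assumes W: "closed_subspace E W" and x: "x \<in> pts E"
  shows "\<exists>!w. w \<in> W \<and> (\<forall>z\<in>W. inner E (vdiff E x w) z = 0)"
proof -
  interpret W: hilbert "subsp E W" by (intro hilbert_subspace hilbert_axioms W)
  have WE: "y \<in> W \<Longrightarrow> y \<in> pts E" for y using closed_subspaceD(1)[OF W] by auto
  have "\<exists>z\<in>pts (subsp E W). \<forall>y\<in>pts (subsp E W). inner E y x = inner (subsp E W) y z"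
    by (rule W.riesz[where C = "hnorm E x"])
       (use x in \<open>auto simp: WE hnorm_def mult.commute dest: WE cauchy_schwarz[of _ x, unfolded hnorm_def]\<close>)
  then obtain w where w: "w \<in> W" "\<And>y. y \<in> W \<Longrightarrow> inner E y x = inner E y w" by auto
  have "inner E x y = inner E w y" if "y \<in> W" for y
    using w(2)[OF that] inner_commute[of x y] inner_commute[of w y] w(1) x WE that by simp
  moreover have "w = w'" if "w' \<in> W" "\<And>y. y \<in> W \<Longrightarrow> inner E x y = inner E w' y" for w'
    using that calculation w W.vec_eqI[of w w'] by auto
  ultimately show ?thesis using w(1) x WE by (intro ex1I[of _ w]) auto
qed

lemma
  assumes "closed_subspace E W" "x \<in> pts E"
  shows projection_mem: "projection_onto E W x \<in> W"
    and projection_inner: "z \<in> W \<Longrightarrow> inner E (vdiff E x (projection_onto E W x)) z = 0"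
proof -
  have "projection_onto E W x = (THE w. w \<in> W \<and> (\<forall>z\<in>W. inner E (vdiff E x w) z = 0))"
    using assms(2) by (simp only: projection_onto_def restrict_apply' if_True)
  thus "projection_onto E W x \<in> W"
    "z \<in> W \<Longrightarrow> inner E (vdiff E x (projection_onto E W x)) z = 0"
    using theI'[OF ex_projection[OF assms]] by metis+
qed

lemma projection_ident:
  assumes W: "closed_subspace E W" and x: "x \<in> W"
  shows "projection_onto E W x = x"
proof -
  have WE: "y \<in> W \<Longrightarrow> y \<in> pts E" for y using closed_subspaceD(1)[OF W] by auto
  have "x \<in> W \<and> (\<forall>z\<in>W. inner E (vdiff E x x) z = 0)" using x WE by auto
  hence "(THE w. w \<in> W \<and> (\<forall>z\<in>W. inner E (vdiff E x w) z = 0)) = x"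
    by (intro the1_equality ex_projection W) (use x WE in auto)
  thus ?thesis using WE[OF x] by (simp add: projection_onto_def)
qed

text \<open>What remains of \<open>x\<close> after projection is orthogonal to \<open>W\<close>,
  hence zero.\<close>

lemma closed_subspace_total:
  assumes W: "closed_subspace E W"
    and tot: "\<And>z. \<lbrakk>z \<in> pts E; \<And>w. w \<in> W \<Longrightarrow> inner E z w = 0\<rbrakk> \<Longrightarrow> z = vzero E"
  shows "W = pts E"
proof
  show WE: "W \<subseteq> pts E" using W unfolding closed_subspace_def by blast
  show "pts E \<subseteq> W"
  proof
    fix x assume x: "x \<in> pts E"
    let ?w = "projection_onto E W x"
    have w: "?w \<in> W" by (rule projection_mem[OF W x])
    have "vdiff E x ?w = vzero E"
      using tot[of "vdiff E x ?w"] projection_inner[OF W x] w WE x by auto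
    hence "x = ?w" using x w WE by (intro definite) auto
    thus "x \<in> W" using w by simp
  qed
qed

lemma bounded_opE:
  assumes "bounded_op E K T"
  obtains C where "C \<ge> 0" "\<And>x. x \<in> pts E \<Longrightarrow> hnorm K (T x) \<le> C * hnorm E x"
proof -
  from assms obtain C where "\<forall>x\<in>pts E. hnorm K (T x) \<le> C * hnorm E x"
    unfolding bounded_op_def by (elim conjE exE)
  hence C: "hnorm K (T x) \<le> C * hnorm E x" if "x \<in> pts E" for x using that by (rule bspec)
  show thesis
  proof (rule that[of "max C 0"])
    fix x assume x: "x \<in> pts E"
    have "C * hnorm E x \<le> max C 0 * hnorm E x" using x by (intro mult_right_mono) auto
    thus "hnorm K (T x) \<le> max C 0 * hnorm E x" using C[OF x] by linarith
  qed simp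
qed

lemma op_norm_le:
  assumes "\<And>x. x \<in> pts E \<Longrightarrow> hnorm K (T x) \<le> C * hnorm E x" "C \<ge> 0"
  shows "op_norm E K T \<le> C"
  unfolding op_norm_def
proof (rule cSup_least)
  have "vzero E \<in> pts E" "hnorm E (vzero E) \<le> 1" by simp_all
  thus "{hnorm K (T x) |x. x \<in> pts E \<and> hnorm E x \<le> 1} \<noteq> {}" by blast
  fix y assume "y \<in> {hnorm K (T x) |x. x \<in> pts E \<and> hnorm E x \<le> 1}"
  then obtain x where x: "x \<in> pts E" "hnorm E x \<le> 1" "y = hnorm K (T x)" by auto
  have "C * hnorm E x \<le> C * 1" using x assms(2) by (intro mult_left_mono) auto
  thus "y \<le> C" using assms(1)[of x] x by simp
qed

lemma norm_le_op_norm: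
  assumes K: "hilbert K" and T: "bounded_op E K T" and x: "x \<in> pts E"
  shows "hnorm K (T x) \<le> op_norm E K T * hnorm E x"
proof (cases "hnorm E x = 0")
  case True
  obtain C where "\<And>x. x \<in> pts E \<Longrightarrow> hnorm K (T x) \<le> C * hnorm E x"
    using bounded_opE[OF T] by blast
  from this[OF x] True show ?thesis by simp
next
  case False
  interpret K: hilbert K by fact
  obtain C where C: "C \<ge> 0" "\<And>x. x \<in> pts E \<Longrightarrow> hnorm K (T x) \<le> C * hnorm E x"
    using bounded_opE[OF T] by blast
  have bdd: "bdd_above {hnorm K (T x) |x. x \<in> pts E \<and> hnorm E x \<le> 1}"
  proof (rule bdd_aboveI)
    fix y assume "y \<in> {hnorm K (T x) |x. x \<in> pts E \<and> hnorm E x \<le> 1}"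
    then obtain x where x: "x \<in> pts E" "hnorm E x \<le> 1" "y = hnorm K (T x)" by auto
    have "C * hnorm E x \<le> C * 1" using x C(1) by (intro mult_left_mono) auto
    thus "y \<le> C" using C(2)[of x] x by simp
  qed
  have pos: "hnorm E x > 0" using False norm_nonneg[OF x] by linarith
  let ?u = "vscale E (of_real (1 / hnorm E x)) x"
  have Tx: "T x \<in> pts K" using T x by (auto simp: bounded_op_def linear_map_def)
  have "hnorm K (T ?u) \<le> op_norm E K T"
    unfolding op_norm_def
    by (rule cSup_upper[OF _ bdd]) (use x pos in \<open>auto simp: norm_divide\<close>)
  moreover have "T ?u = vscale K (of_real (1 / hnorm E x)) (T x)"
    using T x unfolding bounded_op_def linear_map_def by blast
  ultimately show ?thesis
    using pos Tx by (simp add: norm_divide divide_simps mult.commute)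
qed

lemma op_norm_nonneg:
  assumes K: "hilbert K" and T: "bounded_op E K T"
  shows "0 \<le> op_norm E K T"
proof -
  interpret K: hilbert K by fact
  obtain C where C: "C \<ge> 0" "\<And>x. x \<in> pts E \<Longrightarrow> hnorm K (T x) \<le> C * hnorm E x"
    using bounded_opE[OF T] by blast
  have bdd: "bdd_above {hnorm K (T x) |x. x \<in> pts E \<and> hnorm E x \<le> 1}"
  proof (rule bdd_aboveI)
    fix y assume "y \<in> {hnorm K (T x) |x. x \<in> pts E \<and> hnorm E x \<le> 1}"
    then obtain x where x: "x \<in> pts E" "hnorm E x \<le> 1" "y = hnorm K (T x)" by auto
    have "C * hnorm E x \<le> C * 1" using x C(1) by (intro mult_left_mono) auto
    thus "y \<le> C" using C(2)[of x] x by simp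
  qed
  have "T (vzero E) \<in> pts K" using T by (auto simp: bounded_op_def linear_map_def)
  hence "0 \<le> hnorm K (T (vzero E))" by simp
  also have "\<dots> \<le> op_norm E K T"
    unfolding op_norm_def by (rule cSup_upper[OF _ bdd]) (auto intro!: exI[of _ "vzero E"])
  finally show ?thesis .
qed

text \<open>\<open>adjoint\<close> is a definite description, so its value has to be exhibited: for
  a unitary operator its value at \<open>T x\<close> is \<open>x\<close> itself.\<close>

lemma adjoint_unitary:
  assumes T: "unitary_op E K T"
  shows "x \<in> pts E \<Longrightarrow> adjoint E K T (T x) = x"
    and "y \<in> pts K \<Longrightarrow> adjoint E K T y \<in> pts E"
    and "y \<in> pts K \<Longrightarrow> T (adjoint E K T y) = y"
proof -
  have TK: "T x \<in> pts K" if "x \<in> pts E" for x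
    using T that by (auto simp: unitary_op_def)
  show 1: "adjoint E K T (T x) = x" if x: "x \<in> pts E" for x
  proof -
    have "(THE x'. x' \<in> pts E \<and> (\<forall>z\<in>pts E. inner K (T z) (T x) = inner E z x')) = x"
    proof (rule the_equality)
      show "x \<in> pts E \<and> (\<forall>z\<in>pts E. inner K (T z) (T x) = inner E z x)"
        using T x by (auto simp: unitary_op_def)
      fix x' assume x': "x' \<in> pts E \<and> (\<forall>z\<in>pts E. inner K (T z) (T x) = inner E z x')"
      have "inner E z x' = inner E z x" if "z \<in> pts E" for z
        using T x x' that by (auto simp: unitary_op_def)
      thus "x' = x"
        using x x' by (intro vec_eqI) (auto simp: inner_commute[of x'] inner_commute[of x])
    qed
    thus ?thesis using TK[OF x] by (simp add: adjoint_def)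
  qed
  have "T ` pts E = pts K" using T by (simp add: unitary_op_def)
  thus "adjoint E K T y \<in> pts E" "T (adjoint E K T y) = y" if "y \<in> pts K"
    using that 1 by (metis imageE)+
qed

end

section \<open>Commutants as W*-algebras\<close>

lemma le_if_square_le_mult:
  fixes a b :: real
  assumes "a * a \<le> b * a" "0 \<le> b" shows "a \<le> b"
  using assms by (cases "a \<le> 0") auto

lemma linear_mapD:
  assumes "linear_map E K T"
  shows "x \<in> pts E \<Longrightarrow> T x \<in> pts K"
    and "\<lbrakk>x \<in> pts E; y \<in> pts E\<rbrakk> \<Longrightarrow> T (vadd E x y) = vadd K (T x) (T y)"
    and "x \<in> pts E \<Longrightarrow> T (vscale E c x) = vscale K c (T x)"
  using assms unfolding linear_map_def by blast+

text \<open>Closure under adjoints is what puts the adjoint of a commuting operator back into the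
  commutant. It also expresses commutation through matrix coefficients, as
  \<open>inner E (T (S x)) y = inner E (T x) (S' y)\<close>, a condition that survives
  limits.\<close>

locale adjoint_closed = hilbert E for E :: "('v, 'm) hspace_scheme" +
  fixes X :: "('v \<Rightarrow> 'v) set"
  assumes X_mem [simp]: "\<lbrakk>S \<in> X; x \<in> pts E\<rbrakk> \<Longrightarrow> S x \<in> pts E"
    and X_adjoint: "S \<in> X \<Longrightarrow> \<exists>S'\<in>X. \<forall>x\<in>pts E. \<forall>y\<in>pts E. inner E (S x) y = inner E x (S' y)"
begin

abbreviation "V \<equiv> commutant E X"

lemma V_iff: "T \<in> pts V \<longleftrightarrow> T \<in> extensional (pts E) \<and> bounded_op E E T \<and>
    (\<forall>S\<in>X. \<forall>x\<in>pts E. S (T x) = T (S x))"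
proof -
  have "compose (pts E) S T = compose (pts E) T S \<longleftrightarrow> (\<forall>x\<in>pts E. S (T x) = T (S x))" for S
    unfolding compose_def fun_eq_iff restrict_def by metis
  thus ?thesis by (auto simp: commutant_def bounded_operators_def)
qed

lemma V_lin: "T \<in> pts V \<Longrightarrow> linear_map E E T"
  by (simp add: V_iff bounded_op_def)

lemmas V_mem [simp] = linear_mapD(1)[OF V_lin]
  and V_linear_add [simp] = linear_mapD(2)[OF V_lin]
  and V_linear_scale [simp] = linear_mapD(3)[OF V_lin]

lemma V_commute: "\<lbrakk>T \<in> pts V; S \<in> X; x \<in> pts E\<rbrakk> \<Longrightarrow> S (T x) = T (S x)"
  by (simp add: V_iff)

lemma V_bounded: "T \<in> pts V \<Longrightarrow> bounded_op E E T"
  by (simp add: V_iff)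

lemma nrm_V: "nrm V T = op_norm E E T"
  by (simp add: commutant_def bounded_operators_def)

lemma V_norm: "\<lbrakk>T \<in> pts V; x \<in> pts E\<rbrakk> \<Longrightarrow> hnorm E (T x) \<le> nrm V T * hnorm E x"
  unfolding nrm_V by (rule norm_le_op_norm[OF hilbert_axioms V_bounded])

lemma V_norm_nonneg [simp]: "T \<in> pts V \<Longrightarrow> 0 \<le> nrm V T"
  unfolding nrm_V by (rule op_norm_nonneg[OF hilbert_axioms V_bounded])

lemma V_norm_le: "\<lbrakk>\<And>x. x \<in> pts E \<Longrightarrow> hnorm E (T x) \<le> C * hnorm E x; 0 \<le> C\<rbrakk> \<Longrightarrow> nrm V T \<le> C"
  unfolding nrm_V by (rule op_norm_le)

lemma V_form_le: "\<lbrakk>T \<in> pts V; x \<in> pts E; y \<in> pts E\<rbrakk> \<Longrightarrow>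
    cmod (inner E (T x) y) \<le> nrm V T * hnorm E x * hnorm E y"
  by (rule order_trans[OF cauchy_schwarz]) (auto intro!: mult_right_mono V_norm)

lemma V_eqI: "\<lbrakk>S \<in> pts V; T \<in> pts V; \<And>x. x \<in> pts E \<Longrightarrow> S x = T x\<rbrakk> \<Longrightarrow> S = T"
  by (rule extensionalityI[of _ "pts E"]) (simp_all add: V_iff)

text \<open>Linearity and commutation are required of the matrix coefficients, since operators
  obtained from forms are known through these alone.\<close>

lemma V_memI:
  assumes ext: "T \<in> extensional (pts E)"
    and mem [simp]: "\<And>x. x \<in> pts E \<Longrightarrow> T x \<in> pts E"
    and add: "\<And>x y z. \<lbrakk>x \<in> pts E; y \<in> pts E; z \<in> pts E\<rbrakk> \<Longrightarrow>
      inner E (T (vadd E x y)) z = inner E (T x) z + inner E (T y) z"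
    and scale: "\<And>c x z. \<lbrakk>x \<in> pts E; z \<in> pts E\<rbrakk> \<Longrightarrow> inner E (T (vscale E c x)) z = c * inner E (T x) z"
    and bd: "\<And>x. x \<in> pts E \<Longrightarrow> hnorm E (T x) \<le> C * hnorm E x"
    and comm: "\<And>S S' x y. \<lbrakk>S \<in> X; S' \<in> X; \<And>x y. \<lbrakk>x \<in> pts E; y \<in> pts E\<rbrakk> \<Longrightarrow> inner E (S x) y = inner E x (S' y);
      x \<in> pts E; y \<in> pts E\<rbrakk> \<Longrightarrow> inner E (T (S x)) y = inner E (T x) (S' y)"
  shows "T \<in> pts V"
  unfolding V_iff bounded_op_def linear_map_def
proof (intro conjI ballI allI)
  fix S x assume S: "S \<in> X" and x: "x \<in> pts E"
  obtain S' where S': "S' \<in> X" "\<And>x y. \<lbrakk>x \<in> pts E; y \<in> pts E\<rbrakk> \<Longrightarrow> inner E (S x) y = inner E x (S' y)"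
    using X_adjoint[OF S] by blast
  show "S (T x) = T (S x)"
    using S S' x by (intro vec_eqI) (simp_all add: comm[of S S'])
qed (use ext bd in \<open>auto intro!: vec_eqI simp: add scale\<close>)

text \<open>Riesz is applied to \<open>y \<mapsto> cnj (B x y)\<close>, conjugated because the form
  is antilinear in its second argument. All operators of the commutant that are not written down
  explicitly arise here: adjoints, norm limits, and the operators that represent functionals on the
  predual.\<close>

lemma V_of_form:
  assumes add_l: "\<And>x x' y. \<lbrakk>x \<in> pts E; x' \<in> pts E; y \<in> pts E\<rbrakk> \<Longrightarrow> B (vadd E x x') y = B x y + B x' y"
    and scale_l: "\<And>c x y. \<lbrakk>x \<in> pts E; y \<in> pts E\<rbrakk> \<Longrightarrow> B (vscale E c x) y = c * B x y"
    and add_r: "\<And>x y y'. \<lbrakk>x \<in> pts E; y \<in> pts E; y' \<in> pts E\<rbrakk> \<Longrightarrow> B x (vadd E y y') = B x y + B x y'"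
    and scale_r: "\<And>c x y. \<lbrakk>x \<in> pts E; y \<in> pts E\<rbrakk> \<Longrightarrow> B x (vscale E c y) = cnj c * B x y"
    and bd: "\<And>x y. \<lbrakk>x \<in> pts E; y \<in> pts E\<rbrakk> \<Longrightarrow> cmod (B x y) \<le> C * hnorm E x * hnorm E y"
    and comm: "\<And>S S' x y. \<lbrakk>S \<in> X; S' \<in> X; \<And>x y. \<lbrakk>x \<in> pts E; y \<in> pts E\<rbrakk> \<Longrightarrow> inner E (S x) y = inner E x (S' y);
      x \<in> pts E; y \<in> pts E\<rbrakk> \<Longrightarrow> B (S x) y = B x (S' y)"
  shows "\<exists>T\<in>pts V. \<forall>x\<in>pts E. \<forall>y\<in>pts E. inner E (T x) y = B x y"
proof -
  have "\<exists>z\<in>pts E. \<forall>y\<in>pts E. cnj (B x y) = inner E y z" if x: "x \<in> pts E" for x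
    by (rule riesz[where C = "C * hnorm E x"]) (use x bd in \<open>auto simp: add_r scale_r\<close>)
  then obtain t where t: "\<And>x. x \<in> pts E \<Longrightarrow> t x \<in> pts E"
    "\<And>x y. \<lbrakk>x \<in> pts E; y \<in> pts E\<rbrakk> \<Longrightarrow> cnj (B x y) = inner E y (t x)"
    by metis
  define T where "T = restrict t (pts E)"
  have T_mem: "T x \<in> pts E" if "x \<in> pts E" for x using that t(1) by (simp add: T_def)
  have form: "inner E (T x) y = B x y" if "x \<in> pts E" "y \<in> pts E" for x y
    using t(2)[OF that] inner_commute[of "t x" y] t(1) that by (simp add: T_def flip: t(2))
  have "T \<in> pts V"
  proof (rule V_memI[where C = "\<bar>C\<bar>"])
    show "T \<in> extensional (pts E)" by (simp add: T_def)
    fix x assume x: "x \<in> pts E"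
    \<comment> \<open>The bound of the form is used at \<open>y = T x\<close>; one factor
      \<open>hnorm E (T x)\<close> then cancels.\<close>
    have "(hnorm E (T x))\<^sup>2 = Re (B x (T x))"
      using x by (simp add: norm_square T_mem form)
    also have "\<dots> \<le> C * hnorm E x * hnorm E (T x)"
      using bd[OF x T_mem[OF x]] complex_Re_le_cmod[of "B x (T x)"] by linarith
    also have "\<dots> \<le> \<bar>C\<bar> * hnorm E x * hnorm E (T x)"
      using x T_mem[OF x] by (intro mult_right_mono) auto
    finally show "hnorm E (T x) \<le> \<bar>C\<bar> * hnorm E x"
      using x T_mem[OF x] norm_nonneg[OF x] norm_nonneg[OF T_mem[OF x]]
      by (cases "hnorm E (T x) = 0") (auto simp: power2_eq_square)
  next
    fix S S' x y assume *: "S \<in> X" "S' \<in> X" "\<And>x y. \<lbrakk>x \<in> pts E; y \<in> pts E\<rbrakk> \<Longrightarrow> inner E (S x) y = inner E x (S' y)"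
      "x \<in> pts E" "y \<in> pts E"
    show "inner E (T (S x)) y = inner E (T x) (S' y)"
      using comm[OF *] * by (simp add: form)
  qed (auto simp: T_mem form add_l scale_l)
  thus ?thesis using form by blast
qed

text \<open>The form \<open>inner E x (T y)\<close> yields an operator of the commutant; the
  definite description in \<open>adjoint\<close> is then shown to pick this very operator.\<close>

lemma V_adjoint:
  assumes T: "T \<in> pts V"
  shows V_star_mem: "star V T \<in> pts V"
    and V_star_inner: "\<lbrakk>x \<in> pts E; y \<in> pts E\<rbrakk> \<Longrightarrow> inner E (star V T x) y = inner E x (T y)"
proof -
  have "\<exists>T'\<in>pts V. \<forall>x\<in>pts E. \<forall>y\<in>pts E. inner E (T' x) y = inner E x (T y)"
  proof (rule V_of_form[where C = "nrm V T"])
    fix x y assume x: "x \<in> pts E" and y: "y \<in> pts E"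
    have "cmod (inner E x (T y)) \<le> hnorm E x * hnorm E (T y)"
      using x y T by (simp add: cauchy_schwarz)
    also have "\<dots> \<le> hnorm E x * (nrm V T * hnorm E y)"
      using x y T by (intro mult_left_mono V_norm) auto
    finally show "cmod (inner E x (T y)) \<le> nrm V T * hnorm E x * hnorm E y"
      by (simp add: mult_ac)
  qed (use T in \<open>auto simp: V_commute[symmetric]\<close>)
  then obtain T' where T': "T' \<in> pts V"
    "\<And>x y. \<lbrakk>x \<in> pts E; y \<in> pts E\<rbrakk> \<Longrightarrow> inner E (T' x) y = inner E x (T y)" by blast
  have "star V T = T'"
  proof (rule extensionalityI[of _ "pts E"])
    show "T' \<in> extensional (pts E)" using T'(1) by (simp add: V_iff)
    show "star V T \<in> extensional (pts E)"
      by (simp add: commutant_def bounded_operators_def adjoint_def)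
    fix y assume y: "y \<in> pts E"
    have eq: "inner E (T z) y = inner E z (T' y)" if "z \<in> pts E" for z
      using T'(2)[OF y that] inner_commute[of "T z" y] inner_commute[of z "T' y"] that y T T'(1) by simp
    have "(THE x. x \<in> pts E \<and> (\<forall>z\<in>pts E. inner E (T z) y = inner E z x)) = T' y"
    proof (rule the_equality)
      show "T' y \<in> pts E \<and> (\<forall>z\<in>pts E. inner E (T z) y = inner E z (T' y))"
        using T' y eq by simp
      fix x assume "x \<in> pts E \<and> (\<forall>z\<in>pts E. inner E (T z) y = inner E z x)"
      hence x: "x \<in> pts E" "\<And>z. z \<in> pts E \<Longrightarrow> inner E z (T' y) = inner E z x" using eq by auto
      show "x = T' y"
      proof (rule vec_eqI)
        fix z assume z: "z \<in> pts E"
        show "inner E x z = inner E (T' y) z"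
          using x(2)[OF z] inner_commute[OF x(1) z] inner_commute[of "T' y" z] T'(1) y z by simp
      qed (use x T' y in auto)
    qed
    thus "star V T y = T' y"
      using y by (simp add: commutant_def bounded_operators_def adjoint_def)
  qed
  thus "star V T \<in> pts V" "\<lbrakk>x \<in> pts E; y \<in> pts E\<rbrakk> \<Longrightarrow> inner E (star V T x) y = inner E x (T y)"
    using T' by simp_all
qed

lemma V_app [simp]:
  assumes "x \<in> pts E"
  shows "vadd V S T x = vadd E (S x) (T x)" "vscale V c T x = vscale E c (T x)"
    "vzero V x = vzero E" "mult V S T x = S (T x)" "unit V x = x"
    "vdiff V S T x = vdiff E (S x) (T x)"
  using assms by (simp_all add: commutant_def bounded_operators_def compose_def vdiff_def)

lemma V_ext: "vadd V S T \<in> extensional (pts E)" "vscale V c T \<in> extensional (pts E)"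
    "vzero V \<in> extensional (pts E)" "mult V S T \<in> extensional (pts E)" "unit V \<in> extensional (pts E)"
  by (simp_all add: commutant_def bounded_operators_def)

lemma V_adj_swap:
  assumes "T \<in> pts V" "S \<in> X" "S' \<in> X" "\<And>x y. \<lbrakk>x \<in> pts E; y \<in> pts E\<rbrakk> \<Longrightarrow> inner E (S x) y = inner E x (S' y)"
    "x \<in> pts E" "y \<in> pts E"
  shows "inner E (T (S x)) y = inner E (T x) (S' y)"
  using assms V_commute[OF assms(1,2,5)] by (metis V_mem)

lemma V_zero_mem [simp]: "vzero V \<in> pts V"
  by (rule V_memI[where C = 0]) (auto simp: V_ext)

lemma V_unit_mem [simp]: "unit V \<in> pts V"
  by (rule V_memI[where C = 1]) (auto simp: V_ext)

lemma V_add_mem [simp]: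
  assumes "S \<in> pts V" "T \<in> pts V" shows "vadd V S T \<in> pts V"
proof (rule V_memI[where C = "nrm V S + nrm V T"])
  fix x assume x: "x \<in> pts E"
  show "hnorm E (vadd V S T x) \<le> (nrm V S + nrm V T) * hnorm E x"
    using norm_triangle[of "S x" "T x"] V_norm[OF assms(1) x] V_norm[OF assms(2) x] x assms
    by (simp add: algebra_simps)
next
  fix S1 S' x y assume *: "S1 \<in> X" "S' \<in> X" "\<And>x y. \<lbrakk>x \<in> pts E; y \<in> pts E\<rbrakk> \<Longrightarrow> inner E (S1 x) y = inner E x (S' y)"
      "x \<in> pts E" "y \<in> pts E"
  show "inner E (vadd V S T (S1 x)) y = inner E (vadd V S T x) (S' y)"
    using V_adj_swap[OF assms(1) *] V_adj_swap[OF assms(2) *] * assms by simp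
qed (use assms in \<open>auto simp: V_ext distrib_left\<close>)

lemma V_scale_mem [simp]:
  assumes "T \<in> pts V" shows "vscale V c T \<in> pts V"
proof (rule V_memI[where C = "cmod c * nrm V T"])
  fix x assume x: "x \<in> pts E"
  show "hnorm E (vscale V c T x) \<le> cmod c * nrm V T * hnorm E x"
    using V_norm[OF assms(1) x] x assms by (simp add: mult.assoc mult_left_mono)
next
  fix S1 S' x y assume *: "S1 \<in> X" "S' \<in> X" "\<And>x y. \<lbrakk>x \<in> pts E; y \<in> pts E\<rbrakk> \<Longrightarrow> inner E (S1 x) y = inner E x (S' y)"
      "x \<in> pts E" "y \<in> pts E"
  show "inner E (vscale V c T (S1 x)) y = inner E (vscale V c T x) (S' y)"
    using V_adj_swap[OF assms(1) *] * assms by simp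
qed (use assms in \<open>auto simp: V_ext mult.left_commute distrib_left\<close>)

lemma V_mult_norm:
  assumes S: "S \<in> pts V" and T: "T \<in> pts V" and x: "x \<in> pts E"
  shows "hnorm E (S (T x)) \<le> nrm V S * nrm V T * hnorm E x"
proof -
  have "hnorm E (S (T x)) \<le> nrm V S * hnorm E (T x)" using assms by (intro V_norm) auto
  also have "\<dots> \<le> nrm V S * (nrm V T * hnorm E x)" using assms by (intro mult_left_mono V_norm) auto
  finally show ?thesis by (simp add: mult.assoc)
qed

lemma V_mult_mem [simp]:
  assumes "S \<in> pts V" "T \<in> pts V" shows "mult V S T \<in> pts V"
proof (rule V_memI[where C = "nrm V S * nrm V T"])
  fix x assume x: "x \<in> pts E"
  show "hnorm E (mult V S T x) \<le> nrm V S * nrm V T * hnorm E x"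
    using V_mult_norm[OF assms x] x by simp
next
  fix S1 S' x y assume *: "S1 \<in> X" "S' \<in> X" "\<And>x y. \<lbrakk>x \<in> pts E; y \<in> pts E\<rbrakk> \<Longrightarrow> inner E (S1 x) y = inner E x (S' y)"
      "x \<in> pts E" "y \<in> pts E"
  show "inner E (mult V S T (S1 x)) y = inner E (mult V S T x) (S' y)"
    using V_adj_swap[OF assms(1) *(1-3) _ *(5), of "T x"] V_commute[OF assms(2) *(1) *(4)] * assms by simp
qed (use assms in \<open>auto simp: V_ext\<close>)

lemma V_norm_star_le:
  assumes T: "T \<in> pts V" shows "nrm V (star V T) \<le> nrm V T"
proof (rule V_norm_le)
  fix y assume y: "y \<in> pts E"
  note [simp] = V_star_mem[OF T] T
  let ?z = "star V T y"
  have "(hnorm E ?z)\<^sup>2 = Re (inner E y (T ?z))" using y by (simp add: norm_square V_star_inner)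
  also have "\<dots> \<le> hnorm E y * hnorm E (T ?z)"
    using cauchy_schwarz[of y "T ?z"] complex_Re_le_cmod[of "inner E y (T ?z)"] y by simp
  also have "\<dots> \<le> hnorm E y * (nrm V T * hnorm E ?z)"
    using y by (intro mult_left_mono V_norm) auto
  finally have "hnorm E ?z * hnorm E ?z \<le> (nrm V T * hnorm E y) * hnorm E ?z"
    by (simp add: power2_eq_square mult_ac)
  thus "hnorm E ?z \<le> nrm V T * hnorm E y"
    by (rule le_if_square_le_mult) (use y in simp)
qed (use T in simp)

lemma V_norm_triangle:
  assumes "S \<in> pts V" "T \<in> pts V" shows "nrm V (vadd V S T) \<le> nrm V S + nrm V T"
proof (rule V_norm_le)
  fix x assume x: "x \<in> pts E"
  show "hnorm E (vadd V S T x) \<le> (nrm V S + nrm V T) * hnorm E x"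
    using norm_triangle[of "S x" "T x"] V_norm[OF assms(1) x] V_norm[OF assms(2) x] x assms
    by (simp add: algebra_simps)
qed (use assms in simp)

lemma V_norm_scale_le:
  assumes "T \<in> pts V" shows "nrm V (vscale V c T) \<le> cmod c * nrm V T"
  by (rule V_norm_le) (use V_norm[OF assms] assms in \<open>auto simp: mult.assoc intro!: mult_left_mono\<close>)

lemma V_norm_scale:
  assumes T: "T \<in> pts V" shows "nrm V (vscale V c T) = cmod c * nrm V T"
proof (rule antisym[OF V_norm_scale_le[OF T]], cases "c = 0")
  case False
  have "vscale V (inverse c) (vscale V c T) = T"
    using T False by (intro V_eqI vec_eqI) auto
  with V_norm_scale_le[of "vscale V c T" "inverse c"] T have "nrm V T \<le> inverse (cmod c) * nrm V (vscale V c T)"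
    by (simp add: norm_inverse)
  with False show "cmod c * nrm V T \<le> nrm V (vscale V c T)"
    by (simp add: field_simps)
qed (use T in simp)

text \<open>Completeness is obtained weakly: the matrix coefficients converge, their limit is a
  bounded form that inherits commutation, and the uniform Cauchy estimate upgrades weak convergence
  to convergence in norm.\<close>

lemma V_cauchy_converges:
  assumes s: "\<And>n::nat. s n \<in> pts V"
    and cauchy: "\<And>e. e > 0 \<Longrightarrow> \<exists>n0. \<forall>m\<ge>n0. \<forall>n\<ge>n0. nrm V (vdiff V (s m) (s n)) < e"
  shows "\<exists>T\<in>pts V. (\<lambda>n. nrm V (vdiff V (s n) T)) \<longlonglongrightarrow> 0"
proof -
  have diff: "vdiff V S T \<in> pts V" if "S \<in> pts V" "T \<in> pts V" for S T
    using that by (simp add: vdiff_def)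
  have diff_le: "cmod (inner E (s m x) y - inner E (s n x) y) \<le> nrm V (vdiff V (s m) (s n)) * hnorm E x * hnorm E y"
    if "x \<in> pts E" "y \<in> pts E" for x y m n
    using V_form_le[OF diff[OF s[of m] s[of n]] that] that s by simp
  have "\<exists>b. (\<lambda>n. inner E (s n x) y) \<longlonglongrightarrow> b" if x: "x \<in> pts E" and y: "y \<in> pts E" for x y
  proof (subst convergent_def[symmetric], rule Cauchy_convergent, rule CauchyI)
    fix e :: real assume "e > 0"
    \<comment> \<open>The summand 1 keeps the divisor positive when \<open>x\<close> or
      \<open>y\<close> has norm zero.\<close>
    define k where "k = hnorm E x * hnorm E y + 1"
    have k: "k > 0" using x y by (simp add: k_def add_nonneg_pos)
    obtain n0 where n0: "\<forall>m\<ge>n0. \<forall>n\<ge>n0. nrm V (vdiff V (s m) (s n)) < e / k"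
      using cauchy[of "e / k"] \<open>e > 0\<close> k by auto
    have "norm (inner E (s m x) y - inner E (s n x) y) < e" if "m \<ge> n0" "n \<ge> n0" for m n
    proof -
      have "norm (inner E (s m x) y - inner E (s n x) y) \<le> nrm V (vdiff V (s m) (s n)) * (hnorm E x * hnorm E y)"
        using diff_le[OF x y] by (simp add: mult.assoc)
      also have "\<dots> \<le> nrm V (vdiff V (s m) (s n)) * k"
        using diff[OF s s] by (intro mult_left_mono) (auto simp: k_def)
      also have "\<dots> < e" using n0 that k by (simp add: field_simps)
      finally show ?thesis .
    qed
    thus "\<exists>M. \<forall>m\<ge>M. \<forall>n\<ge>M. norm (inner E (s m x) y - inner E (s n x) y) < e" by blast
  qed
  then obtain B where B: "\<And>x y. \<lbrakk>x \<in> pts E; y \<in> pts E\<rbrakk> \<Longrightarrow> (\<lambda>n. inner E (s n x) y) \<longlonglongrightarrow> B x y" by metis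
  \<comment> \<open>The Cauchy estimate passes to the limit in one of its two indices.\<close>
  have close: "cmod (inner E (s n x) y - B x y) \<le> e * hnorm E x * hnorm E y"
    if "\<forall>m\<ge>n0. \<forall>n\<ge>n0. nrm V (vdiff V (s m) (s n)) < e" "n \<ge> n0" "x \<in> pts E" "y \<in> pts E" for n n0 e x y
  proof (rule tendsto_le[OF _ tendsto_const])
    show "(\<lambda>m. cmod (inner E (s n x) y - inner E (s m x) y)) \<longlonglongrightarrow> cmod (inner E (s n x) y - B x y)"
      using that by (intro tendsto_intros B) auto
    have "cmod (inner E (s n x) y - inner E (s m x) y) \<le> e * hnorm E x * hnorm E y" if "m \<ge> n0" for m
    proof -
      have "nrm V (vdiff V (s n) (s m)) * hnorm E x * hnorm E y \<le> e * hnorm E x * hnorm E y"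
        using \<open>\<forall>m\<ge>n0. _\<close> that \<open>n \<ge> n0\<close> \<open>x \<in> pts E\<close> \<open>y \<in> pts E\<close>
        by (intro mult_right_mono) (auto intro: less_imp_le)
      with diff_le[OF \<open>x \<in> pts E\<close> \<open>y \<in> pts E\<close>, of n m] show ?thesis by linarith
    qed
    thus "\<forall>\<^sub>F m in sequentially. cmod (inner E (s n x) y - inner E (s m x) y) \<le> e * hnorm E x * hnorm E y"
      by (auto simp: eventually_sequentially)
  qed simp
  obtain n1 where n1: "\<forall>m\<ge>n1. \<forall>n\<ge>n1. nrm V (vdiff V (s m) (s n)) < 1" using cauchy[of 1] by auto
  have "\<exists>T\<in>pts V. \<forall>x\<in>pts E. \<forall>y\<in>pts E. inner E (T x) y = B x y"
  proof (rule V_of_form[where C = "nrm V (s n1) + 1"])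
    fix x y assume xy: "x \<in> pts E" "y \<in> pts E"
    have "cmod (B x y) \<le> cmod (inner E (s n1 x) y) + cmod (inner E (s n1 x) y - B x y)"
      by (metis norm_minus_commute norm_triangle_sub)
    thus "cmod (B x y) \<le> (nrm V (s n1) + 1) * hnorm E x * hnorm E y"
      using close[OF n1 order.refl xy] V_form_le[OF s[of n1] xy] by (simp add: algebra_simps)
  next
    fix x x' y assume xy: "x \<in> pts E" "x' \<in> pts E" "y \<in> pts E"
    have "(\<lambda>n. inner E (s n (vadd E x x')) y) \<longlonglongrightarrow> B x y + B x' y"
      using tendsto_add[OF B[of x y] B[of x' y]] xy s by simp
    thus "B (vadd E x x') y = B x y + B x' y"
      using B[of "vadd E x x'" y] xy LIMSEQ_unique by blast
  next
    fix c x y assume xy: "x \<in> pts E" "y \<in> pts E"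
    have "(\<lambda>n. inner E (s n (vscale E c x)) y) \<longlonglongrightarrow> c * B x y"
      using tendsto_mult_left[OF B[OF xy]] xy s by simp
    thus "B (vscale E c x) y = c * B x y"
      using B[of "vscale E c x" y] xy LIMSEQ_unique by blast
    have "(\<lambda>n. inner E (s n x) (vscale E c y)) \<longlonglongrightarrow> cnj c * B x y"
      using tendsto_mult_left[OF B[OF xy]] xy s by simp
    thus "B x (vscale E c y) = cnj c * B x y"
      using B[of x "vscale E c y"] xy LIMSEQ_unique by blast
  next
    fix x y y' assume xy: "x \<in> pts E" "y \<in> pts E" "y' \<in> pts E"
    have "(\<lambda>n. inner E (s n x) (vadd E y y')) \<longlonglongrightarrow> B x y + B x y'"
      using tendsto_add[OF B[of x y] B[of x y']] xy s by simp
    thus "B x (vadd E y y') = B x y + B x y'"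
      using B[of x "vadd E y y'"] xy LIMSEQ_unique by blast
  next
    fix S S' x y assume *: "S \<in> X" "S' \<in> X" "\<And>x y. \<lbrakk>x \<in> pts E; y \<in> pts E\<rbrakk> \<Longrightarrow> inner E (S x) y = inner E x (S' y)"
      "x \<in> pts E" "y \<in> pts E"
    have "(\<lambda>n. inner E (s n (S x)) y) \<longlonglongrightarrow> B x (S' y)"
      using B[of x "S' y"] * by (simp add: V_adj_swap[OF s *])
    thus "B (S x) y = B x (S' y)" using B[of "S x" y] * LIMSEQ_unique by (metis X_mem)
  qed
  then obtain T where T: "T \<in> pts V" and TB: "\<And>x y. \<lbrakk>x \<in> pts E; y \<in> pts E\<rbrakk> \<Longrightarrow> inner E (T x) y = B x y" by blast
  have "(\<lambda>n. nrm V (vdiff V (s n) T)) \<longlonglongrightarrow> 0"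
  proof (rule LIMSEQ_I)
    fix e :: real assume "e > 0"
    then obtain n0 where n0: "\<forall>m\<ge>n0. \<forall>n\<ge>n0. nrm V (vdiff V (s m) (s n)) < e / 2" using cauchy[of "e/2"] by auto
    have "nrm V (vdiff V (s n) T) \<le> e / 2" if n: "n \<ge> n0" for n
    proof (rule V_norm_le)
      fix x assume x: "x \<in> pts E"
      let ?z = "vdiff V (s n) T x"
      have z: "?z \<in> pts E" using x s T by simp
      have "inner E ?z w = inner E (s n x) w - B x w" if "w \<in> pts E" for w
        using that x s T by (simp add: TB)
      hence "(hnorm E ?z)\<^sup>2 = Re (inner E (s n x) ?z - B x ?z)"
        using z by (simp add: norm_square del: V_app)
      also have "\<dots> \<le> cmod (inner E (s n x) ?z - B x ?z)" by (rule complex_Re_le_cmod)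
      also have "\<dots> \<le> e / 2 * hnorm E x * hnorm E ?z" by (rule close[OF n0 n x z])
      finally have "hnorm E ?z * hnorm E ?z \<le> (e / 2 * hnorm E x) * hnorm E ?z" by (simp add: power2_eq_square)
      thus "hnorm E ?z \<le> e / 2 * hnorm E x"
        by (rule le_if_square_le_mult) (use \<open>e > 0\<close> x in simp)
    qed (use \<open>e > 0\<close> in simp)
    thus "\<exists>n0. \<forall>n\<ge>n0. norm (nrm V (vdiff V (s n) T) - 0) < e"
      using \<open>e > 0\<close> diff[OF s T] by (intro exI[of _ n0]) fastforce
  qed
  with T show ?thesis by blast
qed

lemma V_star_eqI:
  assumes "S \<in> pts V" "T \<in> pts V" "\<And>x y. \<lbrakk>x \<in> pts E; y \<in> pts E\<rbrakk> \<Longrightarrow> inner E (S x) y = inner E x (T y)"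
  shows "star V T = S"
  using assms by (intro V_eqI vec_eqI) (simp_all add: V_star_mem V_star_inner)

lemma V_star_inner': "\<lbrakk>T \<in> pts V; x \<in> pts E; y \<in> pts E\<rbrakk> \<Longrightarrow> inner E x (star V T y) = inner E (T x) y"
  using V_star_inner[of T y x] inner_commute[of x "star V T y"] inner_commute[of "T x" y]
  by (simp add: V_star_mem)

theorem commutant_cstar: "cstar_algebra V"
proof -
  note [simp] = V_star_mem V_star_inner V_star_inner'
  interpret cs: Defs.complex_space V
    by unfold_locales (auto intro!: V_eqI vec_eqI simp: algebra_simps)
  show ?thesis
  proof
    fix S T assume "S \<in> pts V" "T \<in> pts V"
    thus "nrm V (mult V S T) \<le> nrm V S * nrm V T"
      by (intro V_norm_le) (auto intro!: V_mult_norm)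
  next
    fix T assume T: "T \<in> pts V"
    show "nrm V T = 0 \<longleftrightarrow> T = vzero V"
    proof
      assume "nrm V T = 0"
      hence "hnorm E (T x) = 0" if "x \<in> pts E" for x
        using V_norm[OF T that] that T by (intro antisym) auto
      hence "T x = vzero E" if "x \<in> pts E" for x
        using that T norm_eq_zero[of "T x"] by simp
      thus "T = vzero V" using T by (intro V_eqI) auto
    next
      assume "T = vzero V"
      thus "nrm V T = 0" using T V_norm_le[of T 0] V_norm_nonneg[OF T] by force
    qed
  next
    fix T assume T [simp]: "T \<in> pts V"
    let ?N = "nrm V (mult V (star V T) T)"
    have N: "0 \<le> ?N" by simp
    show "?N = (nrm V T)\<^sup>2"
    proof (rule antisym)
      have "?N \<le> nrm V (star V T) * nrm V T"
        by (intro V_norm_le) (auto intro!: V_mult_norm)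
      also have "\<dots> \<le> nrm V T * nrm V T" by (intro mult_right_mono V_norm_star_le) auto
      finally show "?N \<le> (nrm V T)\<^sup>2" by (simp add: power2_eq_square)
      \<comment> \<open>The square of \<open>hnorm E (T x)\<close> is the coefficient of
        \<open>T* T\<close> at the pair \<open>x\<close>, \<open>x\<close>, so the square root of
        the norm of \<open>T* T\<close> bounds \<open>T\<close>.\<close>
      have "nrm V T \<le> sqrt ?N"
      proof (rule V_norm_le)
        fix x assume x: "x \<in> pts E"
        have "(hnorm E (T x))\<^sup>2 = Re (inner E (mult V (star V T) T x) x)"
          using x by (simp add: norm_square)
        also have "\<dots> \<le> cmod (inner E (mult V (star V T) T x) x)" by (rule complex_Re_le_cmod)
        also have "\<dots> \<le> ?N * hnorm E x * hnorm E x" using x by (intro V_form_le) auto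
        also have "\<dots> = (sqrt ?N * hnorm E x)\<^sup>2" using N by (simp add: power2_eq_square)
        finally show "hnorm E (T x) \<le> sqrt ?N * hnorm E x"
          by (rule power2_le_imp_le) (use x N in simp)
      qed (use N in simp)
      hence "(nrm V T)\<^sup>2 \<le> (sqrt ?N)\<^sup>2" by (intro power_mono) auto
      thus "(nrm V T)\<^sup>2 \<le> ?N" using N by simp
    qed
  qed (auto intro!: V_eqI vec_eqI V_star_eqI V_norm_triangle V_cauchy_converges simp: V_norm_scale algebra_simps)
qed

end

section \<open>Bounded functionals on a C*-algebra\<close>

context cstar_algebra
begin

lemma bounded_functional_le:
  assumes f: "bounded_functional A f" and x: "x \<in> pts A"
  shows "cmod (f x) \<le> functional_norm A f * nrm A x"
proof -
  obtain C where C: "\<forall>x\<in>pts A. cmod (f x) \<le> C * nrm A x"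
    and sc: "\<And>c x. x \<in> pts A \<Longrightarrow> f (vscale A c x) = c * f x"
    using f unfolding bounded_functional_def by blast
  show ?thesis
  proof (cases "nrm A x = 0")
    case True
    with C x show ?thesis by force
  next
    case False
    hence pos: "nrm A x > 0" using nrm_nonneg[OF x] by linarith
    have bdd: "bdd_above {cmod (f x) |x. x \<in> pts A \<and> nrm A x \<le> 1}"
    proof (rule bdd_aboveI)
      fix y assume "y \<in> {cmod (f x) |x. x \<in> pts A \<and> nrm A x \<le> 1}"
      then obtain x where x: "x \<in> pts A" "nrm A x \<le> 1" "y = cmod (f x)" by auto
      have "C * nrm A x \<le> \<bar>C\<bar> * 1" using x nrm_nonneg[of x] by (intro mult_mono) auto
      thus "y \<le> \<bar>C\<bar>" using C x by fastforce
    qed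
    let ?u = "vscale A (of_real (1 / nrm A x)) x"
    have "cmod (f ?u) \<le> functional_norm A f"
      unfolding functional_norm_def
      by (rule cSup_upper[OF _ bdd]) (use x pos scale_closed[OF x] nrm_scale[OF x] in \<open>auto simp: norm_divide\<close>)
    thus ?thesis using pos x by (simp add: sc norm_divide divide_simps mult.commute)
  qed
qed

lemma functional_norm_le:
  assumes "\<And>x. x \<in> pts A \<Longrightarrow> cmod (f x) \<le> C * nrm A x" "0 \<le> C"
  shows "functional_norm A f \<le> C"
  unfolding functional_norm_def
proof (rule cSup_least)
  show "{cmod (f x) |x. x \<in> pts A \<and> nrm A x \<le> 1} \<noteq> {}"
    using zero_closed nrm_eq_zero[OF zero_closed] by (auto intro!: exI[of _ "vzero A"])
  fix y assume "y \<in> {cmod (f x) |x. x \<in> pts A \<and> nrm A x \<le> 1}"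
  then obtain x where x: "x \<in> pts A" "nrm A x \<le> 1" "y = cmod (f x)" by auto
  have "C * nrm A x \<le> C * 1" using x assms(2) by (intro mult_left_mono) auto
  thus "y \<le> C" using assms(1)[of x] x by simp
qed

lemma functional_norm_cong:
  "(\<And>x. x \<in> pts A \<Longrightarrow> f x = g x) \<Longrightarrow> functional_norm A f = functional_norm A g"
  unfolding functional_norm_def by (rule arg_cong[where f = Sup]) (auto; metis)

lemma bounded_functional_cong:
  assumes "bounded_functional A f" "\<And>x. x \<in> pts A \<Longrightarrow> g x = f x"
  shows "bounded_functional A g"
  using assms by (simp add: bounded_functional_def add_closed scale_closed)

lemma functional_norm_zero:
  assumes "\<And>x. x \<in> pts A \<Longrightarrow> f x = 0" shows "functional_norm A f = 0"
proof -
  have "{cmod (f x) |x. x \<in> pts A \<and> nrm A x \<le> 1} = {0}"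
    using assms zero_closed nrm_eq_zero[OF zero_closed] by (auto intro!: exI[of _ "vzero A"])
  thus ?thesis by (simp add: functional_norm_def)
qed

text \<open>Functionals agreeing on the carrier may differ elsewhere, so they must be identified
  explicitly.\<close>

lemma functional_on_functionals_cong:
  assumes "\<And>f g. \<lbrakk>f \<in> D; g \<in> D\<rbrakk> \<Longrightarrow> (\<lambda>x. f x + g x) \<in> D" "\<And>c f. f \<in> D \<Longrightarrow> (\<lambda>x. c * f x) \<in> D"
    and "\<And>f g. \<lbrakk>f \<in> D; g \<in> D\<rbrakk> \<Longrightarrow> L (\<lambda>x. f x + g x) = L f + L g"
    and "\<And>c f. f \<in> D \<Longrightarrow> L (\<lambda>x. c * f x) = c * L f"
    and bd: "\<And>f. f \<in> D \<Longrightarrow> cmod (L f) \<le> C * functional_norm A f"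
    and fg: "f \<in> D" "g \<in> D" "\<And>x. x \<in> pts A \<Longrightarrow> f x = g x"
  shows "L f = L g"
proof -
  let ?h = "\<lambda>x. f x + (-1) * g x"
  have h: "?h \<in> D" using assms(1,2) fg(1,2) by blast
  have "L ?h = L f + L (\<lambda>x. (-1) * g x)" using assms(2,3) fg(1,2) by blast
  also have "\<dots> = L f - L g" using assms(4)[OF fg(2), of "-1"] by simp
  finally have "cmod (L f - L g) \<le> C * functional_norm A ?h" using bd[OF h] by simp
  thus ?thesis using functional_norm_zero[of ?h] fg(3) by simp
qed

end

lemma bounded_functionalD:
  assumes "bounded_functional A f"
  shows "\<lbrakk>x \<in> pts A; y \<in> pts A\<rbrakk> \<Longrightarrow> f (vadd A x y) = f x + f y"
    and "x \<in> pts A \<Longrightarrow> f (vscale A c x) = c * f x"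
  using assms unfolding bounded_functional_def by blast+

section \<open>The predual of a commutant\<close>

context adjoint_closed
begin

definition vec_fun :: "'v \<Rightarrow> 'v \<Rightarrow> ('v \<Rightarrow> 'v) \<Rightarrow> complex" where
  "vec_fun x y T = inner E (T x) y"

definition functional_space :: "(('v \<Rightarrow> 'v) \<Rightarrow> complex) set \<Rightarrow> bool" where
  "functional_space K \<longleftrightarrow> (\<forall>x\<in>pts E. \<forall>y\<in>pts E. vec_fun x y \<in> K) \<and>
     (\<forall>f\<in>K. \<forall>g\<in>K. (\<lambda>T. f T + g T) \<in> K) \<and> (\<forall>c. \<forall>f\<in>K. (\<lambda>T. c * f T) \<in> K) \<and>
     (\<forall>s f. (\<forall>n. s n \<in> K) \<longrightarrow> bounded_functional V f \<longrightarrow>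
        (\<lambda>n::nat. functional_norm V (\<lambda>T. s n T - f T)) \<longlonglongrightarrow> 0 \<longrightarrow> f \<in> K)"

text \<open>Written as an intersection, the closed span comes with an induction principle: a
  property holds for all normal functionals once the functionals that have it form a
  \<open>functional_space\<close>.\<close>

definition normal_functionals :: "(('v \<Rightarrow> 'v) \<Rightarrow> complex) set" where
  "normal_functionals = {f. bounded_functional V f \<and> (\<forall>K. functional_space K \<longrightarrow> f \<in> K)}"

interpretation cs: cstar_algebra V by (rule commutant_cstar)

lemma vec_fun_le: "\<lbrakk>x \<in> pts E; y \<in> pts E; T \<in> pts V\<rbrakk> \<Longrightarrow>
    cmod (vec_fun x y T) \<le> (hnorm E x * hnorm E y) * nrm V T"
  using V_form_le[of T x y] by (simp add: vec_fun_def mult_ac)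

lemma vec_fun_bounded: "\<lbrakk>x \<in> pts E; y \<in> pts E\<rbrakk> \<Longrightarrow> bounded_functional V (vec_fun x y)"
  unfolding bounded_functional_def
  by (intro conjI exI[of _ "hnorm E x * hnorm E y"] ballI vec_fun_le) (simp_all add: vec_fun_def)

lemma bounded_functional_add:
  assumes f: "bounded_functional V f" and g: "bounded_functional V g"
  shows "bounded_functional V (\<lambda>T. f T + g T)"
proof -
  have "cmod (f T + g T) \<le> (functional_norm V f + functional_norm V g) * nrm V T" if "T \<in> pts V" for T
    using cs.bounded_functional_le[OF f that] cs.bounded_functional_le[OF g that]
      norm_triangle_ineq[of "f T" "g T"] by (simp add: algebra_simps)
  thus ?thesis
    using bounded_functionalD[OF f] bounded_functionalD[OF g] unfolding bounded_functional_def
    by (intro conjI exI[of _ "functional_norm V f + functional_norm V g"]) (auto simp: algebra_simps)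
qed

lemma bounded_functional_scale:
  assumes f: "bounded_functional V f"
  shows "bounded_functional V (\<lambda>T. c * f T)"
proof -
  have "cmod (c * f T) \<le> (cmod c * functional_norm V f) * nrm V T" if "T \<in> pts V" for T
    using cs.bounded_functional_le[OF f that] by (simp add: norm_mult mult.assoc mult_left_mono)
  thus ?thesis
    using bounded_functionalD[OF f] unfolding bounded_functional_def
    by (intro conjI exI[of _ "cmod c * functional_norm V f"]) (auto simp: algebra_simps)
qed

lemma normal_functionals_space: "functional_space normal_functionals"
  unfolding functional_space_def
proof (intro conjI ballI allI impI)
  fix s f assume s: "\<forall>n. s n \<in> normal_functionals" and f: "bounded_functional V f"
    and lim: "(\<lambda>n::nat. functional_norm V (\<lambda>T. s n T - f T)) \<longlonglongrightarrow> 0"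
  have "f \<in> K" if K: "functional_space K" for K
  proof -
    have "\<forall>n. s n \<in> K" using s K by (simp add: normal_functionals_def)
    thus ?thesis using K f lim unfolding functional_space_def by blast
  qed
  thus "f \<in> normal_functionals" using f by (simp add: normal_functionals_def)
qed (unfold normal_functionals_def,
     auto intro: vec_fun_bounded bounded_functional_add bounded_functional_scale simp: functional_space_def)

lemma normal_vec_fun: "\<lbrakk>x \<in> pts E; y \<in> pts E\<rbrakk> \<Longrightarrow> vec_fun x y \<in> normal_functionals"
  and normal_add: "\<lbrakk>f \<in> normal_functionals; g \<in> normal_functionals\<rbrakk> \<Longrightarrow> (\<lambda>T. f T + g T) \<in> normal_functionals"
  and normal_scale: "f \<in> normal_functionals \<Longrightarrow> (\<lambda>T. c * f T) \<in> normal_functionals"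
  using normal_functionals_space unfolding functional_space_def by blast+

lemma normal_bounded: "f \<in> normal_functionals \<Longrightarrow> bounded_functional V f"
  by (simp add: normal_functionals_def)

text \<open>Vector functionals of unit vectors suffice for the lower bound: if \<open>x\<close> and
  \<open>T x\<close> are both nonzero, their normalisations give the quotient
  \<open>hnorm E (T x) / hnorm E x\<close>.\<close>

lemma normal_norming:
  assumes T: "T \<in> pts V"
  shows "nrm V T = Sup {cmod (f T) | f. f \<in> normal_functionals \<and> functional_norm V f \<le> 1}"
    (is "_ = Sup ?S")
proof (rule antisym)
  have le: "y \<le> nrm V T" if y: "y \<in> ?S" for y
  proof -
    obtain f where f: "f \<in> normal_functionals" "functional_norm V f \<le> 1" "y = cmod (f T)" using y by auto
    have "functional_norm V f * nrm V T \<le> 1 * nrm V T" using f T by (intro mult_right_mono) auto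
    thus ?thesis using cs.bounded_functional_le[OF normal_bounded[OF f(1)] T] f(3) by simp
  qed
  hence bdd: "bdd_above ?S" by (intro bdd_aboveI)
  have mem: "cmod (inner E (T x) y) \<in> ?S" if "x \<in> pts E" "y \<in> pts E" "hnorm E x * hnorm E y \<le> 1" for x y
  proof -
    have "functional_norm V (vec_fun x y) \<le> hnorm E x * hnorm E y"
      using that by (intro cs.functional_norm_le vec_fun_le) auto
    thus ?thesis using that normal_vec_fun[of x y] by (auto simp: vec_fun_def intro!: exI[of _ "vec_fun x y"])
  qed
  have "0 \<in> ?S" using mem[of "vzero E" "vzero E"] T by simp
  hence S0: "0 \<le> Sup ?S" using bdd by (rule cSup_upper)
  show "Sup ?S \<le> nrm V T" using \<open>0 \<in> ?S\<close> le by (intro cSup_least) auto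
  show "nrm V T \<le> Sup ?S"
  proof (rule V_norm_le[OF _ S0])
    fix x assume x: "x \<in> pts E"
    show "hnorm E (T x) \<le> Sup ?S * hnorm E x"
    proof (cases "hnorm E x = 0 \<or> hnorm E (T x) = 0")
      case True
      thus ?thesis using V_norm[OF T x] S0 x by (auto intro: order_trans)
    next
      case False
      hence pos: "hnorm E x > 0" "hnorm E (T x) > 0"
        using norm_nonneg[OF x] norm_nonneg[of "T x"] T x by (auto simp: less_le)
      define a b where "a = hnorm E x" and "b = hnorm E (T x)"
      let ?u = "vscale E (of_real (1 / a)) x" let ?w = "vscale E (of_real (1 / b)) (T x)"
      have "cmod (inner E (T ?u) ?w) \<in> ?S"
        using pos x T by (intro mem) (auto simp: norm_divide a_def b_def)
      hence "cmod (inner E (T ?u) ?w) \<le> Sup ?S" using bdd by (rule cSup_upper)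
      moreover have "inner E (T ?u) ?w = of_real (b / a)"
        using x T pos inner_self[of "T x"] by (simp add: a_def b_def power2_eq_square)
      ultimately have "b / a \<le> Sup ?S" using pos by (simp add: a_def b_def norm_divide)
      thus ?thesis using pos by (simp add: a_def b_def divide_le_eq)
    qed
  qed
qed

text \<open>On vector functionals, \<open>L\<close> is a bounded form, which some operator
  \<open>T\<close> of the commutant represents. The normal functionals on which \<open>L\<close> is
  evaluation at \<open>T\<close> form a \<open>functional_space\<close>, hence are all of
  them.\<close>

lemma normal_dual:
  assumes Ladd: "\<And>f g. \<lbrakk>f \<in> normal_functionals; g \<in> normal_functionals\<rbrakk> \<Longrightarrow> L (\<lambda>x. f x + g x) = L f + L g"
    and Lscale: "\<And>c f. f \<in> normal_functionals \<Longrightarrow> L (\<lambda>x. c * f x) = c * L f"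
    and Lbd: "\<And>f. f \<in> normal_functionals \<Longrightarrow> cmod (L f) \<le> C * functional_norm V f"
  shows "\<exists>T\<in>pts V. \<forall>f\<in>normal_functionals. L f = f T"
proof -
  \<comment> \<open>\<open>vec_fun\<close> of a sum of vectors and the sum of the two functionals
    are guaranteed to agree on the carrier only, so \<open>L\<close> cannot be rewritten along an
    equality of functions.\<close>
  note cong = cs.functional_on_functionals_cong[where D = normal_functionals and L = L and C = C,
      OF normal_add normal_scale Ladd Lscale Lbd]
  have "\<exists>T\<in>pts V. \<forall>x\<in>pts E. \<forall>y\<in>pts E. inner E (T x) y = L (vec_fun x y)"
  proof (rule V_of_form[where C = "\<bar>C\<bar>"])
    fix x y assume xy: "x \<in> pts E" "y \<in> pts E"
    have fn: "functional_norm V (vec_fun x y) \<le> hnorm E x * hnorm E y"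
      using xy by (intro cs.functional_norm_le vec_fun_le) auto
    have "0 \<le> cmod (vec_fun x y (unit V))" by simp
    have "cmod (L (vec_fun x y)) \<le> C * functional_norm V (vec_fun x y)"
      by (rule Lbd[OF normal_vec_fun[OF xy]])
    also have "\<dots> \<le> \<bar>C\<bar> * (hnorm E x * hnorm E y)"
    proof (rule mult_mono[OF abs_ge_self fn])
      have "cmod (vec_fun x y (vzero V)) \<in> {cmod (vec_fun x y T) |T. T \<in> pts V \<and> nrm V T \<le> 1}"
        using cs.nrm_eq_zero[OF cs.zero_closed] by (auto intro!: exI[of _ "vzero V"])
      moreover have "bdd_above {cmod (vec_fun x y T) |T. T \<in> pts V \<and> nrm V T \<le> 1}"
        using xy by (intro bdd_aboveI[of _ "hnorm E x * hnorm E y"])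
          (auto intro!: order_trans[OF vec_fun_le] mult_left_le)
      ultimately show "0 \<le> functional_norm V (vec_fun x y)"
        unfolding functional_norm_def by (rule order_trans[OF norm_ge_zero cSup_upper])
    qed auto
    finally show "cmod (L (vec_fun x y)) \<le> \<bar>C\<bar> * hnorm E x * hnorm E y" by (simp add: mult.assoc)
  next
    fix x x' y assume xy: "x \<in> pts E" "x' \<in> pts E" "y \<in> pts E"
    have "L (vec_fun (vadd E x x') y) = L (\<lambda>T. vec_fun x y T + vec_fun x' y T)"
      using xy by (intro cong normal_vec_fun normal_add) (auto simp: vec_fun_def)
    thus "L (vec_fun (vadd E x x') y) = L (vec_fun x y) + L (vec_fun x' y)"
      using Ladd[OF normal_vec_fun normal_vec_fun] xy by simp
  next
    fix x y y' assume xy: "x \<in> pts E" "y \<in> pts E" "y' \<in> pts E"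
    have "L (vec_fun x (vadd E y y')) = L (\<lambda>T. vec_fun x y T + vec_fun x y' T)"
      using xy by (intro cong normal_vec_fun normal_add) (auto simp: vec_fun_def)
    thus "L (vec_fun x (vadd E y y')) = L (vec_fun x y) + L (vec_fun x y')"
      using Ladd[OF normal_vec_fun normal_vec_fun] xy by simp
  next
    fix c x y assume xy: "x \<in> pts E" "y \<in> pts E"
    have "L (vec_fun (vscale E c x) y) = L (\<lambda>T. c * vec_fun x y T)"
      using xy by (intro cong normal_vec_fun normal_scale) (auto simp: vec_fun_def)
    thus "L (vec_fun (vscale E c x) y) = c * L (vec_fun x y)"
      using Lscale[OF normal_vec_fun] xy by simp
    have "L (vec_fun x (vscale E c y)) = L (\<lambda>T. cnj c * vec_fun x y T)"
      using xy by (intro cong normal_vec_fun normal_scale) (auto simp: vec_fun_def)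
    thus "L (vec_fun x (vscale E c y)) = cnj c * L (vec_fun x y)"
      using Lscale[OF normal_vec_fun] xy by simp
  next
    fix S S' x y assume *: "S \<in> X" "S' \<in> X" "\<And>x y. \<lbrakk>x \<in> pts E; y \<in> pts E\<rbrakk> \<Longrightarrow> inner E (S x) y = inner E x (S' y)"
      "x \<in> pts E" "y \<in> pts E"
    show "L (vec_fun (S x) y) = L (vec_fun x (S' y))"
      using * by (intro cong normal_vec_fun) (auto simp: vec_fun_def V_adj_swap[OF _ *])
  qed
  then obtain T where T: "T \<in> pts V" and TL: "\<And>x y. \<lbrakk>x \<in> pts E; y \<in> pts E\<rbrakk> \<Longrightarrow> inner E (T x) y = L (vec_fun x y)"
    by blast
  have "functional_space {f \<in> normal_functionals. L f = f T}"
    unfolding functional_space_def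
  proof (intro conjI ballI allI impI)
    fix s f assume s: "\<forall>n. s n \<in> {f \<in> normal_functionals. L f = f T}" and f: "bounded_functional V f"
      and lim: "(\<lambda>n::nat. functional_norm V (\<lambda>T. s n T - f T)) \<longlonglongrightarrow> 0"
    have sn: "s n \<in> normal_functionals" "L (s n) = s n T" for n using s by auto
    have fD: "f \<in> normal_functionals"
      using normal_functionals_space sn(1) f lim unfolding functional_space_def by blast
    have eq: "(\<lambda>T. s n T + (-1) * f T) = (\<lambda>T. s n T - f T)" for n by auto
    have h: "(\<lambda>T. s n T - f T) \<in> normal_functionals" for n
      using normal_add[OF sn(1) normal_scale[OF fD, of "-1"], of n] unfolding eq .
    have "L (\<lambda>T. s n T - f T) = s n T - L f" for n
      using Ladd[OF sn(1) normal_scale[OF fD, of "-1"], of n] Lscale[OF fD, of "-1"] sn(2)[of n] unfolding eq by simp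
    hence "cmod (s n T - L f) \<le> C * functional_norm V (\<lambda>T. s n T - f T)" for n
      using Lbd[OF h[of n]] by simp
    hence "(\<lambda>n. s n T - L f) \<longlonglongrightarrow> 0"
      by (intro Lim_null_comparison[OF _ tendsto_mult_right_zero[OF lim]] always_eventually) auto
    moreover have "cmod (s n T - f T) \<le> functional_norm V (\<lambda>T. s n T - f T) * nrm V T" for n
      using cs.bounded_functional_le[OF normal_bounded[OF h[of n]] T] by simp
    hence "(\<lambda>n. s n T - f T) \<longlonglongrightarrow> 0"
      by (intro Lim_null_comparison[OF _ tendsto_mult_left_zero[OF lim]] always_eventually) auto
    ultimately have "(\<lambda>n. (s n T - L f) - (s n T - f T)) \<longlonglongrightarrow> 0 - 0" by (rule tendsto_diff)
    hence "(\<lambda>n::nat. f T - L f) \<longlonglongrightarrow> 0" by simp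
    hence "f T - L f = 0" by (simp only: LIMSEQ_const_iff)
    thus "f \<in> {f \<in> normal_functionals. L f = f T}" using fD by simp
  qed (auto simp: normal_vec_fun normal_add normal_scale Ladd Lscale TL[symmetric] vec_fun_def[of _ _ T])
  hence "\<forall>f\<in>normal_functionals. L f = f T" unfolding normal_functionals_def by blast
  thus ?thesis using T by blast
qed

theorem commutant_wstar: "wstar_algebra V"
proof
  have "is_predual V normal_functionals"
    unfolding is_predual_def
  proof (intro conjI ballI allI impI)
    show "normal_functionals \<noteq> {}" using normal_vec_fun[OF zero_mem zero_mem] by blast
    fix s f assume "\<forall>n. s n \<in> normal_functionals" "bounded_functional V f"
        "(\<lambda>n::nat. functional_norm V (\<lambda>T. s n T - f T)) \<longlonglongrightarrow> 0"
    thus "f \<in> normal_functionals"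
      using normal_functionals_space unfolding functional_space_def by blast
  next
    fix L :: "(('v \<Rightarrow> 'v) \<Rightarrow> complex) \<Rightarrow> complex"
    assume "\<exists>C. \<forall>f\<in>normal_functionals. cmod (L f) \<le> C * functional_norm V f"
      and "\<forall>f\<in>normal_functionals. \<forall>g\<in>normal_functionals. L (\<lambda>x. f x + g x) = L f + L g"
      and "\<forall>c. \<forall>f\<in>normal_functionals. L (\<lambda>x. c * f x) = c * L f"
    thus "\<exists>T\<in>pts V. \<forall>f\<in>normal_functionals. L f = f T"
      using normal_dual[of L] by blast
  qed (auto simp: normal_bounded normal_add normal_scale intro: normal_norming)
  thus "\<exists>D. is_predual V D" ..
qed

end

text \<open>The operations of \<open>A\<close> are not assumed to satisfy any law; all laws are inherited from \<open>B\<close>.\<close>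

locale star_transport =
  B: wstar_algebra B for B :: "('w, 'n) nstar_scheme" +
  fixes A :: "('v, 'm) nstar_scheme" and h :: "'v \<Rightarrow> 'w"
  assumes iso: "isometric_star_isomorphism A B h"
    and add_c [simp]: "\<lbrakk>x \<in> pts A; y \<in> pts A\<rbrakk> \<Longrightarrow> vadd A x y \<in> pts A"
    and zero_c [simp]: "vzero A \<in> pts A"
    and scale_c [simp]: "x \<in> pts A \<Longrightarrow> vscale A c x \<in> pts A"
    and mult_c [simp]: "\<lbrakk>x \<in> pts A; y \<in> pts A\<rbrakk> \<Longrightarrow> mult A x y \<in> pts A"
    and unit_c [simp]: "unit A \<in> pts A"
    and star_c [simp]: "x \<in> pts A \<Longrightarrow> star A x \<in> pts A"
    and h_zero [simp]: "h (vzero A) = vzero B"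
begin

lemma h_lin: "linear_map A B h" and h_bij: "bij_betw h (pts A) (pts B)"
  and h_mult [simp]: "\<lbrakk>x \<in> pts A; y \<in> pts A\<rbrakk> \<Longrightarrow> h (mult A x y) = mult B (h x) (h y)"
  and h_unit [simp]: "h (unit A) = unit B"
  and h_star [simp]: "x \<in> pts A \<Longrightarrow> h (star A x) = star B (h x)"
  and h_nrm: "x \<in> pts A \<Longrightarrow> nrm A x = nrm B (h x)"
  using iso by (simp_all add: isometric_star_isomorphism_def)

lemmas h_mem [simp] = linear_mapD(1)[OF h_lin]
  and h_add [simp] = linear_mapD(2)[OF h_lin]
  and h_scale [simp] = linear_mapD(3)[OF h_lin]

lemma h_eq: "\<lbrakk>x \<in> pts A; y \<in> pts A\<rbrakk> \<Longrightarrow> x = y \<longleftrightarrow> h x = h y"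
  using h_bij by (auto simp: bij_betw_def inj_on_eq_iff)

lemma h_diff [simp]: "\<lbrakk>x \<in> pts A; y \<in> pts A\<rbrakk> \<Longrightarrow> h (vdiff A x y) = vdiff B (h x) (h y)"
  by (simp add: vdiff_def)

lemma h_surj: "y \<in> pts B \<Longrightarrow> \<exists>x\<in>pts A. h x = y"
  using h_bij by (metis bij_betw_def imageE)

lemma cstar: "cstar_algebra A"
proof
  fix s :: "nat \<Rightarrow> 'v"
  assume s: "\<And>n. s n \<in> pts A"
    and c: "\<And>e. e > 0 \<Longrightarrow> \<exists>n0. \<forall>m\<ge>n0. \<forall>n\<ge>n0. nrm A (vdiff A (s m) (s n)) < e"
  have diff: "vdiff A x y \<in> pts A" if "x \<in> pts A" "y \<in> pts A" for x y using that by (simp add: vdiff_def)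
  have "\<exists>y\<in>pts B. (\<lambda>n. nrm B (vdiff B (h (s n)) y)) \<longlonglongrightarrow> 0"
    using s c by (intro B.complete) (auto simp: h_nrm diff)
  then obtain x where "x \<in> pts A" "(\<lambda>n. nrm B (vdiff B (h (s n)) (h x))) \<longlonglongrightarrow> 0"
    using h_surj by blast
  thus "\<exists>x\<in>pts A. (\<lambda>n. nrm A (vdiff A (s n) x)) \<longlonglongrightarrow> 0"
    using s by (auto simp: h_nrm diff)
qed (auto simp: h_eq h_nrm B.add_assoc B.add_zero B.add_inverse B.scale_one B.scale_scale
    B.scale_add_left B.scale_add_right B.mult_assoc B.mult_add_left B.mult_add_right B.mult_scale_left
    B.mult_scale_right B.unit_left B.unit_right B.star_star B.star_add B.star_scale B.star_mult
    B.nrm_nonneg B.nrm_eq_zero B.nrm_triangle B.nrm_scale B.nrm_mult B.cstar_identity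
    intro: B.add_commute)

lemma functional_norm_h: "functional_norm B f = functional_norm A (\<lambda>x. f (h x))"
proof -
  have "{cmod (f y) |y. y \<in> pts B \<and> nrm B y \<le> 1} = {cmod (f (h x)) |x. x \<in> pts A \<and> nrm A x \<le> 1}"
    using h_surj by (auto simp: h_nrm) (metis h_nrm)
  thus ?thesis by (simp add: functional_norm_def)
qed

lemma bounded_functional_h: "bounded_functional B f \<longleftrightarrow> bounded_functional A (\<lambda>x. f (h x))"
proof -
  have ball: "(\<forall>y\<in>pts B. P y) \<longleftrightarrow> (\<forall>x\<in>pts A. P (h x))" for P
    by (metis h_mem h_surj)
  show ?thesis unfolding bounded_functional_def ball by (auto simp: h_nrm)
qed

theorem wstar: "wstar_algebra A"
proof -
  interpret cstar_algebra A by (rule cstar)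
  obtain D where D: "is_predual B D" using B.has_predual by blast
  hence D0: "D \<noteq> {}" and Db: "\<And>f. f \<in> D \<Longrightarrow> bounded_functional B f"
    and Dadd: "\<And>f g. \<lbrakk>f \<in> D; g \<in> D\<rbrakk> \<Longrightarrow> (\<lambda>x. f x + g x) \<in> D"
    and Dscale: "\<And>c f. f \<in> D \<Longrightarrow> (\<lambda>x. c * f x) \<in> D"
    and Dlim: "\<And>s f. \<lbrakk>\<And>n. s n \<in> D; bounded_functional B f;
        (\<lambda>n::nat. functional_norm B (\<lambda>x. s n x - f x)) \<longlonglongrightarrow> 0\<rbrakk> \<Longrightarrow> f \<in> D"
    and Dnorm: "\<And>x. x \<in> pts B \<Longrightarrow> nrm B x = Sup {cmod (f x) | f. f \<in> D \<and> functional_norm B f \<le> 1}"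
    and Ddual: "\<And>L C. \<lbrakk>\<And>f g. \<lbrakk>f \<in> D; g \<in> D\<rbrakk> \<Longrightarrow> L (\<lambda>x. f x + g x) = L f + L g;
        \<And>c f. f \<in> D \<Longrightarrow> L (\<lambda>x. c * f x) = c * L f;
        \<And>f. f \<in> D \<Longrightarrow> cmod (L f) \<le> C * functional_norm B f\<rbrakk> \<Longrightarrow> \<exists>x\<in>pts B. \<forall>f\<in>D. L f = f x"
    unfolding is_predual_def by blast+
  \<comment> \<open>Besides the pull-backs of members of \<open>D\<close>, every function that
    agrees with one of them on the carrier belongs to \<open>D'\<close>: a norm limit is determined
    by its approximants only there.\<close>
  define D' where "D' = {f. \<exists>g\<in>D. \<forall>x\<in>pts A. f x = g (h x)}"
  define k where "k = inv_into (pts A) h"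
  have k: "y \<in> pts B \<Longrightarrow> h (k y) = y" "x \<in> pts A \<Longrightarrow> k (h x) = x" for x y
    using h_bij by (auto simp: k_def bij_betw_def f_inv_into_f)
  have pull: "(\<lambda>x. g (h x)) \<in> D'" if "g \<in> D" for g using that by (auto simp: D'_def)
  have Db': "bounded_functional A f" if "f \<in> D'" for f
  proof -
    from that obtain g where g: "g \<in> D" "\<And>x. x \<in> pts A \<Longrightarrow> f x = g (h x)" unfolding D'_def by blast
    have "bounded_functional A (\<lambda>x. g (h x))" using Db[OF g(1)] bounded_functional_h by simp
    thus ?thesis by (rule bounded_functional_cong) (rule g(2))
  qed
  have Dadd': "(\<lambda>x. f x + g x) \<in> D'" if "f \<in> D'" "g \<in> D'" for f g
  proof -
    obtain f' g' where "f' \<in> D" "g' \<in> D" "\<And>x. x \<in> pts A \<Longrightarrow> f x = f' (h x)" "\<And>x. x \<in> pts A \<Longrightarrow> g x = g' (h x)"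
      using \<open>f \<in> D'\<close> \<open>g \<in> D'\<close> unfolding D'_def by blast
    thus ?thesis using Dadd[of f' g']
      unfolding D'_def by (intro CollectI bexI[of _ "\<lambda>x. f' x + g' x"]) auto
  qed
  have Dscale': "(\<lambda>x. c * f x) \<in> D'" if "f \<in> D'" for f c
  proof -
    obtain f' where "f' \<in> D" "\<And>x. x \<in> pts A \<Longrightarrow> f x = f' (h x)"
      using \<open>f \<in> D'\<close> unfolding D'_def by blast
    thus ?thesis using Dscale[of f' c]
      unfolding D'_def by (intro CollectI bexI[of _ "\<lambda>x. c * f' x"]) auto
  qed
  have "is_predual A D'"
    unfolding is_predual_def
  proof (intro conjI ballI allI impI)
    show "D' \<noteq> {}" using D0 pull by blast
  next
    fix s f assume s: "\<forall>n. s n \<in> D'" and f: "bounded_functional A f"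
      and lim: "(\<lambda>n::nat. functional_norm A (\<lambda>x. s n x - f x)) \<longlonglongrightarrow> 0"
    obtain g where g: "\<And>n. g n \<in> D" "\<And>n x. x \<in> pts A \<Longrightarrow> s n x = g n (h x)"
      using s unfolding D'_def by simp metis
    have "bounded_functional A (\<lambda>x. f (k (h x)))" using f by (rule bounded_functional_cong) (simp add: k)
    hence "bounded_functional B (\<lambda>y. f (k y))" using bounded_functional_h by simp
    moreover have "functional_norm A (\<lambda>x. s n x - f x) = functional_norm B (\<lambda>y. g n y - f (k y))" for n
      unfolding functional_norm_h by (rule functional_norm_cong) (simp add: g k)
    ultimately have "(\<lambda>y. f (k y)) \<in> D" using lim by (intro Dlim[OF g(1)]) auto
    thus "f \<in> D'" unfolding D'_def by (intro CollectI bexI[of _ "\<lambda>y. f (k y)"]) (simp_all add: k)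
  next
    fix x assume x: "x \<in> pts A"
    have "{cmod (f x) | f. f \<in> D' \<and> functional_norm A f \<le> 1} =
        {cmod (g (h x)) | g. g \<in> D \<and> functional_norm B g \<le> 1}"
    proof (intro equalityI subsetI; elim CollectE exE conjE)
      fix y f assume "f \<in> D'" "functional_norm A f \<le> 1" "y = cmod (f x)"
      moreover obtain g where g: "g \<in> D" "\<And>x. x \<in> pts A \<Longrightarrow> f x = g (h x)"
        using \<open>f \<in> D'\<close> unfolding D'_def by blast
      moreover have "functional_norm A f = functional_norm B g"
        unfolding functional_norm_h by (rule functional_norm_cong) (simp add: g)
      ultimately show "y \<in> {cmod (g (h x)) | g. g \<in> D \<and> functional_norm B g \<le> 1}" using x by auto
    next
      fix y g assume "g \<in> D" "functional_norm B g \<le> 1" "y = cmod (g (h x))"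
      thus "y \<in> {cmod (f x) | f. f \<in> D' \<and> functional_norm A f \<le> 1}"
        using pull[of g] unfolding functional_norm_h by (intro CollectI exI[of _ "\<lambda>x. g (h x)"]) simp
    qed
    thus "nrm A x = Sup {cmod (f x) | f. f \<in> D' \<and> functional_norm A f \<le> 1}"
      using Dnorm[of "h x"] x by (simp add: h_nrm)
  next
    fix L :: "('v \<Rightarrow> complex) \<Rightarrow> complex"
    assume Ladd: "\<forall>f\<in>D'. \<forall>g\<in>D'. L (\<lambda>x. f x + g x) = L f + L g"
      and Lscale: "\<forall>c. \<forall>f\<in>D'. L (\<lambda>x. c * f x) = c * L f"
      and "\<exists>C. \<forall>f\<in>D'. cmod (L f) \<le> C * functional_norm A f"
    then obtain C where C: "\<And>f. f \<in> D' \<Longrightarrow> cmod (L f) \<le> C * functional_norm A f" by blast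
    have "\<exists>y\<in>pts B. \<forall>g\<in>D. L (\<lambda>x. g (h x)) = g y"
      using C by (intro Ddual[of "\<lambda>g. L (\<lambda>x. g (h x))" C])
        (auto simp: functional_norm_h pull Ladd[rule_format, OF pull pull] Lscale[rule_format, OF pull])
    then obtain x where x: "x \<in> pts A" "\<And>g. g \<in> D \<Longrightarrow> L (\<lambda>x. g (h x)) = g (h x)"
      using h_surj by blast
    have "L f = f x" if f: "f \<in> D'" for f
    proof -
      obtain g where g: "g \<in> D" "\<And>x. x \<in> pts A \<Longrightarrow> f x = g (h x)"
        using f unfolding D'_def by blast
      have "L f = L (\<lambda>x. g (h x))"
        by (rule functional_on_functionals_cong[OF Dadd' Dscale' Ladd[rule_format] Lscale[rule_format] C
              f pull[OF g(1)] g(2)])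
      thus ?thesis using x g by simp
    qed
    thus "\<exists>x\<in>pts A. \<forall>f\<in>D'. L f = f x" using x(1) by blast
  qed (auto intro: Db' Dadd' Dscale')
  thus ?thesis by unfold_locales blast
qed

end

section \<open>The spaces L2\<close>

lemma ae_class_self: "f \<in> F \<Longrightarrow> f \<in> ae_class M F f"
  by (simp add: ae_class_def)

lemma ae_class_cong: "AE x in M. f x = g x \<Longrightarrow> ae_class M F f = ae_class M F g"
  by (auto simp: ae_class_def elim: AE_mp)

lemma ae_class_eqD: "\<lbrakk>f \<in> F; ae_class M F f = ae_class M F g\<rbrakk> \<Longrightarrow> AE x in M. f x = g x"
  using ae_class_self[of f F M] by (auto simp: ae_class_def)

lemma rep_mem: "f \<in> F \<Longrightarrow> rep (ae_class M F f) \<in> ae_class M F f"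
  unfolding rep_def by (rule someI[of _ f], rule ae_class_self)

lemma rep_ae_class: "f \<in> F \<Longrightarrow> rep (ae_class M F f) \<in> F"
  and rep_ae_eq: "f \<in> F \<Longrightarrow> AE x in M. rep (ae_class M F f) x = f x"
  using rep_mem[of f F M] by (auto simp: ae_class_def)

lemma ae_class_rep: "a \<in> ae_class M F ` F \<Longrightarrow> ae_class M F (rep a) = a"
  by (elim imageE, hypsubst, rule ae_class_cong, rule rep_ae_eq)

lemma borel_measurable_cnj [measurable (raw)]:
  "f \<in> borel_measurable M \<Longrightarrow> (\<lambda>x. cnj (f x)) \<in> borel_measurable M"
  by (rule borel_measurable_continuous_on) (auto intro: continuous_intros)

lemma integral_mult_cnj_self: "(\<integral>x. f x * cnj (f x) \<partial>M) = of_real (\<integral>x. (cmod (f x))\<^sup>2 \<partial>M)"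
  by (subst integral_complex_of_real[symmetric])
    (rule Bochner_Integration.integral_cong[OF refl], rule complex_norm_square[symmetric])

lemma sq_int_integrable: "f \<in> sq_int M \<Longrightarrow> integrable M (\<lambda>x. (cmod (f x))\<^sup>2)"
  by (simp add: sq_int_def)

lemma sq_int_mult_integrable:
  assumes f: "f \<in> sq_int M" and g: "g \<in> sq_int M"
  shows "integrable M (\<lambda>x. f x * g x)" "integrable M (\<lambda>x. f x * cnj (g x))"
proof -
  have [measurable]: "f \<in> borel_measurable M" "g \<in> borel_measurable M" using f g by (auto simp: sq_int_def)
  have le: "cmod (f x) * cmod (g x) \<le> (cmod (f x))\<^sup>2 + (cmod (g x))\<^sup>2" for x
  proof -
    have "0 \<le> cmod (f x) * cmod (g x)" by simp
    thus ?thesis using sum_squares_bound[of "cmod (f x)" "cmod (g x)"]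
      by (simp del: zero_le_mult_iff mult_nonneg_nonneg)
  qed
  have i: "integrable M (\<lambda>x. (cmod (f x))\<^sup>2 + (cmod (g x))\<^sup>2)"
    using f g by (simp add: sq_int_integrable)
  show "integrable M (\<lambda>x. f x * g x)" "integrable M (\<lambda>x. f x * cnj (g x))"
    by (rule Bochner_Integration.integrable_bound[OF i], measurable, simp add: norm_mult le)+
qed

lemma sq_int_add [simp]:
  assumes f: "f \<in> sq_int M" and g: "g \<in> sq_int M"
  shows "(\<lambda>x. f x + g x) \<in> sq_int M"
proof -
  have [measurable]: "f \<in> borel_measurable M" "g \<in> borel_measurable M" using f g by (auto simp: sq_int_def)
  have le: "(cmod (f x + g x))\<^sup>2 \<le> 2 * (cmod (f x))\<^sup>2 + 2 * (cmod (g x))\<^sup>2" for x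
  proof -
    have "(cmod (f x + g x))\<^sup>2 \<le> (cmod (f x) + cmod (g x))\<^sup>2"
      by (intro power_mono norm_triangle_ineq) auto
    thus ?thesis using sum_squares_bound[of "cmod (f x)" "cmod (g x)"] by (simp add: power2_sum)
  qed
  have "integrable M (\<lambda>x. 2 * (cmod (f x))\<^sup>2 + 2 * (cmod (g x))\<^sup>2)"
    using f g by (simp add: sq_int_integrable)
  hence "integrable M (\<lambda>x. (cmod (f x + g x))\<^sup>2)"
    by (rule Bochner_Integration.integrable_bound) (use le in \<open>auto\<close>)
  thus ?thesis by (simp add: sq_int_def)
qed

lemma sq_int_scale [simp]: "f \<in> sq_int M \<Longrightarrow> (\<lambda>x. c * f x) \<in> sq_int M"
  by (auto simp: sq_int_def norm_mult power_mult_distrib)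

lemma sq_int_zero [simp]: "(\<lambda>x. 0) \<in> sq_int M"
  by (simp add: sq_int_def)

lemma sq_int_diff [simp]: "\<lbrakk>f \<in> sq_int M; g \<in> sq_int M\<rbrakk> \<Longrightarrow> (\<lambda>x. f x - g x) \<in> sq_int M"
  using sq_int_add[of f M "\<lambda>x. -1 * g x"] sq_int_scale[of g M "-1"] by simp

lemma sq_int_cnj: "f \<in> sq_int M \<Longrightarrow> (\<lambda>x. cnj (f x)) \<in> sq_int M"
  by (auto simp: sq_int_def)

lemma sq_int_bounded_mult:
  assumes f: "f \<in> sq_int M" and [measurable]: "\<phi> \<in> borel_measurable M"
    and bd: "AE x in M. cmod (\<phi> x) \<le> C"
  shows "(\<lambda>x. \<phi> x * f x) \<in> sq_int M"
proof -
  have [measurable]: "f \<in> borel_measurable M" using f by (auto simp: sq_int_def)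
  have "integrable M (\<lambda>x. C\<^sup>2 * (cmod (f x))\<^sup>2)" using f by (simp add: sq_int_integrable)
  hence "integrable M (\<lambda>x. (cmod (\<phi> x * f x))\<^sup>2)"
  proof (rule Bochner_Integration.integrable_bound)
    show "AE x in M. norm ((cmod (\<phi> x * f x))\<^sup>2) \<le> norm (C\<^sup>2 * (cmod (f x))\<^sup>2)"
      using bd by eventually_elim (auto simp: norm_mult power_mult_distrib intro!: mult_right_mono power_mono)
  qed measurable
  thus ?thesis by (simp add: sq_int_def)
qed

lemma sq_int_bounded_mult':
  assumes "f \<in> sq_int M" "\<phi> \<in> borel_measurable M" "\<And>x. x \<in> space M \<Longrightarrow> cmod (\<phi> x) \<le> C"
  shows "(\<lambda>x. \<phi> x * f x) \<in> sq_int M"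
  using assms by (intro sq_int_bounded_mult[where C = C]) auto

lemma sq_int_indicator:
  assumes "A \<in> sets M" "emeasure M A < \<infinity>"
  shows "(\<lambda>x. indicator A x) \<in> sq_int M"
proof -
  have "integrable M (indicator A :: _ \<Rightarrow> real)" using assms by (simp add: integrable_indicator_iff)
  moreover have "(\<lambda>x. (cmod (indicator A x))\<^sup>2) = (indicator A :: _ \<Rightarrow> real)"
    by (auto simp: indicator_def)
  ultimately show ?thesis using assms by (simp add: sq_int_def)
qed

lemma L2_pts: "a \<in> pts (L2 M) \<longleftrightarrow> (\<exists>f\<in>sq_int M. a = L2_class M f)"
  by (auto simp: L2_def)

lemma L2_class_mem [simp]: "f \<in> sq_int M \<Longrightarrow> L2_class M f \<in> pts (L2 M)"
  by (auto simp: L2_def)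

lemma rep_sq_int [simp]: "a \<in> pts (L2 M) \<Longrightarrow> rep a \<in> sq_int M"
  by (auto simp: L2_pts rep_ae_class)

lemma L2_class_rep: "a \<in> pts (L2 M) \<Longrightarrow> L2_class M (rep a) = a"
  by (simp add: L2_def ae_class_rep)

lemma L2_class_eq_iff: "f \<in> sq_int M \<Longrightarrow> L2_class M f = L2_class M g \<longleftrightarrow> (AE x in M. f x = g x)"
  using ae_class_cong[where f = f and g = g] ae_class_eqD[where f = f and g = g] by blast

lemma L2_eqI: "\<lbrakk>a \<in> pts (L2 M); b \<in> pts (L2 M); AE x in M. rep a x = rep b x\<rbrakk> \<Longrightarrow> a = b"
  using L2_class_rep ae_class_cong by metis

lemma L2_add:
  assumes "f \<in> sq_int M" "g \<in> sq_int M"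
  shows "vadd (L2 M) (L2_class M f) (L2_class M g) = L2_class M (\<lambda>x. f x + g x)"
  using rep_ae_eq[OF assms(1), of M] rep_ae_eq[OF assms(2), of M]
  by (auto simp: L2_def intro!: ae_class_cong)

lemma L2_scale:
  assumes "f \<in> sq_int M"
  shows "vscale (L2 M) c (L2_class M f) = L2_class M (\<lambda>x. c * f x)"
  using rep_ae_eq[OF assms(1), of M] by (auto simp: L2_def intro!: ae_class_cong)

lemma L2_zero: "vzero (L2 M) = L2_class M (\<lambda>x. 0)"
  by (simp add: L2_def)

lemma L2_diff:
  assumes "f \<in> sq_int M" "g \<in> sq_int M"
  shows "vdiff (L2 M) (L2_class M f) (L2_class M g) = L2_class M (\<lambda>x. f x - g x)"
  using L2_add[OF assms(1) sq_int_scale[OF assms(2), of "-1"]] assms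
  by (simp only: vdiff_def L2_scale) simp

lemma L2_inner:
  assumes "f \<in> sq_int M" "g \<in> sq_int M"
  shows "inner (L2 M) (L2_class M f) (L2_class M g) = (\<integral>x. f x * cnj (g x) \<partial>M)"
proof -
  have [measurable]: "f \<in> borel_measurable M" "g \<in> borel_measurable M"
    "rep (L2_class M f) \<in> borel_measurable M" "rep (L2_class M g) \<in> borel_measurable M"
    using assms rep_sq_int[OF L2_class_mem] by (auto simp: sq_int_def)
  show ?thesis
    unfolding L2_def hspace.simps
    by (rule integral_cong_AE) (use rep_ae_eq[OF assms(1), of M] rep_ae_eq[OF assms(2), of M] in auto)
qed

lemma L2_inner_rep: "inner (L2 M) a b = (\<integral>x. rep a x * cnj (rep b x) \<partial>M)"
  by (simp add: L2_def)

lemma L2_norm: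
  assumes "f \<in> sq_int M"
  shows "hnorm (L2 M) (L2_class M f) = sqrt (\<integral>x. (cmod (f x))\<^sup>2 \<partial>M)"
  using assms by (simp add: hnorm_def L2_inner integral_mult_cnj_self)

text \<open>Riesz--Fischer. Along a fast subsequence \<open>|f\<^sub>k\<^sub>+\<^sub>1 - f\<^sub>k| \<le> 2\<^sup>-\<^sup>k + 2\<^sup>k |f\<^sub>k\<^sub>+\<^sub>1 - f\<^sub>k|\<^sup>2\<close> is summable almost
  everywhere; Fatou's lemma then gives convergence in norm.\<close>

lemma sq_int_cauchy_converges:
  assumes f: "\<And>n::nat. f n \<in> sq_int M"
    and cauchy: "\<And>e. e > 0 \<Longrightarrow> \<exists>n0. \<forall>m\<ge>n0. \<forall>n\<ge>n0. sqrt (\<integral>x. (cmod (f m x - f n x))\<^sup>2 \<partial>M) < e"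
  shows "\<exists>g\<in>sq_int M. (\<lambda>n. sqrt (\<integral>x. (cmod (f n x - g x))\<^sup>2 \<partial>M)) \<longlonglongrightarrow> 0"
proof -
  have [measurable]: "f n \<in> borel_measurable M" for n using f[of n] by (simp add: sq_int_def)
  have int: "integrable M (\<lambda>x. (cmod (f m x - f n x))\<^sup>2)" for m n
    using f by (intro sq_int_integrable) simp
  have "\<exists>n0. \<forall>m\<ge>n0. \<forall>n\<ge>n0. sqrt (\<integral>x. (cmod (f m x - f n x))\<^sup>2 \<partial>M) < (1/2)^k" for k :: nat
    by (rule cauchy) simp
  then obtain N where N: "\<And>k m n. \<lbrakk>m \<ge> N k; n \<ge> N k\<rbrakk> \<Longrightarrow> sqrt (\<integral>x. (cmod (f m x - f n x))\<^sup>2 \<partial>M) < (1/2)^k"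
    by metis
  \<comment> \<open>One index sequence beyond all thresholds: \<open>r k\<close> and
    \<open>r (Suc k)\<close> are both at least \<open>N k\<close>, so consecutive terms are closer
    than \<open>(1/2)^k\<close> in norm, and \<open>r k \<ge> k\<close> sends the indices to
    infinity.\<close>
  define r where "r k = (\<Sum>i\<le>k. N i) + k" for k
  have rN: "r k \<ge> N k" "r (Suc k) \<ge> N k" "r k \<ge> k" for k
    unfolding r_def using member_le_sum[of k "{..k}" N] by auto
  define h where "h k x = cmod (f (r (Suc k)) x - f (r k) x)" for k x
  have [measurable]: "h k \<in> borel_measurable M" for k unfolding h_def by measurable
  \<comment> \<open>Squaring turns the distance \<open>(1/2)^k\<close> into \<open>(1/4)^k\<close>,
    which leaves room for the weight \<open>2^k\<close> in the sum below.\<close>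
  have small: "(\<integral>\<^sup>+x. ennreal ((h k x)\<^sup>2) \<partial>M) \<le> ennreal ((1/4)^k)" for k
  proof -
    have "(\<integral>x. (h k x)\<^sup>2 \<partial>M) \<le> ((1/2)^k)\<^sup>2"
      using N[OF rN(2) rN(1)] unfolding h_def by (intro sqrt_le_D less_imp_le)
    also have "((1/2)^k)\<^sup>2 = (1/4::real)^k" by (simp add: power2_eq_square flip: power_mult_distrib)
    finally show ?thesis
      using int[of "r (Suc k)" "r k"] by (subst nn_integral_eq_integral) (auto simp: h_def ennreal_leI)
  qed
  have "(\<integral>\<^sup>+x. (\<Sum>k. ennreal (2^k * (h k x)\<^sup>2)) \<partial>M) = (\<Sum>k. \<integral>\<^sup>+x. ennreal (2^k * (h k x)\<^sup>2) \<partial>M)"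
    by (intro nn_integral_suminf) auto
  also have "\<dots> \<le> (\<Sum>k. ennreal ((1/2)^k))"
  proof (intro suminf_le allI)
    fix k
    have "(\<integral>\<^sup>+x. ennreal (2^k * (h k x)\<^sup>2) \<partial>M) = ennreal (2^k) * (\<integral>\<^sup>+x. ennreal ((h k x)\<^sup>2) \<partial>M)"
      by (subst nn_integral_cmult[symmetric]) (auto simp: ennreal_mult)
    also have "\<dots> \<le> ennreal (2^k) * ennreal ((1/4)^k)" by (intro mult_left_mono small) auto
    also have "\<dots> = ennreal ((1/2)^k)" by (simp add: ennreal_mult[symmetric] flip: power_mult_distrib)
    finally show "(\<integral>\<^sup>+x. ennreal (2^k * (h k x)\<^sup>2) \<partial>M) \<le> ennreal ((1/2)^k)" .
  qed auto
  also have "\<dots> < \<infinity>" by (subst suminf_ennreal_eq[OF _ summable_sums[OF summable_geometric]]) auto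
  finally have "(\<integral>\<^sup>+x. (\<Sum>k. ennreal (2^k * (h k x)\<^sup>2)) \<partial>M) \<noteq> \<infinity>" by auto
  hence "AE x in M. (\<Sum>k. ennreal (2^k * (h k x)\<^sup>2)) \<noteq> \<infinity>"
    by (intro nn_integral_PInf_AE) auto
  hence conv: "AE x in M. convergent (\<lambda>k. f (r k) x)"
  proof eventually_elim
    case (elim x)
    hence s: "summable (\<lambda>k. 2^k * (h k x)\<^sup>2)" by (intro summable_suminf_not_top) auto
    have "summable (\<lambda>k. (1/2)^k + 2^k * (h k x)\<^sup>2)" by (intro summable_add s summable_geometric) auto
    hence "summable (\<lambda>k. norm (f (r (Suc k)) x - f (r k) x))"
    proof (rule summable_comparison_test'[of _ 0])
      fix k
      \<comment> \<open>Expanding this square bounds the increment by a geometric term plus the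
        weighted square, whose sum over \<open>k\<close> is finite almost everywhere.\<close>
      have "0 \<le> (1/2)^k * (1 - 2^k * h k x)\<^sup>2" by simp
      also have "\<dots> = (1/2)^k - 2 * h k x + 2^k * (h k x)\<^sup>2"
        by (simp add: power2_eq_square algebra_simps power_one_over)
      finally have "h k x \<le> (1/2)^k + 2^k * (h k x)\<^sup>2"
        using norm_ge_zero[of "f (r (Suc k)) x - f (r k) x", folded h_def] by linarith
      thus "norm (norm (f (r (Suc k)) x - f (r k) x)) \<le> (1/2)^k + 2^k * (h k x)\<^sup>2"
        by (simp add: h_def)
    qed
    hence "summable (\<lambda>k. f (r (Suc k)) x - f (r k) x)" by (rule summable_norm_cancel)
    thus ?case
      using sum_lessThan_telescope[of "\<lambda>k. f (r k) x"]
      by (simp add: summable_iff_convergent convergent_diff_const_right_iff)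
  qed
  define g where "g x = lim (\<lambda>k. f (r k) x)" for x
  have [measurable]: "g \<in> borel_measurable M" unfolding g_def by measurable
  have bound: "(\<integral>\<^sup>+x. ennreal ((cmod (g x - f n x))\<^sup>2) \<partial>M) \<le> ennreal (e\<^sup>2)"
    if e: "e > 0" and n0: "\<forall>m\<ge>n0. \<forall>n\<ge>n0. sqrt (\<integral>x. (cmod (f m x - f n x))\<^sup>2 \<partial>M) < e" and n: "n \<ge> n0" for e n0 n
  proof -
    have "(\<integral>\<^sup>+x. ennreal ((cmod (g x - f n x))\<^sup>2) \<partial>M)
        = (\<integral>\<^sup>+x. liminf (\<lambda>k. ennreal ((cmod (f (r k) x - f n x))\<^sup>2)) \<partial>M)"
    proof (rule nn_integral_cong_AE, use conv in eventually_elim)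
      case (elim x)
      hence "(\<lambda>k. f (r k) x) \<longlonglongrightarrow> g x" by (simp add: g_def convergent_LIMSEQ_iff)
      hence "(\<lambda>k. ennreal ((cmod (f (r k) x - f n x))\<^sup>2)) \<longlonglongrightarrow> ennreal ((cmod (g x - f n x))\<^sup>2)"
        by (intro tendsto_intros)
      thus ?case by (rule lim_imp_Liminf[OF sequentially_bot, symmetric])
    qed
    also have "\<dots> \<le> liminf (\<lambda>k. \<integral>\<^sup>+x. ennreal ((cmod (f (r k) x - f n x))\<^sup>2) \<partial>M)"
      by (intro nn_integral_liminf) auto
    also have "\<dots> \<le> liminf (\<lambda>k. ennreal (e\<^sup>2))"
    proof (rule Liminf_mono)
      have "(\<integral>\<^sup>+x. ennreal ((cmod (f (r k) x - f n x))\<^sup>2) \<partial>M) \<le> ennreal (e\<^sup>2)" if "k \<ge> n0" for k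
      proof -
        have "r k \<ge> n0" using rN(3)[of k] that by linarith
        hence "sqrt (\<integral>x. (cmod (f (r k) x - f n x))\<^sup>2 \<partial>M) < e" using n0 n by blast
        hence "(\<integral>x. (cmod (f (r k) x - f n x))\<^sup>2 \<partial>M) \<le> e\<^sup>2"
by (intro sqrt_le_D less_imp_le)
        thus ?thesis using int by (subst nn_integral_eq_integral) (auto simp: ennreal_leI)
      qed
      thus "\<forall>\<^sub>F k in sequentially. (\<integral>\<^sup>+x. ennreal ((cmod (f (r k) x - f n x))\<^sup>2) \<partial>M) \<le> ennreal (e\<^sup>2)"
        by (auto simp: eventually_sequentially)
    qed
    also have "\<dots> = ennreal (e\<^sup>2)" by (simp add: Liminf_const)
    finally show ?thesis .
  qed
  have diff_sq: "(\<lambda>x. g x - f n x) \<in> sq_int M"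
    if "e > 0" "\<forall>m\<ge>n0. \<forall>n\<ge>n0. sqrt (\<integral>x. (cmod (f m x - f n x))\<^sup>2 \<partial>M) < e" "n \<ge> n0" for e n0 n
  proof -
    have "integrable M (\<lambda>x. (cmod (g x - f n x))\<^sup>2)"
      by (rule integrableI_bounded) (use bound[OF that] in \<open>auto intro: le_less_trans\<close>)
    thus ?thesis by (simp add: sq_int_def)
  qed
  obtain n1 where n1: "\<forall>m\<ge>n1. \<forall>n\<ge>n1. sqrt (\<integral>x. (cmod (f m x - f n x))\<^sup>2 \<partial>M) < 1"
    using cauchy[of 1] by auto
  \<comment> \<open>\<open>g\<close> is the sum of the square-integrable functions
    \<open>g - f n1\<close> and \<open>f n1\<close>.\<close>
  have g: "g \<in> sq_int M"
    using sq_int_add[OF diff_sq[of 1 n1 n1] f[of n1]] n1 by simp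
  have "(\<lambda>n. sqrt (\<integral>x. (cmod (f n x - g x))\<^sup>2 \<partial>M)) \<longlonglongrightarrow> 0"
  proof (rule LIMSEQ_I)
    fix e :: real assume "e > 0"
    hence e2: "e / 2 > 0" by simp
    obtain n0 where n0: "\<forall>m\<ge>n0. \<forall>n\<ge>n0. sqrt (\<integral>x. (cmod (f m x - f n x))\<^sup>2 \<partial>M) < e / 2"
      using cauchy[OF e2] by blast
    have le: "sqrt (\<integral>x. (cmod (f n x - g x))\<^sup>2 \<partial>M) \<le> e / 2" if n: "n \<ge> n0" for n
    proof -
      have i: "integrable M (\<lambda>x. (cmod (g x - f n x))\<^sup>2)"
        using diff_sq[OF e2 n0 n] by (rule sq_int_integrable)
      have "ennreal (\<integral>x. (cmod (g x - f n x))\<^sup>2 \<partial>M) \<le> ennreal ((e / 2)\<^sup>2)"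
        using bound[OF e2 n0 n] i by (subst (asm) nn_integral_eq_integral) auto
      hence "(\<integral>x. (cmod (g x - f n x))\<^sup>2 \<partial>M) \<le> (e / 2)\<^sup>2" by (subst (asm) ennreal_le_iff) auto
      hence "sqrt (\<integral>x. (cmod (g x - f n x))\<^sup>2 \<partial>M) \<le> e / 2"
        using e2 by (intro real_le_lsqrt) (auto intro: integral_nonneg_AE)
      thus ?thesis by (simp add: norm_minus_commute)
    qed
    thus "\<exists>n0. \<forall>n\<ge>n0. norm (sqrt (\<integral>x. (cmod (f n x - g x))\<^sup>2 \<partial>M) - 0) < e"
    proof (intro exI[of _ n0] allI impI)
      fix n assume "n0 \<le> n"
      moreover have "0 \<le> sqrt (\<integral>x. (cmod (f n x - g x))\<^sup>2 \<partial>M)"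
        by (simp add: integral_nonneg_AE)
      ultimately show "norm (sqrt (\<integral>x. (cmod (f n x - g x))\<^sup>2 \<partial>M) - 0) < e"
        using le[OF \<open>n0 \<le> n\<close>] \<open>e > 0\<close> by (simp only: diff_zero real_norm_def abs_of_nonneg)
    qed
  qed
  with g show ?thesis by blast
qed

lemma L2_hilbert: "hilbert (L2 M)"
proof
  fix a b assume "a \<in> pts (L2 M)" "b \<in> pts (L2 M)"
  then obtain f g where f: "f \<in> sq_int M" "a = L2_class M f" and g: "g \<in> sq_int M" "b = L2_class M g"
    by (auto simp: L2_pts)
  show "vadd (L2 M) a b \<in> pts (L2 M)" using f g by (simp add: L2_add)
  show "inner (L2 M) a b = cnj (inner (L2 M) b a)"
    using f g by (simp add: L2_inner mult.commute flip: Bochner_Integration.integral_cnj)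
  fix c assume "c \<in> pts (L2 M)"
  then obtain h where h: "h \<in> sq_int M" "c = L2_class M h" by (auto simp: L2_pts)
  show "inner (L2 M) (vadd (L2 M) a b) c = inner (L2 M) a c + inner (L2 M) b c"
    using f g h by (simp add: L2_add L2_inner distrib_right sq_int_mult_integrable)
next
  fix a b k assume "a \<in> pts (L2 M)" "b \<in> pts (L2 M)"
  then obtain f g where f: "f \<in> sq_int M" "a = L2_class M f" and g: "g \<in> sq_int M" "b = L2_class M g"
    by (auto simp: L2_pts)
  show "inner (L2 M) (vscale (L2 M) k a) b = k * inner (L2 M) a b"
    using f g by (simp add: L2_scale L2_inner mult.assoc)
next
  fix a b assume ab: "a \<in> pts (L2 M)" "b \<in> pts (L2 M)"
    and z: "inner (L2 M) (vdiff (L2 M) a b) (vdiff (L2 M) a b) = 0"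
  then obtain f g where f: "f \<in> sq_int M" "a = L2_class M f" and g: "g \<in> sq_int M" "b = L2_class M g"
    by (auto simp: L2_pts)
  have "hnorm (L2 M) (vdiff (L2 M) a b) = 0" using z by (simp add: hnorm_def)
  hence "(\<integral>x. (cmod (f x - g x))\<^sup>2 \<partial>M) = 0" using f g by (simp add: L2_diff L2_norm)
  hence "AE x in M. (cmod (f x - g x))\<^sup>2 = 0"
    using f g by (subst (asm) integral_nonneg_eq_0_iff_AE) (auto intro: sq_int_integrable)
  thus "a = b" using f g by (auto intro!: ae_class_cong)
next
  fix s :: "nat \<Rightarrow> _" assume s: "\<And>n. s n \<in> pts (L2 M)"
    and c: "\<And>e. e > 0 \<Longrightarrow> \<exists>n0. \<forall>m\<ge>n0. \<forall>n\<ge>n0. hnorm (L2 M) (vdiff (L2 M) (s m) (s n)) < e"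
  define f where "f n = rep (s n)" for n
  have f: "f n \<in> sq_int M" "s n = L2_class M (f n)" for n
    using s[of n] by (auto simp: f_def L2_class_rep)
  have nd: "hnorm (L2 M) (vdiff (L2 M) (L2_class M g) (L2_class M h)) = sqrt (\<integral>x. (cmod (g x - h x))\<^sup>2 \<partial>M)"
    if "g \<in> sq_int M" "h \<in> sq_int M" for g h using that by (simp add: L2_diff L2_norm)
  obtain g where g: "g \<in> sq_int M" "(\<lambda>n. sqrt (\<integral>x. (cmod (f n x - g x))\<^sup>2 \<partial>M)) \<longlonglongrightarrow> 0"
    using sq_int_cauchy_converges[of f M] c unfolding f(2) nd[OF f(1) f(1)] by (auto simp: f(1))
  thus "\<exists>x\<in>pts (L2 M). (\<lambda>n. hnorm (L2 M) (vdiff (L2 M) (s n) x)) \<longlonglongrightarrow> 0"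
    by (intro bexI[of _ "L2_class M g"]) (simp_all add: f(2) nd f(1))
next
  fix a assume "a \<in> pts (L2 M)"
  then obtain f where f: "f \<in> sq_int M" "a = L2_class M f" by (auto simp: L2_pts)
  show "0 \<le> Re (inner (L2 M) a a)" using f by (simp add: L2_inner integral_mult_cnj_self)
  show "vscale (L2 M) c a \<in> pts (L2 M)" for c using f by (simp add: L2_scale)
  show "inner (L2 M) (vzero (L2 M)) a = 0" using f by (simp add: L2_zero L2_inner)
qed (simp add: L2_zero)

section \<open>Total sets\<close>

text \<open>Phrased through closed subspaces, totality becomes a rule of proof: a statement extends
  from \<open>S\<close> to the whole space as soon as its solutions form a closed subspace.\<close>

definition total_set :: "('v, 'm) hspace_scheme \<Rightarrow> 'v set \<Rightarrow> bool" where
  "total_set E S \<longleftrightarrow> S \<subseteq> pts E \<and> (\<forall>W. closed_subspace E W \<longrightarrow> S \<subseteq> W \<longrightarrow> W = pts E)"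

lemma total_setD: "\<lbrakk>total_set E S; closed_subspace E W; S \<subseteq> W; x \<in> pts E\<rbrakk> \<Longrightarrow> x \<in> W"
  unfolding total_set_def by blast

lemma total_set_mono:
  assumes "total_set E S" "S \<subseteq> S'" "S' \<subseteq> pts E" shows "total_set E S'"
  unfolding total_set_def
proof (intro conjI allI impI assms)
  fix W assume "closed_subspace E W" "S' \<subseteq> W"
  thus "W = pts E" using assms(1) subset_trans[OF assms(2)] unfolding total_set_def by simp
qed

context hilbert
begin

text \<open>Riesz turns \<open>\<phi>\<close> into an inner product, whose continuity is already
  established.\<close>

lemma closed_subspace_kernel:
  assumes add: "\<And>x y. \<lbrakk>x \<in> pts E; y \<in> pts E\<rbrakk> \<Longrightarrow> \<phi> (vadd E x y) = \<phi> x + \<phi> y"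
    and scale: "\<And>c x. x \<in> pts E \<Longrightarrow> \<phi> (vscale E c x) = c * \<phi> x"
    and bd: "\<And>x. x \<in> pts E \<Longrightarrow> cmod (\<phi> x) \<le> C * hnorm E x"
  shows "closed_subspace E {x \<in> pts E. \<phi> x = 0}"
proof -
  have "\<exists>z\<in>pts E. \<forall>x\<in>pts E. \<phi> x = inner E x z" by (rule riesz[OF add scale bd])
  then obtain z where z: "z \<in> pts E" "\<And>x. x \<in> pts E \<Longrightarrow> \<phi> x = inner E x z" by blast
  show ?thesis
    unfolding closed_subspace_def
  proof (intro conjI ballI allI impI)
    fix s x assume x: "x \<in> pts E" and s: "\<forall>n. s n \<in> {x \<in> pts E. \<phi> x = 0}"
      and lim: "(\<lambda>n::nat. hnorm E (vdiff E (s n) x)) \<longlonglongrightarrow> 0"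
    have "(\<lambda>n. inner E (s n) z) \<longlonglongrightarrow> inner E x z"
      using s by (intro tendsto_inner[OF _ x z(1) lim]) auto
    moreover have "inner E (s n) z = 0" for n using s z(2)[of "s n"] by auto
    ultimately have "inner E x z = 0" by (simp add: LIMSEQ_const_iff)
    thus "x \<in> {x \<in> pts E. \<phi> x = 0}" using x z by simp
  qed (auto simp: z)
qed

end

lemma bounded_opD:
  assumes "bounded_op E K T"
  shows "x \<in> pts E \<Longrightarrow> T x \<in> pts K"
    and "\<lbrakk>x \<in> pts E; y \<in> pts E\<rbrakk> \<Longrightarrow> T (vadd E x y) = vadd K (T x) (T y)"
    and "x \<in> pts E \<Longrightarrow> T (vscale E c x) = vscale K c (T x)"
  using linear_mapD[of E K T] assms by (simp_all add: bounded_op_def)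

lemma bounded_op_compose:
  assumes E: "hilbert E" and T: "bounded_op E K T" and S: "bounded_op K L S" and K: "hilbert K"
  shows "bounded_op E L (\<lambda>x. S (T x))"
proof -
  interpret E: hilbert E by fact
  interpret K: hilbert K by fact
  obtain C where C: "C \<ge> 0" "\<And>x. x \<in> pts E \<Longrightarrow> hnorm K (T x) \<le> C * hnorm E x"
    using E.bounded_opE[OF T] by blast
  obtain D where D: "D \<ge> 0" "\<And>x. x \<in> pts K \<Longrightarrow> hnorm L (S x) \<le> D * hnorm K x"
    using K.bounded_opE[OF S] by blast
  have "hnorm L (S (T x)) \<le> D * C * hnorm E x" if x: "x \<in> pts E" for x
    using D(2)[of "T x"] mult_left_mono[OF C(2)[OF x] D(1)] bounded_opD(1)[OF T x] by (simp add: mult.assoc)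
  thus ?thesis
    unfolding bounded_op_def linear_map_def
    using bounded_opD[OF T] bounded_opD[OF S] by (intro conjI exI[of _ "D * C"]) auto
qed

text \<open>The source of the closed subspaces to which totality is applied: an identity of bounded
  operators is extended one matrix coefficient at a time. The two target spaces may differ, so with
  the identity as \<open>S\<close> the same lemma treats the isometry property.\<close>

lemma closed_subspace_inner_eq:
  assumes E: "hilbert E" and K: "hilbert K" and L: "hilbert L"
    and T: "bounded_op E K T" and S: "bounded_op E L S" and y: "y \<in> pts K" "z \<in> pts L"
  shows "closed_subspace E {x \<in> pts E. inner K (T x) y = inner L (S x) z}"
proof -
  interpret E: hilbert E by fact
  interpret K: hilbert K by fact
  interpret L: hilbert L by fact
  obtain C where C: "C \<ge> 0" "\<And>x. x \<in> pts E \<Longrightarrow> hnorm K (T x) \<le> C * hnorm E x"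
    using E.bounded_opE[OF T] by blast
  obtain D where D: "D \<ge> 0" "\<And>x. x \<in> pts E \<Longrightarrow> hnorm L (S x) \<le> D * hnorm E x"
    using E.bounded_opE[OF S] by blast
  have "closed_subspace E {x \<in> pts E. inner K (T x) y - inner L (S x) z = 0}"
  proof (rule E.closed_subspace_kernel[where C = "C * hnorm K y + D * hnorm L z"])
    fix x assume x: "x \<in> pts E"
    have "cmod (inner K (T x) y) \<le> C * hnorm E x * hnorm K y"
      using K.cauchy_schwarz[of "T x" y] mult_right_mono[OF C(2)[OF x], of "hnorm K y"] x y bounded_opD(1)[OF T x] by simp
    moreover have "cmod (inner L (S x) z) \<le> D * hnorm E x * hnorm L z"
      using L.cauchy_schwarz[of "S x" z] mult_right_mono[OF D(2)[OF x], of "hnorm L z"] x y bounded_opD(1)[OF S x] by simp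
    ultimately show "cmod (inner K (T x) y - inner L (S x) z) \<le> (C * hnorm K y + D * hnorm L z) * hnorm E x"
      using norm_triangle_ineq4[of "inner K (T x) y" "inner L (S x) z"] by (simp add: algebra_simps)
  qed (use y bounded_opD[OF T] bounded_opD[OF S] in \<open>auto simp: algebra_simps\<close>)
  thus ?thesis by simp
qed

lemma bounded_op_eq_on_total:
  assumes E: "hilbert E" and K: "hilbert K" and T: "bounded_op E K T" and S: "bounded_op E K S"
    and tot: "total_set E A" and eq: "\<And>x. x \<in> A \<Longrightarrow> T x = S x" and x: "x \<in> pts E"
  shows "T x = S x"
proof -
  interpret K: hilbert K by fact
  show ?thesis
  proof (rule K.vec_eqI)
    fix y assume y: "y \<in> pts K"
    have "A \<subseteq> {x \<in> pts E. inner K (T x) y = inner K (S x) y}"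
      using eq tot by (auto simp: total_set_def)
    from total_setD[OF tot closed_subspace_inner_eq[OF E K K T S y y] this x]
    show "inner K (T x) y = inner K (S x) y" by simp
  qed (use x bounded_opD[OF T] bounded_opD[OF S] in auto)
qed

lemma bounded_op_id: "bounded_op E E (\<lambda>x. x)"
  unfolding bounded_op_def linear_map_def by (auto intro!: exI[of _ 1])

text \<open>The identity is extended in one argument at a time; conjugate symmetry turns the second
  argument into the first.\<close>

lemma isometry_on_total:
  assumes E: "hilbert E" and K: "hilbert K" and T: "bounded_op E K T"
    and tot: "total_set E A" and iso: "\<And>x y. \<lbrakk>x \<in> A; y \<in> A\<rbrakk> \<Longrightarrow> inner K (T x) (T y) = inner E x y"
    and x: "x \<in> pts E" and y: "y \<in> pts E"
  shows "inner K (T x) (T y) = inner E x y"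
proof -
  interpret E: hilbert E by fact
  interpret K: hilbert K by fact
  have AE: "z \<in> pts E" if "z \<in> A" for z using tot that by (auto simp: total_set_def)
  have 1: "inner K (T x) (T z) = inner E x z" if z: "z \<in> A" and x: "x \<in> pts E" for x z
  proof -
    have "A \<subseteq> {x \<in> pts E. inner K (T x) (T z) = inner E x z}" using iso z AE by auto
    from total_setD[OF tot closed_subspace_inner_eq[OF E K E T bounded_op_id bounded_opD(1)[OF T AE[OF z]] AE[OF z]] this x]
    show ?thesis by simp
  qed
  have "A \<subseteq> {z \<in> pts E. inner K (T z) (T x) = inner E z x}"
  proof
    fix z assume z: "z \<in> A"
    show "z \<in> {z \<in> pts E. inner K (T z) (T x) = inner E z x}"
      using 1[OF z x] K.inner_commute[of "T z" "T x"] E.inner_commute[of z x] AE[OF z] x bounded_opD(1)[OF T] by simp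
  qed
  from total_setD[OF tot closed_subspace_inner_eq[OF E K E T bounded_op_id bounded_opD(1)[OF T x] x] this y]
  have "inner K (T y) (T x) = inner E y x" by simp
  thus ?thesis
    using K.inner_commute[of "T x" "T y"] E.inner_commute[of x y] x y bounded_opD(1)[OF T] by simp
qed

text \<open>The preimages of a convergent sequence are Cauchy, and \<open>T\<close> maps their limit
  to the limit of the sequence. Surjectivity of an isometry thereby reduces to hitting a total
  set.\<close>

lemma isometry_range_closed:
  assumes E: "hilbert E" and K: "hilbert K" and T: "linear_map E K T"
    and iso: "\<And>x y. \<lbrakk>x \<in> pts E; y \<in> pts E\<rbrakk> \<Longrightarrow> inner K (T x) (T y) = inner E x y"
  shows "closed_subspace K (T ` pts E)"
proof -
  interpret E: hilbert E by fact
  interpret K: hilbert K by fact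
  note T' = linear_mapD[OF T]
  have Td: "T (vdiff E x y) = vdiff K (T x) (T y)" if "x \<in> pts E" "y \<in> pts E" for x y
    using that T' by (simp add: vdiff_def)
  have Tn: "hnorm K (T x) = hnorm E x" if "x \<in> pts E" for x using iso that by (simp add: hnorm_def)
  have T0: "T (vzero E) = vzero K"
    using T' iso[of "vzero E" "vzero E"] by (intro K.eq_zeroI) auto
  show ?thesis
    unfolding closed_subspace_def
  proof (intro conjI ballI allI impI)
    show "T ` pts E \<subseteq> pts K" using T' by auto
    show "vzero K \<in> T ` pts E" using T0 by (metis E.zero_mem image_eqI)
    show "vadd K x y \<in> T ` pts E" if "x \<in> T ` pts E" "y \<in> T ` pts E" for x y
      using that by (auto simp flip: T'(2))
    show "vscale K c x \<in> T ` pts E" if "x \<in> T ` pts E" for c x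
      using that by (auto simp flip: T'(3))
    fix s y assume y: "y \<in> pts K" and s: "\<forall>n. s n \<in> T ` pts E"
      and lim: "(\<lambda>n::nat. hnorm K (vdiff K (s n) y)) \<longlonglongrightarrow> 0"
    have "\<forall>n. \<exists>x. x \<in> pts E \<and> s n = T x" using s by blast
    then obtain t where t: "\<And>n. t n \<in> pts E" "\<And>n. s n = T (t n)" by metis
    have "\<exists>x\<in>pts E. (\<lambda>n. hnorm E (vdiff E (t n) x)) \<longlonglongrightarrow> 0"
    proof (rule E.cauchy_converges[OF t(1)])
      fix e :: real assume "e > 0"
      then obtain n0 where n0: "\<And>n. n \<ge> n0 \<Longrightarrow> hnorm K (vdiff K (s n) y) < e / 2"
        using LIMSEQ_D[OF lim, of "e / 2"] y s T' by fastforce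
      have "hnorm E (vdiff E (t m) (t n)) < e" if "m \<ge> n0" "n \<ge> n0" for m n
      proof -
        have sK: "s n \<in> pts K" for n using t T' by simp
        have "hnorm E (vdiff E (t m) (t n)) = hnorm K (vdiff K (s m) (s n))"
          using t by (simp add: Td Tn flip: Tn)
        also have "vdiff K (s m) (s n) = vadd K (vdiff K (s m) y) (vdiff K y (s n))"
          using sK y by (intro K.vec_eqI) auto
        also have "hnorm K \<dots> \<le> hnorm K (vdiff K (s m) y) + hnorm K (vdiff K (s n) y)"
          using K.norm_triangle[of "vdiff K (s m) y" "vdiff K y (s n)"] K.diff_swap[of y "s n"] sK y by simp
        also have "\<dots> < e" using n0[OF that(1)] n0[OF that(2)] by simp
        finally show ?thesis .
      qed
      thus "\<exists>n0. \<forall>m\<ge>n0. \<forall>n\<ge>n0. hnorm E (vdiff E (t m) (t n)) < e" by blast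
    qed
    then obtain x where x: "x \<in> pts E" and xl: "(\<lambda>n. hnorm E (vdiff E (t n) x)) \<longlonglongrightarrow> 0" by blast
    have xl': "(\<lambda>n. hnorm K (vdiff K (s n) (T x))) \<longlonglongrightarrow> 0"
      using xl t x by (simp add: Tn flip: Td)
    have "y = T x"
    proof (rule K.vec_eqI)
      fix z assume z: "z \<in> pts K"
      have sK: "s n \<in> pts K" for n using t T' by simp
      show "inner K y z = inner K (T x) z"
        using K.tendsto_inner(1)[OF sK y z lim] K.tendsto_inner(1)[OF sK T'(1)[OF x] z xl'] by (rule LIMSEQ_unique)
    qed (use x y T' in auto)
    thus "y \<in> T ` pts E" using x by simp
  qed
qed

lemma cnj_indicator [simp]: "cnj (indicator A x) = indicator A x"
  by (simp add: indicator_def)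

section \<open>Indicator functions are total in L2\<close>

text \<open>Dynkin's argument: the sets over which \<open>w\<close> integrates to zero are closed
  under countable disjoint unions, and under complements because the whole space lies in
  \<open>G\<close>. An intersection-stable generator then gives all measurable sets.\<close>

lemma (in sigma_finite_measure) AE_zero_if_generator_integrals_zero:
  fixes w :: "'a \<Rightarrow> complex"
  assumes G: "Int_stable G" "G \<subseteq> Pow (space M)" "sets M = sigma_sets (space M) G" "space M \<in> G"
    and w: "integrable M w" and z: "\<And>E. E \<in> G \<Longrightarrow> (LINT x:E|M. w x) = 0"
  shows "AE x in M. w x = 0"
proof (rule density_zero[OF w])
  have si: "set_integrable M E w" if "E \<in> sets M" for E
    using that w by (simp add: set_integrable_def integrable_mult_indicator)
  fix E assume "E \<in> sets M"
  hence "E \<in> sigma_sets (space M) G" using G by simp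
  thus "(LINT x:E|M. w x) = 0"
  proof (induction rule: sigma_sets_induct_disjoint[OF G(1,2), consumes 1, case_names basic empty compl union])
    case (compl E)
    have E: "E \<in> sets M" using compl G(3) by simp
    have "(LINT x:space M|M. w x) = (LINT x:E|M. w x) + (LINT x:space M - E|M. w x)"
      using E sets.sets_into_space[OF E]
      by (subst set_integral_Un[symmetric]) (auto intro!: si simp: Un_absorb1)
    thus ?case using compl z[OF G(4)] by simp
  next
    case (union A)
    have A: "A i \<in> sets M" for i using union(2) G(3) by auto
    have "(LINT x:(\<Union>i. A i)|M. w x) = (\<Sum>i. LINT x:A i|M. w x)"
      using union(1) A by (intro lebesgue_integral_countable_add si) (auto simp: disjoint_family_on_def)
    thus ?case using union by simp
  qed (use z in \<open>auto simp: set_lebesgue_integral_def\<close>)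
qed

text \<open>A square-integrable function need not be integrable; cutting it down to the sets
  \<open>A n\<close> of finite measure makes the criterion for integrable functions
  applicable.\<close>

lemma (in sigma_finite_measure) L2_zero_if_orthogonal_to_indicators:
  assumes G: "Int_stable G" "G \<subseteq> Pow (space M)" "sets M = sigma_sets (space M) G" "space M \<in> G"
    and A: "\<And>n::nat. A n \<in> sets M" "\<And>n. emeasure M (A n) < \<infinity>" "(\<Union>n. A n) = space M"
    and f: "f \<in> sq_int M" and z: "\<And>E n. E \<in> G \<Longrightarrow> (\<integral>x. f x * indicator (E \<inter> A n) x \<partial>M) = 0"
  shows "AE x in M. f x = 0"
proof -
  have "AE x in M. f x * indicator (A n) x = 0" for n
  proof (rule AE_zero_if_generator_integrals_zero[OF G])
    show "integrable M (\<lambda>x. f x * indicator (A n) x)"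
      using sq_int_mult_integrable(1)[OF f sq_int_indicator[OF A(1,2)]] by simp
    fix E assume "E \<in> G"
    have "(LINT x:E|M. f x * indicator (A n) x) = (\<integral>x. f x * indicator (E \<inter> A n) x \<partial>M)"
      unfolding set_lebesgue_integral_def
      by (rule Bochner_Integration.integral_cong) (auto simp: indicator_def)
    thus "(LINT x:E|M. f x * indicator (A n) x) = 0" using z[OF \<open>E \<in> G\<close>] by simp
  qed
  hence "AE x in M. \<forall>n. f x * indicator (A n) x = 0" by (subst AE_all_countable) blast
  with AE_space show ?thesis
  proof eventually_elim
    case (elim x)
    then obtain n where "x \<in> A n" using A(3) by blast
    thus ?case using elim(2)[rule_format, of n] by simp
  qed
qed

text \<open>The generator is a parameter because it takes two values: all measurable sets, and the
  measurable rectangles of a product.\<close>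

lemma (in sigma_finite_measure) L2_indicator_total:
  assumes G: "Int_stable G" "G \<subseteq> Pow (space M)" "sets M = sigma_sets (space M) G" "space M \<in> G"
    and A: "\<And>n::nat. A n \<in> sets M" "\<And>n. emeasure M (A n) < \<infinity>" "(\<Union>n. A n) = space M"
  shows "total_set (L2 M) {L2_class M (\<lambda>x. indicator (E \<inter> A n) x) | E n. E \<in> G}" (is "total_set _ ?S")
proof -
  interpret hilbert "L2 M" by (rule L2_hilbert)
  have si: "(\<lambda>x. indicator (E \<inter> A n) x) \<in> sq_int M" if "E \<in> G" for E n
  proof (rule sq_int_indicator)
    have E: "E \<in> sets M" using that G(3) by auto
    show "E \<inter> A n \<in> sets M" using E A(1) by auto
    show "emeasure M (E \<inter> A n) < \<infinity>"
      using emeasure_mono[of "E \<inter> A n" "A n" M] A(1,2)[of n] by (auto intro: le_less_trans)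
  qed
  show ?thesis
    unfolding total_set_def
  proof (intro conjI allI impI)
    show "?S \<subseteq> pts (L2 M)" using si by auto
    fix W assume W: "closed_subspace (L2 M) W" "?S \<subseteq> W"
    show "W = pts (L2 M)"
    proof (rule closed_subspace_total[OF W(1)])
      fix z assume z: "z \<in> pts (L2 M)" and orth: "\<And>w. w \<in> W \<Longrightarrow> inner (L2 M) z w = 0"
      have "(\<integral>x. rep z x * indicator (E \<inter> A n) x \<partial>M) = 0" if E: "E \<in> G" for E n
      proof -
        have "L2_class M (\<lambda>x. indicator (E \<inter> A n) x) \<in> W" using W(2) E by blast
        hence "inner (L2 M) (L2_class M (rep z)) (L2_class M (\<lambda>x. indicator (E \<inter> A n) x)) = 0"
          using orth z by (simp add: L2_class_rep)
        thus ?thesis unfolding L2_inner[OF rep_sq_int[OF z] si[OF E]] by simp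
      qed
      hence "AE x in M. rep z x = 0"
        using z by (intro L2_zero_if_orthogonal_to_indicators[OF G A]) auto
      hence "L2_class M (rep z) = vzero (L2 M)" unfolding L2_zero by (intro ae_class_cong)
      thus "z = vzero (L2 M)" using z by (simp add: L2_class_rep)
    qed
  qed
qed

lemma (in sigma_finite_measure) L2_indicators_total:
  "total_set (L2 M) {L2_class M (\<lambda>x. indicator E x) | E. E \<in> sets M \<and> emeasure M E < \<infinity>}"
proof -
  obtain A :: "nat \<Rightarrow> 'a set" where A: "range A \<subseteq> sets M" "(\<Union>i. A i) = space M" "\<And>i. emeasure M (A i) \<noteq> \<infinity>"
    using sigma_finite by blast
  have fin: "emeasure M (E \<inter> A n) < \<infinity>" if "E \<in> sets M" for E n
    using emeasure_mono[of "E \<inter> A n" "A n" M] A(1,3) by (metis IntE UNIV_I image_subset_iff infinity_ennreal_def less_top order_le_less_trans subsetI)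
  have t: "total_set (L2 M) {L2_class M (\<lambda>x. indicator (E \<inter> A n) x) | E n. E \<in> sets M}"
  proof (rule L2_indicator_total)
    show "sets M = sigma_sets (space M) (sets M)" by (simp add: sets.sigma_sets_eq)
    show "Int_stable (sets M)" by (simp add: Int_stable_def)
    show "emeasure M (A n) < \<infinity>" for n using A(3)[of n] by (simp add: less_top)
  qed (use A in \<open>auto dest: sets.sets_into_space\<close>)
  show ?thesis
    by (rule total_set_mono[OF t]) (use A(1) fin in \<open>auto intro!: L2_class_mem sq_int_indicator\<close>)
qed

section \<open>L2 of a product\<close>

context pair_sigma_finite
begin

lemma AE_fst:
  assumes "AE x in M1. P x" shows "AE z in M1 \<Otimes>\<^sub>M M2. P (fst z)"
proof -
  obtain A where A: "{x \<in> space M1. \<not> P x} \<subseteq> A" "emeasure M1 A = 0" "A \<in> sets M1"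
    using assms by (rule AE_E)
  show ?thesis
  proof (rule AE_I)
    show "{z \<in> space (M1 \<Otimes>\<^sub>M M2). \<not> P (fst z)} \<subseteq> A \<times> space M2"
      using A(1) by (auto simp: space_pair_measure)
    show "emeasure (M1 \<Otimes>\<^sub>M M2) (A \<times> space M2) = 0"
      using A by (simp add: M2.emeasure_pair_measure_Times)
    show "A \<times> space M2 \<in> sets (M1 \<Otimes>\<^sub>M M2)" using A(3) by simp
  qed
qed

lemma AE_snd:
  assumes "AE x in M2. P x" shows "AE z in M1 \<Otimes>\<^sub>M M2. P (snd z)"
proof -
  obtain A where A: "{x \<in> space M2. \<not> P x} \<subseteq> A" "emeasure M2 A = 0" "A \<in> sets M2"
    using assms by (rule AE_E)
  show ?thesis
  proof (rule AE_I)
    show "{z \<in> space (M1 \<Otimes>\<^sub>M M2). \<not> P (snd z)} \<subseteq> space M1 \<times> A"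
      using A(1) by (auto simp: space_pair_measure)
    show "emeasure (M1 \<Otimes>\<^sub>M M2) (space M1 \<times> A) = 0"
      using A by (simp add: M2.emeasure_pair_measure_Times)
    show "space M1 \<times> A \<in> sets (M1 \<Otimes>\<^sub>M M2)" using A(3) by simp
  qed
qed

lemma tensor_integrable:
  fixes f :: "'a \<Rightarrow> 'c::{real_normed_field, second_countable_topology, banach}"
  assumes f: "integrable M1 f" and g: "integrable M2 g"
  shows "integrable (M1 \<Otimes>\<^sub>M M2) (\<lambda>(x, y). f x * g y)"
proof (rule Fubini_integrable)
  have [measurable]: "f \<in> borel_measurable M1" "g \<in> borel_measurable M2" using f g by auto
  show "(\<lambda>(x, y). f x * g y) \<in> borel_measurable (M1 \<Otimes>\<^sub>M M2)" by measurable
  show "integrable M1 (\<lambda>x. \<integral>y. norm (case (x, y) of (x, y) \<Rightarrow> f x * g y) \<partial>M2)"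
    using f g by (simp add: norm_mult)
  show "AE x in M1. integrable M2 (\<lambda>y. case (x, y) of (x, y) \<Rightarrow> f x * g y)"
    using g by simp
qed

lemma tensor_integral:
  fixes f :: "'a \<Rightarrow> 'c::{real_normed_field, second_countable_topology, banach}"
  assumes f: "integrable M1 f" and g: "integrable M2 g"
  shows "(\<integral>z. f (fst z) * g (snd z) \<partial>(M1 \<Otimes>\<^sub>M M2)) = (\<integral>x. f x \<partial>M1) * (\<integral>y. g y \<partial>M2)"
  using integral_fst'[OF tensor_integrable[OF assms]] by (simp add: case_prod_unfold)

lemma tensor_sq_int [simp]:
  assumes f: "f \<in> sq_int M1" and g: "g \<in> sq_int M2"
  shows "(\<lambda>(x, y). f x * g y) \<in> sq_int (M1 \<Otimes>\<^sub>M M2)"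
proof -
  have [measurable]: "f \<in> borel_measurable M1" "g \<in> borel_measurable M2" using f g by (auto simp: sq_int_def)
  have "integrable (M1 \<Otimes>\<^sub>M M2) (\<lambda>(x, y). (cmod (f x))\<^sup>2 * (cmod (g y))\<^sup>2)"
    using f g by (intro tensor_integrable sq_int_integrable)
  moreover have "(\<lambda>z. (cmod (case z of (x, y) \<Rightarrow> f x * g y))\<^sup>2) = (\<lambda>(x, y). (cmod (f x))\<^sup>2 * (cmod (g y))\<^sup>2)"
    by (auto simp: norm_mult power_mult_distrib)
  ultimately show ?thesis by (simp add: sq_int_def)
qed

lemma elem_tensor_class:
  assumes f: "f \<in> sq_int M1" and g: "g \<in> sq_int M2"
  shows "elem_tensor M1 M2 (L2_class M1 f) (L2_class M2 g) = L2_class (M1 \<Otimes>\<^sub>M M2) (\<lambda>(x, y). f x * g y)"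
  unfolding elem_tensor_def
proof (rule ae_class_cong)
  from AE_fst[OF rep_ae_eq[OF f, of M1]] AE_snd[OF rep_ae_eq[OF g, of M2]]
  show "AE z in M1 \<Otimes>\<^sub>M M2. (case z of (x, y) \<Rightarrow> rep (L2_class M1 f) x * rep (L2_class M2 g) y) =
      (case z of (x, y) \<Rightarrow> f x * g y)"
    by eventually_elim (simp add: case_prod_unfold)
qed

lemma elem_tensor_mem: "\<lbrakk>a \<in> pts (L2 M1); b \<in> pts (L2 M2)\<rbrakk> \<Longrightarrow> elem_tensor M1 M2 a b \<in> pts (L2 (M1 \<Otimes>\<^sub>M M2))"
  unfolding elem_tensor_def by simp

lemma elem_tensor_inner:
  assumes "a \<in> pts (L2 M1)" "b \<in> pts (L2 M2)" "c \<in> pts (L2 M1)" "d \<in> pts (L2 M2)"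
  shows "inner (L2 (M1 \<Otimes>\<^sub>M M2)) (elem_tensor M1 M2 a b) (elem_tensor M1 M2 c d) =
    inner (L2 M1) a c * inner (L2 M2) b d"
proof -
  have "inner (L2 (M1 \<Otimes>\<^sub>M M2)) (elem_tensor M1 M2 a b) (elem_tensor M1 M2 c d) =
      (\<integral>z. (rep a (fst z) * cnj (rep c (fst z))) * (rep b (snd z) * cnj (rep d (snd z))) \<partial>(M1 \<Otimes>\<^sub>M M2))"
    unfolding elem_tensor_def using assms
    by (subst L2_inner[OF tensor_sq_int tensor_sq_int]) (simp_all add: case_prod_unfold mult_ac)
  also have "\<dots> = (\<integral>x. rep a x * cnj (rep c x) \<partial>M1) * (\<integral>y. rep b y * cnj (rep d y) \<partial>M2)"
    using assms by (intro tensor_integral sq_int_mult_integrable) auto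
  finally show ?thesis by (simp add: L2_inner_rep)
qed

lemma rectangles_total:
  "total_set (L2 (M1 \<Otimes>\<^sub>M M2)) {elem_tensor M1 M2 (L2_class M1 (indicator A)) (L2_class M2 (indicator B)) | A B.
     A \<in> sets M1 \<and> emeasure M1 A < \<infinity> \<and> B \<in> sets M2 \<and> emeasure M2 B < \<infinity>}" (is "total_set _ ?R")
proof -
  interpret P: sigma_finite_measure "M1 \<Otimes>\<^sub>M M2"
    by (rule sigma_finite_pair_measure; unfold_locales)
  obtain A :: "nat \<Rightarrow> 'a set" where A: "range A \<subseteq> sets M1" "(\<Union>i. A i) = space M1" "\<And>i. emeasure M1 (A i) \<noteq> \<infinity>"
    using M1.sigma_finite by blast
  obtain B :: "nat \<Rightarrow> 'b set" where B: "range B \<subseteq> sets M2" "(\<Union>i. B i) = space M2" "\<And>i. emeasure M2 (B i) \<noteq> \<infinity>"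
    using M2.sigma_finite by blast
  have As: "A i \<in> sets M1" "B i \<in> sets M2" for i using A(1) B(1) by auto
  \<comment> \<open>\<open>prod_decode\<close> enumerates the products of the two exhausting
    sequences. A rectangle cut down by such a product is again a rectangle, with sides of finite
    measure.\<close>
  define C where "C n = A (fst (prod_decode n)) \<times> B (snd (prod_decode n))" for n
  let ?G = "{a \<times> b | a b. a \<in> sets M1 \<and> b \<in> sets M2}"
  have fin1: "emeasure M1 (a \<inter> A i) < \<infinity>" if "a \<in> sets M1" for a i
    by (rule le_less_trans[OF emeasure_mono[of _ "A i"]]) (use A(3)[of i] As in \<open>auto simp: less_top\<close>)
  have fin2: "emeasure M2 (b \<inter> B i) < \<infinity>" if "b \<in> sets M2" for b i
    by (rule le_less_trans[OF emeasure_mono[of _ "B i"]]) (use B(3)[of i] As in \<open>auto simp: less_top\<close>)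
  have t: "total_set (L2 (M1 \<Otimes>\<^sub>M M2)) {L2_class (M1 \<Otimes>\<^sub>M M2) (\<lambda>x. indicator (E \<inter> C n) x) | E n. E \<in> ?G}"
  proof (rule P.L2_indicator_total)
    show "Int_stable ?G" by (rule Int_stable_pair_measure_generator)
    show "?G \<subseteq> Pow (space (M1 \<Otimes>\<^sub>M M2))"
      by (auto simp: space_pair_measure dest: sets.sets_into_space)
    show "sets (M1 \<Otimes>\<^sub>M M2) = sigma_sets (space (M1 \<Otimes>\<^sub>M M2)) ?G"
      by (simp add: sets_pair_measure space_pair_measure)
    show "space (M1 \<Otimes>\<^sub>M M2) \<in> ?G" by (auto simp: space_pair_measure)
    show "C n \<in> sets (M1 \<Otimes>\<^sub>M M2)" for n using As by (simp add: C_def)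
    show "emeasure (M1 \<Otimes>\<^sub>M M2) (C n) < \<infinity>" for n
      using As A(3) B(3) by (simp add: C_def M2.emeasure_pair_measure_Times ennreal_mult_less_top less_top)
    show "(\<Union>n. C n) = space (M1 \<Otimes>\<^sub>M M2)"
    proof (intro equalityI subsetI)
      fix z assume "z \<in> space (M1 \<Otimes>\<^sub>M M2)"
      hence "fst z \<in> (\<Union>i. A i)" "snd z \<in> (\<Union>i. B i)" using A(2) B(2) by (auto simp: space_pair_measure)
      then obtain i j where "fst z \<in> A i" "snd z \<in> B j" by blast
      hence "z \<in> C (prod_encode (i, j))" by (cases z) (simp add: C_def)
      thus "z \<in> (\<Union>n. C n)" by blast
    qed (use A(2) B(2) in \<open>auto simp: C_def space_pair_measure\<close>)
  qed
  show ?thesis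
  proof (rule total_set_mono[OF t])
    show "{L2_class (M1 \<Otimes>\<^sub>M M2) (\<lambda>x. indicator (E \<inter> C n) x) | E n. E \<in> ?G} \<subseteq> ?R"
    proof (intro subsetI, elim CollectE exE conjE)
      fix x E n a b assume x: "x = L2_class (M1 \<Otimes>\<^sub>M M2) (\<lambda>x. indicator (E \<inter> C n) x)"
        and E: "E = a \<times> b" "a \<in> sets M1" "b \<in> sets M2"
      let ?a = "a \<inter> A (fst (prod_decode n))" and ?b = "b \<inter> B (snd (prod_decode n))"
      have "x = elem_tensor M1 M2 (L2_class M1 (indicator ?a)) (L2_class M2 (indicator ?b))"
        unfolding x using E As fin1 fin2
        by (subst elem_tensor_class)
          (auto intro!: sq_int_indicator arg_cong[where f = "L2_class _"] simp: C_def fun_eq_iff indicator_def)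
      thus "x \<in> ?R" using E As fin1 fin2 by blast
    qed
    show "?R \<subseteq> pts (L2 (M1 \<Otimes>\<^sub>M M2))"
      by (auto intro!: elem_tensor_mem L2_class_mem sq_int_indicator)
  qed
qed

lemma sq_int_sections:
  assumes f: "f \<in> sq_int (M1 \<Otimes>\<^sub>M M2)"
  shows "AE x in M1. (\<lambda>y. f (x, y)) \<in> sq_int M2"
  using AE_integrable_fst'[OF sq_int_integrable[OF f]] AE_space
proof eventually_elim
  case (elim x)
  have "f \<in> borel_measurable (M1 \<Otimes>\<^sub>M M2)" using f by (simp add: sq_int_def)
  hence "(\<lambda>y. f (x, y)) \<in> borel_measurable M2" using elim(2) by measurable
  thus ?case using elim(1) by (simp add: sq_int_def)
qed

lemma slice_class:
  assumes f: "f \<in> sq_int (M1 \<Otimes>\<^sub>M M2)"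
  shows "AE x in M1. slice M2 (L2_class (M1 \<Otimes>\<^sub>M M2) f) x = L2_class M2 (\<lambda>y. f (x, y))"
  using AE_pair[OF rep_ae_eq[OF f, of "M1 \<Otimes>\<^sub>M M2"]]
  unfolding slice_def by eventually_elim (rule ae_class_cong)

lemma inner_sections:
  assumes f: "f \<in> sq_int (M1 \<Otimes>\<^sub>M M2)" and g: "g \<in> sq_int (M1 \<Otimes>\<^sub>M M2)"
  shows "inner (L2 (M1 \<Otimes>\<^sub>M M2)) (L2_class (M1 \<Otimes>\<^sub>M M2) f) (L2_class (M1 \<Otimes>\<^sub>M M2) g) =
      (\<integral>x. \<integral>y. f (x, y) * cnj (g (x, y)) \<partial>M2 \<partial>M1)"
    and "integrable M1 (\<lambda>x. \<integral>y. f (x, y) * cnj (g (x, y)) \<partial>M2)"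
proof -
  note i = sq_int_mult_integrable(2)[OF f g]
  show "integrable M1 (\<lambda>x. \<integral>y. f (x, y) * cnj (g (x, y)) \<partial>M2)" by (rule integrable_fst'[OF i])
  show "inner (L2 (M1 \<Otimes>\<^sub>M M2)) (L2_class (M1 \<Otimes>\<^sub>M M2) f) (L2_class (M1 \<Otimes>\<^sub>M M2) g) =
      (\<integral>x. \<integral>y. f (x, y) * cnj (g (x, y)) \<partial>M2 \<partial>M1)"
    unfolding L2_inner[OF f g] integral_fst'[OF i] ..
qed

end

section \<open>Operators on L2\<close>

text \<open>\<open>W\<close> is given only as a bounded operator with prescribed values on
  elementary tensors. There it inherits inner products from \<open>F\<close>, so it is isometric by
  totality of the rectangles; its range is closed and contains all rectangles because
  \<open>F\<close> is onto.\<close>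

lemma tensor_op_unitary:
  assumes "pair_sigma_finite M N" and "sigma_finite_measure M'"
    and F: "unitary_op (L2 M) (L2 M') F" and W: "is_tensor_op M N M' N F (\<lambda>b. b) W"
  shows "unitary_op (L2 (M \<Otimes>\<^sub>M N)) (L2 (M' \<Otimes>\<^sub>M N)) W"
proof -
  interpret pair_sigma_finite M N by fact
  interpret M': sigma_finite_measure M' by fact
  interpret P': pair_sigma_finite M' N ..
  have Wb: "bounded_op (L2 (M \<Otimes>\<^sub>M N)) (L2 (M' \<Otimes>\<^sub>M N)) W"
    and We: "\<And>a b. \<lbrakk>a \<in> pts (L2 M); b \<in> pts (L2 N)\<rbrakk> \<Longrightarrow> W (elem_tensor M N a b) = elem_tensor M' N (F a) b"
    using W unfolding is_tensor_op_def by blast+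
  have Fm: "F a \<in> pts (L2 M')" and Fi: "inner (L2 M') (F a) (F b) = inner (L2 M) a b"
    if "a \<in> pts (L2 M)" "b \<in> pts (L2 M)" for a b
    using F that unfolding unitary_op_def by blast+
  have iso: "inner (L2 (M' \<Otimes>\<^sub>M N)) (W x) (W y) = inner (L2 (M \<Otimes>\<^sub>M N)) x y"
    if "x \<in> pts (L2 (M \<Otimes>\<^sub>M N))" "y \<in> pts (L2 (M \<Otimes>\<^sub>M N))" for x y
  proof (rule isometry_on_total[OF L2_hilbert L2_hilbert Wb rectangles_total _ that], elim CollectE exE conjE)
    fix x y A B C D
    assume *: "x = elem_tensor M N (L2_class M (indicator A)) (L2_class N (indicator B))"
      "y = elem_tensor M N (L2_class M (indicator C)) (L2_class N (indicator D))"
      "A \<in> sets M" "emeasure M A < \<infinity>" "B \<in> sets N" "emeasure N B < \<infinity>"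
      "C \<in> sets M" "emeasure M C < \<infinity>" "D \<in> sets N" "emeasure N D < \<infinity>"
    have "L2_class M (indicator A) \<in> pts (L2 M)" "L2_class N (indicator B) \<in> pts (L2 N)"
      "L2_class M (indicator C) \<in> pts (L2 M)" "L2_class N (indicator D) \<in> pts (L2 N)"
      using * by (auto intro!: L2_class_mem sq_int_indicator)
    thus "inner (L2 (M' \<Otimes>\<^sub>M N)) (W x) (W y) = inner (L2 (M \<Otimes>\<^sub>M N)) x y"
      unfolding *(1,2) by (simp add: We Fm Fi P'.elem_tensor_inner elem_tensor_inner)
  qed
  have lin: "linear_map (L2 (M \<Otimes>\<^sub>M N)) (L2 (M' \<Otimes>\<^sub>M N)) W" using Wb by (simp add: bounded_op_def)
  have "W ` pts (L2 (M \<Otimes>\<^sub>M N)) = pts (L2 (M' \<Otimes>\<^sub>M N))"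
  proof
    show "W ` pts (L2 (M \<Otimes>\<^sub>M N)) \<subseteq> pts (L2 (M' \<Otimes>\<^sub>M N))" using linear_mapD(1)[OF lin] by blast
    have cl: "closed_subspace (L2 (M' \<Otimes>\<^sub>M N)) (W ` pts (L2 (M \<Otimes>\<^sub>M N)))"
      by (rule isometry_range_closed[OF L2_hilbert L2_hilbert lin iso])
    have "elem_tensor M' N (L2_class M' (indicator A)) (L2_class N (indicator B)) \<in> W ` pts (L2 (M \<Otimes>\<^sub>M N))"
      if AB: "A \<in> sets M'" "emeasure M' A < \<infinity>" "B \<in> sets N" "emeasure N B < \<infinity>" for A B
    proof -
      have b: "L2_class N (indicator B) \<in> pts (L2 N)" "L2_class M' (indicator A) \<in> pts (L2 M')"
        using AB by (auto intro!: L2_class_mem sq_int_indicator)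
      then obtain a where a: "a \<in> pts (L2 M)" "L2_class M' (indicator A) = F a"
        using F unfolding unitary_op_def by blast
      show ?thesis using We[OF a(1) b(1)] a(2) elem_tensor_mem[OF a(1) b(1)] by (metis image_eqI)
    qed
    hence "{elem_tensor M' N (L2_class M' (indicator A)) (L2_class N (indicator B)) | A B.
      A \<in> sets M' \<and> emeasure M' A < \<infinity> \<and> B \<in> sets N \<and> emeasure N B < \<infinity>} \<subseteq> W ` pts (L2 (M \<Otimes>\<^sub>M N))"
      by blast
    with total_setD[OF P'.rectangles_total cl]
    show "pts (L2 (M' \<Otimes>\<^sub>M N)) \<subseteq> W ` pts (L2 (M \<Otimes>\<^sub>M N))" by blast
  qed
  thus ?thesis using lin iso by (simp add: unitary_op_def)
qed

definition mul_op :: "'x measure \<Rightarrow> ('x \<Rightarrow> complex) \<Rightarrow> ('x \<Rightarrow> complex) set \<Rightarrow> ('x \<Rightarrow> complex) set" where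
  "mul_op M \<phi> a = L2_class M (\<lambda>x. \<phi> x * rep a x)"

definition comp_op :: "'x measure \<Rightarrow> ('x \<Rightarrow> 'x) \<Rightarrow> ('x \<Rightarrow> complex) set \<Rightarrow> ('x \<Rightarrow> complex) set" where
  "comp_op M \<tau> a = L2_class M (\<lambda>x. rep a (\<tau> x))"

lemma mul_op_class:
  assumes "f \<in> sq_int M" shows "mul_op M \<phi> (L2_class M f) = L2_class M (\<lambda>x. \<phi> x * f x)"
  unfolding mul_op_def
proof (rule ae_class_cong)
  show "AE x in M. \<phi> x * rep (L2_class M f) x = \<phi> x * f x"
    using rep_ae_eq[OF assms, of M] by eventually_elim simp
qed

lemma L2_bounded_opI:
  assumes T: "\<And>f. f \<in> sq_int M \<Longrightarrow> T (L2_class M f) = L2_class N (t f)"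
    and t: "\<And>f. f \<in> sq_int M \<Longrightarrow> t f \<in> sq_int N"
    and add: "\<And>f g. \<lbrakk>f \<in> sq_int M; g \<in> sq_int M\<rbrakk> \<Longrightarrow> t (\<lambda>x. f x + g x) = (\<lambda>x. t f x + t g x)"
    and scale: "\<And>c f. f \<in> sq_int M \<Longrightarrow> t (\<lambda>x. c * f x) = (\<lambda>x. c * t f x)"
    and bd: "\<And>f. f \<in> sq_int M \<Longrightarrow> (\<integral>x. (cmod (t f x))\<^sup>2 \<partial>N) \<le> C\<^sup>2 * (\<integral>x. (cmod (f x))\<^sup>2 \<partial>M)"
  shows "bounded_op (L2 M) (L2 N) T"
  unfolding bounded_op_def linear_map_def
proof (intro conjI ballI allI exI[of _ "\<bar>C\<bar>"])
  fix a c assume "a \<in> pts (L2 M)"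
  then obtain f where f: "f \<in> sq_int M" "a = L2_class M f" by (auto simp: L2_pts)
  show "T a \<in> pts (L2 N)" using f by (simp add: T t)
  show "T (vscale (L2 M) c a) = vscale (L2 N) c (T a)" using f by (simp add: L2_scale T t scale)
  show "hnorm (L2 N) (T a) \<le> \<bar>C\<bar> * hnorm (L2 M) a"
    using real_sqrt_le_mono[OF bd[OF f(1)]] f by (simp add: T t L2_norm real_sqrt_mult)
  fix b assume "b \<in> pts (L2 M)"
  then obtain g where g: "g \<in> sq_int M" "b = L2_class M g" by (auto simp: L2_pts)
  show "T (vadd (L2 M) a b) = vadd (L2 N) (T a) (T b)" using f g by (simp add: L2_add T t add)
qed

lemma mul_op_bounded:
  assumes [measurable]: "\<phi> \<in> borel_measurable M" and bd: "\<And>x. x \<in> space M \<Longrightarrow> cmod (\<phi> x) \<le> C"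
  shows "bounded_op (L2 M) (L2 M) (mul_op M \<phi>)"
proof (rule L2_bounded_opI)
  fix f assume f: "f \<in> sq_int M"
  show sq: "(\<lambda>x. \<phi> x * f x) \<in> sq_int M"
    using f bd by (intro sq_int_bounded_mult'[where C = C]) auto
  have "(\<integral>x. (cmod (\<phi> x * f x))\<^sup>2 \<partial>M) \<le> (\<integral>x. C\<^sup>2 * (cmod (f x))\<^sup>2 \<partial>M)"
    by (rule integral_mono) (use sq_int_integrable[OF f] sq_int_integrable[OF sq] bd in
        \<open>auto simp: norm_mult power_mult_distrib intro!: mult_right_mono power_mono\<close>)
  thus "(\<integral>x. (cmod (\<phi> x * f x))\<^sup>2 \<partial>M) \<le> C\<^sup>2 * (\<integral>x. (cmod (f x))\<^sup>2 \<partial>M)" by simp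
qed (auto simp: mul_op_class algebra_simps)

text \<open>Composition respects classes because \<open>\<tau>\<close> preserves the measure, so
  that preimages of null sets are null.\<close>

lemma comp_op_class:
  assumes f: "f \<in> sq_int M" and \<tau>: "\<tau> \<in> measurable M M" "distr M M \<tau> = M"
  shows "comp_op M \<tau> (L2_class M f) = L2_class M (\<lambda>x. f (\<tau> x))"
proof -
  have [measurable]: "f \<in> borel_measurable M" "rep (L2_class M f) \<in> borel_measurable M"
    using f rep_sq_int[OF L2_class_mem[OF f]] by (auto simp: sq_int_def)
  have "AE x in distr M M \<tau>. rep (L2_class M f) x = f x"
    unfolding \<tau>(2) by (rule rep_ae_eq[OF f])
  hence "AE x in M. rep (L2_class M f) (\<tau> x) = f (\<tau> x)"
    by (rule AE_distrD[OF \<tau>(1)])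
  thus ?thesis unfolding comp_op_def by (rule ae_class_cong)
qed

lemma sq_int_comp:
  assumes f: "f \<in> sq_int M" and \<tau>: "\<tau> \<in> measurable M M" "distr M M \<tau> = M"
  shows "(\<lambda>x. f (\<tau> x)) \<in> sq_int M"
    and "(\<integral>x. (cmod (f (\<tau> x)))\<^sup>2 \<partial>M) = (\<integral>x. (cmod (f x))\<^sup>2 \<partial>M)"
proof -
  have [measurable]: "f \<in> borel_measurable M" using f by (auto simp: sq_int_def)
  have "integrable (distr M M \<tau>) (\<lambda>x. (cmod (f x))\<^sup>2)" using f \<tau> by (simp add: sq_int_integrable)
  hence "integrable M (\<lambda>x. (cmod (f (\<tau> x)))\<^sup>2)" using \<tau>(1) by (subst (asm) integrable_distr_eq) auto
  thus "(\<lambda>x. f (\<tau> x)) \<in> sq_int M" using \<tau>(1) by (simp add: sq_int_def)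
  show "(\<integral>x. (cmod (f (\<tau> x)))\<^sup>2 \<partial>M) = (\<integral>x. (cmod (f x))\<^sup>2 \<partial>M)"
    using integral_distr[OF \<tau>(1), of "\<lambda>x. (cmod (f x))\<^sup>2"] \<tau>(2) by simp
qed

lemma comp_op_bounded:
  assumes \<tau>: "\<tau> \<in> measurable M M" "distr M M \<tau> = M"
  shows "bounded_op (L2 M) (L2 M) (comp_op M \<tau>)"
  by (rule L2_bounded_opI[where C = 1 and t = "\<lambda>f x. f (\<tau> x)"]) (auto simp: comp_op_class[OF _ \<tau>] sq_int_comp[OF _ \<tau>])

lemma comp_op_adjoint:
  assumes \<tau>: "\<tau> \<in> measurable M M" "distr M M \<tau> = M" and \<sigma>: "\<sigma> \<in> measurable M M" "distr M M \<sigma> = M"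
    and inv: "\<And>x. x \<in> space M \<Longrightarrow> \<sigma> (\<tau> x) = x"
    and a: "a \<in> pts (L2 M)" and b: "b \<in> pts (L2 M)"
  shows "inner (L2 M) (comp_op M \<tau> a) b = inner (L2 M) a (comp_op M \<sigma> b)"
proof -
  obtain f g where f: "f \<in> sq_int M" "a = L2_class M f" and g: "g \<in> sq_int M" "b = L2_class M g"
    using a b by (auto simp: L2_pts)
  have [measurable]: "f \<in> borel_measurable M" "g \<in> borel_measurable M" using f g by (auto simp: sq_int_def)
  note [measurable] = \<tau>(1) \<sigma>(1)
  have "(\<integral>x. f x * cnj (g (\<sigma> x)) \<partial>M) = (\<integral>x. f x * cnj (g (\<sigma> x)) \<partial>distr M M \<tau>)" by (simp add: \<tau>(2))
  also have "\<dots> = (\<integral>x. f (\<tau> x) * cnj (g (\<sigma> (\<tau> x))) \<partial>M)" by (rule integral_distr) measurable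
  also have "\<dots> = (\<integral>x. f (\<tau> x) * cnj (g x) \<partial>M)"
    by (rule Bochner_Integration.integral_cong) (auto simp: inv)
  finally show ?thesis
    using f g by (simp add: comp_op_class \<tau> \<sigma> L2_inner sq_int_comp(1))
qed

lemma integrable_indicator_complex:
  assumes "A \<in> sets M" "emeasure M A < \<infinity>"
  shows "integrable M (\<lambda>x. indicator A x :: complex)"
proof -
  have "integrable M (\<lambda>x. complex_of_real (indicator A x))" using assms by simp
  moreover have "complex_of_real (indicator A x) = indicator A x" for x by (simp add: indicator_def)
  ultimately show ?thesis by simp
qed

section \<open>The group and its dual\<close>

lemma haar_measureD:
  assumes "haar_measure T op M"
  shows "space M = topspace T" "sets M = sigma_sets (topspace T) {U. openin T U}"
    "emeasure M (space M) \<noteq> 0"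
    "\<lbrakk>a \<in> topspace T; B \<in> sets M\<rbrakk> \<Longrightarrow> emeasure M (op a ` B) = emeasure M B"
    "compactin T K \<Longrightarrow> emeasure M K < \<infinity>"
  using assms unfolding haar_measure_def by blast+

locale lca_group =
  fixes \<nu> :: "'g::topological_ab_group_add measure"
  assumes loc_compact: "locally_compact_space (euclidean :: 'g topology)"
    and sigma_compact: "sigma_compact_space (euclidean :: 'g topology)"
    and metrizable: "metrizable_space (euclidean :: 'g topology)"
    and haar: "haar_measure euclidean (+) \<nu>"
begin

lemma space_haar [simp]: "space \<nu> = UNIV"
  using haar_measureD(1)[OF haar] by simp

lemma sets_haar [measurable_cong, simp]: "sets \<nu> = sets borel"
  using haar_measureD(2)[OF haar] by (simp add: borel_def)

lemma haar_translate: "B \<in> sets borel \<Longrightarrow> emeasure \<nu> ((+) a ` B) = emeasure \<nu> B"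
  using haar_measureD(4)[OF haar, of a B] by simp

lemmas haar_compact_finite = haar_measureD(5)[OF haar]

lemma haar_nonzero: "emeasure \<nu> UNIV \<noteq> 0"
  using haar_measureD(3)[OF haar] by simp

lemma compact_borel: "compactin euclidean (K :: 'g set) \<Longrightarrow> K \<in> sets borel"
  using compactin_imp_closedin[OF metrizable_imp_Hausdorff_space[OF metrizable]] by (auto intro: borel_closed)

sublocale sigma_finite_measure \<nu>
proof
  obtain K :: "nat \<Rightarrow> 'g set" where K: "\<And>n. compactin euclidean (K n)" "(\<Union>n. K n) = UNIV"
    using sigma_compact by (auto simp: sigma_compact_space_def)
  show "\<exists>A. countable A \<and> A \<subseteq> sets \<nu> \<and> \<Union> A = space \<nu> \<and> (\<forall>a\<in>A. emeasure \<nu> a \<noteq> \<infinity>)"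
    using K haar_compact_finite by (intro exI[of _ "range K"]) (auto simp: compact_borel less_top[symmetric])
qed

lemma translation_measurable: "(\<lambda>u. u - a) \<in> measurable \<nu> \<nu>"
  unfolding measurable_cong_sets[OF sets_haar sets_haar]
  by (intro borel_measurable_continuous_onI continuous_intros)

lemma translation_distr: "distr \<nu> \<nu> (\<lambda>u. u - a) = \<nu>"
proof (rule measure_eqI)
  fix B assume B: "B \<in> sets (distr \<nu> \<nu> (\<lambda>u. u - a))"
  have "(\<lambda>u. u - a) -` B = (+) a ` B"
    by (auto simp: image_iff algebra_simps intro: exI[of _ "_ - a"]) (metis add_diff_cancel_left' diff_add_cancel)
  thus "emeasure (distr \<nu> \<nu> (\<lambda>u. u - a)) B = emeasure \<nu> B"
    using B translation_measurable by (simp add: emeasure_distr haar_translate)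
qed simp

lemma metric:
  obtains d where "Metric_space (UNIV :: 'g set) d" "Metric_space.mtopology UNIV d = euclidean"
proof -
  obtain M d where M: "Metric_space M d" "euclidean = (Metric_space.mtopology M d :: 'g topology)"
    using metrizable unfolding metrizable_space_def by blast
  have "topspace (euclidean :: 'g topology) = M"
    unfolding M(2) by (rule Metric_space.topspace_mtopology[OF M(1)])
  hence MU: "M = UNIV" by (simp only: topspace_euclidean)
  show thesis by (rule that[of d]) (use M(1) M(2)[symmetric] in \<open>simp_all only: MU\<close>)
qed

text \<open>The maps \<open>s k\<close> replace the group variable by a countable index, which
  reduces joint measurability of the pairing to measurability at fixed points. Their values also
  provide countably many translates of a neighbourhood of \<open>0\<close> that cover the
  group.\<close>

lemma countable_approximation:
  obtains s :: "nat \<Rightarrow> 'g \<Rightarrow> 'g"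
  where "\<And>x. (\<lambda>k. s k x) \<longlonglongrightarrow> x"
    "\<And>k. \<exists>(e :: nat \<Rightarrow> 'g) \<iota>. \<iota> \<in> measurable borel (count_space UNIV) \<and> s k = (\<lambda>x. e (\<iota> x))"
proof -
  obtain d where d: "Metric_space (UNIV :: 'g set) d" and top: "Metric_space.mtopology UNIV d = euclidean"
    by (rule metric)
  interpret Metric_space UNIV d by fact
  obtain K :: "nat \<Rightarrow> 'g set" where K: "\<And>n. compactin euclidean (K n)" "(\<Union>n. K n) = UNIV"
    using sigma_compact by (auto simp: sigma_compact_space_def)
  have "\<exists>F. finite F \<and> K n \<subseteq> (\<Union>x\<in>F. mball x (1 / real (Suc k)))" for n k
    using compactin_imp_mtotally_bounded[of "K n"] K(1)[of n] unfolding top mtotally_bounded_def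
    by (meson zero_less_divide_1_iff of_nat_0_less_iff zero_less_Suc)
  then obtain F where F: "\<And>n k. finite (F n k)" "\<And>n k. K n \<subseteq> (\<Union>x\<in>F n k. mball x (1 / real (Suc k)))"
    by metis
  define D where "D k = (\<Union>n. F n k)" for k
  have D: "countable (D k)" for k unfolding D_def using F(1) by (auto intro: countable_finite)
  have cover: "\<exists>c\<in>D k. x \<in> mball c (1 / real (Suc k))" for x k
  proof -
    obtain n where "x \<in> K n" using K(2) by blast
    thus ?thesis using F(2)[of n k] unfolding D_def by blast
  qed
  have Dne: "D k \<noteq> {}" for k using cover[of k undefined] by blast
  define e where "e k = from_nat_into (D k)" for k
  \<comment> \<open>The first ball of radius \<open>1 / (k + 1)\<close> around a centre
    \<open>e k i\<close> that contains \<open>x\<close>. Taking the least index makes the choice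
    measurable, since balls are open.\<close>
  define \<iota> where "\<iota> k x = (LEAST i. x \<in> mball (e k i) (1 / real (Suc k)))" for k x
  have near: "x \<in> mball (e k (\<iota> k x)) (1 / real (Suc k))" for x k
  proof -
    obtain c where c: "c \<in> D k" "x \<in> mball c (1 / real (Suc k))" using cover by blast
    obtain i where "e k i = c" using from_nat_into_surj[OF D c(1)] unfolding e_def by blast
    hence "x \<in> mball (e k i) (1 / real (Suc k))" using c by simp
    thus ?thesis unfolding \<iota>_def by (rule LeastI)
  qed
  show thesis
  proof (rule that[of "\<lambda>k x. e k (\<iota> k x)"])
    fix k
    have "open (mball (e k i) (1 / real (Suc k)))" for i
      using openin_mball[of "e k i" "1 / real (Suc k)"] unfolding top by simp
    hence "(\<lambda>x. x \<in> mball (e k i) (1 / real (Suc k))) \<in> measurable borel (count_space UNIV)" for i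
      by (simp add: pred_def borel_open del: in_mball)
    hence "\<iota> k \<in> measurable borel (count_space UNIV)" unfolding \<iota>_def by (rule measurable_Least)
    thus "\<exists>(e' :: nat \<Rightarrow> 'g) \<iota>'. \<iota>' \<in> measurable borel (count_space UNIV) \<and> (\<lambda>x. e k (\<iota> k x)) = (\<lambda>x. e' (\<iota>' x))"
      by blast
  next
    fix x
    have "limitin mtopology (\<lambda>k. e k (\<iota> k x)) x sequentially"
      unfolding limitin_metric
    proof (intro conjI allI impI)
      fix \<epsilon> :: real assume "\<epsilon> > 0"
      then obtain n where n: "1 / real (Suc n) < \<epsilon>" using nat_approx_posE by blast
      have "d (e k (\<iota> k x)) x < \<epsilon>" if "k \<ge> n" for k
      proof -
        have "1 / real (Suc k) \<le> 1 / real (Suc n)" using that by (simp add: frac_le)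
        thus ?thesis using near[of x k] n by simp
      qed
      thus "\<forall>\<^sub>F k in sequentially. e k (\<iota> k x) \<in> UNIV \<and> d (e k (\<iota> k x)) x < \<epsilon>"
        by (auto simp: eventually_sequentially)
    qed simp
    thus "(\<lambda>k. e k (\<iota> k x)) \<longlonglongrightarrow> x" unfolding top by simp
  qed
qed

text \<open>If \<open>U\<close> were null, so would be its countably many translates by the values
  of the maps \<open>s k\<close>. These cover the group: \<open>x - s k x\<close> tends to
  \<open>0\<close>, hence enters \<open>U\<close>.\<close>

lemma haar_open_pos:
  assumes U: "open U" "0 \<in> (U :: 'g set)" shows "emeasure \<nu> U > 0"
proof (rule ccontr)
  assume "\<not> emeasure \<nu> U > 0"
  hence U0: "emeasure \<nu> U = 0" by simp
  obtain s where e: "\<And>x. (\<lambda>k. s k x) \<longlonglongrightarrow> x"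
    and "\<And>k. \<exists>(e :: nat \<Rightarrow> 'g) \<iota>. \<iota> \<in> measurable borel (count_space UNIV) \<and> s k = (\<lambda>x. e (\<iota> x))"
    by (rule countable_approximation) blast
  then obtain e :: "nat \<Rightarrow> nat \<Rightarrow> 'g" and \<iota> where s: "\<And>k. s k = (\<lambda>x. e k (\<iota> k x))" by metis
  have Ub: "(+) c ` U \<in> sets borel" for c
  proof -
    have "(+) c ` U = (\<lambda>u. u - c) -` U \<inter> space \<nu>"
      by (auto simp: image_iff algebra_simps intro: exI[of _ "_ - c"]) (metis add_diff_cancel_left' diff_add_cancel)
    also have "\<dots> \<in> sets \<nu>" using U by (intro measurable_sets[OF translation_measurable]) auto
    finally show ?thesis by simp
  qed
  have "x \<in> (\<Union>k i. (+) (e k i) ` U)" for x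
  proof -
    have "(\<lambda>k. x - s k x) \<longlonglongrightarrow> x - x" by (intro tendsto_intros e)
    hence "\<forall>\<^sub>F k in sequentially. x - e k (\<iota> k x) \<in> U" using U by (auto simp: s dest: topological_tendstoD)
    then obtain k where "x - e k (\<iota> k x) \<in> U" by (auto simp: eventually_sequentially)
    hence "x \<in> (+) (e k (\<iota> k x)) ` U" by (auto intro: image_eqI[of _ _ "x - e k (\<iota> k x)"])
    thus ?thesis by blast
  qed
  hence "(\<Union>k i. (+) (e k i) ` U) = UNIV" by blast
  moreover have "(\<Union>k i. (+) (e k i) ` U) \<in> null_sets \<nu>"
    using U U0 Ub by (intro null_sets_UN) (auto simp: null_sets_def haar_translate)
  ultimately show False using haar_nonzero by (simp add: null_sets_def)
qed

end

locale lca_group_dual = lca_group \<nu> for \<nu> :: "'g::topological_ab_group_add measure" +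
  fixes \<nu>' :: "('g \<Rightarrow> complex) measure" and F
  assumes dual_haar: "haar_measure dual_topology dual_mult \<nu>'"
    and plancherel: "fourier_plancherel \<nu> \<nu>' F"
begin

lemma F_unitary: "unitary_op (L2 \<nu>) (L2 \<nu>') F"
  and F_sq_int: "\<lbrakk>f \<in> sq_int \<nu>; integrable \<nu> f\<rbrakk> \<Longrightarrow> fourier1 \<nu> f \<in> sq_int \<nu>'"
  and F_class: "\<lbrakk>f \<in> sq_int \<nu>; integrable \<nu> f\<rbrakk> \<Longrightarrow> F (L2_class \<nu> f) = L2_class \<nu>' (fourier1 \<nu> f)"
  using plancherel by (simp_all add: fourier_plancherel_def)

lemma topspace_dual: "topspace (dual_topology :: ('g \<Rightarrow> complex) topology) = dual_group"
proof -
  have "\<Union> {{\<xi> \<in> dual_group. \<xi> ` K \<subseteq> U} | K U. compact K \<and> open U} = (dual_group :: ('g \<Rightarrow> complex) set)"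
    by (auto intro!: exI[of _ dual_group] exI[of _ "{}"])
  thus ?thesis unfolding dual_topology_def topology_generated_by_topspace .
qed

lemma space_dual [simp]: "space \<nu>' = dual_group"
  using haar_measureD(1)[OF dual_haar] topspace_dual by simp

text \<open>A point is compact, so the sets \<open>\<xi> x \<in> U\<close> belong to the generating
  family of the compact-open topology.\<close>

lemma char_eval_measurable [measurable]: "(\<lambda>\<xi>. \<xi> x) \<in> borel_measurable \<nu>'"
proof (rule borel_measurableI)
  fix U :: "complex set" assume U: "open U"
  have "(\<lambda>\<xi>. \<xi> x) -` U \<inter> space \<nu>' = {\<xi> \<in> dual_group. \<xi> ` {x} \<subseteq> U}" by auto
  moreover have "openin dual_topology {\<xi> \<in> dual_group. \<xi> ` {x} \<subseteq> U}"
    unfolding dual_topology_def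
    by (intro topology_generated_by_Basis CollectI exI[of _ "{x}"] exI[of _ U] conjI refl U) simp
  hence "{\<xi> \<in> dual_group. \<xi> ` {x} \<subseteq> U} \<in> sets \<nu>'"
    unfolding haar_measureD(2)[OF dual_haar] by (intro sigma_sets.Basic CollectI)
  ultimately show "(\<lambda>\<xi>. \<xi> x) -` U \<inter> space \<nu>' \<in> sets \<nu>'" by (simp only:)
qed

lemma char_norm: "\<xi> \<in> dual_group \<Longrightarrow> cmod (\<xi> x) = 1"
  and char_mult: "\<xi> \<in> dual_group \<Longrightarrow> \<xi> (x + y) = \<xi> x * \<xi> y"
  and char_cont: "\<xi> \<in> dual_group \<Longrightarrow> continuous_on UNIV \<xi>"
  by (simp_all add: dual_group_def)

lemma char_tendsto: "\<lbrakk>\<xi> \<in> dual_group; s \<longlonglongrightarrow> x\<rbrakk> \<Longrightarrow> (\<lambda>n. \<xi> (s n)) \<longlonglongrightarrow> \<xi> x"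
  using continuous_on_tendsto_compose[OF char_cont] by auto

lemma char_measurable: "\<xi> \<in> dual_group \<Longrightarrow> \<xi> \<in> borel_measurable \<nu>"
  unfolding measurable_cong_sets[OF sets_haar refl] by (rule borel_measurable_continuous_onI[OF char_cont])

lemma char_zero: "\<xi> \<in> dual_group \<Longrightarrow> \<xi> 0 = 1"
  using char_mult[of \<xi> 0 0] char_norm[of \<xi> 0] by auto

text \<open>Evaluation at a fixed point is measurable. With \<open>x\<close> replaced by
  \<open>s k x\<close> the pairing is a countable patchwork of such evaluations, and continuity of
  each character gives the limit in \<open>k\<close>.\<close>

lemma char_joint_measurable: "(\<lambda>(x, \<xi>). \<xi> x) \<in> borel_measurable (\<nu> \<Otimes>\<^sub>M \<nu>')"
proof -
  obtain s where e: "\<And>x. (\<lambda>k. s k x) \<longlonglongrightarrow> x"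
    and s: "\<And>k. \<exists>(e :: nat \<Rightarrow> 'g) \<iota>. \<iota> \<in> measurable borel (count_space UNIV) \<and> s k = (\<lambda>x. e (\<iota> x))"
    by (rule countable_approximation) blast
  have "(\<lambda>z. (snd z) (s k (fst z))) \<in> borel_measurable (\<nu> \<Otimes>\<^sub>M \<nu>')" for k
  proof -
    obtain e :: "nat \<Rightarrow> 'g" and \<iota> where \<iota>: "\<iota> \<in> measurable borel (count_space UNIV)" and sk: "s k = (\<lambda>x. e (\<iota> x))"
      using s[of k] by blast
    show ?thesis
      unfolding sk
    proof (rule measurable_compose_countable[where f = "\<lambda>i z. (snd z) (e i)" and g = "\<lambda>z. \<iota> (fst z)"])
      show "(\<lambda>z. snd z (e i)) \<in> borel_measurable (\<nu> \<Otimes>\<^sub>M \<nu>')" for i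
        by (rule measurable_compose[OF measurable_snd char_eval_measurable])
      have "\<iota> \<in> measurable \<nu> (count_space UNIV)" using \<iota> unfolding measurable_cong_sets[OF sets_haar refl] .
      thus "(\<lambda>z. \<iota> (fst z)) \<in> measurable (\<nu> \<Otimes>\<^sub>M \<nu>') (count_space UNIV)"
        by (rule measurable_compose[OF measurable_fst])
    qed
  qed
  hence "(\<lambda>z. (snd z) (fst z)) \<in> borel_measurable (\<nu> \<Otimes>\<^sub>M \<nu>')"
    by (rule borel_measurable_LIMSEQ_metric) (auto simp: space_pair_measure intro: char_tendsto e)
  thus ?thesis by (simp add: case_prod_unfold)
qed

text \<open>The transforms of indicators of small neighbourhoods of \<open>0\<close> are square integrable
  and have no common zero.\<close>

lemma dual_sigma_finite: "sigma_finite_measure \<nu>'"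
proof -
  obtain d where d: "Metric_space (UNIV :: 'g set) d" and top: "Metric_space.mtopology UNIV d = euclidean"
    by (rule metric)
  interpret Metric_space UNIV d by fact
  obtain W K where W: "open W" "compactin euclidean K" "(0::'g) \<in> W" "W \<subseteq> K"
    using loc_compact unfolding locally_compact_space_def by (metis UNIV_I open_openin topspace_euclidean)
  \<comment> \<open>The balls shrink to \<open>0\<close>, and intersecting with \<open>W\<close>,
    which lies in a compact set, keeps the measure finite.\<close>
  define U where "U n = mball 0 (1 / real (Suc n)) \<inter> W" for n :: nat
  have Uo: "open (U n)" for n
    using openin_mball[of 0 "1 / real (Suc n)"] W(1) unfolding U_def top by auto
  have U0: "0 \<in> U n" for n using W(3) by (simp add: U_def)
  have Uf: "emeasure \<nu> (U n) < \<infinity>" for n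
  proof -
    have "emeasure \<nu> (U n) \<le> emeasure \<nu> K"
      using W(4) compact_borel[OF W(2)] by (intro emeasure_mono) (auto simp: U_def)
    thus ?thesis using haar_compact_finite[OF W(2)] by (rule le_less_trans)
  qed
  define f where "f n = (\<lambda>x. indicator (U n) x :: complex)" for n
  have fi: "integrable \<nu> (f n)" for n
    unfolding f_def using Uo Uf by (intro integrable_indicator_complex) auto
  have fs: "f n \<in> sq_int \<nu>" for n unfolding f_def using Uo Uf by (intro sq_int_indicator) auto
  define h where "h n = fourier1 \<nu> (f n)" for n
  have hs: "h n \<in> sq_int \<nu>'" for n unfolding h_def by (rule F_sq_int[OF fs fi])
  have [measurable]: "h n \<in> borel_measurable \<nu>'" for n using hs[of n] by (simp add: sq_int_def)
  \<comment> \<open>Level sets of the squared modulus of the transforms; Chebyshev's inequality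
    makes their measure finite.\<close>
  define A where "A n k = {\<xi> \<in> space \<nu>'. 1 / real (Suc k) \<le> (cmod (h n \<xi>))\<^sup>2}" for n k
  have As: "A n k \<in> sets \<nu>'" for n k unfolding A_def by measurable
  have Af: "emeasure \<nu>' (A n k) < \<infinity>" for n k
  proof -
    have "integrable \<nu>' (\<lambda>\<xi>. real (Suc k) * (cmod (h n \<xi>))\<^sup>2)" using sq_int_integrable[OF hs] by simp
    hence "(\<integral>\<^sup>+\<xi>. ennreal (norm (real (Suc k) * (cmod (h n \<xi>))\<^sup>2)) \<partial>\<nu>') < \<infinity>"
      unfolding integrable_iff_bounded by (rule conjunct2)
    moreover have "emeasure \<nu>' (A n k) \<le> (\<integral>\<^sup>+\<xi>. ennreal (norm (real (Suc k) * (cmod (h n \<xi>))\<^sup>2)) \<partial>\<nu>')"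
      unfolding nn_integral_indicator[OF As, symmetric]
    proof (rule nn_integral_mono)
      fix \<xi> assume "\<xi> \<in> space \<nu>'"
      show "indicator (A n k) \<xi> \<le> ennreal (norm (real (Suc k) * (cmod (h n \<xi>))\<^sup>2))"
      proof (cases "\<xi> \<in> A n k")
        case True
        hence "1 \<le> real (Suc k) * (cmod (h n \<xi>))\<^sup>2" by (simp add: A_def field_simps)
        thus ?thesis using True by (simp add: ennreal_1[symmetric] ennreal_leI del: ennreal_1)
      qed simp
    qed
    ultimately show ?thesis by (rule le_less_trans[rotated])
  qed
  \<comment> \<open>By continuity a character has real part above 1/2 on some \<open>U n\<close>.
    The real part of the transform of the indicator of \<open>U n\<close> is then at least half the
    measure of \<open>U n\<close>, which is positive.\<close>
  have "\<exists>n k. \<xi> \<in> A n k" if \<xi>: "\<xi> \<in> dual_group" for \<xi>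
  proof -
    have "continuous_map mtopology euclidean \<xi>" using char_cont[OF \<xi>] unfolding top by simp
    have "open (\<xi> -` {z. Re z > 1/2})"
      using char_cont[OF \<xi>] open_halfspace_Re_gt[of "1/2"] by (intro open_vimage) auto
    moreover have "0 \<in> \<xi> -` {z. Re z > 1/2}" using char_zero[OF \<xi>] by simp
    ultimately obtain r where r: "r > 0" "mball 0 r \<subseteq> \<xi> -` {z. Re z > 1/2}"
      using openin_mtopology unfolding top by (metis open_openin)
    then obtain n where n: "1 / real (Suc n) < r" using nat_approx_posE by blast
    have sub: "U n \<subseteq> \<xi> -` {z. Re z > 1/2}"
      using r(2) mball_subset_concentric[of "1 / real (Suc n)" r 0] n by (auto simp: U_def)
    have int: "integrable \<nu> (\<lambda>x. cnj (\<xi> x) * f n x)"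
    proof (rule Bochner_Integration.integrable_bound[OF fi[of n]])
      show "(\<lambda>x. cnj (\<xi> x) * f n x) \<in> borel_measurable \<nu>"
        by (intro borel_measurable_times borel_measurable_cnj char_measurable[OF \<xi>]
            borel_measurable_integrable[OF fi])
    qed (auto simp: norm_mult char_norm[OF \<xi>])
    have "0 < 1/2 * measure \<nu> (U n)"
      using haar_open_pos[OF Uo U0, of n] Uf[of n] by (simp add: measure_def enn2real_positive_iff)
    also have "\<dots> = (\<integral>x. 1/2 * indicator (U n) x \<partial>\<nu>)" using Uo Uf[of n] by simp
    also have "\<dots> \<le> (\<integral>x. Re (cnj (\<xi> x) * f n x) \<partial>\<nu>)"
    proof (rule integral_mono)
      show "integrable \<nu> (\<lambda>x. 1/2 * indicator (U n) x :: real)" using Uo Uf[of n] by (intro integrable_mult_right integrable_real_indicator) auto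
      show "integrable \<nu> (\<lambda>x. Re (cnj (\<xi> x) * f n x))" using int by (rule integrable_Re)
      show "1/2 * indicator (U n) x \<le> Re (cnj (\<xi> x) * f n x)" for x
        using sub by (auto simp: f_def indicator_def)
    qed
    also have "\<dots> = Re (h n \<xi>)" unfolding h_def fourier1_def by (rule integral_Re[OF int])
    finally have "0 < (cmod (h n \<xi>))\<^sup>2" by auto
    then obtain k where "1 / real (Suc k) < (cmod (h n \<xi>))\<^sup>2" using nat_approx_posE by blast
    hence "\<xi> \<in> A n k" using \<xi> by (simp add: A_def)
    thus ?thesis by blast
  qed
  hence cover: "(\<Union>n k. A n k) = space \<nu>'" by (auto simp: A_def)
  show ?thesis
  proof
    show "\<exists>S. countable S \<and> S \<subseteq> sets \<nu>' \<and> \<Union> S = space \<nu>' \<and> (\<forall>a\<in>S. emeasure \<nu>' a \<noteq> \<infinity>)"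
    proof (intro exI[of _ "range (\<lambda>(n, k). A n k)"] conjI)
      show "\<Union> (range (\<lambda>(n, k). A n k)) = space \<nu>'" using cover by auto
    qed (use As Af in \<open>auto simp: less_top[symmetric]\<close>)
  qed
qed

lemma fourier1_translate:
  assumes f: "integrable \<nu> f" and \<xi>: "\<xi> \<in> dual_group"
  shows "fourier1 \<nu> (\<lambda>x. f (x - a)) \<xi> = cnj (\<xi> a) * fourier1 \<nu> f \<xi>"
proof -
  have [measurable]: "\<xi> \<in> borel_measurable \<nu>" "f \<in> borel_measurable \<nu>"
    using char_measurable[OF \<xi>] f by auto
  have "fourier1 \<nu> (\<lambda>x. f (x - a)) \<xi> = (\<integral>x. cnj (\<xi> (x - a + a)) * f (x - a) \<partial>\<nu>)"
    by (simp add: fourier1_def)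
  also have "\<dots> = (\<integral>x. cnj (\<xi> a) * (cnj (\<xi> (x - a)) * f (x - a)) \<partial>\<nu>)"
    unfolding char_mult[OF \<xi>] by (simp add: mult_ac)
  also have "\<dots> = (\<integral>x. cnj (\<xi> a) * (cnj (\<xi> x) * f x) \<partial>distr \<nu> \<nu> (\<lambda>u. u - a))"
    by (rule integral_distr[OF translation_measurable, symmetric]) measurable
  also have "\<dots> = cnj (\<xi> a) * fourier1 \<nu> f \<xi>"
    unfolding translation_distr by (simp add: fourier1_def)
  finally show ?thesis .
qed

text \<open>The Fourier transforms of integrable functions are dense, which is all that is needed of the
  uniqueness theorem.\<close>

lemma AE_zero_if_fourier_orthogonal:
  assumes D: "D \<in> sq_int \<nu>'"
    and orth: "\<And>A. \<lbrakk>A \<in> sets \<nu>; emeasure \<nu> A < \<infinity>\<rbrakk> \<Longrightarrow> (\<integral>\<xi>. fourier1 \<nu> (indicator A) \<xi> * D \<xi> \<partial>\<nu>') = 0"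
  shows "AE \<xi> in \<nu>'. D \<xi> = 0"
proof -
  interpret G: hilbert "L2 \<nu>" by (rule L2_hilbert)
  interpret G': hilbert "L2 \<nu>'" by (rule L2_hilbert)
  \<comment> \<open>The conjugate of \<open>D\<close>, because the inner product conjugates its
    second argument.\<close>
  define c where "c = L2_class \<nu>' (\<lambda>\<xi>. cnj (D \<xi>))"
  have cD: "(\<lambda>\<xi>. cnj (D \<xi>)) \<in> sq_int \<nu>'" using D by (rule sq_int_cnj)
  have c: "c \<in> pts (L2 \<nu>')" unfolding c_def using cD by simp
  have bF: "bounded_op (L2 \<nu>) (L2 \<nu>') F"
    using F_unitary unfolding unitary_op_def bounded_op_def
    by (auto simp: hnorm_def intro!: exI[of _ 1])
  have zero: "bounded_op (L2 \<nu>) (L2 \<nu>') (\<lambda>_. vzero (L2 \<nu>'))"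
  proof -
    have "vadd (L2 \<nu>') (vzero (L2 \<nu>')) (vzero (L2 \<nu>')) = vzero (L2 \<nu>')"
      "vscale (L2 \<nu>') k (vzero (L2 \<nu>')) = vzero (L2 \<nu>')" for k
      by (rule G'.vec_eqI; simp)+
    thus ?thesis unfolding bounded_op_def linear_map_def by (auto intro!: exI[of _ 0])
  qed
  have "{L2_class \<nu> (\<lambda>x. indicator E x) | E. E \<in> sets \<nu> \<and> emeasure \<nu> E < \<infinity>} \<subseteq>
      {x \<in> pts (L2 \<nu>). inner (L2 \<nu>') (F x) c = inner (L2 \<nu>') (vzero (L2 \<nu>')) c}"
  proof (intro subsetI, elim CollectE exE conjE)
    fix x E assume x: "x = L2_class \<nu> (\<lambda>x. indicator E x)" and E: "E \<in> sets \<nu>" "emeasure \<nu> E < \<infinity>"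
    have s: "(\<lambda>x. indicator E x) \<in> sq_int \<nu>" using E by (rule sq_int_indicator)
    have i: "integrable \<nu> (\<lambda>x. indicator E x :: complex)" using E by (rule integrable_indicator_complex)
    have "inner (L2 \<nu>') (F x) c = (\<integral>\<xi>. fourier1 \<nu> (indicator E) \<xi> * cnj (cnj (D \<xi>)) \<partial>\<nu>')"
      unfolding x c_def using F_class[OF s i] L2_inner[OF F_sq_int[OF s i] cD] by simp
    also have "\<dots> = 0" using orth[OF E] by simp
    finally show "x \<in> {x \<in> pts (L2 \<nu>). inner (L2 \<nu>') (F x) c = inner (L2 \<nu>') (vzero (L2 \<nu>')) c}"
      using x s c by simp
  qed
  from total_setD[OF L2_indicators_total closed_subspace_inner_eq[OF L2_hilbert L2_hilbert L2_hilbert bF zero c c] this]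
  have "inner (L2 \<nu>') (F x) c = 0" if "x \<in> pts (L2 \<nu>)" for x using that c by simp
  moreover have "F ` pts (L2 \<nu>) = pts (L2 \<nu>')"
    using F_unitary unfolding unitary_op_def by (elim conjE)
  hence "c \<in> F ` pts (L2 \<nu>)" using c by simp
  ultimately have "inner (L2 \<nu>') c c = 0" by blast
  hence "c = vzero (L2 \<nu>')" by (rule G'.eq_zeroI[OF c])
  hence "AE \<xi> in \<nu>'. cnj (D \<xi>) = 0"
    unfolding c_def L2_zero L2_class_eq_iff[OF cD] .
  thus ?thesis by simp
qed

end

section \<open>Complex vectors and matrices\<close>

text \<open>Finite-dimensional space as an instance of \<open>hilbert\<close>: the abstract
  estimates then apply fiber by fiber, and \<open>mat_norm\<close> becomes an
  \<open>op_norm\<close>.\<close>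

definition cvec :: "nat \<Rightarrow> complex Matrix.vec hspace" where
  "cvec n = \<lparr>pts = carrier_vec n, vadd = (+), vzero = 0\<^sub>v n, vscale = (\<cdot>\<^sub>v), inner = (\<lambda>v w. v \<bullet>c w)\<rparr>"

abbreviation vsq :: "complex Matrix.vec \<Rightarrow> real" where
  "vsq v \<equiv> Re (v \<bullet>c v)"

lemma cvec_simps [simp]:
  "pts (cvec n) = carrier_vec n" "vadd (cvec n) = (+)" "vzero (cvec n) = 0\<^sub>v n"
  "vscale (cvec n) = (\<cdot>\<^sub>v)" "inner (cvec n) v w = v \<bullet>c w"
  by (simp_all add: cvec_def)

lemma cscalar_prod_sum: "\<lbrakk>v \<in> carrier_vec n; w \<in> carrier_vec n\<rbrakk> \<Longrightarrow> v \<bullet>c w = (\<Sum>j<n. v $ j * cnj (w $ j))"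
  by (auto simp: scalar_prod_def lessThan_atLeast0 intro!: sum.cong)

lemma vsq_sum: "v \<in> carrier_vec n \<Longrightarrow> vsq v = (\<Sum>j<n. (cmod (v $ j))\<^sup>2)"
  by (simp only: cscalar_prod_sum Re_sum, intro sum.cong refl) (simp add: cmod_power2 flip: power2_eq_square)

lemma vsq_nonneg [simp]: "0 \<le> vsq v"
  by (subst vsq_sum[of v "dim_vec v"]) (auto intro: sum_nonneg carrier_vecI)

lemma hnorm_cvec: "hnorm (cvec n) v = sqrt (vsq v)"
  by (simp add: hnorm_def)

lemma vdiff_cvec: "\<lbrakk>v \<in> carrier_vec n; w \<in> carrier_vec n\<rbrakk> \<Longrightarrow> vdiff (cvec n) v w = v - w"
  by (auto simp: vdiff_def)

lemma cvec_hilbert: "hilbert (cvec n)"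
proof
  fix v w u assume v: "v \<in> pts (cvec n)" and w: "w \<in> pts (cvec n)" and u: "u \<in> pts (cvec n)"
  show "inner (cvec n) (vadd (cvec n) v w) u = inner (cvec n) v u + inner (cvec n) w u"
    using v w u by (simp add: cscalar_prod_sum[of _ n] sum.distrib distrib_right)
next
  fix v w c assume v: "v \<in> pts (cvec n)" and w: "w \<in> pts (cvec n)"
  show "inner (cvec n) (vscale (cvec n) c v) w = c * inner (cvec n) v w"
    using v w by (simp add: cscalar_prod_sum[of _ n] sum_distrib_left mult.assoc)
  show "inner (cvec n) v w = cnj (inner (cvec n) w v)"
    using v w by (simp add: cscalar_prod_sum[of _ n] mult.commute)
next
  fix v w assume v: "v \<in> pts (cvec n)" and w: "w \<in> pts (cvec n)"
    and z: "inner (cvec n) (vdiff (cvec n) v w) (vdiff (cvec n) v w) = 0"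
  have "vsq (v - w) = 0" using z v w by (simp add: vdiff_cvec)
  hence "(\<Sum>j<n. (cmod ((v - w) $ j))\<^sup>2) = 0" using v w vsq_sum[of "v - w" n] by simp
  hence "\<forall>j<n. (v - w) $ j = 0" by (subst (asm) sum_nonneg_eq_0_iff) auto
  thus "v = w" using v w by (intro eq_vecI) auto
next
  fix s :: "nat \<Rightarrow> complex Matrix.vec" assume s: "\<And>k. s k \<in> pts (cvec n)"
    and c: "\<And>e. e > 0 \<Longrightarrow> \<exists>n0. \<forall>k\<ge>n0. \<forall>l\<ge>n0. hnorm (cvec n) (vdiff (cvec n) (s k) (s l)) < e"
  have le: "cmod (s k $ j - s l $ j) \<le> hnorm (cvec n) (vdiff (cvec n) (s k) (s l))" if j: "j < n" for j k l
  proof -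
    have "(cmod ((s k - s l) $ j))\<^sup>2 \<le> vsq (s k - s l)"
      using s[of k] s[of l] j member_le_sum[of j "{..<n}" "\<lambda>j. (cmod ((s k - s l) $ j))\<^sup>2"]
      by (subst vsq_sum[of _ n]) auto
    thus ?thesis using s[of k] s[of l] j by (simp add: vdiff_cvec hnorm_cvec real_le_rsqrt)
  qed
  have "\<exists>a. (\<lambda>k. s k $ j) \<longlonglongrightarrow> a" if j: "j < n" for j
  proof (subst convergent_def[symmetric], rule Cauchy_convergent, rule CauchyI)
    fix e :: real assume "e > 0"
    then obtain n0 where "\<forall>k\<ge>n0. \<forall>l\<ge>n0. hnorm (cvec n) (vdiff (cvec n) (s k) (s l)) < e" using c by blast
    thus "\<exists>M. \<forall>m\<ge>M. \<forall>l\<ge>M. norm (s m $ j - s l $ j) < e" using le[OF j] le_less_trans by blast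
  qed
  then obtain a where a: "\<And>j. j < n \<Longrightarrow> (\<lambda>k. s k $ j) \<longlonglongrightarrow> a j" by metis
  let ?v = "Matrix.vec n a"
  have "(\<lambda>k. sqrt (\<Sum>j<n. (cmod (s k $ j - a j))\<^sup>2)) \<longlonglongrightarrow> sqrt (\<Sum>j<n. (cmod (a j - a j))\<^sup>2)"
    by (intro tendsto_intros a) auto
  moreover have "hnorm (cvec n) (vdiff (cvec n) (s k) ?v) = sqrt (\<Sum>j<n. (cmod (s k $ j - a j))\<^sup>2)" for k
    using s[of k] by (simp add: vdiff_cvec hnorm_cvec vsq_sum[of _ n])
  ultimately show "\<exists>x\<in>pts (cvec n). (\<lambda>k. hnorm (cvec n) (vdiff (cvec n) (s k) x)) \<longlonglongrightarrow> 0"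
    by (intro bexI[of _ ?v]) auto
qed (auto simp: vsq_nonneg)

lemma mult_mat_vec_sum:
  "\<lbrakk>(A :: complex Matrix.mat) \<in> carrier_mat n m; v \<in> carrier_vec m; i < n\<rbrakk> \<Longrightarrow>
    (A *\<^sub>v v) $ i = (\<Sum>j<m. A $$ (i, j) * v $ j)"
  by (auto simp: scalar_prod_def lessThan_atLeast0 intro!: sum.cong)

lemma mult_mat_vec_linear:
  assumes A: "(A :: complex Matrix.mat) \<in> carrier_mat n m"
  shows "bounded_op (cvec m) (cvec n) ((*\<^sub>v) A)"
proof -
  interpret hilbert "cvec m" by (rule cvec_hilbert)
  \<comment> \<open>The square of the Hilbert-Schmidt norm of \<open>A\<close>; Cauchy-Schwarz on
    each row bounds the corresponding entry of the product.\<close>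
  define C where "C = (\<Sum>i<n. vsq (conjugate (row A i)))"
  have "hnorm (cvec n) (A *\<^sub>v v) \<le> sqrt C * hnorm (cvec m) v" if v: "v \<in> carrier_vec m" for v
  proof -
    have "(cmod ((A *\<^sub>v v) $ i))\<^sup>2 \<le> vsq (conjugate (row A i)) * vsq v" if i: "i < n" for i
    proof -
      define r where "r = conjugate (row A i)"
      have r: "r \<in> carrier_vec m" using A i by (simp add: r_def)
      have "(A *\<^sub>v v) $ i = v \<bullet>c r"
        using A v i by (simp add: r_def comm_scalar_prod[of "row A i" m v])
      hence "cmod ((A *\<^sub>v v) $ i) \<le> sqrt (vsq v) * sqrt (vsq (conjugate (row A i)))"
        using cauchy_schwarz[of v r] v r by (simp only: hnorm_cvec cvec_simps r_def)
      hence "(cmod ((A *\<^sub>v v) $ i))\<^sup>2 \<le> (sqrt (vsq v) * sqrt (vsq (conjugate (row A i))))\<^sup>2"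
        by (rule power_mono) simp
      thus ?thesis by (simp only: power_mult_distrib real_sqrt_pow2 vsq_nonneg mult.commute)
    qed
    hence "vsq (A *\<^sub>v v) \<le> C * vsq v"
      using A v by (subst vsq_sum[of _ n]) (auto simp: C_def sum_distrib_right intro!: sum_mono)
    thus ?thesis by (simp add: hnorm_cvec flip: real_sqrt_mult)
  qed
  thus ?thesis
    using A unfolding bounded_op_def linear_map_def
    by (auto simp: mult_add_distrib_mat_vec intro!: exI[of _ "sqrt C"] mult_mat_vec)
qed

lemma mat_norm_op_norm:
  assumes A: "A \<in> carrier_mat n m"
  shows "mat_norm A = op_norm (cvec m) (cvec n) ((*\<^sub>v) A)"
  using A by (simp add: mat_norm_def op_norm_def hnorm_cvec)

lemma mat_norm_nonneg: "A \<in> carrier_mat n m \<Longrightarrow> 0 \<le> mat_norm A"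
  unfolding mat_norm_op_norm
  by (rule hilbert.op_norm_nonneg[OF cvec_hilbert cvec_hilbert mult_mat_vec_linear])

lemma vsq_mat_le:
  assumes A: "A \<in> carrier_mat n m" and v: "v \<in> carrier_vec m" and C: "mat_norm A \<le> C"
  shows "vsq (A *\<^sub>v v) \<le> C\<^sup>2 * vsq v"
proof -
  have "sqrt (vsq (A *\<^sub>v v)) \<le> mat_norm A * sqrt (vsq v)"
    using hilbert.norm_le_op_norm[OF cvec_hilbert cvec_hilbert mult_mat_vec_linear[OF A]] v
    unfolding mat_norm_op_norm[OF A] by (simp add: hnorm_cvec)
  also have "\<dots> \<le> C * sqrt (vsq v)" using C by (intro mult_right_mono) auto
  finally have "(sqrt (vsq (A *\<^sub>v v)))\<^sup>2 \<le> (C * sqrt (vsq v))\<^sup>2" by (rule power_mono) simp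
  thus ?thesis by (simp add: power_mult_distrib)
qed

lemma mat_norm_le:
  assumes A: "A \<in> carrier_mat n m" and C: "0 \<le> C"
    and le: "\<And>v. v \<in> carrier_vec m \<Longrightarrow> vsq (A *\<^sub>v v) \<le> C\<^sup>2 * vsq v"
  shows "mat_norm A \<le> C"
  unfolding mat_norm_op_norm[OF A]
proof (rule hilbert.op_norm_le[OF cvec_hilbert _ C])
  fix v assume "v \<in> pts (cvec m)"
  hence "sqrt (vsq (A *\<^sub>v v)) \<le> sqrt (C\<^sup>2 * vsq v)" by (intro real_sqrt_le_mono le) simp
  thus "hnorm (cvec n) (A *\<^sub>v v) \<le> C * hnorm (cvec m) v"
    using C by (simp add: hnorm_cvec real_sqrt_mult)
qed

lemma mat_norm_zero_iff:
  assumes A: "A \<in> carrier_mat n m" and z: "mat_norm A \<le> 0"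
  shows "A = 0\<^sub>m n m"
proof (rule eq_matI)
  fix i j assume ij: "i < dim_row (0\<^sub>m n m :: complex Matrix.mat)" "j < dim_col (0\<^sub>m n m :: complex Matrix.mat)"
  have "vsq (A *\<^sub>v unit_vec m j) \<le> 0" using vsq_mat_le[OF A _ z, of "unit_vec m j"] by simp
  hence "(\<Sum>i<n. (cmod ((A *\<^sub>v unit_vec m j) $ i))\<^sup>2) \<le> 0" using A by (subst (asm) vsq_sum[of _ n]) auto
  hence "(\<Sum>i<n. (cmod ((A *\<^sub>v unit_vec m j) $ i))\<^sup>2) = 0" by (intro antisym sum_nonneg) auto
  hence "(A *\<^sub>v unit_vec m j) $ i = 0" using ij by (subst (asm) sum_nonneg_eq_0_iff) auto
  thus "A $$ (i, j) = 0\<^sub>m n m $$ (i, j)" using A ij by (simp add: scalar_prod_right_unit)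
qed (use A in auto)

lemma mat_adjoint_carrier [simp]: "(A :: complex Matrix.mat) \<in> carrier_mat n m \<Longrightarrow> mat_adjoint A \<in> carrier_mat m n"
  by (auto simp: mat_adjoint_def mat_of_rows_def)

lemma mat_adjoint_index:
  "\<lbrakk>(A :: complex Matrix.mat) \<in> carrier_mat n m; i < m; j < n\<rbrakk> \<Longrightarrow> mat_adjoint A $$ (i, j) = cnj (A $$ (j, i))"
  by (auto simp: mat_adjoint_def mat_of_rows_def)

lemma mat_adjoint_inner:
  assumes A: "(A :: complex Matrix.mat) \<in> carrier_mat n m" and v: "v \<in> carrier_vec n" and w: "w \<in> carrier_vec m"
  shows "(mat_adjoint A *\<^sub>v v) \<bullet>c w = v \<bullet>c (A *\<^sub>v w)"
proof -
  have B: "mat_adjoint A \<in> carrier_mat m n" using A by simp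
  have "(mat_adjoint A *\<^sub>v v) $ j = (\<Sum>i<n. cnj (A $$ (i, j)) * v $ i)" if j: "j < m" for j
    using mult_mat_vec_sum[OF B v j] j by (simp add: mat_adjoint_index[OF A])
  hence 1: "(mat_adjoint A *\<^sub>v v) \<bullet>c w = (\<Sum>j<m. (\<Sum>i<n. cnj (A $$ (i, j)) * v $ i) * cnj (w $ j))"
    using B v w by (subst cscalar_prod_sum[of _ m]) (auto intro!: mult_mat_vec_carrier)
  have "(A *\<^sub>v w) $ i = (\<Sum>j<m. A $$ (i, j) * w $ j)" if i: "i < n" for i
    using mult_mat_vec_sum[OF A w i] .
  hence 2: "v \<bullet>c (A *\<^sub>v w) = (\<Sum>i<n. v $ i * (\<Sum>j<m. cnj (A $$ (i, j)) * cnj (w $ j)))"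
    using A v w by (subst cscalar_prod_sum[of _ n]) (auto intro!: mult_mat_vec_carrier)
  show ?thesis unfolding 1 2 sum_distrib_left sum_distrib_right
    by (subst sum.swap) (simp add: mult_ac)
qed

lemma mat_norm_add:
  assumes A: "A \<in> carrier_mat n m" and B: "B \<in> carrier_mat n m" and C: "mat_norm A \<le> C" "mat_norm B \<le> D"
  shows "mat_norm (A + B) \<le> C + D"
proof (rule mat_norm_le)
  have CD: "0 \<le> C" "0 \<le> D" using mat_norm_nonneg[OF A] mat_norm_nonneg[OF B] C by auto
  thus "0 \<le> C + D" by simp
  fix v :: "complex Matrix.vec" assume v: "v \<in> carrier_vec m"
  have sq: "sqrt (vsq (A *\<^sub>v v)) \<le> C * sqrt (vsq v)" "sqrt (vsq (B *\<^sub>v v)) \<le> D * sqrt (vsq v)"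
    using real_sqrt_le_mono[OF vsq_mat_le[OF A v C(1)]] real_sqrt_le_mono[OF vsq_mat_le[OF B v C(2)]] CD
    by (simp_all add: real_sqrt_mult)
  have "sqrt (vsq (A *\<^sub>v v + B *\<^sub>v v)) \<le> sqrt (vsq (A *\<^sub>v v)) + sqrt (vsq (B *\<^sub>v v))"
    using hilbert.norm_triangle[OF cvec_hilbert, of "A *\<^sub>v v" n "B *\<^sub>v v"] A B v by (simp add: hnorm_cvec mult_mat_vec_carrier[of _ n m])
  also have "\<dots> \<le> (C + D) * sqrt (vsq v)" using sq by (simp add: distrib_right)
  finally have "(sqrt (vsq (A *\<^sub>v v + B *\<^sub>v v)))\<^sup>2 \<le> ((C + D) * sqrt (vsq v))\<^sup>2" by (rule power_mono) simp
  thus "vsq ((A + B) *\<^sub>v v) \<le> (C + D)\<^sup>2 * vsq v"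
    using A B v by (simp add: add_mult_distrib_mat_vec[of A n m] power_mult_distrib)
qed (use A B in auto)

lemma vsq_smult: "vsq (c \<cdot>\<^sub>v v) = (cmod c)\<^sup>2 * vsq v"
proof -
  have v: "v \<in> carrier_vec (dim_vec v)" by (rule carrier_vecI) simp
  show ?thesis
    using v by (subst (1 2) vsq_sum[of _ "dim_vec v"]) (auto simp: norm_mult power_mult_distrib sum_distrib_left)
qed

lemma mat_norm_smult:
  assumes A: "A \<in> carrier_mat n m" and C: "mat_norm A \<le> C"
  shows "mat_norm (c \<cdot>\<^sub>m A) \<le> cmod c * C"
proof (rule mat_norm_le)
  have C0: "0 \<le> C" using mat_norm_nonneg[OF A] C by simp
  thus "0 \<le> cmod c * C" by simp
  fix v :: "complex Matrix.vec" assume v: "v \<in> carrier_vec m"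
  have "(c \<cdot>\<^sub>m A) *\<^sub>v v = c \<cdot>\<^sub>v (A *\<^sub>v v)" using A v by (intro eq_vecI) auto
  moreover have "(cmod c)\<^sup>2 * vsq (A *\<^sub>v v) \<le> (cmod c)\<^sup>2 * (C\<^sup>2 * vsq v)"
    by (rule mult_left_mono[OF vsq_mat_le[OF A v C]]) simp
  ultimately show "vsq ((c \<cdot>\<^sub>m A) *\<^sub>v v) \<le> (cmod c * C)\<^sup>2 * vsq v"
    by (simp only: vsq_smult power_mult_distrib mult.assoc)
qed (use A in auto)

lemma mat_norm_mult:
  assumes A: "A \<in> carrier_mat n n" and B: "B \<in> carrier_mat n n" and C: "mat_norm A \<le> C" "mat_norm B \<le> D"
  shows "mat_norm (A * B) \<le> C * D"
proof (rule mat_norm_le)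
  have CD: "0 \<le> C" "0 \<le> D" using mat_norm_nonneg[OF A] mat_norm_nonneg[OF B] C by auto
  thus "0 \<le> C * D" by simp
  fix v :: "complex Matrix.vec" assume v: "v \<in> carrier_vec n"
  have "vsq (A *\<^sub>v (B *\<^sub>v v)) \<le> C\<^sup>2 * vsq (B *\<^sub>v v)" using B v by (intro vsq_mat_le[OF A _ C(1)]) auto
  also have "\<dots> \<le> C\<^sup>2 * (D\<^sup>2 * vsq v)" by (intro mult_left_mono vsq_mat_le[OF B v C(2)]) simp
  finally show "vsq ((A * B) *\<^sub>v v) \<le> (C * D)\<^sup>2 * vsq v"
    using A B v by (simp add: assoc_mult_mat_vec[of A n n B n] power_mult_distrib mult_ac)
qed (use A B in auto)

lemma mat_norm_adjoint:
  assumes A: "A \<in> carrier_mat n n" and C: "mat_norm A \<le> C"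
  shows "mat_norm (mat_adjoint A) \<le> C"
proof (rule mat_norm_le)
  interpret hilbert "cvec n" by (rule cvec_hilbert)
  show C0: "0 \<le> C" using mat_norm_nonneg[OF A] C by simp
  fix v :: "complex Matrix.vec" assume v: "v \<in> carrier_vec n"
  let ?z = "mat_adjoint A *\<^sub>v v"
  have z: "?z \<in> carrier_vec n" using mat_adjoint_carrier[OF A] v by simp
  have "sqrt (vsq ?z) * sqrt (vsq ?z) = Re (v \<bullet>c (A *\<^sub>v ?z))"
    unfolding mat_adjoint_inner[OF A v z, symmetric] by (simp add: abs_of_nonneg)
  also have "\<dots> \<le> sqrt (vsq v) * sqrt (vsq (A *\<^sub>v ?z))"
    using cauchy_schwarz[of v "A *\<^sub>v ?z"] complex_Re_le_cmod[of "v \<bullet>c (A *\<^sub>v ?z)"] A v z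
    by (simp add: hnorm_cvec)
  also have "\<dots> \<le> sqrt (vsq v) * (C * sqrt (vsq ?z))"
    using real_sqrt_le_mono[OF vsq_mat_le[OF A z C]] C0 by (intro mult_left_mono) (simp_all add: real_sqrt_mult)
  finally have "sqrt (vsq ?z) * sqrt (vsq ?z) \<le> (C * sqrt (vsq v)) * sqrt (vsq ?z)" by (simp add: mult_ac)
  hence "sqrt (vsq ?z) \<le> C * sqrt (vsq v)" by (rule le_if_square_le_mult) (use C0 in simp)
  hence "(sqrt (vsq ?z))\<^sup>2 \<le> (C * sqrt (vsq v))\<^sup>2" by (rule power_mono) simp
  thus "vsq ?z \<le> C\<^sup>2 * vsq v" by (simp add: power_mult_distrib)
qed (rule mat_adjoint_carrier[OF A])

text \<open>Lists of pairs of rationals form a countable type that encodes dense sets of vectors in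
  all dimensions at once, as needed for almost-everywhere statements over a varying dimension. Only
  the first \<open>m\<close> entries of a list are read.\<close>

lemma ex_rational_vec_near:
  assumes v: "v \<in> carrier_vec m" and e: "0 < e"
  shows "\<exists>l :: (rat \<times> rat) list. vsq (v - Matrix.vec m (\<lambda>j. Complex (of_rat (fst (l ! j))) (of_rat (snd (l ! j))))) < e"
proof -
  \<comment> \<open>Each coordinate contributes at most \<open>2 * r\<close>, one \<open>r\<close>
    for the real and one for the imaginary part, so the sum over \<open>m\<close> coordinates stays
    below \<open>e\<close>.\<close>
  define r where "r = e / (2 * real m + 1)"
  have r: "r > 0" using e by (simp add: r_def)
  have "\<exists>q. (x - of_rat q)\<^sup>2 < r" for x :: real
  proof -
    obtain q where "x < of_rat q" "of_rat q < x + sqrt r" using of_rat_dense[of x "x + sqrt r"] r by auto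
    hence "\<bar>x - of_rat q\<bar> < sqrt r" by simp
    hence "\<bar>x - of_rat q\<bar>\<^sup>2 < (sqrt r)\<^sup>2" by (intro power_strict_mono) auto
    thus ?thesis using r by auto
  qed
  then obtain f :: "real \<Rightarrow> rat" where f: "\<And>x. (x - of_rat (f x))\<^sup>2 < r" by metis
  let ?l = "map (\<lambda>j. (f (Re (v $ j)), f (Im (v $ j)))) [0..<m]"
  let ?q = "Matrix.vec m (\<lambda>j. Complex (of_rat (fst (?l ! j))) (of_rat (snd (?l ! j))))"
  have "vsq (v - ?q) = (\<Sum>j<m. (cmod ((v - ?q) $ j))\<^sup>2)" using v by (intro vsq_sum) auto
  also have "\<dots> \<le> (\<Sum>j<m. 2 * r)"
  proof (rule sum_mono)
    fix j assume j: "j \<in> {..<m}"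
    show "(cmod ((v - ?q) $ j))\<^sup>2 \<le> 2 * r"
      using j v f[of "Re (v $ j)"] f[of "Im (v $ j)"] by (simp add: cmod_power2)
  qed
  also have "\<dots> < e" using e by (simp add: r_def field_simps)
  finally show ?thesis by blast
qed

text \<open>\<open>mat_norm A\<close> is a finite, though uncontrolled, Lipschitz constant; the
  resulting continuity extends the estimate from the rational vectors to all vectors.\<close>

lemma mat_norm_le_if_rational:
  assumes A: "A \<in> carrier_mat n m" and C: "0 \<le> C"
    and le: "\<And>l :: (rat \<times> rat) list. let q = Matrix.vec m (\<lambda>j. Complex (of_rat (fst (l ! j))) (of_rat (snd (l ! j))))
      in vsq (A *\<^sub>v q) \<le> C\<^sup>2 * vsq q"
  shows "mat_norm A \<le> C"
proof (rule mat_norm_le[OF A C])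
  interpret hilbert "cvec m" by (rule cvec_hilbert)
  interpret N: hilbert "cvec n" by (rule cvec_hilbert)
  fix v :: "complex Matrix.vec" assume v: "v \<in> carrier_vec m"
  define K where "K = mat_norm A"
  have K: "0 \<le> K" using mat_norm_nonneg[OF A] by (simp add: K_def)
  have "sqrt (vsq (A *\<^sub>v v)) \<le> C * sqrt (vsq v)"
  proof (rule field_le_epsilon)
    fix e :: real assume e: "0 < e"
    \<comment> \<open>Replacing \<open>v\<close> by \<open>q\<close> costs
      \<open>K * \<delta>\<close> on the left and \<open>C * \<delta>\<close> on the right of the
      estimate; together they are to be at most \<open>e\<close>. The summand 1 avoids a division by
      zero.\<close>
    define \<delta> where "\<delta> = e / (K + C + 1)"
    have \<delta>: "0 < \<delta>" "(K + C) * \<delta> \<le> e" using e K C by (simp_all add: \<delta>_def divide_simps)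
    then obtain l :: "(rat \<times> rat) list" where l: "vsq (v - Matrix.vec m (\<lambda>j. Complex (of_rat (fst (l ! j))) (of_rat (snd (l ! j))))) < \<delta>\<^sup>2"
      using ex_rational_vec_near[OF v, of "\<delta>\<^sup>2"] by auto
    define q where "q = Matrix.vec m (\<lambda>j. Complex (of_rat (fst (l ! j))) (of_rat (snd (l ! j))))"
    have q: "q \<in> carrier_vec m" by (simp add: q_def)
    have vq: "sqrt (vsq (v - q)) \<le> \<delta>"
      using real_sqrt_le_mono[OF less_imp_le[OF l]] \<delta>(1) by (simp add: q_def)
    have Aq: "sqrt (vsq (A *\<^sub>v q)) \<le> C * sqrt (vsq q)"
      using real_sqrt_le_mono[OF le[of l, unfolded Let_def, folded q_def]] C by (simp add: real_sqrt_mult)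
    have Avq: "sqrt (vsq (A *\<^sub>v (v - q))) \<le> K * sqrt (vsq (v - q))"
      using real_sqrt_le_mono[OF vsq_mat_le[OF A, of "v - q" K]] v q K by (simp add: real_sqrt_mult K_def)
    have dist: "A *\<^sub>v (v - q) = A *\<^sub>v v - A *\<^sub>v q" using A v q by (rule mult_minus_distrib_mat_vec)
    have "sqrt (vsq (A *\<^sub>v v)) \<le> sqrt (vsq (A *\<^sub>v (v - q))) + sqrt (vsq (A *\<^sub>v q))"
      using N.norm_le_diff[of "A *\<^sub>v v" "A *\<^sub>v q"] A v q by (simp add: hnorm_cvec vdiff_cvec dist)
    also have "\<dots> \<le> K * \<delta> + C * sqrt (vsq q)" using Aq Avq mult_left_mono[OF vq K] by linarith
    also have "sqrt (vsq q) \<le> \<delta> + sqrt (vsq v)"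
      using norm_le_diff[of q v] diff_swap[of q v] vq v q by (simp add: hnorm_cvec vdiff_cvec)
    hence "K * \<delta> + C * sqrt (vsq q) \<le> K * \<delta> + C * (\<delta> + sqrt (vsq v))" using C by (intro add_left_mono mult_left_mono)
    also have "\<dots> \<le> C * sqrt (vsq v) + e" using \<delta>(2) by (simp add: algebra_simps)
    finally show "sqrt (vsq (A *\<^sub>v v)) \<le> C * sqrt (vsq v) + e" .
  qed
  hence "(sqrt (vsq (A *\<^sub>v v)))\<^sup>2 \<le> (C * sqrt (vsq v))\<^sup>2" by (rule power_mono) simp
  thus "vsq (A *\<^sub>v v) \<le> C\<^sup>2 * vsq v" by (simp add: power_mult_distrib)
qed

section \<open>Measurable fields of vectors and matrices\<close>

locale fields = sigma_finite_measure M for M :: "'x measure" +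
  fixes d :: "'x \<Rightarrow> nat"
  assumes dim_measurable [measurable]: "d \<in> measurable M (count_space UNIV)"
begin

text \<open>The dimension takes countably many values, so measurability on the level sets can be
  glued. The predicate \<open>P\<close> selects the levels on which a coordinate exists; on the
  others the function is set to 0.\<close>

lemma level_measurable:
  fixes f :: "'x \<Rightarrow> complex"
  shows "(\<forall>m. P m \<longrightarrow> f \<in> borel_measurable (restrict_space M {x \<in> space M. d x = m})) \<longleftrightarrow>
    (\<lambda>x. if P (d x) then f x else 0) \<in> borel_measurable M"
proof
  assume *: "\<forall>m. P m \<longrightarrow> f \<in> borel_measurable (restrict_space M {x \<in> space M. d x = m})"
  show "(\<lambda>x. if P (d x) then f x else 0) \<in> borel_measurable M"
  proof (rule measurable_piecewise_restrict[where C = "range (\<lambda>m. {x \<in> space M. d x = m})"])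
    fix S assume "S \<in> range (\<lambda>m. {x \<in> space M. d x = m})"
    then obtain m where S: "S = {x \<in> space M. d x = m}" by blast
    show "S \<inter> space M \<in> sets M" unfolding S by measurable
    show "(\<lambda>x. if P (d x) then f x else 0) \<in> borel_measurable (restrict_space M S)"
    proof (cases "P m")
      case True
      hence "f \<in> borel_measurable (restrict_space M S)" using * S by blast
      thus ?thesis
        by (subst measurable_cong[of _ _ f]) (auto simp: S space_restrict_space True)
    next
      case False
      thus ?thesis
        by (subst measurable_cong[of _ _ "\<lambda>_. 0"]) (auto simp: S space_restrict_space)
    qed
  qed auto
next
  assume *: "(\<lambda>x. if P (d x) then f x else 0) \<in> borel_measurable M"
  show "\<forall>m. P m \<longrightarrow> f \<in> borel_measurable (restrict_space M {x \<in> space M. d x = m})"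
  proof (intro allI impI)
    fix m assume m: "P m"
    show "f \<in> borel_measurable (restrict_space M {x \<in> space M. d x = m})"
      by (subst measurable_cong[of _ _ "\<lambda>x. if P (d x) then f x else 0"])
        (use m measurable_restrict_space1[OF *] in \<open>auto simp: space_restrict_space\<close>)
  qed
qed

text \<open>The number of terms is itself a measurable function with countably many values.\<close>

lemma measurable_sum_dim [measurable (raw)]:
  fixes f :: "nat \<Rightarrow> 'x \<Rightarrow> 'b::{second_countable_topology, topological_comm_monoid_add}"
  assumes "\<And>j. f j \<in> borel_measurable M"
  shows "(\<lambda>x. \<Sum>j<d x. f j x) \<in> borel_measurable M"
  by (rule measurable_compose_countable[where g = d and f = "\<lambda>m x. \<Sum>j<m. f j x"])
    (auto intro: borel_measurable_sum assms)

text \<open>Extension by zero turns the coordinates into measurable functions on all of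
  \<open>M\<close>; an entry beyond the dimension of the vector would be an unspecified
  value.\<close>

definition vcoord :: "('x \<Rightarrow> complex Matrix.vec) \<Rightarrow> nat \<Rightarrow> 'x \<Rightarrow> complex" where
  "vcoord h j x = (if j < d x then h x $ j else 0)"

definition mcoord :: "('x \<Rightarrow> complex Matrix.mat) \<Rightarrow> nat \<Rightarrow> nat \<Rightarrow> 'x \<Rightarrow> complex" where
  "mcoord s i j x = (if i < d x \<and> j < d x then s x $$ (i, j) else 0)"

definition vmeas :: "('x \<Rightarrow> complex Matrix.vec) \<Rightarrow> bool" where
  "vmeas h \<longleftrightarrow> (\<forall>x\<in>space M. h x \<in> carrier_vec (d x)) \<and> (\<forall>j. vcoord h j \<in> borel_measurable M)"

definition mmeas :: "('x \<Rightarrow> complex Matrix.mat) \<Rightarrow> bool" where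
  "mmeas s \<longleftrightarrow> (\<forall>x\<in>space M. s x \<in> carrier_mat (d x) (d x)) \<and> (\<forall>i j. mcoord s i j \<in> borel_measurable M)"

lemma vmeasD: "vmeas h \<Longrightarrow> x \<in> space M \<Longrightarrow> h x \<in> carrier_vec (d x)"
  "vmeas h \<Longrightarrow> vcoord h j \<in> borel_measurable M"
  by (auto simp: vmeas_def)

lemma mmeasD: "mmeas s \<Longrightarrow> x \<in> space M \<Longrightarrow> s x \<in> carrier_mat (d x) (d x)"
  "mmeas s \<Longrightarrow> mcoord s i j \<in> borel_measurable M"
  by (auto simp: mmeas_def)

lemma vmeas_dim: "\<lbrakk>vmeas h; x \<in> space M\<rbrakk> \<Longrightarrow> dim_vec (h x) = d x"
  and mmeas_dim: "\<lbrakk>mmeas s; x \<in> space M\<rbrakk> \<Longrightarrow> dim_row (s x) = d x" "\<lbrakk>mmeas s; x \<in> space M\<rbrakk> \<Longrightarrow> dim_col (s x) = d x"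
  by (auto dest: vmeasD(1) mmeasD(1))

lemma vec_fields_iff: "h \<in> vec_fields M d \<longleftrightarrow> vmeas h \<and> integrable M (\<lambda>x. vsq (h x))"
proof -
  have "(\<forall>m. \<forall>j<m. (\<lambda>x. h x $ j) \<in> borel_measurable (restrict_space M {x \<in> space M. d x = m})) \<longleftrightarrow>
      (\<forall>j m. j < m \<longrightarrow> (\<lambda>x. h x $ j) \<in> borel_measurable (restrict_space M {x \<in> space M. d x = m}))" by blast
  also have "\<dots> \<longleftrightarrow> (\<forall>j. vcoord h j \<in> borel_measurable M)"
    unfolding level_measurable vcoord_def by simp
  finally show ?thesis by (auto simp: vec_fields_def vmeas_def)
qed

lemma mat_fields_iff: "s \<in> mat_fields M d \<longleftrightarrow> mmeas s \<and> (\<exists>C. AE x in M. mat_norm (s x) \<le> C)"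
proof -
  have "(\<forall>m. \<forall>i<m. \<forall>j<m. (\<lambda>x. s x $$ (i, j)) \<in> borel_measurable (restrict_space M {x \<in> space M. d x = m})) \<longleftrightarrow>
      (\<forall>i j m. i < m \<and> j < m \<longrightarrow> (\<lambda>x. s x $$ (i, j)) \<in> borel_measurable (restrict_space M {x \<in> space M. d x = m}))" by blast
  also have "\<dots> \<longleftrightarrow> (\<forall>i j. mcoord s i j \<in> borel_measurable M)"
    unfolding level_measurable mcoord_def by simp
  finally show ?thesis by (auto simp: mat_fields_def mmeas_def)
qed

lemma vec_fields_vmeas: "h \<in> vec_fields M d \<Longrightarrow> vmeas h"
  and vec_fields_integrable: "h \<in> vec_fields M d \<Longrightarrow> integrable M (\<lambda>x. vsq (h x))"
  by (simp_all add: vec_fields_iff)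

lemma vmeasI:
  assumes "\<And>x. x \<in> space M \<Longrightarrow> h x \<in> carrier_vec (d x)"
    and "\<And>j. g j \<in> borel_measurable M" "\<And>x j. \<lbrakk>x \<in> space M; j < d x\<rbrakk> \<Longrightarrow> h x $ j = g j x"
  shows "vmeas h"
  unfolding vmeas_def
proof (intro conjI ballI allI assms(1))
  fix j
  note [measurable] = assms(2)
  have "(\<lambda>x. if j < d x then g j x else 0) \<in> borel_measurable M" by measurable
  thus "vcoord h j \<in> borel_measurable M"
    by (subst measurable_cong[of _ _ "\<lambda>x. if j < d x then g j x else 0"]) (auto simp: vcoord_def assms(3))
qed

lemma mmeasI:
  assumes "\<And>x. x \<in> space M \<Longrightarrow> s x \<in> carrier_mat (d x) (d x)"
    and "\<And>i j. g i j \<in> borel_measurable M"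
    and "\<And>x i j. \<lbrakk>x \<in> space M; i < d x; j < d x\<rbrakk> \<Longrightarrow> s x $$ (i, j) = g i j x"
  shows "mmeas s"
  unfolding mmeas_def
proof (intro conjI ballI allI assms(1))
  fix i j
  note [measurable] = assms(2)
  have "(\<lambda>x. if i < d x \<and> j < d x then g i j x else 0) \<in> borel_measurable M" by measurable
  thus "mcoord s i j \<in> borel_measurable M"
    by (subst measurable_cong[of _ _ "\<lambda>x. if i < d x \<and> j < d x then g i j x else 0"]) (auto simp: mcoord_def assms(3))
qed

lemma vcoord_eq: "j < d x \<Longrightarrow> vcoord h j x = h x $ j"
  and mcoord_eq: "i < d x \<Longrightarrow> j < d x \<Longrightarrow> mcoord s i j x = s x $$ (i, j)"
  by (simp_all add: vcoord_def mcoord_def)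

lemma vmeas_vec: "(\<And>j. g j \<in> borel_measurable M) \<Longrightarrow> vmeas (\<lambda>x. Matrix.vec (d x) (\<lambda>j. g j x))"
  by (rule vmeasI[where g = g]) auto

lemma vmeas_add:
  assumes "vmeas h" "vmeas k" shows "vmeas (\<lambda>x. h x + k x)"
  by (rule vmeasI[where g = "\<lambda>j x. vcoord h j x + vcoord k j x"])
    (use vmeasD[OF assms(1)] vmeasD[OF assms(2)] in \<open>auto simp: vcoord_eq vmeas_dim[OF assms(1)] vmeas_dim[OF assms(2)]\<close>)

lemma vmeas_smult:
  assumes [measurable]: "\<phi> \<in> borel_measurable M" and "vmeas h" shows "vmeas (\<lambda>x. \<phi> x \<cdot>\<^sub>v h x)"
  by (rule vmeasI[where g = "\<lambda>j x. \<phi> x * vcoord h j x"])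
    (use assms(1) vmeasD[OF assms(2)] in \<open>auto simp: vcoord_eq vmeas_dim[OF assms(2)]\<close>)

lemma vmeas_mult:
  assumes "mmeas s" "vmeas h" shows "vmeas (\<lambda>x. s x *\<^sub>v h x)"
proof (rule vmeasI[where g = "\<lambda>i x. \<Sum>j<d x. mcoord s i j x * vcoord h j x"])
  note [measurable] = mmeasD(2)[OF assms(1)] vmeasD(2)[OF assms(2)]
  show "(\<lambda>x. \<Sum>j<d x. mcoord s i j x * vcoord h j x) \<in> borel_measurable M" for i by measurable
  fix x assume x: "x \<in> space M"
  note c = mmeasD(1)[OF assms(1) x] vmeasD(1)[OF assms(2) x]
  show "s x *\<^sub>v h x \<in> carrier_vec (d x)" using c by (rule mult_mat_vec_carrier)
  fix i assume "i < d x"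
  thus "(s x *\<^sub>v h x) $ i = (\<Sum>j<d x. mcoord s i j x * vcoord h j x)"
    unfolding mult_mat_vec_sum[OF c \<open>i < d x\<close>] by (intro sum.cong) (auto simp: mcoord_eq vcoord_eq)
qed

lemma measurable_cscalar_prod:
  assumes "vmeas h" "vmeas k" shows "(\<lambda>x. h x \<bullet>c k x) \<in> borel_measurable M"
proof -
  note [measurable] = vmeasD(2)[OF assms(1)] vmeasD(2)[OF assms(2)]
  have "(\<lambda>x. \<Sum>j<d x. vcoord h j x * cnj (vcoord k j x)) \<in> borel_measurable M" by measurable
  thus ?thesis
    by (subst measurable_cong[of _ _ "\<lambda>x. \<Sum>j<d x. vcoord h j x * cnj (vcoord k j x)"])
      (use vmeasD[OF assms(1)] vmeasD[OF assms(2)] in \<open>auto simp: cscalar_prod_sum vcoord_eq\<close>)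
qed

lemma measurable_vsq:
  assumes "vmeas h" shows "(\<lambda>x. vsq (h x)) \<in> borel_measurable M"
proof -
  note [measurable] = measurable_cscalar_prod[OF assms assms]
  show ?thesis by measurable
qed

lemma mmeas_add:
  assumes "mmeas s" "mmeas t" shows "mmeas (\<lambda>x. s x + t x)"
  by (rule mmeasI[where g = "\<lambda>i j x. mcoord s i j x + mcoord t i j x"])
    (use mmeasD[OF assms(1)] mmeasD[OF assms(2)] in \<open>auto simp: mcoord_eq mmeas_dim[OF assms(1)] mmeas_dim[OF assms(2)]\<close>)

lemma mmeas_smult:
  assumes "mmeas s" shows "mmeas (\<lambda>x. c \<cdot>\<^sub>m s x)"
  by (rule mmeasI[where g = "\<lambda>i j x. c * mcoord s i j x"]) (use mmeasD[OF assms(1)] in \<open>auto simp: mcoord_eq mmeas_dim[OF assms(1)]\<close>)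

lemma mmeas_one: "mmeas (\<lambda>x. 1\<^sub>m (d x))"
  by (rule mmeasI[where g = "\<lambda>i j x. if i = j then 1 else 0"]) auto

lemma mmeas_zero: "mmeas (\<lambda>x. 0\<^sub>m (d x) (d x))"
  by (rule mmeasI[where g = "\<lambda>i j x. 0"]) auto

lemma mmeas_adjoint:
  assumes "mmeas s" shows "mmeas (\<lambda>x. mat_adjoint (s x))"
proof (rule mmeasI[where g = "\<lambda>i j x. cnj (mcoord s j i x)"])
  note [measurable] = mmeasD(2)[OF assms(1)]
  show "(\<lambda>x. cnj (mcoord s j i x)) \<in> borel_measurable M" for i j by measurable
qed (use mmeasD(1)[OF assms(1)] in \<open>auto simp: mcoord_eq mat_adjoint_index[OF mmeasD(1)[OF assms]]\<close>)

lemma mmeas_mult: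
  assumes "mmeas s" "mmeas t" shows "mmeas (\<lambda>x. s x * t x)"
proof (rule mmeasI[where g = "\<lambda>i j x. \<Sum>k<d x. mcoord s i k x * mcoord t k j x"])
  note [measurable] = mmeasD(2)[OF assms(1)] mmeasD(2)[OF assms(2)]
  show "(\<lambda>x. \<Sum>k<d x. mcoord s i k x * mcoord t k j x) \<in> borel_measurable M" for i j by measurable
  fix x assume x: "x \<in> space M"
  note c = mmeasD(1)[OF assms(1) x] mmeasD(1)[OF assms(2) x]
  show "s x * t x \<in> carrier_mat (d x) (d x)" using c by simp
  fix i j assume "i < d x" "j < d x"
  thus "(s x * t x) $$ (i, j) = (\<Sum>k<d x. mcoord s i k x * mcoord t k j x)"
    using c by (auto simp: scalar_prod_def lessThan_atLeast0 mcoord_eq intro!: sum.cong)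
qed

subsection \<open>Square-integrable vector fields\<close>

abbreviation "VF \<equiv> vec_fields M d"
abbreviation "X \<equiv> vec_direct_integral M d"
abbreviation "vcl \<equiv> vec_class M d"

lemma VF_carrier: "h \<in> VF \<Longrightarrow> x \<in> space M \<Longrightarrow> h x \<in> carrier_vec (d x)"
  by (rule vmeasD(1)[OF vec_fields_vmeas])

text \<open>By the parallelogram law the two sides differ by \<open>vsq (v - w)\<close>.\<close>

lemma vsq_add_le:
  assumes "v \<in> carrier_vec n" "w \<in> carrier_vec n" shows "vsq (v + w) \<le> 2 * vsq v + 2 * vsq w"
proof -
  interpret hilbert "cvec n" by (rule cvec_hilbert)
  have "vsq (v + w) = vsq v + vsq w + 2 * Re (v \<bullet>c w)"
    using norm_add_square[of v w] assms by (simp add: hnorm_cvec)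
  moreover have "0 \<le> vsq (v - w)" by simp
  moreover have "vsq (v - w) = vsq v + vsq w - 2 * Re (v \<bullet>c w)"
    using norm_diff_square[of v w] assms by (simp add: hnorm_cvec vdiff_cvec)
  ultimately show ?thesis by linarith
qed

lemma cscalar_prod_le:
  assumes "v \<in> carrier_vec n" "w \<in> carrier_vec n"
  shows "cmod (v \<bullet>c w) \<le> sqrt (vsq v) * sqrt (vsq w)" "cmod (v \<bullet>c w) \<le> vsq v + vsq w"
proof -
  interpret hilbert "cvec n" by (rule cvec_hilbert)
  show 1: "cmod (v \<bullet>c w) \<le> sqrt (vsq v) * sqrt (vsq w)"
    using cauchy_schwarz[of v w] assms by (simp add: hnorm_cvec)
  have "2 * (sqrt (vsq v) * sqrt (vsq w)) \<le> vsq v + vsq w"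
    using sum_squares_bound[of "sqrt (vsq v)" "sqrt (vsq w)"] by simp
  moreover have "0 \<le> sqrt (vsq v) * sqrt (vsq w)" by simp
  ultimately show "cmod (v \<bullet>c w) \<le> vsq v + vsq w" using 1 by linarith
qed

lemma VF_I:
  assumes "vmeas h" "integrable M g" "AE x in M. vsq (h x) \<le> g x"
  shows "h \<in> VF"
proof -
  have "integrable M (\<lambda>x. vsq (h x))"
    by (rule Bochner_Integration.integrable_bound[OF assms(2) measurable_vsq[OF assms(1)]])
      (use assms(3) in \<open>eventually_elim, use vsq_nonneg in force\<close>)
  thus ?thesis using assms(1) by (simp add: vec_fields_iff)
qed

lemma VF_add [simp]:
  assumes "h \<in> VF" "k \<in> VF" shows "(\<lambda>x. h x + k x) \<in> VF"
proof (rule VF_I)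
  show "vmeas (\<lambda>x. h x + k x)" using assms by (intro vmeas_add vec_fields_vmeas)
  show "integrable M (\<lambda>x. 2 * vsq (h x) + 2 * vsq (k x))" using assms by (simp add: vec_fields_integrable)
  show "AE x in M. vsq (h x + k x) \<le> 2 * vsq (h x) + 2 * vsq (k x)"
    using AE_space by eventually_elim (rule vsq_add_le[OF VF_carrier[OF assms(1)] VF_carrier[OF assms(2)]])
qed

lemma VF_smult:
  assumes "\<phi> \<in> borel_measurable M" "h \<in> VF" and bd: "AE x in M. cmod (\<phi> x) \<le> B"
  shows "(\<lambda>x. \<phi> x \<cdot>\<^sub>v h x) \<in> VF"
proof (rule VF_I)
  show "vmeas (\<lambda>x. \<phi> x \<cdot>\<^sub>v h x)" using assms by (intro vmeas_smult vec_fields_vmeas)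
  show "integrable M (\<lambda>x. B\<^sup>2 * vsq (h x))" using assms by (simp add: vec_fields_integrable)
  show "AE x in M. vsq (\<phi> x \<cdot>\<^sub>v h x) \<le> B\<^sup>2 * vsq (h x)"
    using bd by eventually_elim (unfold vsq_smult, intro mult_right_mono power_mono, auto)
qed

lemma VF_scale [simp]: "h \<in> VF \<Longrightarrow> (\<lambda>x. c \<cdot>\<^sub>v h x) \<in> VF"
  by (rule VF_smult[where B = "cmod c"]) auto

lemma VF_mult:
  assumes "mmeas s" "h \<in> VF" and bd: "AE x in M. mat_norm (s x) \<le> C"
  shows "(\<lambda>x. s x *\<^sub>v h x) \<in> VF"
    and "(\<integral>x. vsq (s x *\<^sub>v h x) \<partial>M) \<le> C\<^sup>2 * (\<integral>x. vsq (h x) \<partial>M)"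
proof -
  have le: "AE x in M. vsq (s x *\<^sub>v h x) \<le> C\<^sup>2 * vsq (h x)"
    using bd AE_space by eventually_elim (rule vsq_mat_le[OF mmeasD(1)[OF assms(1)] VF_carrier[OF assms(2)]])
  have i: "integrable M (\<lambda>x. C\<^sup>2 * vsq (h x))" using assms by (simp add: vec_fields_integrable)
  show m: "(\<lambda>x. s x *\<^sub>v h x) \<in> VF"
    by (rule VF_I[OF vmeas_mult[OF assms(1) vec_fields_vmeas[OF assms(2)]] i le])
  have "(\<integral>x. vsq (s x *\<^sub>v h x) \<partial>M) \<le> (\<integral>x. C\<^sup>2 * vsq (h x) \<partial>M)"
    by (rule integral_mono_AE[OF vec_fields_integrable[OF m] i le])
  thus "(\<integral>x. vsq (s x *\<^sub>v h x) \<partial>M) \<le> C\<^sup>2 * (\<integral>x. vsq (h x) \<partial>M)" by simp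
qed

lemma VF_inner_integrable:
  assumes "h \<in> VF" "k \<in> VF" shows "integrable M (\<lambda>x. h x \<bullet>c k x)"
proof (rule Bochner_Integration.integrable_bound)
  show "integrable M (\<lambda>x. vsq (h x) + vsq (k x))" using assms by (simp add: vec_fields_integrable)
  show "(\<lambda>x. h x \<bullet>c k x) \<in> borel_measurable M" using assms by (intro measurable_cscalar_prod vec_fields_vmeas)
  show "AE x in M. norm (h x \<bullet>c k x) \<le> norm (vsq (h x) + vsq (k x))"
    using AE_space
  proof eventually_elim
    case (elim x)
    have "0 \<le> vsq (h x) + vsq (k x)" by simp
    thus ?case using cscalar_prod_le(2)[OF VF_carrier[OF assms(1) elim] VF_carrier[OF assms(2) elim]] by simp
  qed
qed

lemma X_pts: "a \<in> pts X \<longleftrightarrow> (\<exists>h\<in>VF. a = vcl h)"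
  by (auto simp: vec_direct_integral_def)

lemma X_class_mem [simp]: "h \<in> VF \<Longrightarrow> vcl h \<in> pts X"
  by (auto simp: vec_direct_integral_def)

lemma rep_VF [simp]: "a \<in> pts X \<Longrightarrow> rep a \<in> VF"
  by (auto simp: X_pts rep_ae_class)

lemma X_class_rep: "a \<in> pts X \<Longrightarrow> vcl (rep a) = a"
  by (simp add: vec_direct_integral_def ae_class_rep)

lemma vcl_rep_AE: "h \<in> VF \<Longrightarrow> AE x in M. rep (vcl h) x = h x"
  by (rule rep_ae_eq)

lemma X_add:
  assumes "h \<in> VF" "k \<in> VF" shows "vadd X (vcl h) (vcl k) = vcl (\<lambda>x. h x + k x)"
proof -
  have "AE x in M. rep (vcl h) x + rep (vcl k) x = h x + k x"
    using vcl_rep_AE[OF assms(1)] vcl_rep_AE[OF assms(2)] by eventually_elim simp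
  thus ?thesis by (simp add: vec_direct_integral_def) (rule ae_class_cong)
qed

lemma X_scale:
  assumes "h \<in> VF" shows "vscale X c (vcl h) = vcl (\<lambda>x. c \<cdot>\<^sub>v h x)"
proof -
  have "AE x in M. c \<cdot>\<^sub>v rep (vcl h) x = c \<cdot>\<^sub>v h x"
    using vcl_rep_AE[OF assms(1)] by eventually_elim simp
  thus ?thesis by (simp add: vec_direct_integral_def) (rule ae_class_cong)
qed

lemma X_inner_rep: "inner X a b = (\<integral>x. rep a x \<bullet>c rep b x \<partial>M)"
  by (simp add: vec_direct_integral_def)

lemma X_inner:
  assumes "h \<in> VF" "k \<in> VF" shows "inner X (vcl h) (vcl k) = (\<integral>x. h x \<bullet>c k x \<partial>M)"
  unfolding X_inner_rep
proof (rule integral_cong_AE)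
  show "AE x in M. rep (vcl h) x \<bullet>c rep (vcl k) x = h x \<bullet>c k x"
    using vcl_rep_AE[OF assms(1)] vcl_rep_AE[OF assms(2)] by eventually_elim simp
qed (use assms in \<open>auto intro!: measurable_cscalar_prod vec_fields_vmeas\<close>)

lemma X_norm:
  assumes "h \<in> VF" shows "hnorm X (vcl h) = sqrt (\<integral>x. vsq (h x) \<partial>M)"
  unfolding hnorm_def X_inner[OF assms assms] integral_Re[OF VF_inner_integrable[OF assms assms], symmetric] ..

subsection \<open>Essentially bounded matrix fields\<close>

abbreviation "MF \<equiv> mat_fields M d"
abbreviation "Z \<equiv> mat_direct_integral M d"
abbreviation "mcl \<equiv> mat_class M d"

lemma MF_mmeas: "s \<in> MF \<Longrightarrow> mmeas s" by (simp add: mat_fields_iff)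

lemma MF_carrier: "s \<in> MF \<Longrightarrow> x \<in> space M \<Longrightarrow> s x \<in> carrier_mat (d x) (d x)"
  by (rule mmeasD(1)[OF MF_mmeas])

lemma MF_bound: "s \<in> MF \<Longrightarrow> \<exists>C. AE x in M. mat_norm (s x) \<le> C"
  by (simp add: mat_fields_iff)

lemma MF_I: "\<lbrakk>mmeas s; AE x in M. mat_norm (s x) \<le> C\<rbrakk> \<Longrightarrow> s \<in> MF"
  by (auto simp: mat_fields_iff)

lemma MF_zero [simp]: "(\<lambda>x. 0\<^sub>m (d x) (d x)) \<in> MF"
proof (rule MF_I[OF mmeas_zero])
  have "mat_norm (0\<^sub>m n n) \<le> 0" for n
  proof (rule mat_norm_le[OF zero_carrier_mat order.refl])
    fix v :: "complex Matrix.vec" assume "v \<in> carrier_vec n"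
    hence "0\<^sub>m n n *\<^sub>v v = 0\<^sub>v n" by (intro eq_vecI) auto
    thus "vsq (0\<^sub>m n n *\<^sub>v v) \<le> 0\<^sup>2 * vsq v" by simp
  qed
  thus "AE x in M. mat_norm (0\<^sub>m (d x) (d x)) \<le> 0" by simp
qed

lemma MF_one [simp]: "(\<lambda>x. 1\<^sub>m (d x)) \<in> MF"
  by (rule MF_I[where C = 1]) (auto intro!: mat_norm_le simp: mmeas_one)

lemma MF_add [simp]:
  assumes "s \<in> MF" "t \<in> MF" shows "(\<lambda>x. s x + t x) \<in> MF"
proof -
  obtain C D where C: "AE x in M. mat_norm (s x) \<le> C" and D: "AE x in M. mat_norm (t x) \<le> D"
    using MF_bound assms by blast
  show ?thesis
  proof (rule MF_I)
    show "AE x in M. mat_norm (s x + t x) \<le> C + D"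
      using C D AE_space by eventually_elim (rule mat_norm_add[OF MF_carrier[OF assms(1)] MF_carrier[OF assms(2)]])
  qed (use assms in \<open>intro mmeas_add MF_mmeas\<close>)
qed

lemma MF_scale [simp]:
  assumes "s \<in> MF" shows "(\<lambda>x. c \<cdot>\<^sub>m s x) \<in> MF"
proof -
  obtain C where C: "AE x in M. mat_norm (s x) \<le> C" using MF_bound assms by blast
  show ?thesis
  proof (rule MF_I)
    show "AE x in M. mat_norm (c \<cdot>\<^sub>m s x) \<le> cmod c * C"
      using C AE_space by eventually_elim (rule mat_norm_smult[OF MF_carrier[OF assms(1)]])
  qed (use assms in \<open>intro mmeas_smult MF_mmeas\<close>)
qed

lemma MF_mult [simp]:
  assumes "s \<in> MF" "t \<in> MF" shows "(\<lambda>x. s x * t x) \<in> MF"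
proof -
  obtain C D where C: "AE x in M. mat_norm (s x) \<le> C" and D: "AE x in M. mat_norm (t x) \<le> D"
    using MF_bound assms by blast
  show ?thesis
  proof (rule MF_I)
    show "AE x in M. mat_norm (s x * t x) \<le> C * D"
      using C D AE_space by eventually_elim (rule mat_norm_mult[OF MF_carrier[OF assms(1)] MF_carrier[OF assms(2)]])
  qed (use assms in \<open>intro mmeas_mult MF_mmeas\<close>)
qed

lemma MF_adjoint [simp]:
  assumes "s \<in> MF" shows "(\<lambda>x. mat_adjoint (s x)) \<in> MF"
proof -
  obtain C where C: "AE x in M. mat_norm (s x) \<le> C" using MF_bound assms by blast
  show ?thesis
  proof (rule MF_I)
    show "AE x in M. mat_norm (mat_adjoint (s x)) \<le> C"
      using C AE_space by eventually_elim (rule mat_norm_adjoint[OF MF_carrier[OF assms(1)]])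
  qed (use assms in \<open>intro mmeas_adjoint MF_mmeas\<close>)
qed

lemma MF_mult_VF: "\<lbrakk>s \<in> MF; h \<in> VF\<rbrakk> \<Longrightarrow> (\<lambda>x. s x *\<^sub>v h x) \<in> VF"
  using VF_mult(1)[OF MF_mmeas] MF_bound by blast

lemma Z_pts: "a \<in> pts Z \<longleftrightarrow> (\<exists>s\<in>MF. a = mcl s)"
  by (auto simp: mat_direct_integral_def)

lemma Z_class_mem [simp]: "s \<in> MF \<Longrightarrow> mcl s \<in> pts Z"
  by (auto simp: mat_direct_integral_def)

lemma mcl_rep_AE: "s \<in> MF \<Longrightarrow> AE x in M. rep (mcl s) x = s x"
  by (rule rep_ae_eq)

lemma Z_ops:
  assumes s: "s \<in> MF" and t: "t \<in> MF"
  shows "vadd Z (mcl s) (mcl t) = mcl (\<lambda>x. s x + t x)"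
    and "vscale Z c (mcl s) = mcl (\<lambda>x. c \<cdot>\<^sub>m s x)"
    and "mult Z (mcl s) (mcl t) = mcl (\<lambda>x. s x * t x)"
    and "star Z (mcl s) = mcl (\<lambda>x. mat_adjoint (s x))"
proof -
  note r = mcl_rep_AE[OF s] mcl_rep_AE[OF t]
  have "AE x in M. rep (mcl s) x + rep (mcl t) x = s x + t x" using r by eventually_elim simp
  thus "vadd Z (mcl s) (mcl t) = mcl (\<lambda>x. s x + t x)"
    by (simp add: mat_direct_integral_def) (rule ae_class_cong)
  have "AE x in M. c \<cdot>\<^sub>m rep (mcl s) x = c \<cdot>\<^sub>m s x" using r(1) by eventually_elim simp
  thus "vscale Z c (mcl s) = mcl (\<lambda>x. c \<cdot>\<^sub>m s x)"
    by (simp add: mat_direct_integral_def) (rule ae_class_cong)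
  have "AE x in M. rep (mcl s) x * rep (mcl t) x = s x * t x" using r by eventually_elim simp
  thus "mult Z (mcl s) (mcl t) = mcl (\<lambda>x. s x * t x)"
    by (simp add: mat_direct_integral_def) (rule ae_class_cong)
  have "AE x in M. mat_adjoint (rep (mcl s) x) = mat_adjoint (s x)" using r(1) by eventually_elim simp
  thus "star Z (mcl s) = mcl (\<lambda>x. mat_adjoint (s x))"
    by (simp add: mat_direct_integral_def) (rule ae_class_cong)
qed

lemma Z_consts: "vzero Z = mcl (\<lambda>x. 0\<^sub>m (d x) (d x))" "unit Z = mcl (\<lambda>x. 1\<^sub>m (d x))"
  by (simp_all add: mat_direct_integral_def)

text \<open>The infimum that defines the norm is itself an essential bound: each
  \<open>Inf S + 1 / (n + 1)\<close> is one, and the countably many exceptional null sets can be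
  united.\<close>

lemma nrm_Z:
  assumes s: "s \<in> MF"
  shows nrm_Z_AE: "AE x in M. mat_norm (s x) \<le> nrm Z (mcl s)"
    and nrm_Z_le: "\<lbrakk>0 \<le> C; AE x in M. mat_norm (s x) \<le> C\<rbrakk> \<Longrightarrow> nrm Z (mcl s) \<le> C"
    and nrm_Z_nonneg: "0 \<le> nrm Z (mcl s)"
proof -
  have iff: "(AE x in M. mat_norm (rep (mcl s) x) \<le> C) \<longleftrightarrow> (AE x in M. mat_norm (s x) \<le> C)" for C
  proof
    assume "AE x in M. mat_norm (rep (mcl s) x) \<le> C"
    with mcl_rep_AE[OF s] show "AE x in M. mat_norm (s x) \<le> C" by eventually_elim simp
  next
    assume "AE x in M. mat_norm (s x) \<le> C"
    with mcl_rep_AE[OF s] show "AE x in M. mat_norm (rep (mcl s) x) \<le> C" by eventually_elim simp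
  qed
  define S where "S = {C. 0 \<le> C \<and> (AE x in M. mat_norm (s x) \<le> C)}"
  have n: "nrm Z (mcl s) = Inf S" by (simp add: mat_direct_integral_def iff S_def)
  have bdd: "bdd_below S" by (auto simp: S_def intro: bdd_belowI)
  obtain C where "AE x in M. mat_norm (s x) \<le> C" using MF_bound[OF s] by blast
  hence "AE x in M. mat_norm (s x) \<le> max C 0" by eventually_elim simp
  hence ne: "S \<noteq> {}" by (auto simp: S_def intro!: exI[of _ "max C 0"])
  show "nrm Z (mcl s) \<le> C" if "0 \<le> C" "AE x in M. mat_norm (s x) \<le> C" for C
    unfolding n using that bdd by (intro cInf_lower) (auto simp: S_def)
  show "0 \<le> nrm Z (mcl s)" unfolding n using ne by (intro cInf_greatest) (auto simp: S_def)
  have "AE x in M. mat_norm (s x) \<le> Inf S + 1 / real (Suc n)" for n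
  proof -
    have "Inf S < Inf S + 1 / real (Suc n)" by simp
    then obtain C where "C \<in> S" "C < Inf S + 1 / real (Suc n)" using cInf_lessD[OF ne] by blast
    hence "AE x in M. mat_norm (s x) \<le> C" "C \<le> Inf S + 1 / real (Suc n)" by (auto simp: S_def)
    thus ?thesis by (auto elim: eventually_mono)
  qed
  hence "AE x in M. \<forall>n. mat_norm (s x) \<le> Inf S + 1 / real (Suc n)" by (subst AE_all_countable) blast
  thus "AE x in M. mat_norm (s x) \<le> nrm Z (mcl s)"
  proof eventually_elim
    case (elim x)
    show ?case unfolding n
    proof (rule field_le_epsilon)
      fix e :: real assume "e > 0"
      then obtain n where "1 / real (Suc n) < e" using nat_approx_posE by blast
      thus "mat_norm (s x) \<le> Inf S + e" using elim[rule_format, of n] by linarith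
    qed
  qed
qed

lemma mult_op_class:
  assumes s: "s \<in> MF" and h: "h \<in> VF"
  shows "mult_op M d (mcl s) (vcl h) = vcl (\<lambda>x. s x *\<^sub>v h x)"
  unfolding mult_op_def
proof (rule ae_class_cong)
  show "AE x in M. rep (mcl s) x *\<^sub>v rep (vcl h) x = s x *\<^sub>v h x"
    using mcl_rep_AE[OF s] vcl_rep_AE[OF h] by eventually_elim simp
qed

end

section \<open>Decomposable operators\<close>

context fields
begin

text \<open>For the restriction of \<open>h\<close> to a measurable set \<open>E\<close>, the
  integral bound says that \<open>C\<^sup>2 * vsq (h x) - vsq (t h x)\<close> has nonnegative
  integral over \<open>E\<close>, because \<open>t\<close> commutes with the restriction.\<close>

lemma pointwise_bound:
  assumes tV: "\<And>h. h \<in> VF \<Longrightarrow> t h \<in> VF"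
    and tn: "\<And>h. h \<in> VF \<Longrightarrow> (\<integral>x. vsq (t h x) \<partial>M) \<le> C\<^sup>2 * (\<integral>x. vsq (h x) \<partial>M)"
    and tc: "\<And>E h. \<lbrakk>E \<in> sets M; h \<in> VF\<rbrakk> \<Longrightarrow>
      AE x in M. t (\<lambda>x. indicator E x \<cdot>\<^sub>v h x) x = indicator E x \<cdot>\<^sub>v t h x"
    and h: "h \<in> VF"
  shows "AE x in M. vsq (t h x) \<le> C\<^sup>2 * vsq (h x)"
proof -
  have i1: "integrable M (\<lambda>x. vsq (h x))" and i2: "integrable M (\<lambda>x. vsq (t h x))"
    using h tV by (auto intro: vec_fields_integrable)
  have ind: "vsq (indicator E x \<cdot>\<^sub>v v) = indicator E x * vsq v" for E and x :: 'x and v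
    by (simp add: vsq_smult indicator_def)
  have "AE x in M. 0 \<le> C\<^sup>2 * vsq (h x) - vsq (t h x)"
  proof (rule density_nonneg)
    show "integrable M (\<lambda>x. C\<^sup>2 * vsq (h x) - vsq (t h x))" using i1 i2 by simp
    fix E assume E: "E \<in> sets M"
    have hE: "(\<lambda>x. indicator E x \<cdot>\<^sub>v h x) \<in> VF"
      using E h by (intro VF_smult[where B = 1]) (auto simp: indicator_def)
    have j1: "integrable M (\<lambda>x. indicator E x * vsq (h x))"
      and j2: "integrable M (\<lambda>x. indicator E x * vsq (t h x))"
      using integrable_mult_indicator[OF E i1] integrable_mult_indicator[OF E i2] by simp_all
    have "(\<integral>x. vsq (t (\<lambda>x. indicator E x \<cdot>\<^sub>v h x) x) \<partial>M) = (\<integral>x. indicator E x * vsq (t h x) \<partial>M)"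
    proof (rule integral_cong_AE)
      show "AE x in M. vsq (t (\<lambda>x. indicator E x \<cdot>\<^sub>v h x) x) = indicator E x * vsq (t h x)"
        using tc[OF E h] by eventually_elim (simp only: ind)
    qed (use measurable_vsq[OF vec_fields_vmeas[OF tV[OF hE]]] j2 in auto)
    moreover have "(\<integral>x. vsq (indicator E x \<cdot>\<^sub>v h x) \<partial>M) = (\<integral>x. indicator E x * vsq (h x) \<partial>M)"
      by (simp only: ind)
    ultimately have "0 \<le> C\<^sup>2 * (\<integral>x. indicator E x * vsq (h x) \<partial>M) - (\<integral>x. indicator E x * vsq (t h x) \<partial>M)"
      using tn[OF hE] by (simp only: diff_ge_0_iff_ge)
    also have "\<dots> = (\<integral>x. C\<^sup>2 * (indicator E x * vsq (h x)) - indicator E x * vsq (t h x) \<partial>M)"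
      using j1 j2 by simp
    also have "\<dots> = (LINT x:E|M. C\<^sup>2 * vsq (h x) - vsq (t h x))"
      unfolding set_lebesgue_integral_def by (intro Bochner_Integration.integral_cong) (auto simp: algebra_simps)
    finally show "0 \<le> (LINT x:E|M. C\<^sup>2 * vsq (h x) - vsq (t h x))" .
  qed
  thus ?thesis by simp
qed

text \<open>The exceptional null set may depend on the vector, so the norm bound is assembled from
  countably many rational vectors. A test vector is given by a sequence \<open>u\<close>, truncated
  to the dimension at each point.\<close>

lemma mat_norm_AE_le:
  assumes s: "mmeas s" and C: "0 \<le> C"
    and le: "\<And>(u :: nat \<Rightarrow> complex) m. AE x in M. d x = m \<longrightarrow>
      vsq (s x *\<^sub>v Matrix.vec (d x) u) \<le> C\<^sup>2 * vsq (Matrix.vec (d x) u)"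
  shows "AE x in M. mat_norm (s x) \<le> C"
proof -
  define u :: "(rat \<times> rat) list \<Rightarrow> nat \<Rightarrow> complex" where
    "u l j = Complex (of_rat (fst (l ! j))) (of_rat (snd (l ! j)))" for l j
  have "AE x in M. \<forall>l. \<forall>m. d x = m \<longrightarrow> vsq (s x *\<^sub>v Matrix.vec (d x) (u l)) \<le> C\<^sup>2 * vsq (Matrix.vec (d x) (u l))"
    unfolding AE_all_countable using le by blast
  with AE_space show ?thesis
  proof eventually_elim
    case (elim x)
    show ?case
    proof (rule mat_norm_le_if_rational[OF mmeasD(1)[OF s elim(1)] C])
      fix l
      have ul: "(\<lambda>j. Complex (of_rat (fst (l ! j))) (of_rat (snd (l ! j)))) = u l" by (rule ext) (simp add: u_def)
      show "let q = Matrix.vec (d x) (\<lambda>j. Complex (of_rat (fst (l ! j))) (of_rat (snd (l ! j))))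
        in vsq (s x *\<^sub>v q) \<le> C\<^sup>2 * vsq q"
        unfolding Let_def ul using elim(2) by blast
    qed
  qed
qed

text \<open>The square root of a strictly positive integrable function, which sigma-finiteness
  provides. It stands in for the constant 1, which is not square integrable over a space of infinite
  measure.\<close>

lemma ex_weight:
  obtains w :: "'x \<Rightarrow> real" where "w \<in> borel_measurable M" "\<And>x. 0 < w x" "integrable M (\<lambda>x. (w x)\<^sup>2)"
proof -
  obtain f :: "'x \<Rightarrow> real" where f: "f \<in> borel_measurable M" "\<And>x. f x > 0" "integrable M f"
    using obtain_positive_integrable_function by blast
  show thesis
  proof (rule that[of "\<lambda>x. sqrt (f x)"])
    have "(\<lambda>x. (sqrt (f x))\<^sup>2) = f" using f(2) by (intro ext) (simp add: less_imp_le)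
    thus "integrable M (\<lambda>x. (sqrt (f x))\<^sup>2)" using f(3) by simp
  qed (use f in auto)
qed

text \<open>The dimension may be unbounded; the cut-off at \<open>n\<close> coordinates leaves at
  most \<open>n\<close> terms, each of size at most
  \<open>B\<^sup>2 * (w x)\<^sup>2\<close>.\<close>

lemma weighted_VF:
  fixes w :: "'x \<Rightarrow> real"
  assumes w: "w \<in> borel_measurable M" "integrable M (\<lambda>x. (w x)\<^sup>2)"
    and g: "\<And>j. j < n \<Longrightarrow> g j \<in> borel_measurable M" "\<And>j x. \<lbrakk>j < n; x \<in> space M\<rbrakk> \<Longrightarrow> cmod (g j x) \<le> B"
  shows "(\<lambda>x. Matrix.vec (d x) (\<lambda>i. if i < n then g i x * of_real (w x) else 0)) \<in> VF"
proof (rule VF_I)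
  let ?g = "\<lambda>i x. if i < n then g i x * of_real (w x) else 0"
  have "?g i \<in> borel_measurable M" for i using w(1) g(1)[of i] by (cases "i < n") auto
  thus "vmeas (\<lambda>x. Matrix.vec (d x) (\<lambda>i. ?g i x))" by (rule vmeas_vec)
  show "integrable M (\<lambda>x. real n * (B\<^sup>2 * (w x)\<^sup>2))" using w(2) by simp
  show "AE x in M. vsq (Matrix.vec (d x) (\<lambda>i. ?g i x)) \<le> real n * (B\<^sup>2 * (w x)\<^sup>2)"
    using AE_space
  proof eventually_elim
    case (elim x)
    have "vsq (Matrix.vec (d x) (\<lambda>i. ?g i x)) = (\<Sum>i<d x. (cmod (?g i x))\<^sup>2)"
      by (subst vsq_sum[of _ "d x"]) auto
    also have "\<dots> = (\<Sum>i\<in>{..<d x} \<inter> {..<n}. (cmod (?g i x))\<^sup>2)"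
      by (intro sum.mono_neutral_right) auto
    also have "\<dots> \<le> (\<Sum>i\<in>{..<n}. (cmod (?g i x))\<^sup>2)" by (intro sum_mono2) auto
    also have "\<dots> \<le> (\<Sum>i\<in>{..<n}. B\<^sup>2 * (w x)\<^sup>2)"
      using g(2) elim by (intro sum_mono) (auto simp: norm_mult power_mult_distrib intro!: mult_right_mono power_mono)
    finally show ?case by simp
  qed
qed

text \<open>On one level set of the dimension all truncations of \<open>u\<close> coincide, so their
  size is a single constant.\<close>

lemma weighted_const_VF:
  fixes w :: "'x \<Rightarrow> real"
  assumes w: "w \<in> borel_measurable M" "integrable M (\<lambda>x. (w x)\<^sup>2)"
  shows "(\<lambda>x. (indicator {x \<in> space M. d x = m} x * of_real (w x)) \<cdot>\<^sub>v Matrix.vec (d x) u) \<in> VF"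
proof (rule VF_I)
  show "vmeas (\<lambda>x. (indicator {x \<in> space M. d x = m} x * of_real (w x)) \<cdot>\<^sub>v Matrix.vec (d x) u)"
    using w(1) by (intro vmeas_smult vmeas_vec) auto
  show "integrable M (\<lambda>x. vsq (Matrix.vec m u) * (w x)\<^sup>2)" using w(2) by simp
  show "AE x in M. vsq ((indicator {x \<in> space M. d x = m} x * of_real (w x)) \<cdot>\<^sub>v Matrix.vec (d x) u)
      \<le> vsq (Matrix.vec m u) * (w x)\<^sup>2"
    by (rule AE_I2, unfold vsq_smult) (auto simp: norm_mult power_mult_distrib indicator_def)
qed

lemma mat_norm_AE_le_if_weighted:
  fixes w :: "'x \<Rightarrow> real"
  assumes s: "mmeas s" and C: "0 \<le> C" and w: "w \<in> borel_measurable M" "\<And>x. 0 < w x" "integrable M (\<lambda>x. (w x)\<^sup>2)"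
    and le: "\<And>h. h \<in> VF \<Longrightarrow> AE x in M. vsq (s x *\<^sub>v h x) \<le> C\<^sup>2 * vsq (h x)"
  shows "AE x in M. mat_norm (s x) \<le> C"
proof (rule mat_norm_AE_le[OF s C])
  fix u :: "nat \<Rightarrow> complex" and m
  let ?c = "\<lambda>x. indicator {x \<in> space M. d x = m} x * complex_of_real (w x)"
  have "AE x in M. vsq (s x *\<^sub>v (?c x \<cdot>\<^sub>v Matrix.vec (d x) u)) \<le> C\<^sup>2 * vsq (?c x \<cdot>\<^sub>v Matrix.vec (d x) u)"
    by (rule le[OF weighted_const_VF[OF w(1,3)]])
  with AE_space show "AE x in M. d x = m \<longrightarrow> vsq (s x *\<^sub>v Matrix.vec (d x) u) \<le> C\<^sup>2 * vsq (Matrix.vec (d x) u)"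
  proof eventually_elim
    case (elim x)
    show ?case
    proof
      assume "d x = m"
      hence c: "?c x = of_real (w x)" using elim(1) by simp
      have "s x *\<^sub>v (of_real (w x) \<cdot>\<^sub>v Matrix.vec (d x) u) = of_real (w x) \<cdot>\<^sub>v (s x *\<^sub>v Matrix.vec (d x) u)"
        by (rule mult_mat_vec[OF mmeasD(1)[OF s elim(1)]]) simp
      with elim(2) have "(w x)\<^sup>2 * vsq (s x *\<^sub>v Matrix.vec (d x) u) \<le> C\<^sup>2 * ((w x)\<^sup>2 * vsq (Matrix.vec (d x) u))"
        unfolding c by (simp only: vsq_smult norm_of_real power2_abs)
      hence "(w x)\<^sup>2 * vsq (s x *\<^sub>v Matrix.vec (d x) u) \<le> (w x)\<^sup>2 * (C\<^sup>2 * vsq (Matrix.vec (d x) u))"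
        by (simp only: mult_ac)
      thus "vsq (s x *\<^sub>v Matrix.vec (d x) u) \<le> C\<^sup>2 * vsq (Matrix.vec (d x) u)"
        by (rule mult_left_le_imp_le) (use w(2)[of x] in simp)
    qed
  qed
qed

text \<open>The harder half of the equality between the norm of a multiplication operator and the
  essential supremum of its matrix norms: the integral bound is localised to a pointwise one, which
  is then tested on weighted constant vectors.\<close>

lemma mat_norm_AE_le_if_bounded:
  assumes s: "s \<in> MF" and C: "0 \<le> C"
    and le: "\<And>h. h \<in> VF \<Longrightarrow> (\<integral>x. vsq (s x *\<^sub>v h x) \<partial>M) \<le> C\<^sup>2 * (\<integral>x. vsq (h x) \<partial>M)"
  shows "AE x in M. mat_norm (s x) \<le> C"
proof -
  obtain w :: "'x \<Rightarrow> real" where w: "w \<in> borel_measurable M" "\<And>x. 0 < w x" "integrable M (\<lambda>x. (w x)\<^sup>2)"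
    by (rule ex_weight) blast
  show ?thesis
  proof (rule mat_norm_AE_le_if_weighted[OF MF_mmeas[OF s] C w])
    fix h assume h: "h \<in> VF"
    show "AE x in M. vsq (s x *\<^sub>v h x) \<le> C\<^sup>2 * vsq (h x)"
    proof (rule pointwise_bound[where t = "\<lambda>h x. s x *\<^sub>v h x", OF MF_mult_VF[OF s] le _ h])
      fix E h assume h: "h \<in> VF"
      show "AE x in M. s x *\<^sub>v (indicator E x \<cdot>\<^sub>v h x) = indicator E x \<cdot>\<^sub>v (s x *\<^sub>v h x)"
        using AE_space by eventually_elim (rule mult_mat_vec[OF MF_carrier[OF s] VF_carrier[OF h]])
    qed
  qed
qed

text \<open>The \<open>j\<close>-th column of the matrix field is the image of the field \<open>w e\<^sub>j\<close> divided by the weight \<open>w\<close>,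
  which makes \<open>w e\<^sub>j\<close> square integrable.\<close>

theorem decomposable:
  assumes lin: "linear_map X X T" and bd: "\<And>a. a \<in> pts X \<Longrightarrow> hnorm X (T a) \<le> C * hnorm X a" and C: "0 \<le> C"
    and comm: "\<And>\<phi> h B. \<lbrakk>\<phi> \<in> borel_measurable M; \<And>x. x \<in> space M \<Longrightarrow> cmod (\<phi> x) \<le> B; h \<in> VF\<rbrakk> \<Longrightarrow>
      T (vcl (\<lambda>x. \<phi> x \<cdot>\<^sub>v h x)) = vcl (\<lambda>x. \<phi> x \<cdot>\<^sub>v rep (T (vcl h)) x)"
  shows "\<exists>s\<in>MF. \<forall>a\<in>pts X. T a = mult_op M d (mcl s) a"
proof -
  define t where "t h = rep (T (vcl h))" for h
  have tX: "T (vcl h) \<in> pts X" if "h \<in> VF" for h using linear_mapD(1)[OF lin] that by simp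
  have tV: "t h \<in> VF" if "h \<in> VF" for h using tX[OF that] by (simp add: t_def)
  have tcl: "vcl (t h) = T (vcl h)" if "h \<in> VF" for h using tX[OF that] by (simp add: t_def X_class_rep)
  have t_cong: "t h = t k" if "AE x in M. h x = k x" for h k
    unfolding t_def ae_class_cong[OF that] ..
  have t_add: "AE x in M. t (\<lambda>x. h x + k x) x = t h x + t k x" if h: "h \<in> VF" and k: "k \<in> VF" for h k
  proof -
    have "vcl (t (\<lambda>x. h x + k x)) = vcl (\<lambda>x. t h x + t k x)"
      unfolding tcl[OF VF_add[OF h k]] X_add[OF h k, symmetric] X_add[OF tV[OF h] tV[OF k], symmetric]
        tcl[OF h] tcl[OF k] using h k by (intro linear_mapD(2)[OF lin]) auto
    thus ?thesis by (rule ae_class_eqD[OF tV[OF VF_add[OF h k]]])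
  qed
  have t_smult: "AE x in M. t (\<lambda>x. \<phi> x \<cdot>\<^sub>v h x) x = \<phi> x \<cdot>\<^sub>v t h x"
    if \<phi>: "\<phi> \<in> borel_measurable M" "\<And>x. x \<in> space M \<Longrightarrow> cmod (\<phi> x) \<le> B" and h: "h \<in> VF" for \<phi> h B
  proof -
    have \<phi>h: "(\<lambda>x. \<phi> x \<cdot>\<^sub>v h x) \<in> VF" using \<phi> h by (intro VF_smult[where B = B]) auto
    have "vcl (t (\<lambda>x. \<phi> x \<cdot>\<^sub>v h x)) = vcl (\<lambda>x. \<phi> x \<cdot>\<^sub>v t h x)"
      unfolding tcl[OF \<phi>h] unfolding t_def by (rule comm[OF \<phi> h])
    thus ?thesis by (rule ae_class_eqD[OF tV[OF \<phi>h]])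
  qed
  have tn: "(\<integral>x. vsq (t h x) \<partial>M) \<le> C\<^sup>2 * (\<integral>x. vsq (h x) \<partial>M)" if h: "h \<in> VF" for h
  proof -
    have "sqrt (\<integral>x. vsq (t h x) \<partial>M) \<le> C * sqrt (\<integral>x. vsq (h x) \<partial>M)"
      using bd[OF X_class_mem[OF h]] unfolding tcl[OF h, symmetric] X_norm[OF h] X_norm[OF tV[OF h]] .
    hence "(sqrt (\<integral>x. vsq (t h x) \<partial>M))\<^sup>2 \<le> (C * sqrt (\<integral>x. vsq (h x) \<partial>M))\<^sup>2"
      by (rule power_mono) (simp add: integral_nonneg_AE)
    thus ?thesis by (simp add: power_mult_distrib integral_nonneg_AE)
  qed
  obtain w :: "'x \<Rightarrow> real" where w: "w \<in> borel_measurable M" "\<And>x. 0 < w x" "integrable M (\<lambda>x. (w x)\<^sup>2)"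
    by (rule ex_weight) blast
  note [measurable] = w(1)
  \<comment> \<open>The weighted unit vector field, zero where the dimension is at most
    \<open>j\<close>. The nested conditionals give it the form that \<open>weighted_VF\<close>
    expects for \<open>n = Suc j\<close>.\<close>
  define b where "b j = (\<lambda>x. Matrix.vec (d x) (\<lambda>i. if i < Suc j then (if i = j then 1 else 0) * complex_of_real (w x) else 0))" for j
  have b: "b j \<in> VF" for j
    unfolding b_def by (rule weighted_VF[OF w(1,3), where B = 1]) auto
  define g where "g n \<phi> = (\<lambda>x. Matrix.vec (d x) (\<lambda>i. if i < n then \<phi> i x * complex_of_real (w x) else 0))" for n and \<phi> :: "nat \<Rightarrow> 'x \<Rightarrow> complex"
  \<comment> \<open>The image of a combination of the fields \<open>b j\<close> with bounded
    coefficient functions is determined by the images of the \<open>b j\<close>. Finitely many terms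
    are involved, so additivity and the commutation with bounded multipliers suffice.\<close>
  have tg: "AE x in M. t (g n \<phi>) x = Matrix.vec (d x) (\<lambda>i. \<Sum>j<n. \<phi> j x * t (b j) x $ i)"
    if "\<And>j. j < n \<Longrightarrow> \<phi> j \<in> borel_measurable M" "\<And>j x. \<lbrakk>j < n; x \<in> space M\<rbrakk> \<Longrightarrow> cmod (\<phi> j x) \<le> B" for n \<phi> B
    using that
  proof (induction n)
    case 0
    have eq: "(\<lambda>x. 0 \<cdot>\<^sub>v b 0 x) = g 0 \<phi>" unfolding g_def b_def by (intro ext eq_vecI) auto
    have "AE x in M. t (g 0 \<phi>) x = 0 \<cdot>\<^sub>v t (b 0) x"
      using t_smult[of "\<lambda>_. 0" 0 "b 0"] b unfolding eq by simp
    with AE_space show ?case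
    proof eventually_elim
      case (elim x)
      show ?case unfolding elim(2) using carrier_vecD[OF VF_carrier[OF tV[OF b] elim(1), of 0]] by (intro eq_vecI) auto
    qed
  next
    case (Suc n)
    have gn: "g n \<phi> \<in> VF" unfolding g_def using Suc.prems by (intro weighted_VF[OF w(1,3), where B = B]) auto
    have \<phi>b: "(\<lambda>x. \<phi> n x \<cdot>\<^sub>v b n x) \<in> VF" using Suc.prems by (intro VF_smult[OF _ b, where B = B]) auto
    have eq: "(\<lambda>x. g n \<phi> x + \<phi> n x \<cdot>\<^sub>v b n x) = g (Suc n) \<phi>"
      unfolding g_def b_def by (intro ext eq_vecI) (auto simp: less_Suc_eq)
    have ih: "AE x in M. t (g n \<phi>) x = Matrix.vec (d x) (\<lambda>i. \<Sum>j<n. \<phi> j x * t (b j) x $ i)"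
      using Suc.prems by (intro Suc.IH) auto
    have sm: "AE x in M. t (\<lambda>x. \<phi> n x \<cdot>\<^sub>v b n x) x = \<phi> n x \<cdot>\<^sub>v t (b n) x"
      using Suc.prems by (intro t_smult[where B = B] b) auto
    from t_add[OF gn \<phi>b] ih sm AE_space show ?case
      unfolding eq
    proof eventually_elim
      case (elim x)
      show ?case unfolding elim(1-3) using carrier_vecD[OF VF_carrier[OF tV[OF b] elim(4), of n]] by (intro eq_vecI) auto
    qed
  qed
  define s where "s = (\<lambda>x. Matrix.mat (d x) (d x) (\<lambda>(i, j). t (b j) x $ i / of_real (w x)))"
  have s: "mmeas s"
  proof (rule mmeasI[where g = "\<lambda>i j x. vcoord (t (b j)) i x / of_real (w x)"])
    note [measurable] = vmeasD(2)[OF vec_fields_vmeas[OF tV[OF b]]]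
    show "(\<lambda>x. vcoord (t (b j)) i x / complex_of_real (w x)) \<in> borel_measurable M" for i j by measurable
  qed (auto simp: s_def vcoord_eq)
  have ts: "AE x in M. t h x = s x *\<^sub>v h x" if h: "h \<in> VF" for h
  proof -
    note hm [measurable] = vmeasD(2)[OF vec_fields_vmeas[OF h]]
    \<comment> \<open>On \<open>E n\<close> the field \<open>h\<close> has at most \<open>n\<close>
      coordinates, whose quotients by \<open>w\<close> are bounded by \<open>n\<close>; there
      \<open>tg\<close> computes the image of \<open>h\<close>. The sets \<open>E n\<close> exhaust
      the space.\<close>
    define E where "E n = {x \<in> space M. d x \<le> n \<and> (\<forall>j<n. cmod (vcoord h j x) \<le> real n * w x)}" for n
    have E [measurable]: "E n \<in> sets M" for n unfolding E_def by measurable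
    have "AE x in M. x \<in> E n \<longrightarrow> t h x = s x *\<^sub>v h x" for n
    proof -
      define \<phi> where "\<phi> j x = indicator (E n) x * vcoord h j x / complex_of_real (w x)" for j x
      have \<phi>m: "\<phi> j \<in> borel_measurable M" for j unfolding \<phi>_def by measurable
      have \<phi>b: "cmod (\<phi> j x) \<le> real n" if "j < n" "x \<in> space M" for j x
        using that w(2)[of x] by (auto simp: \<phi>_def E_def indicator_def norm_divide divide_le_eq)
      have "g n \<phi> x = indicator (E n) x \<cdot>\<^sub>v h x" if x: "x \<in> space M" for x
      proof (rule eq_vecI)
        fix i assume "i < dim_vec (indicator (E n) x \<cdot>\<^sub>v h x)"
        hence i: "i < d x" using VF_carrier[OF h x] by simp
        show "g n \<phi> x $ i = (indicator (E n) x \<cdot>\<^sub>v h x) $ i"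
          using i VF_carrier[OF h x] w(2)[of x] by (auto simp: g_def \<phi>_def indicator_def vcoord_eq E_def)
      qed (use VF_carrier[OF h x] in \<open>auto simp: g_def\<close>)
      hence "t (g n \<phi>) = t (\<lambda>x. indicator (E n) x \<cdot>\<^sub>v h x)" by (intro t_cong AE_I2)
      moreover have "AE x in M. t (\<lambda>x. indicator (E n) x \<cdot>\<^sub>v h x) x = indicator (E n) x \<cdot>\<^sub>v t h x"
        by (rule t_smult[where B = 1, OF _ _ h]) (auto simp: indicator_def)
      moreover have "AE x in M. t (g n \<phi>) x = Matrix.vec (d x) (\<lambda>i. \<Sum>j<n. \<phi> j x * t (b j) x $ i)"
        using \<phi>m \<phi>b by (rule tg)
      ultimately have "AE x in M. indicator (E n) x \<cdot>\<^sub>v t h x = Matrix.vec (d x) (\<lambda>i. \<Sum>j<n. \<phi> j x * t (b j) x $ i)"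
        by (auto elim: AE_mp)
      with AE_space show ?thesis
      proof eventually_elim
        case (elim x)
        show ?case
        proof
          assume xE: "x \<in> E n"
          have dn: "d x \<le> n" using xE by (simp add: E_def)
          have hx: "h x \<in> carrier_vec (d x)" by (rule VF_carrier[OF h elim(1)])
          have sx: "s x \<in> carrier_mat (d x) (d x)" by (simp add: s_def)
          have "t h x = indicator (E n) x \<cdot>\<^sub>v t h x" using xE by simp
          also have "\<dots> = Matrix.vec (d x) (\<lambda>i. \<Sum>j<n. \<phi> j x * t (b j) x $ i)" by (rule elim(2))
          also have "\<dots> = s x *\<^sub>v h x"
          proof (rule eq_vecI)
            fix i assume "i < dim_vec (s x *\<^sub>v h x)"
            hence i: "i < d x" by (simp add: s_def)
            have "(\<Sum>j<n. \<phi> j x * t (b j) x $ i) = (\<Sum>j<d x. \<phi> j x * t (b j) x $ i)"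
              using dn by (intro sum.mono_neutral_right) (auto simp: \<phi>_def vcoord_def)
            also have "\<dots> = (\<Sum>j<d x. s x $$ (i, j) * h x $ j)"
              using xE i by (intro sum.cong) (auto simp: \<phi>_def vcoord_eq s_def)
            finally show "Matrix.vec (d x) (\<lambda>i. \<Sum>j<n. \<phi> j x * t (b j) x $ i) $ i = (s x *\<^sub>v h x) $ i"
              using i mult_mat_vec_sum[OF sx hx i] by simp
          qed (simp add: s_def)
          finally show "t h x = s x *\<^sub>v h x" .
        qed
      qed
    qed
    hence "AE x in M. \<forall>n. x \<in> E n \<longrightarrow> t h x = s x *\<^sub>v h x" by (subst AE_all_countable) blast
    with AE_space show ?thesis
    proof eventually_elim
      case (elim x)
      \<comment> \<open>The sum dominates the dimension and every quotient of a coordinate by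
        \<open>w x\<close> at once.\<close>
      obtain n where n: "real (d x) + (\<Sum>j<d x. cmod (vcoord h j x) / w x) \<le> real n"
        using real_arch_simple by blast
      have S: "0 \<le> (\<Sum>j<d x. cmod (vcoord h j x) / w x)" using w(2)[of x] by (intro sum_nonneg) auto
      have "cmod (vcoord h j x) \<le> real n * w x" for j
      proof (cases "j < d x")
        case True
        have "cmod (vcoord h j x) / w x \<le> (\<Sum>j<d x. cmod (vcoord h j x) / w x)"
          using True w(2)[of x] by (intro member_le_sum) auto
        hence "cmod (vcoord h j x) / w x \<le> real n" using n by linarith
        thus ?thesis using w(2)[of x] by (simp add: divide_le_eq)
      qed (use w(2)[of x] in \<open>simp add: vcoord_def\<close>)
      moreover have "d x \<le> n" using n S by linarith
      ultimately have "x \<in> E n" using elim(1) by (simp add: E_def)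
      thus ?case using elim(2) by blast
    qed
  qed
  \<comment> \<open>The matrices were built column by column, without control of their norms; the
    bound is recovered from that of the operator by localisation.\<close>
  have "AE x in M. mat_norm (s x) \<le> C"
  proof (rule mat_norm_AE_le_if_weighted[OF s C w])
    fix h assume h: "h \<in> VF"
    have "AE x in M. vsq (t h x) \<le> C\<^sup>2 * vsq (h x)"
    proof (rule pointwise_bound[where t = t, OF tV tn _ h])
      fix E h assume "E \<in> sets M" "h \<in> VF"
      thus "AE x in M. t (\<lambda>x. indicator E x \<cdot>\<^sub>v h x) x = indicator E x \<cdot>\<^sub>v t h x"
        by (intro t_smult[where B = 1]) (auto simp: indicator_def)
    qed
    with ts[OF h] show "AE x in M. vsq (s x *\<^sub>v h x) \<le> C\<^sup>2 * vsq (h x)" by eventually_elim simp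
  qed
  hence sM: "s \<in> MF" using s by (rule MF_I[rotated])
  have "T a = mult_op M d (mcl s) a" if a: "a \<in> pts X" for a
  proof -
    obtain h where h: "h \<in> VF" "a = vcl h" using a by (auto simp: X_pts)
    have "T a = vcl (t h)" using h by (simp add: tcl)
    also have "\<dots> = vcl (\<lambda>x. s x *\<^sub>v h x)" by (rule ae_class_cong[OF ts[OF h(1)]])
    finally show ?thesis using h sM by (simp add: mult_op_class)
  qed
  with sM show ?thesis by blast
qed

text \<open>The difference \<open>z\<close>, truncated to the set where
  \<open>vsq (z x) \<le> n\<close>, is a bounded test field; pairing \<open>z\<close> with it gives
  the integral of \<open>vsq (z x)\<close> over this set.\<close>

lemma VF_eq_if_bounded_orthogonal:
  assumes h: "h \<in> VF" and k: "k \<in> VF"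
    and orth: "\<And>w B. \<lbrakk>w \<in> VF; \<And>x. x \<in> space M \<Longrightarrow> vsq (w x) \<le> B\<rbrakk> \<Longrightarrow>
      (\<integral>x. h x \<bullet>c w x \<partial>M) = (\<integral>x. k x \<bullet>c w x \<partial>M)"
  shows "AE x in M. h x = k x"
proof -
  define z where "z x = h x + (-1) \<cdot>\<^sub>v k x" for x
  have z: "z \<in> VF" unfolding z_def using h k by (intro VF_add VF_scale)
  note [measurable] = measurable_vsq[OF vec_fields_vmeas[OF z]]
  have "AE x in M. vsq (z x) \<le> real n \<longrightarrow> vsq (z x) = 0" for n
  proof -
    define w where "w x = indicator {x \<in> space M. vsq (z x) \<le> real n} x \<cdot>\<^sub>v z x" for x
    have w: "w \<in> VF" unfolding w_def by (rule VF_smult[where B = 1, OF _ z]) (auto simp: indicator_def)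
    have wb: "vsq (w x) \<le> real n" if "x \<in> space M" for x
      using that by (auto simp: w_def vsq_smult indicator_def)
    have zw: "z x \<bullet>c w x = h x \<bullet>c w x - k x \<bullet>c w x" if x: "x \<in> space M" for x
    proof -
      interpret hilbert "cvec (d x)" by (rule cvec_hilbert)
      show ?thesis
        using inner_add_left[of "h x" "(-1) \<cdot>\<^sub>v k x" "w x"] inner_scale_left[of "k x" "w x" "-1"]
          VF_carrier[OF h x] VF_carrier[OF k x] VF_carrier[OF w x] by (simp add: z_def)
    qed
    have "(\<integral>x. z x \<bullet>c w x \<partial>M) = (\<integral>x. h x \<bullet>c w x - k x \<bullet>c w x \<partial>M)"
      by (rule Bochner_Integration.integral_cong) (auto simp: zw)
    also have "\<dots> = 0" using orth[OF w wb] h k w by (simp add: VF_inner_integrable)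
    finally have "(\<integral>x. Re (z x \<bullet>c w x) \<partial>M) = 0"
      using integral_Re[OF VF_inner_integrable[OF z w]] by simp
    moreover have zwr: "Re (z x \<bullet>c w x) = indicator {x \<in> space M. vsq (z x) \<le> real n} x * vsq (z x)" if "x \<in> space M" for x
    proof -
      interpret hilbert "cvec (d x)" by (rule cvec_hilbert)
      show ?thesis
        using inner_scale_right[of "z x" "z x" "indicator {x \<in> space M. vsq (z x) \<le> real n} x"] VF_carrier[OF z that]
        by (auto simp: w_def indicator_def)
    qed
    ultimately have "AE x in M. Re (z x \<bullet>c w x) = 0"
      using VF_inner_integrable[OF z w]
      by (subst (asm) integral_nonneg_eq_0_iff_AE) (auto intro!: AE_I2 simp: zwr indicator_def)
    with AE_space show ?thesis by eventually_elim (auto simp: zwr indicator_def)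
  qed
  hence "AE x in M. \<forall>n. vsq (z x) \<le> real n \<longrightarrow> vsq (z x) = 0" by (subst AE_all_countable) blast
  with AE_space show ?thesis
  proof eventually_elim
    case (elim x)
    interpret hilbert "cvec (d x)" by (rule cvec_hilbert)
    note c = VF_carrier[OF h elim(1)] VF_carrier[OF k elim(1)] VF_carrier[OF z elim(1)]
    have "vsq (z x) = 0" using elim(2) real_arch_simple[of "vsq (z x)"] by blast
    hence "z x = 0\<^sub>v (d x)" using norm_eq_zero[of "z x"] c by (simp add: hnorm_cvec)
    hence "vdiff (cvec (d x)) (h x) (k x) = 0\<^sub>v (d x)" by (simp add: vdiff_def z_def)
    thus "h x = k x" using definite[of "h x" "k x"] c by simp
  qed
qed

end

section \<open>Finite-dimensional fibers\<close>

context hilbert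
begin

text \<open>A linear combination is described by its inner products, which avoids iterating the
  carrier-based addition.\<close>

lemma finite_combination:
  fixes n :: nat
  assumes e: "\<And>j. j < n \<Longrightarrow> e j \<in> W" and W: "W \<subseteq> pts E" "vzero E \<in> W"
    "\<And>x y. \<lbrakk>x \<in> W; y \<in> W\<rbrakk> \<Longrightarrow> vadd E x y \<in> W" "\<And>c x. x \<in> W \<Longrightarrow> vscale E c x \<in> W"
  shows "\<exists>x\<in>W. \<forall>y\<in>pts E. inner E x y = (\<Sum>j<n. a j * inner E (e j) y)"
  using e
proof (induction n)
  case 0
  thus ?case using W by (intro bexI[of _ "vzero E"]) auto
next
  case (Suc n)
  then obtain x where x: "x \<in> W" "\<forall>y\<in>pts E. inner E x y = (\<Sum>j<n. a j * inner E (e j) y)" by auto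
  have en: "e n \<in> W" using Suc.prems by simp
  have mem: "x \<in> pts E" "e n \<in> pts E" using x en W(1) by auto
  show ?case
    by (rule bexI[of _ "vadd E x (vscale E (a n) (e n))"]) (use x en W mem in auto)
qed

text \<open>Parseval's identity: the combination \<open>x'\<close> with the Fourier coefficients of
  \<open>x\<close> differs from \<open>x\<close> by a vector of \<open>W\<close> orthogonal to the
  basis, hence by zero.\<close>

lemma finite_basis_expansion:
  fixes n :: nat
  assumes W: "W \<subseteq> pts E" "vzero E \<in> W"
    "\<And>x y. \<lbrakk>x \<in> W; y \<in> W\<rbrakk> \<Longrightarrow> vadd E x y \<in> W" "\<And>c x. x \<in> W \<Longrightarrow> vscale E c x \<in> W"
    and basis: "orthonormal_basis E W {j. j < n} e" and x: "x \<in> W" and y: "y \<in> pts E"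
  shows "inner E x y = (\<Sum>j<n. inner E x (e j) * inner E (e j) y)"
proof -
  have e: "e j \<in> W" if "j < n" for j using basis that by (auto simp: orthonormal_basis_def)
  obtain x' where x': "x' \<in> W" "\<And>y. y \<in> pts E \<Longrightarrow> inner E x' y = (\<Sum>j<n. inner E x (e j) * inner E (e j) y)"
    using finite_combination[of n e W "\<lambda>j. inner E x (e j)", OF e W] by blast
  have mem: "x \<in> pts E" "x' \<in> pts E" using x x' W(1) by auto
  have "inner E (vdiff E x x') (e k) = 0" if k: "k < n" for k
  proof -
    have ek: "e k \<in> pts E" using e[OF k] W(1) by auto
    have "inner E x' (e k) = (\<Sum>j<n. if j = k then inner E x (e j) else 0)"
      unfolding x'(2)[OF ek] using basis k by (intro sum.cong) (auto simp: orthonormal_basis_def)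
    also have "\<dots> = inner E x (e k)" using k by simp
    finally show ?thesis using mem ek by simp
  qed
  moreover have "vdiff E x x' \<in> W" unfolding vdiff_def by (intro W(3,4) x x')
  ultimately have "vdiff E x x' = vzero E" using basis by (auto simp: orthonormal_basis_def)
  hence "x = x'" using mem by (intro definite) auto
  thus ?thesis using x'(2)[OF y] by simp
qed

lemma dense_total:
  assumes D: "D \<subseteq> pts E" and dense: "\<And>x e. \<lbrakk>x \<in> pts E; e > 0\<rbrakk> \<Longrightarrow> \<exists>y\<in>D. hnorm E (vdiff E x y) < e"
  shows "total_set E D"
  unfolding total_set_def
proof (intro conjI allI impI D)
  fix W assume W: "closed_subspace E W" and DW: "D \<subseteq> W"
  show "W = pts E"
  proof
    show "W \<subseteq> pts E" by (rule closed_subspaceD(1)[OF W])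
    show "pts E \<subseteq> W"
    proof
      fix x assume x: "x \<in> pts E"
      have "\<exists>y\<in>D. hnorm E (vdiff E x y) < 1 / real (Suc n)" for n by (rule dense[OF x]) simp
      then obtain s where s: "\<And>n. s n \<in> D" "\<And>n. hnorm E (vdiff E x (s n)) < 1 / real (Suc n)" by metis
      have sE: "s n \<in> pts E" for n using s(1) D by auto
      have lim: "(\<lambda>n. hnorm E (vdiff E (s n) x)) \<longlonglongrightarrow> 0"
      proof (rule Lim_null_comparison[OF _ LIMSEQ_Suc[OF lim_1_over_n]], rule always_eventually, rule allI)
        fix n
        have "0 \<le> hnorm E (vdiff E (s n) x)" using sE x by simp
        thus "norm (hnorm E (vdiff E (s n) x)) \<le> 1 / real (Suc n)"
          using s(2)[of n] diff_swap[OF sE[of n] x] by simp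
      qed
      show "x \<in> W" by (rule closed_subspace_limit[OF W subsetD[OF DW s(1)] x lim])
    qed
  qed
qed

end

text \<open>A vector with \<open>inner E w w \<noteq> 0\<close> normalises to an orthonormal set
  with one element. This describes \<open>Omega\<close> as the set of points with a nonzero
  fiber.\<close>

lemma hdim_pos_iff:
  assumes E: "hilbert E" and W: "W \<subseteq> pts E" "\<And>c x. x \<in> W \<Longrightarrow> vscale E c x \<in> W"
  shows "0 < hdim E W \<longleftrightarrow> (\<exists>w\<in>W. inner E w w \<noteq> 0)"
proof -
  interpret hilbert E by fact
  show ?thesis
  proof
    assume "0 < hdim E W"
    then obtain B where B: "finite B" "B \<subseteq> W" "\<forall>x\<in>B. \<forall>y\<in>B. inner E x y = (if x = y then 1 else 0)" "0 < enat (card B)"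
      unfolding hdim_def less_Sup_iff by blast
    have "B \<noteq> {}" using B(4) by (auto simp: enat_0)
    thus "\<exists>w\<in>W. inner E w w \<noteq> 0" using B(2,3) by fastforce
  next
    assume "\<exists>w\<in>W. inner E w w \<noteq> 0"
    then obtain w where w: "w \<in> W" "inner E w w \<noteq> 0" by blast
    have wE: "w \<in> pts E" using w W by auto
    have n: "hnorm E w \<noteq> 0" using w(2) inner_self[OF wE] by auto
    let ?u = "vscale E (of_real (1 / hnorm E w)) w"
    have "inner E ?u ?u = 1" using n wE by (simp add: inner_self[OF wE] power2_eq_square)
    hence "enat 1 \<le> hdim E W"
      unfolding hdim_def using W(2)[OF w(1)] by (intro Sup_upper) (auto intro!: exI[of _ "{?u}"])
    moreover have "0 < enat 1" by (simp add: zero_enat_def)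
    ultimately show "0 < hdim E W" by (rule less_le_trans[rotated])
  qed
qed

section \<open>Slices of elements of L2 of a product\<close>

context pair_sigma_finite
begin

lemma slice_eqI:
  assumes a: "a \<in> pts (L2 (M1 \<Otimes>\<^sub>M M2))" and b: "b \<in> pts (L2 (M1 \<Otimes>\<^sub>M M2))"
    and eq: "AE x in M1. slice M2 a x = slice M2 b x"
  shows "a = b"
proof (rule L2_eqI[OF a b])
  have [measurable]: "rep a \<in> borel_measurable (M1 \<Otimes>\<^sub>M M2)" "rep b \<in> borel_measurable (M1 \<Otimes>\<^sub>M M2)"
    using rep_sq_int[OF a] rep_sq_int[OF b] by (auto simp: sq_int_def)
  have "AE x in M1. AE y in M2. rep a (x, y) = rep b (x, y)"
    using sq_int_sections[OF rep_sq_int[OF a]] eq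
    by eventually_elim (unfold slice_def, rule ae_class_eqD)
  thus "AE z in M1 \<Otimes>\<^sub>M M2. rep a z = rep b z"
    by (rule AE_pair_measure[rotated]) measurable
qed

lemma slice_mem:
  assumes "a \<in> pts (L2 (M1 \<Otimes>\<^sub>M M2))" shows "AE x in M1. slice M2 a x \<in> pts (L2 M2)"
  using sq_int_sections[OF rep_sq_int[OF assms]] by eventually_elim (simp add: slice_def)

lemma slice_add:
  assumes a: "a \<in> pts (L2 (M1 \<Otimes>\<^sub>M M2))" and b: "b \<in> pts (L2 (M1 \<Otimes>\<^sub>M M2))"
  shows "AE x in M1. slice M2 (vadd (L2 (M1 \<Otimes>\<^sub>M M2)) a b) x = vadd (L2 M2) (slice M2 a x) (slice M2 b x)"
proof -
  have "vadd (L2 (M1 \<Otimes>\<^sub>M M2)) a b = L2_class (M1 \<Otimes>\<^sub>M M2) (\<lambda>z. rep a z + rep b z)"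
    using L2_add[OF rep_sq_int[OF a] rep_sq_int[OF b]] a b by (simp add: L2_class_rep)
  note eq = this
  from slice_class[OF sq_int_add[OF rep_sq_int[OF a] rep_sq_int[OF b]]]
    sq_int_sections[OF rep_sq_int[OF a]] sq_int_sections[OF rep_sq_int[OF b]]
  show ?thesis
  proof eventually_elim
    case (elim x)
    show ?case unfolding eq elim(1) by (simp add: slice_def L2_add[OF elim(2,3)])
  qed
qed

lemma slice_mul:
  assumes a: "a \<in> pts (L2 (M1 \<Otimes>\<^sub>M M2))" and \<phi>: "\<phi> \<in> borel_measurable M1" "\<And>x. x \<in> space M1 \<Longrightarrow> cmod (\<phi> x) \<le> B"
  shows "AE x in M1. slice M2 (mul_op (M1 \<Otimes>\<^sub>M M2) (\<lambda>z. \<phi> (fst z)) a) x = vscale (L2 M2) (\<phi> x) (slice M2 a x)"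
proof -
  have "(\<lambda>z. \<phi> (fst z) * rep a z) \<in> sq_int (M1 \<Otimes>\<^sub>M M2)"
    using \<phi> by (intro sq_int_bounded_mult'[where C = B] rep_sq_int a) (auto simp: space_pair_measure)
  from slice_class[OF this] sq_int_sections[OF rep_sq_int[OF a]]
  show ?thesis
  proof eventually_elim
    case (elim x)
    show ?case unfolding mul_op_def elim(1) by (simp add: slice_def L2_scale[OF elim(2)])
  qed
qed

text \<open>Scalars are constant multipliers, so homogeneity of the coefficient map becomes a case
  of its compatibility with multipliers.\<close>

lemma L2_scale_mul:
  assumes "a \<in> pts (L2 M)" shows "vscale (L2 M) c a = mul_op M (\<lambda>_. c) a"
  using L2_scale[OF rep_sq_int[OF assms], of c] assms by (simp add: mul_op_def L2_class_rep)

end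

section \<open>The spectral representation\<close>

locale translation_setting = lca_group_dual \<nu> \<nu>' F
  for \<nu> :: "'g::topological_ab_group_add measure" and \<nu>' :: "('g \<Rightarrow> complex) measure" and F +
  fixes lam :: "'y measure"
    and FI :: "('g \<times> 'y \<Rightarrow> complex) set \<Rightarrow> (('g \<Rightarrow> complex) \<times> 'y \<Rightarrow> complex) set"
    and H :: "('g \<times> 'y \<Rightarrow> complex) set set"
    and Phat :: "('g \<Rightarrow> complex) \<Rightarrow> ('y \<Rightarrow> complex) set \<Rightarrow> ('y \<Rightarrow> complex) set"
    and q :: "nat \<Rightarrow> ('g \<Rightarrow> complex) \<Rightarrow> 'y \<Rightarrow> complex"
  assumes lam_sigma_finite: "sigma_finite_measure lam"
    and lam_separable: "separable_hspace (L2 lam)"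
    and FI_tensor: "is_tensor_op \<nu> lam \<nu>' lam F (\<lambda>b. b) FI"
    and H_closed: "closed_subspace (L2 (\<nu> \<Otimes>\<^sub>M lam)) H"
    and H_invariant: "\<And>a f. f \<in> H \<Longrightarrow> translation \<nu> lam a f \<in> H"
    and Phat_projection: "\<And>\<xi>. \<xi> \<in> dual_group \<Longrightarrow> is_orthogonal_projection (L2 lam) (Phat \<xi>)"
    and Phat_integral: "is_direct_integral_of \<nu>' lam (hat_projection \<nu> lam \<nu>' FI H) Phat"
    and q_basis: "is_fiber_basis \<nu>' lam Phat q"
    and fiber_finite: "\<And>\<xi>. \<xi> \<in> Omega \<nu>' lam Phat \<Longrightarrow> fiber_dim lam Phat \<xi> < \<infinity>"
begin

sublocale N: sigma_finite_measure lam by (rule lam_sigma_finite)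
sublocale D: sigma_finite_measure \<nu>' by (rule dual_sigma_finite)
sublocale P: pair_sigma_finite \<nu> lam ..
sublocale P': pair_sigma_finite \<nu>' lam ..

abbreviation "K \<equiv> L2 (\<nu> \<Otimes>\<^sub>M lam)"
abbreviation "K' \<equiv> L2 (\<nu>' \<Otimes>\<^sub>M lam)"
abbreviation "L \<equiv> L2 lam"
abbreviation "\<Omega> \<equiv> Omega \<nu>' lam Phat"
abbreviation "\<omega> \<equiv> OmegaM \<nu>' lam Phat"
abbreviation "dm \<equiv> fdim lam Phat"
abbreviation "fib \<equiv> fiber lam Phat"

sublocale K: hilbert K by (rule L2_hilbert)
sublocale K': hilbert K' by (rule L2_hilbert)
sublocale L: hilbert L by (rule L2_hilbert)

lemma FI_unitary: "unitary_op K K' FI"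
  by (rule tensor_op_unitary[OF P.pair_sigma_finite_axioms D.sigma_finite_measure_axioms F_unitary FI_tensor])

lemma FI_lin: "linear_map K K' FI" and FI_inner: "\<lbrakk>x \<in> pts K; y \<in> pts K\<rbrakk> \<Longrightarrow> inner K' (FI x) (FI y) = inner K x y"
  using FI_unitary unfolding unitary_op_def by blast+

lemma FI_bounded: "bounded_op K K' FI"
  using FI_tensor by (simp add: is_tensor_op_def)

subsection \<open>Translations\<close>

abbreviation tau :: "'g \<Rightarrow> 'g \<times> 'y \<Rightarrow> 'g \<times> 'y" where "tau a \<equiv> \<lambda>(u, v). (u - a, v)"

lemma tau_measurable: "tau a \<in> measurable (\<nu> \<Otimes>\<^sub>M lam) (\<nu> \<Otimes>\<^sub>M lam)"
  unfolding case_prod_unfold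
  by (rule measurable_Pair[OF measurable_compose[OF measurable_fst translation_measurable] measurable_snd])

lemma tau_distr: "distr (\<nu> \<Otimes>\<^sub>M lam) (\<nu> \<Otimes>\<^sub>M lam) (tau a) = \<nu> \<Otimes>\<^sub>M lam"
proof -
  have id: "distr lam lam (\<lambda>v. v) = lam" by (rule distr_id)
  have "distr \<nu> \<nu> (\<lambda>u. u - a) \<Otimes>\<^sub>M distr lam lam (\<lambda>v. v) =
      distr (\<nu> \<Otimes>\<^sub>M lam) (\<nu> \<Otimes>\<^sub>M lam) (\<lambda>(u, v). (u - a, v))"
    by (rule pair_measure_distr[OF translation_measurable]) (simp_all add: id lam_sigma_finite)
  thus ?thesis by (simp add: translation_distr id)
qed

lemma translation_comp: "translation \<nu> lam a = comp_op (\<nu> \<Otimes>\<^sub>M lam) (tau a)"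
  unfolding translation_def comp_op_def by (intro ext arg_cong[where f = "L2_class _"]) auto

lemma translation_bounded: "bounded_op K K (translation \<nu> lam a)"
  unfolding translation_comp by (rule comp_op_bounded[OF tau_measurable tau_distr])

lemma translation_adjoint:
  "\<lbrakk>f \<in> pts K; g \<in> pts K\<rbrakk> \<Longrightarrow> inner K (translation \<nu> lam a f) g = inner K f (translation \<nu> lam (- a) g)"
  unfolding translation_comp
  by (rule comp_op_adjoint[OF tau_measurable tau_distr tau_measurable tau_distr]) auto

lemma char_mul_bounded: "bounded_op K' K' (mul_op (\<nu>' \<Otimes>\<^sub>M lam) (\<lambda>z. cnj (fst z a)))"
proof (rule mul_op_bounded[where C = 1])
  show "(\<lambda>z. cnj (fst z a)) \<in> borel_measurable (\<nu>' \<Otimes>\<^sub>M lam)"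
    by (intro borel_measurable_cnj measurable_compose[OF measurable_fst char_eval_measurable])
qed (auto simp: space_pair_measure char_norm)

text \<open>Both sides are bounded in \<open>f\<close>, so rectangles suffice. There translation
  moves only the first factor, whose indicator is integrable, so that the rule for the transform
  integral of a translate applies.\<close>

lemma FI_translation:
  assumes f: "f \<in> pts K"
  shows "FI (translation \<nu> lam a f) = mul_op (\<nu>' \<Otimes>\<^sub>M lam) (\<lambda>z. cnj (fst z a)) (FI f)"
proof (rule bounded_op_eq_on_total[OF L2_hilbert L2_hilbert _ _ P.rectangles_total _ f])
  show "bounded_op K K' (\<lambda>f. FI (translation \<nu> lam a f))"
    by (rule bounded_op_compose[OF L2_hilbert translation_bounded FI_bounded L2_hilbert])
  show "bounded_op K K' (\<lambda>f. mul_op (\<nu>' \<Otimes>\<^sub>M lam) (\<lambda>z. cnj (fst z a)) (FI f))"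
    by (rule bounded_op_compose[OF L2_hilbert FI_bounded char_mul_bounded L2_hilbert])
  fix x assume "x \<in> {elem_tensor \<nu> lam (L2_class \<nu> (indicator A)) (L2_class lam (indicator B)) |A B.
      A \<in> sets \<nu> \<and> emeasure \<nu> A < \<infinity> \<and> B \<in> sets lam \<and> emeasure lam B < \<infinity>}"
  then obtain A B where x: "x = elem_tensor \<nu> lam (L2_class \<nu> (indicator A)) (L2_class lam (indicator B))"
    and A: "A \<in> sets \<nu>" "emeasure \<nu> A < \<infinity>" and B: "B \<in> sets lam" "emeasure lam B < \<infinity>" by blast
  let ?A = "\<lambda>u. indicator A u :: complex" and ?B = "\<lambda>v. indicator B v :: complex"
  have sA: "?A \<in> sq_int \<nu>" and sB: "?B \<in> sq_int lam" using A B by (auto intro: sq_int_indicator)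
  have iA: "integrable \<nu> ?A" using A by (rule integrable_indicator_complex)
  have sAt: "(\<lambda>u. ?A (u - a)) \<in> sq_int \<nu>"
    by (rule sq_int_comp(1)[OF sA translation_measurable translation_distr])
  have "integrable (distr \<nu> \<nu> (\<lambda>u. u - a)) ?A" unfolding translation_distr by (rule iA)
  hence iAt: "integrable \<nu> (\<lambda>u. ?A (u - a))" by (rule integrable_distr[OF translation_measurable])
  have FIe: "FI (elem_tensor \<nu> lam (L2_class \<nu> f) (L2_class lam ?B)) =
      L2_class (\<nu>' \<Otimes>\<^sub>M lam) (\<lambda>(\<xi>, v). fourier1 \<nu> f \<xi> * ?B v)"
    if "f \<in> sq_int \<nu>" "integrable \<nu> f" for f
  proof -
    have "FI (elem_tensor \<nu> lam (L2_class \<nu> f) (L2_class lam ?B)) = elem_tensor \<nu>' lam (F (L2_class \<nu> f)) (L2_class lam ?B)"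
      using FI_tensor that sB unfolding is_tensor_op_def by (auto simp del: L2_pts)
    thus ?thesis using P'.elem_tensor_class[OF F_sq_int[OF that] sB] by (simp add: F_class that)
  qed
  have "translation \<nu> lam a x = L2_class (\<nu> \<Otimes>\<^sub>M lam) (\<lambda>z. (\<lambda>(u, v). ?A u * ?B v) (tau a z))"
    unfolding x P.elem_tensor_class[OF sA sB] translation_comp
    by (rule comp_op_class[OF P.tensor_sq_int[OF sA sB] tau_measurable tau_distr])
  also have "\<dots> = elem_tensor \<nu> lam (L2_class \<nu> (\<lambda>u. ?A (u - a))) (L2_class lam ?B)"
    unfolding P.elem_tensor_class[OF sAt sB] by (intro arg_cong[where f = "L2_class _"]) auto
  finally have "FI (translation \<nu> lam a x) = L2_class (\<nu>' \<Otimes>\<^sub>M lam) (\<lambda>(\<xi>, v). fourier1 \<nu> (\<lambda>u. ?A (u - a)) \<xi> * ?B v)"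
    using FIe[OF sAt iAt] by simp
  also have "\<dots> = L2_class (\<nu>' \<Otimes>\<^sub>M lam) (\<lambda>z. cnj (fst z a) * (\<lambda>(\<xi>, v). fourier1 \<nu> ?A \<xi> * ?B v) z)"
    by (rule ae_class_cong, rule AE_I2) (auto simp: space_pair_measure fourier1_translate[OF iA])
  also have "\<dots> = mul_op (\<nu>' \<Otimes>\<^sub>M lam) (\<lambda>z. cnj (fst z a)) (FI x)"
    unfolding x FIe[OF sA iA] by (rule mul_op_class[OF P'.tensor_sq_int[OF F_sq_int[OF sA iA] sB], symmetric])
  finally show "FI (translation \<nu> lam a x) = mul_op (\<nu>' \<Otimes>\<^sub>M lam) (\<lambda>z. cnj (fst z a)) (FI x)" .
qed

subsection \<open>Fibers\<close>

lemma Phat_bounded: "\<xi> \<in> dual_group \<Longrightarrow> bounded_op L L (Phat \<xi>)"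
  and Phat_idem: "\<lbrakk>\<xi> \<in> dual_group; x \<in> pts L\<rbrakk> \<Longrightarrow> Phat \<xi> (Phat \<xi> x) = Phat \<xi> x"
  using Phat_projection[of \<xi>] by (auto simp: is_orthogonal_projection_def)

lemma fib_subspace:
  assumes \<xi>: "\<xi> \<in> dual_group"
  shows "fib \<xi> \<subseteq> pts L" "vzero L \<in> fib \<xi>" "\<lbrakk>x \<in> fib \<xi>; y \<in> fib \<xi>\<rbrakk> \<Longrightarrow> vadd L x y \<in> fib \<xi>"
    "x \<in> fib \<xi> \<Longrightarrow> vscale L c x \<in> fib \<xi>" "x \<in> fib \<xi> \<Longrightarrow> Phat \<xi> x = x"
proof -
  note P = bounded_opD[OF Phat_bounded[OF \<xi>]]
  show "fib \<xi> \<subseteq> pts L" using P(1) by (auto simp: fiber_def)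
  \<comment> \<open>The zero vector is written as a multiple of itself so that homogeneity of
    \<open>Phat \<xi>\<close> shows it to be fixed.\<close>
  have z: "vscale L 0 (vzero L) = vzero L" by (rule L.vec_eqI) auto
  have "vscale L 0 (Phat \<xi> (vzero L)) = vzero L" by (rule L.vec_eqI) (auto simp: P(1))
  hence "Phat \<xi> (vzero L) = vzero L" using P(3)[of "vzero L" 0] by (simp add: z)
  thus "vzero L \<in> fib \<xi>" unfolding fiber_def by (metis L.zero_mem image_eqI)
  show "vadd L x y \<in> fib \<xi>" if "x \<in> fib \<xi>" "y \<in> fib \<xi>"
    using that unfolding fiber_def by (auto simp flip: P(2))
  show "vscale L c x \<in> fib \<xi>" if "x \<in> fib \<xi>"
    using that unfolding fiber_def by (auto simp flip: P(3))
  show "Phat \<xi> x = x" if "x \<in> fib \<xi>" using that Phat_idem[OF \<xi>] unfolding fiber_def by auto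
qed

lemma H_sub: "f \<in> H \<Longrightarrow> f \<in> pts K"
  using closed_subspaceD(1)[OF H_closed] by blast

lemma hat_projection_FI: "f \<in> pts K \<Longrightarrow> hat_projection \<nu> lam \<nu>' FI H (FI f) = FI (projection_onto K H f)"
  unfolding hat_projection_def by (simp add: K.adjoint_unitary(1)[OF FI_unitary])

lemma slice_hat:
  "g \<in> pts K' \<Longrightarrow> AE \<xi> in \<nu>'. slice lam (hat_projection \<nu> lam \<nu>' FI H g) \<xi> = Phat \<xi> (slice lam g \<xi>)"
  using Phat_integral unfolding is_direct_integral_of_def by blast

lemma slice_in_fiber:
  assumes f: "f \<in> H" shows "AE \<xi> in \<nu>'. slice lam (FI f) \<xi> \<in> fib \<xi>"
proof -
  have g: "FI f \<in> pts K'" by (rule linear_mapD(1)[OF FI_lin H_sub[OF f]])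
  have "hat_projection \<nu> lam \<nu>' FI H (FI f) = FI f"
    using hat_projection_FI[OF H_sub[OF f]] K.projection_ident[OF H_closed f] by simp
  with slice_hat[OF g] have "AE \<xi> in \<nu>'. slice lam (FI f) \<xi> = Phat \<xi> (slice lam (FI f) \<xi>)" by simp
  with P'.slice_mem[OF g] show ?thesis
    by eventually_elim (metis fiber_def image_eqI)
qed

text \<open>Together with \<open>slice_in_fiber\<close> this identifies the transform of
  \<open>H\<close> with the fields that take their values in the fibers. The transform of the
  projection of \<open>f\<close> has the slices \<open>Phat \<xi> (slice lam g \<xi>)\<close>, and
  these are the slices of \<open>g\<close>, since \<open>Phat \<xi>\<close> fixes the fiber.\<close>

lemma in_FI_H:
  assumes g: "g \<in> pts K'" and s: "AE \<xi> in \<nu>'. slice lam g \<xi> \<in> fib \<xi>"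
  shows "g \<in> FI ` H"
proof -
  obtain f where f: "f \<in> pts K" "g = FI f"
    using FI_unitary g unfolding unitary_op_def by blast
  let ?p = "projection_onto K H f"
  have p: "?p \<in> H" by (rule K.projection_mem[OF H_closed f(1)])
  have "AE \<xi> in \<nu>'. slice lam (FI ?p) \<xi> = slice lam g \<xi>"
    using slice_hat[OF g] s AE_space
  proof eventually_elim
    case (elim \<xi>)
    thus ?case using fib_subspace(5)[of \<xi>] hat_projection_FI[OF f(1)] f(2) by simp
  qed
  hence "FI ?p = g" using linear_mapD(1)[OF FI_lin H_sub[OF p]] g by (intro P'.slice_eqI) auto
  thus ?thesis using p by blast
qed

end

section \<open>Measurability of the support and of the fiber dimension\<close>

context translation_setting
begin

lemma Omega_iff: "\<xi> \<in> \<Omega> \<longleftrightarrow> \<xi> \<in> dual_group \<and> (\<exists>w\<in>fib \<xi>. inner L w w \<noteq> 0)"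
  unfolding Omega_def fiber_dim_def
  using hdim_pos_iff[OF L2_hilbert fib_subspace(1,4)] by auto

lemma fiber_outside_Omega: "\<lbrakk>\<xi> \<in> dual_group; \<xi> \<notin> \<Omega>; w \<in> fib \<xi>\<rbrakk> \<Longrightarrow> w = vzero L"
  using fib_subspace(1)[of \<xi>] L.eq_zeroI[of w] Omega_iff[of \<xi>] by blast

lemma Omega_dual: "\<xi> \<in> \<Omega> \<Longrightarrow> \<xi> \<in> dual_group"
  by (simp add: Omega_iff)

text \<open>A fiber is nonzero exactly if some matrix coefficient of \<open>Phat \<xi>\<close>
  between vectors of a countable dense set is nonzero. Separability of \<open>L\<close> thus gives a
  countable union of measurable conditions.\<close>

lemma Omega_sets: "\<Omega> \<in> sets \<nu>'"
proof -
  obtain S where S: "countable S" "S \<subseteq> pts L" "\<And>x e. \<lbrakk>x \<in> pts L; e > 0\<rbrakk> \<Longrightarrow> \<exists>y\<in>S. hnorm L (vdiff L x y) < e"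
    using lam_separable unfolding separable_hspace_def by blast
  have tot: "total_set L S" by (rule L.dense_total[OF S(2,3)])
  have zero: "bounded_op L L (\<lambda>_. vzero L)"
  proof -
    have "vadd L (vzero L) (vzero L) = vzero L" "vscale L k (vzero L) = vzero L" for k
      by (rule L.vec_eqI; simp)+
    thus ?thesis unfolding bounded_op_def linear_map_def by (auto intro!: exI[of _ 0])
  qed
  have "\<Omega> = (\<Union>(x, y)\<in>S \<times> S. {\<xi> \<in> space \<nu>'. inner L (Phat \<xi> x) y \<noteq> 0})"
  proof (intro equalityI subsetI)
    fix \<xi> assume "\<xi> \<in> (\<Union>(x, y)\<in>S \<times> S. {\<xi> \<in> space \<nu>'. inner L (Phat \<xi> x) y \<noteq> 0})"
    then obtain x y where xy: "x \<in> S" "y \<in> S" and \<xi>: "\<xi> \<in> dual_group" and nz: "inner L (Phat \<xi> x) y \<noteq> 0" by auto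
    have mem: "x \<in> pts L" "y \<in> pts L" using xy S(2) by auto
    have f: "Phat \<xi> x \<in> fib \<xi>" using mem by (auto simp: fiber_def)
    have "Phat \<xi> x \<noteq> vzero L" using nz mem by auto
    hence "inner L (Phat \<xi> x) (Phat \<xi> x) \<noteq> 0"
      using L.eq_zeroI[of "Phat \<xi> x"] bounded_opD(1)[OF Phat_bounded[OF \<xi>] mem(1)] by blast
    thus "\<xi> \<in> \<Omega>" using f \<xi> by (auto simp: Omega_iff)
  next
    fix \<xi> assume "\<xi> \<in> \<Omega>"
    then obtain w where \<xi>: "\<xi> \<in> dual_group" and w: "w \<in> fib \<xi>" "inner L w w \<noteq> 0" by (auto simp: Omega_iff)
    have wL: "w \<in> pts L" using w(1) fib_subspace(1)[OF \<xi>] by auto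
    show "\<xi> \<in> (\<Union>(x, y)\<in>S \<times> S. {\<xi> \<in> space \<nu>'. inner L (Phat \<xi> x) y \<noteq> 0})"
    proof (rule ccontr)
      assume "\<not> ?thesis"
      hence z: "inner L (Phat \<xi> x) y = 0" if "x \<in> S" "y \<in> S" for x y using that \<xi> by auto
      \<comment> \<open>Vanishing of the coefficients extends from \<open>S\<close> to all
        \<open>x\<close>, in particular to \<open>w\<close>, which \<open>Phat \<xi>\<close> fixes.
        A second appeal to density then gives \<open>inner L w w = 0\<close>.\<close>
      have z1: "inner L (Phat \<xi> x) y = 0" if y: "y \<in> S" and x: "x \<in> pts L" for x y
      proof -
        have yL: "y \<in> pts L" using y S(2) by auto
        have "S \<subseteq> {x \<in> pts L. inner L (Phat \<xi> x) y = inner L (vzero L) y}" using z y S(2) yL by auto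
        from total_setD[OF tot closed_subspace_inner_eq[OF L2_hilbert L2_hilbert L2_hilbert Phat_bounded[OF \<xi>] zero yL yL] this x]
        show ?thesis using yL by simp
      qed
      have "S \<subseteq> {y \<in> pts L. inner L y w = inner L (vzero L) w}"
      proof
        fix y assume y: "y \<in> S"
        have yL: "y \<in> pts L" using y S(2) by auto
        have "inner L w y = 0" using z1[OF y wL] fib_subspace(5)[OF \<xi> w(1)] by simp
        thus "y \<in> {y \<in> pts L. inner L y w = inner L (vzero L) w}" using L.inner_commute[OF yL wL] yL wL by simp
      qed
      from total_setD[OF tot closed_subspace_inner_eq[OF L2_hilbert L2_hilbert L2_hilbert bounded_op_id zero wL wL] this wL]
      show False using w(2) wL by simp
    qed
  qed
  also have "\<dots> \<in> sets \<nu>'"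
  proof (rule sets.countable_UN'')
    fix p assume "p \<in> S \<times> S"
    then obtain x y where p: "p = (x, y)" "x \<in> S" "y \<in> S" by auto
    have "(\<lambda>\<xi>. inner L (Phat \<xi> x) y) \<in> borel_measurable \<nu>'"
      using Phat_integral p S(2) unfolding is_direct_integral_of_def by blast
    hence "{\<xi> \<in> space \<nu>'. inner L (Phat \<xi> x) y \<noteq> 0} \<in> sets \<nu>'" by measurable
    thus "(case p of (x, y) \<Rightarrow> {\<xi> \<in> space \<nu>'. inner L (Phat \<xi> x) y \<noteq> 0}) \<in> sets \<nu>'" by (simp add: p)
  qed (use S(1) in simp)
  finally show ?thesis .
qed

lemma Omega_Int_space: "\<Omega> \<inter> space \<nu>' \<in> sets \<nu>'"
  using Omega_sets sets.top by (rule sets.Int)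

lemma space_omega [simp]: "space \<omega> = \<Omega>"
  using Omega_dual by (auto simp: space_restrict_space)

abbreviation qc :: "nat \<Rightarrow> ('g \<Rightarrow> complex) \<Rightarrow> ('y \<Rightarrow> complex) set" where
  "qc j \<xi> \<equiv> L2_class lam (q j \<xi>)"

lemma q_measurable: "(\<lambda>(\<xi>, v). q j \<xi> v) \<in> borel_measurable (\<omega> \<Otimes>\<^sub>M lam)"
  using q_basis unfolding is_fiber_basis_def by blast

lemma q_sq_int: "\<xi> \<in> \<Omega> \<Longrightarrow> q j \<xi> \<in> sq_int lam"
  using q_basis unfolding is_fiber_basis_def by blast

lemma less_fiber_dim_iff:
  assumes "\<xi> \<in> \<Omega>" shows "enat j < fiber_dim lam Phat \<xi> \<longleftrightarrow> j < dm \<xi>"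
  using fiber_finite[OF assms] by (cases "fiber_dim lam Phat \<xi>") auto

lemma q_orthonormal:
  assumes \<xi>: "\<xi> \<in> \<Omega>" shows "orthonormal_basis L (fib \<xi>) {j. j < dm \<xi>} (\<lambda>j. qc j \<xi>)"
proof -
  have "orthonormal_basis L (fib \<xi>) {j. enat j < fiber_dim lam Phat \<xi>} (\<lambda>j. qc j \<xi>)"
    using q_basis \<xi> unfolding is_fiber_basis_def by blast
  thus ?thesis unfolding less_fiber_dim_iff[OF \<xi>] .
qed

lemma q_zero:
  assumes \<xi>: "\<xi> \<in> \<Omega>" and j: "dm \<xi> \<le> j" shows "qc j \<xi> = vzero L"
proof -
  have "fiber_dim lam Phat \<xi> \<le> enat j \<Longrightarrow> qc j \<xi> = vzero L"
    using q_basis \<xi> unfolding is_fiber_basis_def by blast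
  thus ?thesis using j unfolding not_less[symmetric] less_fiber_dim_iff[OF \<xi>] by blast
qed

lemma q_norm: "\<xi> \<in> \<Omega> \<Longrightarrow> (\<integral>v. (cmod (q j \<xi> v))\<^sup>2 \<partial>lam) = (if j < dm \<xi> then 1 else 0)"
proof -
  assume \<xi>: "\<xi> \<in> \<Omega>"
  have "complex_of_real (\<integral>v. (cmod (q j \<xi> v))\<^sup>2 \<partial>lam) = inner L (qc j \<xi>) (qc j \<xi>)"
    using q_sq_int[OF \<xi>] by (simp add: L2_inner integral_mult_cnj_self)
  also have "\<dots> = (if j < dm \<xi> then 1 else 0)"
  proof (cases "j < dm \<xi>")
    case True
    thus ?thesis using q_orthonormal[OF \<xi>] unfolding orthonormal_basis_def by simp
  next
    case False
    thus ?thesis using q_zero[OF \<xi>, of j] by simp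
  qed
  finally show "(\<integral>v. (cmod (q j \<xi> v))\<^sup>2 \<partial>lam) = (if j < dm \<xi> then 1 else 0)"
    by (simp split: if_splits)
qed

text \<open>The squared norm of \<open>q j \<xi>\<close> is 1 or 0 according to whether
  \<open>j < dm \<xi>\<close>, so measurability of the basis fields makes the dimension
  measurable.\<close>

lemma dm_measurable: "dm \<in> measurable \<omega> (count_space UNIV)"
proof -
  have "(\<lambda>(\<xi>, v). (cmod (q j \<xi> v))\<^sup>2) \<in> borel_measurable (\<omega> \<Otimes>\<^sub>M lam)" for j
    using measurable_compose[OF q_measurable[of j], of "\<lambda>z. (cmod z)\<^sup>2" borel] by (simp add: case_prod_unfold)
  hence n: "(\<lambda>\<xi>. \<integral>v. (cmod (q j \<xi> v))\<^sup>2 \<partial>lam) \<in> borel_measurable \<omega>" for j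
    by (rule N.borel_measurable_lebesgue_integral)
  have lt: "{\<xi> \<in> space \<omega>. j < dm \<xi>} \<in> sets \<omega>" for j
  proof -
    have "{\<xi> \<in> space \<omega>. j < dm \<xi>} = {\<xi> \<in> space \<omega>. (\<integral>v. (cmod (q j \<xi> v))\<^sup>2 \<partial>lam) \<noteq> 0}"
      by (auto simp: q_norm split: if_splits)
    also have "\<dots> \<in> sets \<omega>" using n[of j] by measurable
    finally show ?thesis .
  qed
  have "dm -` {m} \<inter> space \<omega> \<in> sets \<omega>" for m
  proof -
    \<comment> \<open>The case \<open>m = 0\<close> is separate because subtraction of natural
      numbers truncates \<open>m - 1\<close> to 0.\<close>
    have "dm -` {m} \<inter> space \<omega> = (if m = 0 then space \<omega> else {\<xi> \<in> space \<omega>. m - 1 < dm \<xi>}) - {\<xi> \<in> space \<omega>. m < dm \<xi>}"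
      by auto
    also have "\<dots> \<in> sets \<omega>" using lt by (auto simp del: space_omega)
    finally show ?thesis .
  qed
  thus ?thesis by (subst measurable_count_space_eq2_countable) auto
qed

sublocale O: sigma_finite_measure \<omega>
  by (rule sigma_finite_measure_restrict_space[OF D.sigma_finite_measure_axioms Omega_sets])

sublocale Fd: fields \<omega> dm
  by unfold_locales (rule dm_measurable)

lemma AE_omega: "AE \<xi> in \<nu>'. Q \<xi> \<Longrightarrow> AE \<xi> in \<omega>. Q \<xi>"
  unfolding AE_restrict_space_iff[OF Omega_Int_space] by (elim eventually_mono) simp

lemma integral_omega:
  fixes f :: "_ \<Rightarrow> complex"
  shows "(\<integral>\<xi>. f \<xi> \<partial>\<omega>) = (\<integral>\<xi>. indicator \<Omega> \<xi> *\<^sub>R f \<xi> \<partial>\<nu>')"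
  by (rule integral_restrict_space[OF Omega_Int_space])

lemma integrable_omega:
  fixes f :: "_ \<Rightarrow> complex"
  shows "integrable \<omega> f \<longleftrightarrow> integrable \<nu>' (\<lambda>\<xi>. indicator \<Omega> \<xi> *\<^sub>R f \<xi>)"
  by (rule integrable_restrict_space[OF Omega_Int_space])

subsection \<open>The coefficient map\<close>

definition cf :: "(('g \<Rightarrow> complex) \<times> 'y \<Rightarrow> complex) set \<Rightarrow> ('g \<Rightarrow> complex) \<Rightarrow> complex Matrix.vec" where
  "cf g \<xi> = Matrix.vec (dm \<xi>) (\<lambda>j. \<integral>v. cnj (q j \<xi> v) * rep g (\<xi>, v) \<partial>lam)"

lemma coefficient_map_cf: "coefficient_map \<nu>' lam Phat q g = Fd.vcl (cf g)"
  by (simp add: coefficient_map_def cf_def[abs_def])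

lemma cf_carrier [simp]: "cf g \<xi> \<in> carrier_vec (dm \<xi>)"
  by (simp add: cf_def)

lemma cf_index:
  assumes \<xi>: "\<xi> \<in> \<Omega>" and s: "(\<lambda>v. rep g (\<xi>, v)) \<in> sq_int lam" and j: "j < dm \<xi>"
  shows "cf g \<xi> $ j = inner L (slice lam g \<xi>) (qc j \<xi>)"
  using j by (simp add: cf_def slice_def L2_inner[OF s q_sq_int[OF \<xi>]] mult.commute)

lemma restricted_measurable:
  assumes "f \<in> borel_measurable (\<nu>' \<Otimes>\<^sub>M lam)" shows "f \<in> borel_measurable (\<omega> \<Otimes>\<^sub>M lam)"
proof -
  have "fst \<in> measurable (\<omega> \<Otimes>\<^sub>M lam) \<nu>'"
    by (rule measurable_compose[OF measurable_fst measurable_restrict_space1[OF measurable_ident, unfolded id_def]])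
  hence "(\<lambda>z. (fst z, snd z)) \<in> measurable (\<omega> \<Otimes>\<^sub>M lam) (\<nu>' \<Otimes>\<^sub>M lam)"
    by (intro measurable_Pair measurable_snd) simp
  from measurable_compose[OF this assms] show ?thesis by simp
qed

lemma cf_vmeas:
  assumes g: "g \<in> pts K'" shows "Fd.vmeas (cf g)"
  unfolding cf_def[abs_def]
proof (rule Fd.vmeas_vec)
  fix j
  have "rep g \<in> borel_measurable (\<omega> \<Otimes>\<^sub>M lam)"
    using rep_sq_int[OF g] by (intro restricted_measurable) (simp add: sq_int_def)
  hence "(\<lambda>(\<xi>, v). cnj (q j \<xi> v) * rep g (\<xi>, v)) \<in> borel_measurable (\<omega> \<Otimes>\<^sub>M lam)"
    using q_measurable[of j] by (simp add: case_prod_unfold borel_measurable_cnj borel_measurable_times)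
  thus "(\<lambda>\<xi>. \<integral>v. cnj (q j \<xi> v) * rep g (\<xi>, v) \<partial>lam) \<in> borel_measurable \<omega>"
    by (rule N.borel_measurable_lebesgue_integral)
qed

text \<open>Parseval's identity in the fiber over \<open>\<xi>\<close>, which contains the slice of
  \<open>g\<close>.\<close>

lemma cf_inner_pointwise:
  assumes \<xi>: "\<xi> \<in> \<Omega>" and s: "(\<lambda>v. rep g (\<xi>, v)) \<in> sq_int lam" "(\<lambda>v. rep k (\<xi>, v)) \<in> sq_int lam"
    and f: "slice lam g \<xi> \<in> fib \<xi>"
  shows "cf g \<xi> \<bullet>c cf k \<xi> = (\<integral>v. rep g (\<xi>, v) * cnj (rep k (\<xi>, v)) \<partial>lam)"
proof -
  note \<xi>d = Omega_dual[OF \<xi>]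
  have mem: "slice lam k \<xi> \<in> pts L" "slice lam g \<xi> \<in> pts L" using s by (auto simp: slice_def)
  have "cf g \<xi> \<bullet>c cf k \<xi> = (\<Sum>j<dm \<xi>. inner L (slice lam g \<xi>) (qc j \<xi>) * cnj (inner L (slice lam k \<xi>) (qc j \<xi>)))"
    by (subst cscalar_prod_sum[of _ "dm \<xi>"]) (auto simp: cf_index[OF \<xi>] s)
  also have "\<dots> = (\<Sum>j<dm \<xi>. inner L (slice lam g \<xi>) (qc j \<xi>) * inner L (qc j \<xi>) (slice lam k \<xi>))"
    using mem q_sq_int[OF \<xi>] by (intro sum.cong) (auto simp: L.inner_commute[of "L2_class lam (q _ \<xi>)"])
  also have "\<dots> = inner L (slice lam g \<xi>) (slice lam k \<xi>)"
    by (rule L.finite_basis_expansion[OF fib_subspace(1-4)[OF \<xi>d] q_orthonormal[OF \<xi>] f mem(1), symmetric])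
  finally show ?thesis using s by (simp add: slice_def L2_inner)
qed

text \<open>Integrating the pointwise identity gives the inner product over \<open>\<Omega>\<close>
  only. Off \<open>\<Omega>\<close> the fibers are zero, so the slices of \<open>FI f\<close> vanish
  there and nothing is lost.\<close>

lemma cf_inner:
  assumes f: "f \<in> H" and k: "k \<in> H"
  shows "AE \<xi> in \<omega>. cf (FI f) \<xi> \<bullet>c cf (FI k) \<xi> = (\<integral>v. rep (FI f) (\<xi>, v) * cnj (rep (FI k) (\<xi>, v)) \<partial>lam)"
    and "(\<integral>\<xi>. cf (FI f) \<xi> \<bullet>c cf (FI k) \<xi> \<partial>\<omega>) = inner K f k"
    and "integrable \<omega> (\<lambda>\<xi>. cf (FI f) \<xi> \<bullet>c cf (FI k) \<xi>)"
proof -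
  have mem: "FI f \<in> pts K'" "FI k \<in> pts K'" using linear_mapD(1)[OF FI_lin H_sub] f k by auto
  note good = P'.sq_int_sections[OF rep_sq_int[OF mem(1)]] P'.sq_int_sections[OF rep_sq_int[OF mem(2)]] slice_in_fiber[OF f]
  let ?I = "\<lambda>\<xi>. \<integral>v. rep (FI f) (\<xi>, v) * cnj (rep (FI k) (\<xi>, v)) \<partial>lam"
  show 1: "AE \<xi> in \<omega>. cf (FI f) \<xi> \<bullet>c cf (FI k) \<xi> = ?I \<xi>"
    using AE_omega[OF good(1)] AE_omega[OF good(2)] AE_omega[OF good(3)] AE_space
    by eventually_elim (rule cf_inner_pointwise, auto)
  have out: "AE \<xi> in \<nu>'. indicator \<Omega> \<xi> *\<^sub>R ?I \<xi> = ?I \<xi>"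
    using good AE_space
  proof eventually_elim
    case (elim \<xi>)
    show ?case
    proof (cases "\<xi> \<in> \<Omega>")
      case False
      have "slice lam (FI f) \<xi> = vzero L" using fiber_outside_Omega[of \<xi>] elim False by simp
      hence "inner L (slice lam (FI f) \<xi>) (slice lam (FI k) \<xi>) = 0" using elim(2) by (simp add: slice_def)
      thus ?thesis using elim(1,2) False by (simp add: slice_def L2_inner)
    qed simp
  qed
  have cm: "(\<lambda>\<xi>. cf (FI f) \<xi> \<bullet>c cf (FI k) \<xi>) \<in> borel_measurable \<omega>"
    by (rule Fd.measurable_cscalar_prod[OF cf_vmeas[OF mem(1)] cf_vmeas[OF mem(2)]])
  have i: "integrable \<nu>' ?I" by (rule P'.inner_sections(2)[OF rep_sq_int[OF mem(1)] rep_sq_int[OF mem(2)]])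
  have iO: "integrable \<nu>' (\<lambda>\<xi>. indicator \<Omega> \<xi> *\<^sub>R ?I \<xi>)"
    by (rule integrable_mult_indicator[OF Omega_sets i])
  have i': "integrable \<omega> ?I" unfolding integrable_omega by (rule iO)
  have "integrable \<omega> (\<lambda>\<xi>. cf (FI f) \<xi> \<bullet>c cf (FI k) \<xi>) \<longleftrightarrow> integrable \<omega> ?I"
    by (rule integrable_cong_AE[OF cm borel_measurable_integrable[OF i'] 1])
  thus "integrable \<omega> (\<lambda>\<xi>. cf (FI f) \<xi> \<bullet>c cf (FI k) \<xi>)" using i' by simp
  have "(\<integral>\<xi>. cf (FI f) \<xi> \<bullet>c cf (FI k) \<xi> \<partial>\<omega>) = (\<integral>\<xi>. ?I \<xi> \<partial>\<omega>)"
    by (rule integral_cong_AE[OF cm borel_measurable_integrable[OF i'] 1])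
  also have "\<dots> = (\<integral>\<xi>. indicator \<Omega> \<xi> *\<^sub>R ?I \<xi> \<partial>\<nu>')" by (rule integral_omega)
  also have "\<dots> = (\<integral>\<xi>. ?I \<xi> \<partial>\<nu>')"
    by (rule integral_cong_AE[OF borel_measurable_integrable[OF iO] borel_measurable_integrable[OF i] out])
  also have "\<dots> = inner K' (FI f) (FI k)"
    using P'.inner_sections(1)[OF rep_sq_int[OF mem(1)] rep_sq_int[OF mem(2)]] mem by (simp add: L2_class_rep)
  also have "\<dots> = inner K f k" by (rule FI_inner[OF H_sub[OF f] H_sub[OF k]])
  finally show "(\<integral>\<xi>. cf (FI f) \<xi> \<bullet>c cf (FI k) \<xi> \<partial>\<omega>) = inner K f k" .
qed

lemma cf_VF: "f \<in> H \<Longrightarrow> cf (FI f) \<in> Fd.VF"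
  unfolding Fd.vec_fields_iff
  using cf_vmeas[OF linear_mapD(1)[OF FI_lin H_sub]] integrable_Re[OF cf_inner(3)] by simp

lemma cf_add:
  assumes g: "g \<in> pts K'" and k: "k \<in> pts K'"
  shows "AE \<xi> in \<omega>. cf (vadd K' g k) \<xi> = cf g \<xi> + cf k \<xi>"
proof -
  have gk: "vadd K' g k \<in> pts K'" using g k by simp
  show ?thesis
    using AE_omega[OF P'.sq_int_sections[OF rep_sq_int[OF g]]] AE_omega[OF P'.sq_int_sections[OF rep_sq_int[OF k]]]
      AE_omega[OF P'.sq_int_sections[OF rep_sq_int[OF gk]]] AE_omega[OF P'.slice_add[OF g k]] AE_space
  proof eventually_elim
    case (elim \<xi>)
    have \<xi>: "\<xi> \<in> \<Omega>" using elim(5) by simp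
    have mem: "slice lam g \<xi> \<in> pts L" "slice lam k \<xi> \<in> pts L" using elim by (auto simp: slice_def)
    show ?case
      using mem q_sq_int[OF \<xi>] by (intro eq_vecI) (auto simp: cf_index[OF \<xi>] elim cf_def[of _ \<xi>, THEN arg_cong[where f = dim_vec]])
  qed
qed

text \<open>A bounded multiplier in the first variable acts on each slice as a scalar. Constants
  give homogeneity of \<open>R\<close>, characters its behaviour under translations.\<close>

lemma cf_mul:
  assumes g: "g \<in> pts K'" and \<phi>: "\<phi> \<in> borel_measurable \<nu>'" "\<And>\<xi>. \<xi> \<in> dual_group \<Longrightarrow> cmod (\<phi> \<xi>) \<le> B"
  shows "AE \<xi> in \<omega>. cf (mul_op (\<nu>' \<Otimes>\<^sub>M lam) (\<lambda>z. \<phi> (fst z)) g) \<xi> = \<phi> \<xi> \<cdot>\<^sub>v cf g \<xi>"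
proof -
  let ?m = "mul_op (\<nu>' \<Otimes>\<^sub>M lam) (\<lambda>z. \<phi> (fst z)) g"
  have "(\<lambda>z. \<phi> (fst z) * rep g z) \<in> sq_int (\<nu>' \<Otimes>\<^sub>M lam)"
    using \<phi> by (intro sq_int_bounded_mult'[where C = B] rep_sq_int g) (auto simp: space_pair_measure)
  hence m: "?m \<in> pts K'" unfolding mul_op_def by simp
  have sl: "AE \<xi> in \<nu>'. slice lam ?m \<xi> = vscale L (\<phi> \<xi>) (slice lam g \<xi>)"
    by (rule P'.slice_mul[OF g \<phi>(1)]) (use \<phi>(2) in simp)
  show ?thesis
    using AE_omega[OF P'.sq_int_sections[OF rep_sq_int[OF g]]] AE_omega[OF P'.sq_int_sections[OF rep_sq_int[OF m]]]
      AE_omega[OF sl] AE_space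
  proof eventually_elim
    case (elim \<xi>)
    have \<xi>: "\<xi> \<in> \<Omega>" using elim(4) by simp
    have mem: "slice lam g \<xi> \<in> pts L" using elim by (auto simp: slice_def)
    show ?case
    proof (rule eq_vecI)
      fix j assume "j < dim_vec (\<phi> \<xi> \<cdot>\<^sub>v cf g \<xi>)"
      hence j: "j < dm \<xi>" and jd: "j < dim_vec (cf g \<xi>)" by (simp_all add: cf_def)
      show "cf ?m \<xi> $ j = (\<phi> \<xi> \<cdot>\<^sub>v cf g \<xi>) $ j"
        using mem q_sq_int[OF \<xi>]
        unfolding index_smult_vec(1)[OF jd] cf_index[OF \<xi> elim(2) j] cf_index[OF \<xi> elim(1) j] elim(3) by simp
    qed (simp add: cf_def)
  qed
qed

subsection \<open>The unitary operator R\<close>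

abbreviation "R \<equiv> Rmap \<nu>' lam Phat q FI H"
abbreviation "Hs \<equiv> subsp K H"

sublocale Hs: hilbert Hs by (rule hilbert_subspace[OF L2_hilbert H_closed])

lemma Xspace_X: "Xspace \<nu>' lam Phat = Fd.X"
  by (simp add: Xspace_def)

lemma R_cf: "f \<in> H \<Longrightarrow> R f = Fd.vcl (cf (FI f))"
  by (simp add: Rmap_def coefficient_map_cf)

lemma R_linear: "linear_map Hs Fd.X R"
  unfolding linear_map_def
proof (intro conjI ballI allI)
  fix f assume "f \<in> pts Hs" hence f: "f \<in> H" by simp
  have FIf: "FI f \<in> pts K'" by (rule linear_mapD(1)[OF FI_lin H_sub[OF f]])
  show "R f \<in> pts Fd.X" unfolding R_cf[OF f] by (rule Fd.X_class_mem[OF cf_VF[OF f]])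
  fix c
  have cfH: "vscale K c f \<in> H" by (rule closed_subspaceD(4)[OF H_closed f])
  have "FI (vscale K c f) = mul_op (\<nu>' \<Otimes>\<^sub>M lam) (\<lambda>z. c) (FI f)"
    using linear_mapD(3)[OF FI_lin H_sub[OF f], of c] P.L2_scale_mul[OF FIf, of c] by simp
  hence "R (vscale K c f) = Fd.vcl (\<lambda>\<xi>. c \<cdot>\<^sub>v cf (FI f) \<xi>)"
    unfolding R_cf[OF cfH] using cf_mul[OF FIf, of "\<lambda>_. c" "cmod c"] by (intro ae_class_cong) simp
  thus "R (vscale Hs c f) = vscale Fd.X c (R f)"
    unfolding R_cf[OF f] Fd.X_scale[OF cf_VF[OF f]] by simp
  fix k assume "k \<in> pts Hs" hence k: "k \<in> H" by simp
  have FIk: "FI k \<in> pts K'" by (rule linear_mapD(1)[OF FI_lin H_sub[OF k]])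
  have fk: "vadd K f k \<in> H" by (rule closed_subspaceD(3)[OF H_closed f k])
  have "R (vadd K f k) = Fd.vcl (\<lambda>\<xi>. cf (FI f) \<xi> + cf (FI k) \<xi>)"
    unfolding R_cf[OF fk] linear_mapD(2)[OF FI_lin H_sub[OF f] H_sub[OF k]]
    by (rule ae_class_cong[OF cf_add[OF FIf FIk]])
  thus "R (vadd Hs f k) = vadd Fd.X (R f) (R k)"
    unfolding R_cf[OF f] R_cf[OF k] Fd.X_add[OF cf_VF[OF f] cf_VF[OF k]] by simp
qed

lemma R_inner: "\<lbrakk>f \<in> H; k \<in> H\<rbrakk> \<Longrightarrow> inner Fd.X (R f) (R k) = inner K f k"
  unfolding R_cf by (subst Fd.X_inner) (auto intro: cf_VF cf_inner(2))

text \<open>The inverse of the coefficient map. It is constructed as a function on the product,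
  because joint measurability and square integrability have to be settled before its class can be
  used.\<close>

lemma synthesis:
  assumes h: "h \<in> Fd.VF"
  obtains g where "g \<in> sq_int (\<nu>' \<Otimes>\<^sub>M lam)"
    "\<And>\<xi>. \<xi> \<in> \<Omega> \<Longrightarrow> (\<lambda>v. g (\<xi>, v)) = (\<lambda>v. \<Sum>j<dm \<xi>. h \<xi> $ j * q j \<xi> v)"
    "\<And>\<xi>. \<xi> \<notin> \<Omega> \<Longrightarrow> (\<lambda>v. g (\<xi>, v)) = (\<lambda>v. 0)"
    "\<And>\<xi>. \<xi> \<in> \<Omega> \<Longrightarrow> L2_class lam (\<lambda>v. g (\<xi>, v)) \<in> fib \<xi>"
    "\<And>\<xi> y. \<lbrakk>\<xi> \<in> \<Omega>; y \<in> pts L\<rbrakk> \<Longrightarrow> inner L (L2_class lam (\<lambda>v. g (\<xi>, v))) y = (\<Sum>j<dm \<xi>. h \<xi> $ j * inner L (qc j \<xi>) y)"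
    "\<And>\<xi>. \<xi> \<in> \<Omega> \<Longrightarrow> (\<lambda>v. g (\<xi>, v)) \<in> sq_int lam"
proof -
  \<comment> \<open>Zero outside \<open>\<Omega>\<close>, where neither \<open>h\<close> nor the
    basis is under control.\<close>
  define g where "g z = (if z \<in> \<Omega> \<times> UNIV then \<Sum>j<dm (fst z). h (fst z) $ j * q j (fst z) (snd z) else 0)" for z
  have gO: "(\<lambda>v. g (\<xi>, v)) = (\<lambda>v. \<Sum>j<dm \<xi>. h \<xi> $ j * q j \<xi> v)" if "\<xi> \<in> \<Omega>" for \<xi>
    using that by (simp add: g_def)
  have g0: "(\<lambda>v. g (\<xi>, v)) = (\<lambda>v. 0)" if "\<xi> \<notin> \<Omega>" for \<xi> using that by (simp add: g_def)
  have sum_sq: "(\<lambda>v. \<Sum>j<n. a j * q j \<xi> v) \<in> sq_int lam" if "\<xi> \<in> \<Omega>" for n \<xi> and a :: "nat \<Rightarrow> complex"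
    by (induction n) (use q_sq_int[OF that] in auto)
  have sum_inner: "inner L (L2_class lam (\<lambda>v. \<Sum>j<n. a j * q j \<xi> v)) y = (\<Sum>j<n. a j * inner L (qc j \<xi>) y)"
    if \<xi>: "\<xi> \<in> \<Omega>" and y: "y \<in> pts L" for n \<xi> y and a :: "nat \<Rightarrow> complex"
  proof (induction n)
    case 0
    show ?case using y by (simp add: L2_zero[symmetric])
  next
    case (Suc n)
    have "L2_class lam (\<lambda>v. \<Sum>j<Suc n. a j * q j \<xi> v) =
        vadd L (L2_class lam (\<lambda>v. \<Sum>j<n. a j * q j \<xi> v)) (vscale L (a n) (qc n \<xi>))"
      using sum_sq[OF \<xi>] q_sq_int[OF \<xi>] by (simp add: L2_scale L2_add)
    thus ?case using sum_sq[OF \<xi>] q_sq_int[OF \<xi>] y Suc by simp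
  qed
  have sq: "(\<lambda>v. g (\<xi>, v)) \<in> sq_int lam" if "\<xi> \<in> \<Omega>" for \<xi> unfolding gO[OF that] by (rule sum_sq[OF that])
  have inn: "inner L (L2_class lam (\<lambda>v. g (\<xi>, v))) y = (\<Sum>j<dm \<xi>. h \<xi> $ j * inner L (qc j \<xi>) y)"
    if "\<xi> \<in> \<Omega>" "y \<in> pts L" for \<xi> y
    unfolding gO[OF that(1)] by (rule sum_inner[OF that])
  have qf: "qc j \<xi> \<in> fib \<xi>" if "\<xi> \<in> \<Omega>" "j < dm \<xi>" for j \<xi>
    using q_orthonormal[OF that(1)] that(2) by (auto simp: orthonormal_basis_def)
  have fibr: "L2_class lam (\<lambda>v. g (\<xi>, v)) \<in> fib \<xi>" if \<xi>: "\<xi> \<in> \<Omega>" for \<xi>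
  proof -
    note fs = fib_subspace(1-4)[OF Omega_dual[OF \<xi>]]
    obtain x where x: "x \<in> fib \<xi>" "\<And>y. y \<in> pts L \<Longrightarrow> inner L x y = (\<Sum>j<dm \<xi>. h \<xi> $ j * inner L (qc j \<xi>) y)"
      using L.finite_combination[of "dm \<xi>" "\<lambda>j. qc j \<xi>" "fib \<xi>" "\<lambda>j. h \<xi> $ j", OF qf[OF \<xi>] fs] by blast
    have "L2_class lam (\<lambda>v. g (\<xi>, v)) = x"
      using sq[OF \<xi>] x fs(1) by (intro L.vec_eqI) (auto simp: inn[OF \<xi>])
    thus ?thesis using x by simp
  qed
  \<comment> \<open>Pythagoras in the fiber; it reduces square integrability over the product to
    that of \<open>h\<close>.\<close>
  have nrm: "(\<integral>v. (cmod (g (\<xi>, v)))\<^sup>2 \<partial>lam) = vsq (h \<xi>)" if \<xi>: "\<xi> \<in> \<Omega>" for \<xi>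
  proof -
    let ?x = "L2_class lam (\<lambda>v. g (\<xi>, v))"
    have x: "?x \<in> pts L" using sq[OF \<xi>] by simp
    have hc: "h \<xi> \<in> carrier_vec (dm \<xi>)" using Fd.VF_carrier[OF h] \<xi> by simp
    have qx: "inner L (qc j \<xi>) ?x = cnj (h \<xi> $ j)" if j: "j < dm \<xi>" for j
    proof -
      have ql: "qc k \<xi> \<in> pts L" for k using q_sq_int[OF \<xi>] by simp
      have "inner L ?x (qc j \<xi>) = (\<Sum>k<dm \<xi>. if k = j then h \<xi> $ k else 0)"
        unfolding inn[OF \<xi> ql] using q_orthonormal[OF \<xi>] j
        by (intro sum.cong) (auto simp: orthonormal_basis_def)
      also have "\<dots> = h \<xi> $ j" using j by simp
      finally show ?thesis using L.inner_commute[OF ql x, of j] by simp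
    qed
    have "complex_of_real (\<integral>v. (cmod (g (\<xi>, v)))\<^sup>2 \<partial>lam) = inner L ?x ?x"
      using sq[OF \<xi>] by (simp add: L2_inner integral_mult_cnj_self)
    also have "\<dots> = (\<Sum>j<dm \<xi>. h \<xi> $ j * cnj (h \<xi> $ j))" unfolding inn[OF \<xi> x] by (intro sum.cong) (auto simp: qx)
    also have "\<dots> = h \<xi> \<bullet>c h \<xi>" by (rule cscalar_prod_sum[OF hc hc, symmetric])
    finally show ?thesis by (metis Re_complex_of_real)
  qed
  \<comment> \<open>The coefficients and basis fields are measurable over \<open>\<omega>\<close>.
    The sum is treated there, with its varying number of terms as a countable index, and is then
    extended by zero.\<close>
  have gm: "g \<in> borel_measurable (\<nu>' \<Otimes>\<^sub>M lam)"
  proof -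
    have hm: "(\<lambda>z. Fd.vcoord h j (fst z)) \<in> borel_measurable (\<omega> \<Otimes>\<^sub>M lam)" for j
      by (rule measurable_compose[OF measurable_fst Fd.vmeasD(2)[OF Fd.vec_fields_vmeas[OF h]]])
    have qm: "(\<lambda>z. q j (fst z) (snd z)) \<in> borel_measurable (\<omega> \<Otimes>\<^sub>M lam)" for j
      using q_measurable[of j] by (simp add: case_prod_unfold)
    have dmm: "(\<lambda>z. dm (fst z)) \<in> measurable (\<omega> \<Otimes>\<^sub>M lam) (count_space UNIV)"
      by (rule measurable_compose[OF measurable_fst dm_measurable])
    have "(\<lambda>z. \<Sum>j<dm (fst z). Fd.vcoord h j (fst z) * q j (fst z) (snd z)) \<in> borel_measurable (\<omega> \<Otimes>\<^sub>M lam)"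
      by (rule measurable_compose_countable[OF _ dmm]) (intro borel_measurable_sum borel_measurable_times hm qm)
    moreover have "(\<lambda>z. (fst z, snd z)) \<in> measurable (restrict_space (\<nu>' \<Otimes>\<^sub>M lam) (\<Omega> \<times> UNIV)) (\<omega> \<Otimes>\<^sub>M lam)"
    proof (rule measurable_Pair)
      show "fst \<in> measurable (restrict_space (\<nu>' \<Otimes>\<^sub>M lam) (\<Omega> \<times> UNIV)) \<omega>"
        by (rule measurable_restrict_space2) (auto simp: space_restrict_space intro: measurable_restrict_space1)
      show "snd \<in> measurable (restrict_space (\<nu>' \<Otimes>\<^sub>M lam) (\<Omega> \<times> UNIV)) lam"
        by (rule measurable_restrict_space1) simp
    qed
    ultimately have m: "(\<lambda>z. \<Sum>j<dm (fst z). Fd.vcoord h j (fst z) * q j (fst z) (snd z)) \<in>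
        borel_measurable (restrict_space (\<nu>' \<Otimes>\<^sub>M lam) (\<Omega> \<times> UNIV))"
      using measurable_compose by fastforce
    have "\<Omega> \<times> UNIV \<inter> space (\<nu>' \<Otimes>\<^sub>M lam) = \<Omega> \<times> space lam"
      using Omega_dual by (auto simp: space_pair_measure)
    hence S: "\<Omega> \<times> UNIV \<inter> space (\<nu>' \<Otimes>\<^sub>M lam) \<in> sets (\<nu>' \<Otimes>\<^sub>M lam)" using Omega_sets by simp
    have "(\<lambda>z. if z \<in> \<Omega> \<times> UNIV then \<Sum>j<dm (fst z). Fd.vcoord h j (fst z) * q j (fst z) (snd z) else 0)
        \<in> borel_measurable (\<nu>' \<Otimes>\<^sub>M lam)"
      using m by (subst measurable_restrict_space_iff[OF S, symmetric]) auto
    moreover have "g = (\<lambda>z. if z \<in> \<Omega> \<times> UNIV then \<Sum>j<dm (fst z). Fd.vcoord h j (fst z) * q j (fst z) (snd z) else 0)"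
      unfolding g_def by (intro ext if_cong refl sum.cong) (auto simp: Fd.vcoord_eq)
    ultimately show ?thesis by simp
  qed
  have "integrable (\<nu>' \<Otimes>\<^sub>M lam) (\<lambda>z. (cmod (g z))\<^sup>2)"
  proof (rule P'.Fubini_integrable)
    show "(\<lambda>z. (cmod (g z))\<^sup>2) \<in> borel_measurable (\<nu>' \<Otimes>\<^sub>M lam)" using gm by measurable
    have "integrable \<nu>' (\<lambda>\<xi>. indicator \<Omega> \<xi> *\<^sub>R vsq (h \<xi>))"
      using Fd.vec_fields_integrable[OF h] unfolding integrable_restrict_space[OF Omega_Int_space] .
    moreover have "(\<lambda>\<xi>. indicator \<Omega> \<xi> *\<^sub>R vsq (h \<xi>)) = (\<lambda>\<xi>. \<integral>v. norm ((cmod (g (\<xi>, v)))\<^sup>2) \<partial>lam)"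
    proof
      fix \<xi>
      show "indicator \<Omega> \<xi> *\<^sub>R vsq (h \<xi>) = (\<integral>v. norm ((cmod (g (\<xi>, v)))\<^sup>2) \<partial>lam)"
      proof (cases "\<xi> \<in> \<Omega>")
        case False
        have "g (\<xi>, v) = 0" for v using fun_cong[OF g0[OF False], of v] by simp
        thus ?thesis using False by simp
      qed (simp add: nrm)
    qed
    ultimately show "integrable \<nu>' (\<lambda>\<xi>. \<integral>v. norm ((cmod (g (\<xi>, v)))\<^sup>2) \<partial>lam)" by simp
    have "(\<lambda>v. g (\<xi>, v)) \<in> sq_int lam" for \<xi> by (cases "\<xi> \<in> \<Omega>") (simp_all add: sq g0)
    thus "AE \<xi> in \<nu>'. integrable lam (\<lambda>v. (cmod (g (\<xi>, v)))\<^sup>2)" by (intro AE_I2 sq_int_integrable)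
  qed
  hence "g \<in> sq_int (\<nu>' \<Otimes>\<^sub>M lam)" using gm by (simp add: sq_int_def)
  from that[OF this gO g0 fibr inn sq] show thesis .
qed

text \<open>The synthesised function has its slices in the fibers, so it comes from an element of
  \<open>H\<close>; by orthonormality its coefficients are those of \<open>h\<close>.\<close>

lemma R_surj:
  assumes "a \<in> pts Fd.X" shows "a \<in> R ` H"
proof -
  obtain h where h: "h \<in> Fd.VF" "a = Fd.vcl h" using assms by (auto simp: Fd.X_pts)
  obtain g where g: "g \<in> sq_int (\<nu>' \<Otimes>\<^sub>M lam)"
    and gO: "\<And>\<xi>. \<xi> \<in> \<Omega> \<Longrightarrow> (\<lambda>v. g (\<xi>, v)) = (\<lambda>v. \<Sum>j<dm \<xi>. h \<xi> $ j * q j \<xi> v)"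
    and g0: "\<And>\<xi>. \<xi> \<notin> \<Omega> \<Longrightarrow> (\<lambda>v. g (\<xi>, v)) = (\<lambda>v. 0)"
    and gf: "\<And>\<xi>. \<xi> \<in> \<Omega> \<Longrightarrow> L2_class lam (\<lambda>v. g (\<xi>, v)) \<in> fib \<xi>"
    and gi: "\<And>\<xi> y. \<lbrakk>\<xi> \<in> \<Omega>; y \<in> pts L\<rbrakk> \<Longrightarrow> inner L (L2_class lam (\<lambda>v. g (\<xi>, v))) y = (\<Sum>j<dm \<xi>. h \<xi> $ j * inner L (qc j \<xi>) y)"
    and gs: "\<And>\<xi>. \<xi> \<in> \<Omega> \<Longrightarrow> (\<lambda>v. g (\<xi>, v)) \<in> sq_int lam"
    using synthesis[OF h(1)] by blast
  let ?G = "L2_class (\<nu>' \<Otimes>\<^sub>M lam) g"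
  have G: "?G \<in> pts K'" using g by simp
  note sl = P'.slice_class[OF g]
  have "AE \<xi> in \<nu>'. slice lam ?G \<xi> \<in> fib \<xi>"
    using sl AE_space
  proof eventually_elim
    case (elim \<xi>)
    show ?case
    proof (cases "\<xi> \<in> \<Omega>")
      case False
      have "slice lam ?G \<xi> = vzero L" unfolding elim(1) g0[OF False] by (simp add: L2_zero)
      thus ?thesis using fib_subspace(2) elim(2) by simp
    qed (simp add: elim(1) gf)
  qed
  then obtain f where f: "f \<in> H" "FI f = ?G" using in_FI_H[OF G] by blast
  have "AE \<xi> in \<omega>. cf ?G \<xi> = h \<xi>"
    using AE_omega[OF sl] AE_omega[OF P'.sq_int_sections[OF rep_sq_int[OF G]]] AE_space
  proof eventually_elim
    case (elim \<xi>)
    have \<xi>: "\<xi> \<in> \<Omega>" using elim(3) by simp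
    have hc: "h \<xi> \<in> carrier_vec (dm \<xi>)" using Fd.VF_carrier[OF h(1)] \<xi> by simp
    show ?case
    proof (rule eq_vecI)
      fix j assume "j < dim_vec (h \<xi>)"
      hence j: "j < dm \<xi>" using hc by simp
      have ql: "qc j \<xi> \<in> pts L" using q_sq_int[OF \<xi>] by simp
      have "cf ?G \<xi> $ j = (\<Sum>k<dm \<xi>. h \<xi> $ k * inner L (qc k \<xi>) (qc j \<xi>))"
        unfolding cf_index[OF \<xi> elim(2) j] elim(1) gi[OF \<xi> ql] ..
      also have "\<dots> = (\<Sum>k<dm \<xi>. if k = j then h \<xi> $ k else 0)"
        using q_orthonormal[OF \<xi>] j by (intro sum.cong) (auto simp: orthonormal_basis_def)
      finally show "cf ?G \<xi> $ j = h \<xi> $ j" using j by simp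
    qed (use hc in \<open>simp add: cf_def\<close>)
  qed
  hence "R f = a" unfolding R_cf[OF f(1)] f(2) h(2) by (rule ae_class_cong)
  thus ?thesis using f(1) by blast
qed

lemma R_unitary: "unitary_op Hs Fd.X R"
  unfolding unitary_op_def
  using R_linear R_inner R_surj linear_mapD(1)[OF R_linear] by auto

lemma R_translation:
  assumes f: "f \<in> H"
  shows "R (translation \<nu> lam a f) = Fd.vcl (\<lambda>\<xi>. cnj (\<xi> a) \<cdot>\<^sub>v cf (FI f) \<xi>)"
  unfolding R_cf[OF H_invariant[OF f]] FI_translation[OF H_sub[OF f]]
proof (rule ae_class_cong, rule cf_mul)
  show "FI f \<in> pts K'" by (rule linear_mapD(1)[OF FI_lin H_sub[OF f]])
qed (auto simp: char_norm)

end

lemma smult_cscalar_prod: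
  assumes "v \<in> carrier_vec n" "w \<in> carrier_vec n"
  shows "(c \<cdot>\<^sub>v v) \<bullet>c w = c * (v \<bullet>c w)" "v \<bullet>c (c \<cdot>\<^sub>v w) = cnj c * (v \<bullet>c w)"
  using hilbert.inner_scale_left[OF cvec_hilbert, of v n w c] hilbert.inner_scale_right[OF cvec_hilbert, of w n v c] assms
  by simp_all

section \<open>Operators commuting with all characters\<close>

context translation_setting
begin

lemma VF_char: "u \<in> Fd.VF \<Longrightarrow> (\<lambda>\<xi>. cnj (\<xi> a) \<cdot>\<^sub>v u \<xi>) \<in> Fd.VF"
  and char_omega_measurable: "(\<lambda>\<xi>. cnj (\<xi> a)) \<in> borel_measurable \<omega>"
proof -
  show m: "(\<lambda>\<xi>. cnj (\<xi> a)) \<in> borel_measurable \<omega>"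
    by (intro borel_measurable_cnj measurable_restrict_space1 char_eval_measurable)
  show "(\<lambda>\<xi>. cnj (\<xi> a) \<cdot>\<^sub>v u \<xi>) \<in> Fd.VF" if "u \<in> Fd.VF"
  proof (rule Fd.VF_smult[OF m that])
    show "AE \<xi> in \<omega>. cmod (cnj (\<xi> a)) \<le> 1"
      using AE_space by eventually_elim (simp add: char_norm Omega_dual)
  qed
qed

text \<open>Integrability lets Fubini turn the pairing with the transform of an indicator into an
  integral of the vanishing character integrals; square integrability lets totality of the
  transforms conclude.\<close>

lemma AE_zero_if_character_orthogonal:
  assumes D: "integrable \<omega> D" "integrable \<omega> (\<lambda>\<xi>. (cmod (D \<xi>))\<^sup>2)"
    and orth: "\<And>a. (\<integral>\<xi>. cnj (\<xi> a) * D \<xi> \<partial>\<omega>) = 0"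
  shows "AE \<xi> in \<omega>. D \<xi> = 0"
proof -
  \<comment> \<open>Extension by zero to the whole dual group, where the Fourier transforms
    live.\<close>
  define E where "E \<xi> = indicator \<Omega> \<xi> *\<^sub>R D \<xi>" for \<xi>
  have E: "integrable \<nu>' E" using D(1) unfolding integrable_omega E_def .
  have "integrable \<nu>' (\<lambda>\<xi>. indicator \<Omega> \<xi> *\<^sub>R (cmod (D \<xi>))\<^sup>2)"
    using D(2) unfolding integrable_restrict_space[OF Omega_Int_space] .
  moreover have "(\<lambda>\<xi>. indicator \<Omega> \<xi> *\<^sub>R (cmod (D \<xi>))\<^sup>2) = (\<lambda>\<xi>. (cmod (E \<xi>))\<^sup>2)"
    by (auto simp: E_def indicator_def fun_eq_iff)
  ultimately have E2: "E \<in> sq_int \<nu>'" using E by (simp add: sq_int_def borel_measurable_integrable)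
  have chE: "(\<integral>\<xi>. cnj (\<xi> x) * E \<xi> \<partial>\<nu>') = 0" for x
  proof -
    have "(\<lambda>\<xi>. cnj (\<xi> x) * E \<xi>) = (\<lambda>\<xi>. indicator \<Omega> \<xi> *\<^sub>R (cnj (\<xi> x) * D \<xi>))"
      by (auto simp: E_def indicator_def fun_eq_iff)
    thus ?thesis using orth[of x] unfolding integral_omega by simp
  qed
  interpret Q: pair_sigma_finite \<nu> \<nu>' ..
  have "AE \<xi> in \<nu>'. E \<xi> = 0"
  proof (rule AE_zero_if_fourier_orthogonal[OF E2])
    fix A assume A: "A \<in> sets \<nu>" "emeasure \<nu> A < \<infinity>"
    let ?A = "\<lambda>x. indicator A x :: complex"
    have iA: "integrable \<nu> ?A" using A by (rule integrable_indicator_complex)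
    have m: "(\<lambda>(x, \<xi>). cnj (\<xi> x) * (?A x * E \<xi>)) \<in> borel_measurable (\<nu> \<Otimes>\<^sub>M \<nu>')"
    proof -
      have "(\<lambda>z. cnj (snd z (fst z))) \<in> borel_measurable (\<nu> \<Otimes>\<^sub>M \<nu>')"
        using char_joint_measurable by (intro borel_measurable_cnj) (simp add: case_prod_unfold)
      moreover have "(\<lambda>z. ?A (fst z) * E (snd z)) \<in> borel_measurable (\<nu> \<Otimes>\<^sub>M \<nu>')"
        using borel_measurable_integrable[OF Q.tensor_integrable[OF iA E]] by (simp add: case_prod_unfold)
      ultimately show ?thesis unfolding case_prod_unfold by (rule borel_measurable_times)
    qed
    have i: "integrable (\<nu> \<Otimes>\<^sub>M \<nu>') (\<lambda>(x, \<xi>). cnj (\<xi> x) * (?A x * E \<xi>))"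
    proof (rule Bochner_Integration.integrable_bound[OF Q.tensor_integrable[OF iA E] m])
      show "AE z in \<nu> \<Otimes>\<^sub>M \<nu>'. norm (case z of (x, \<xi>) \<Rightarrow> cnj (\<xi> x) * (?A x * E \<xi>)) \<le> norm (case z of (x, \<xi>) \<Rightarrow> ?A x * E \<xi>)"
        by (rule AE_I2) (auto simp: space_pair_measure norm_mult char_norm)
    qed
    have "(\<integral>\<xi>. fourier1 \<nu> ?A \<xi> * E \<xi> \<partial>\<nu>') = (\<integral>\<xi>. (\<integral>x. cnj (\<xi> x) * (?A x * E \<xi>) \<partial>\<nu>) \<partial>\<nu>')"
      unfolding fourier1_def by (simp add: mult.assoc flip: integral_mult_left_zero)
    also have "\<dots> = (\<integral>x. (\<integral>\<xi>. cnj (\<xi> x) * (?A x * E \<xi>) \<partial>\<nu>') \<partial>\<nu>)"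
      by (rule Q.Fubini_integral[OF i])
    also have "\<dots> = (\<integral>x. ?A x * (\<integral>\<xi>. cnj (\<xi> x) * E \<xi> \<partial>\<nu>') \<partial>\<nu>)"
    proof (rule Bochner_Integration.integral_cong[OF refl])
      fix x
      have "(\<lambda>\<xi>. cnj (\<xi> x) * (?A x * E \<xi>)) = (\<lambda>\<xi>. ?A x * (cnj (\<xi> x) * E \<xi>))" by (simp add: mult_ac)
      thus "(\<integral>\<xi>. cnj (\<xi> x) * (?A x * E \<xi>) \<partial>\<nu>') = ?A x * (\<integral>\<xi>. cnj (\<xi> x) * E \<xi> \<partial>\<nu>')"
        by (simp only: integral_mult_right_zero)
    qed
    finally show "(\<integral>\<xi>. fourier1 \<nu> ?A \<xi> * E \<xi> \<partial>\<nu>') = 0" by (simp add: chE)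
  qed
  from AE_omega[OF this] AE_space show ?thesis by eventually_elim (simp add: E_def)
qed

text \<open>Since \<open>A\<close> commutes with characters, each character integral of the
  difference \<open>D\<close> is the defect in the adjoint relation for a modulated
  \<open>u\<close>, hence zero. The bounds on \<open>u\<close> and \<open>w\<close> dominate the
  squared modulus of \<open>D\<close> by multiples of \<open>vsq (A u \<xi>)\<close> and
  \<open>vsq (B w \<xi>)\<close>.\<close>

lemma character_covariant_form:
  assumes A_mem: "\<And>u. u \<in> Fd.VF \<Longrightarrow> A u \<in> Fd.VF" and B_mem: "\<And>u. u \<in> Fd.VF \<Longrightarrow> B u \<in> Fd.VF"
    and adj: "\<And>u w. \<lbrakk>u \<in> Fd.VF; w \<in> Fd.VF\<rbrakk> \<Longrightarrow> (\<integral>\<xi>. A u \<xi> \<bullet>c w \<xi> \<partial>\<omega>) = (\<integral>\<xi>. u \<xi> \<bullet>c B w \<xi> \<partial>\<omega>)"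
    and cov: "\<And>u a. u \<in> Fd.VF \<Longrightarrow> AE \<xi> in \<omega>. A (\<lambda>\<xi>. cnj (\<xi> a) \<cdot>\<^sub>v u \<xi>) \<xi> = cnj (\<xi> a) \<cdot>\<^sub>v A u \<xi>"
    and u: "u \<in> Fd.VF" "\<And>\<xi>. \<xi> \<in> \<Omega> \<Longrightarrow> vsq (u \<xi>) \<le> C"
    and w: "w \<in> Fd.VF" "\<And>\<xi>. \<xi> \<in> \<Omega> \<Longrightarrow> vsq (w \<xi>) \<le> C"
  shows "AE \<xi> in \<omega>. A u \<xi> \<bullet>c w \<xi> = u \<xi> \<bullet>c B w \<xi>"
proof -
  note c = Fd.VF_carrier[OF u(1)] Fd.VF_carrier[OF w(1)] Fd.VF_carrier[OF A_mem[OF u(1)]] Fd.VF_carrier[OF B_mem[OF w(1)]]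
  note i1 = Fd.VF_inner_integrable[OF A_mem[OF u(1)] w(1)] and i2 = Fd.VF_inner_integrable[OF u(1) B_mem[OF w(1)]]
  define D where "D \<xi> = A u \<xi> \<bullet>c w \<xi> - u \<xi> \<bullet>c B w \<xi>" for \<xi>
  have D: "integrable \<omega> D" unfolding D_def by (rule Bochner_Integration.integrable_diff[OF i1 i2])
  have bnd: "(cmod (D \<xi>))\<^sup>2 \<le> 2 * C * vsq (A u \<xi>) + 2 * C * vsq (B w \<xi>)" if \<xi>: "\<xi> \<in> space \<omega>" for \<xi>
  proof -
    have sq: "(cmod (v \<bullet>c v'))\<^sup>2 \<le> vsq v * vsq v'" if "v \<in> carrier_vec (dm \<xi>)" "v' \<in> carrier_vec (dm \<xi>)" for v v'
      using power_mono[OF Fd.cscalar_prod_le(1)[OF that], of 2] by (simp add: power_mult_distrib)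
    have "(cmod (A u \<xi> \<bullet>c w \<xi>))\<^sup>2 \<le> vsq (A u \<xi>) * C"
      by (rule order_trans[OF sq[OF c(3,2)[OF \<xi>]]]) (use w(2) \<xi> in \<open>intro mult_left_mono, auto\<close>)
    moreover have "(cmod (u \<xi> \<bullet>c B w \<xi>))\<^sup>2 \<le> C * vsq (B w \<xi>)"
      by (rule order_trans[OF sq[OF c(1,4)[OF \<xi>]]]) (use u(2) \<xi> in \<open>intro mult_right_mono, auto\<close>)
    moreover have "(cmod (x - y))\<^sup>2 \<le> 2 * (cmod x)\<^sup>2 + 2 * (cmod y)\<^sup>2" for x y :: complex
    proof -
      have "(cmod (x - y))\<^sup>2 \<le> (cmod x + cmod y)\<^sup>2" by (intro power_mono norm_triangle_ineq4) simp
      also have "\<dots> \<le> 2 * (cmod x)\<^sup>2 + 2 * (cmod y)\<^sup>2"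
        using sum_squares_bound[of "cmod x" "cmod y"] by (simp add: power2_sum)
      finally show ?thesis .
    qed
    note this[of "A u \<xi> \<bullet>c w \<xi>" "u \<xi> \<bullet>c B w \<xi>"]
    ultimately show ?thesis unfolding D_def by (simp add: mult.commute mult.left_commute)
  qed
  have D2: "integrable \<omega> (\<lambda>\<xi>. (cmod (D \<xi>))\<^sup>2)"
  proof (rule Bochner_Integration.integrable_bound)
    show "integrable \<omega> (\<lambda>\<xi>. 2 * C * vsq (A u \<xi>) + 2 * C * vsq (B w \<xi>))"
      by (intro Bochner_Integration.integrable_add integrable_mult_right Fd.vec_fields_integrable A_mem B_mem u(1) w(1))
    show "(\<lambda>\<xi>. (cmod (D \<xi>))\<^sup>2) \<in> borel_measurable \<omega>"
      using borel_measurable_integrable[OF D] by measurable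
    show "AE \<xi> in \<omega>. norm ((cmod (D \<xi>))\<^sup>2) \<le> norm (2 * C * vsq (A u \<xi>) + 2 * C * vsq (B w \<xi>))"
    proof (rule AE_I2)
      fix \<xi> assume "\<xi> \<in> space \<omega>"
      from bnd[OF this] show "norm ((cmod (D \<xi>))\<^sup>2) \<le> norm (2 * C * vsq (A u \<xi>) + 2 * C * vsq (B w \<xi>))" by simp
    qed
  qed
  have "AE \<xi> in \<omega>. D \<xi> = 0"
  proof (rule AE_zero_if_character_orthogonal[OF D D2])
    fix a
    let ?u = "\<lambda>\<xi>. cnj (\<xi> a) \<cdot>\<^sub>v u \<xi>"
    have cu: "?u \<in> Fd.VF" by (rule VF_char[OF u(1)])
    note j1 = Fd.VF_inner_integrable[OF A_mem[OF cu] w(1)] and j2 = Fd.VF_inner_integrable[OF cu B_mem[OF w(1)]]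
    have "AE \<xi> in \<omega>. A ?u \<xi> \<bullet>c w \<xi> - ?u \<xi> \<bullet>c B w \<xi> = cnj (\<xi> a) * D \<xi>"
      using cov[OF u(1), of a] AE_space
    proof eventually_elim
      case (elim \<xi>)
      show ?case unfolding elim(1) D_def
        using smult_cscalar_prod(1)[OF c(3,2)[OF elim(2)]] smult_cscalar_prod(1)[OF c(1,4)[OF elim(2)]]
        by (simp add: right_diff_distrib)
    qed
    hence "(\<integral>\<xi>. cnj (\<xi> a) * D \<xi> \<partial>\<omega>) = (\<integral>\<xi>. A ?u \<xi> \<bullet>c w \<xi> - ?u \<xi> \<bullet>c B w \<xi> \<partial>\<omega>)"
      by (intro integral_cong_AE borel_measurable_times char_omega_measurable borel_measurable_diff
          borel_measurable_integrable[OF D] borel_measurable_integrable[OF j1] borel_measurable_integrable[OF j2]) auto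
    also have "\<dots> = 0" using adj[OF cu w(1)] Bochner_Integration.integral_diff[OF j1 j2] by simp
    finally show "(\<integral>\<xi>. cnj (\<xi> a) * D \<xi> \<partial>\<omega>) = 0" .
  qed
  thus ?thesis by eventually_elim (simp add: D_def)
qed

text \<open>With \<open>u\<close> also the product of \<open>\<phi>\<close> and \<open>u\<close> is
  bounded, so the pointwise adjoint relation holds for both. Comparing the two moves
  \<open>\<phi>\<close> past \<open>A\<close> in every pairing with a bounded field, and such
  pairings determine a field.\<close>

lemma character_covariant_bounded:
  assumes A_mem: "\<And>u. u \<in> Fd.VF \<Longrightarrow> A u \<in> Fd.VF" and B_mem: "\<And>u. u \<in> Fd.VF \<Longrightarrow> B u \<in> Fd.VF"
    and adj: "\<And>u w. \<lbrakk>u \<in> Fd.VF; w \<in> Fd.VF\<rbrakk> \<Longrightarrow> (\<integral>\<xi>. A u \<xi> \<bullet>c w \<xi> \<partial>\<omega>) = (\<integral>\<xi>. u \<xi> \<bullet>c B w \<xi> \<partial>\<omega>)"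
    and cov: "\<And>u a. u \<in> Fd.VF \<Longrightarrow> AE \<xi> in \<omega>. A (\<lambda>\<xi>. cnj (\<xi> a) \<cdot>\<^sub>v u \<xi>) \<xi> = cnj (\<xi> a) \<cdot>\<^sub>v A u \<xi>"
    and u: "u \<in> Fd.VF" "\<And>\<xi>. \<xi> \<in> \<Omega> \<Longrightarrow> vsq (u \<xi>) \<le> C"
    and \<phi>: "\<phi> \<in> borel_measurable \<omega>" "\<And>\<xi>. \<xi> \<in> \<Omega> \<Longrightarrow> cmod (\<phi> \<xi>) \<le> b"
  shows "AE \<xi> in \<omega>. A (\<lambda>\<xi>. \<phi> \<xi> \<cdot>\<^sub>v u \<xi>) \<xi> = \<phi> \<xi> \<cdot>\<^sub>v A u \<xi>"
proof -
  have \<phi>AE: "AE \<xi> in \<omega>. cmod (\<phi> \<xi>) \<le> b" by (rule AE_I2) (use \<phi>(2) in simp)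
  let ?u = "\<lambda>\<xi>. \<phi> \<xi> \<cdot>\<^sub>v u \<xi>"
  have \<phi>u: "?u \<in> Fd.VF" by (rule Fd.VF_smult[OF \<phi>(1) u(1) \<phi>AE])
  have \<phi>Au: "(\<lambda>\<xi>. \<phi> \<xi> \<cdot>\<^sub>v A u \<xi>) \<in> Fd.VF" by (rule Fd.VF_smult[OF \<phi>(1) A_mem[OF u(1)] \<phi>AE])
  have \<phi>ub: "vsq (?u \<xi>) \<le> b\<^sup>2 * C" if "\<xi> \<in> \<Omega>" for \<xi>
    unfolding vsq_smult using \<phi>(2)[OF that] u(2)[OF that] by (intro mult_mono power_mono) auto
  show ?thesis
  proof (rule Fd.VF_eq_if_bounded_orthogonal[OF A_mem[OF \<phi>u] \<phi>Au])
    fix w :: "('g \<Rightarrow> complex) \<Rightarrow> complex Matrix.vec" and B' assume w: "w \<in> Fd.VF" "\<And>\<xi>. \<xi> \<in> space \<omega> \<Longrightarrow> vsq (w \<xi>) \<le> B'"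
    \<comment> \<open>One bound for the three fields \<open>w\<close>, \<open>u\<close> and
      \<open>\<phi>\<close> times \<open>u\<close>.\<close>
    define C' where "C' = max B' (max C (b\<^sup>2 * C))"
    have b1: "vsq (w \<xi>) \<le> C'" and b2: "vsq (u \<xi>) \<le> C'" and b3: "vsq (?u \<xi>) \<le> C'" if "\<xi> \<in> \<Omega>" for \<xi>
      using w(2)[of \<xi>] u(2)[OF that] \<phi>ub[OF that] that unfolding C'_def space_omega by (blast intro: order_trans max.cobounded1 max.cobounded2)+
    have "AE \<xi> in \<omega>. A ?u \<xi> \<bullet>c w \<xi> = ?u \<xi> \<bullet>c B w \<xi>"
      by (rule character_covariant_form[of A B, OF A_mem B_mem adj cov \<phi>u b3 w(1) b1])
    moreover have "AE \<xi> in \<omega>. A u \<xi> \<bullet>c w \<xi> = u \<xi> \<bullet>c B w \<xi>"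
      by (rule character_covariant_form[of A B, OF A_mem B_mem adj cov u(1) b2 w(1) b1])
    ultimately have "AE \<xi> in \<omega>. A ?u \<xi> \<bullet>c w \<xi> = (\<phi> \<xi> \<cdot>\<^sub>v A u \<xi>) \<bullet>c w \<xi>"
      using AE_space
    proof eventually_elim
      case (elim \<xi>)
      show ?case unfolding elim(1)
        using elim(2) smult_cscalar_prod(1)[OF Fd.VF_carrier[OF u(1) elim(3)] Fd.VF_carrier[OF B_mem[OF w(1)] elim(3)]]
          smult_cscalar_prod(1)[OF Fd.VF_carrier[OF A_mem[OF u(1)] elim(3)] Fd.VF_carrier[OF w(1) elim(3)]]
        by simp
    qed
    thus "(\<integral>\<xi>. A ?u \<xi> \<bullet>c w \<xi> \<partial>\<omega>) = (\<integral>\<xi>. (\<phi> \<xi> \<cdot>\<^sub>v A u \<xi>) \<bullet>c w \<xi> \<partial>\<omega>)"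
      by (intro integral_cong_AE borel_measurable_integrable Fd.VF_inner_integrable A_mem \<phi>u \<phi>Au w(1))
  qed
qed

text \<open>Here \<open>u\<close> may be unbounded while the test field \<open>w\<close> stays
  bounded. The bounded case is applied with \<open>A\<close> and \<open>B\<close> exchanged, to
  \<open>w\<close> and the conjugate of \<open>\<phi>\<close>, and the adjoint relation carries the
  result back to \<open>A\<close>.\<close>

lemma character_covariant_decomposable:
  assumes A_mem: "\<And>u. u \<in> Fd.VF \<Longrightarrow> A u \<in> Fd.VF" and B_mem: "\<And>u. u \<in> Fd.VF \<Longrightarrow> B u \<in> Fd.VF"
    and adj: "\<And>u w. \<lbrakk>u \<in> Fd.VF; w \<in> Fd.VF\<rbrakk> \<Longrightarrow> (\<integral>\<xi>. A u \<xi> \<bullet>c w \<xi> \<partial>\<omega>) = (\<integral>\<xi>. u \<xi> \<bullet>c B w \<xi> \<partial>\<omega>)"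
    and adj': "\<And>u w. \<lbrakk>u \<in> Fd.VF; w \<in> Fd.VF\<rbrakk> \<Longrightarrow> (\<integral>\<xi>. B u \<xi> \<bullet>c w \<xi> \<partial>\<omega>) = (\<integral>\<xi>. u \<xi> \<bullet>c A w \<xi> \<partial>\<omega>)"
    and cov: "\<And>u a. u \<in> Fd.VF \<Longrightarrow> AE \<xi> in \<omega>. B (\<lambda>\<xi>. cnj (\<xi> a) \<cdot>\<^sub>v u \<xi>) \<xi> = cnj (\<xi> a) \<cdot>\<^sub>v B u \<xi>"
    and u: "u \<in> Fd.VF"
    and \<phi>: "\<phi> \<in> borel_measurable \<omega>" "\<And>\<xi>. \<xi> \<in> \<Omega> \<Longrightarrow> cmod (\<phi> \<xi>) \<le> b"
  shows "AE \<xi> in \<omega>. A (\<lambda>\<xi>. \<phi> \<xi> \<cdot>\<^sub>v u \<xi>) \<xi> = \<phi> \<xi> \<cdot>\<^sub>v A u \<xi>"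
proof -
  have \<phi>AE: "AE \<xi> in \<omega>. cmod (\<phi> \<xi>) \<le> b" "AE \<xi> in \<omega>. cmod (cnj (\<phi> \<xi>)) \<le> b" by (rule AE_I2; use \<phi>(2) in simp)+
  have c\<phi>: "(\<lambda>\<xi>. cnj (\<phi> \<xi>)) \<in> borel_measurable \<omega>" by (rule borel_measurable_cnj[OF \<phi>(1)])
  let ?u = "\<lambda>\<xi>. \<phi> \<xi> \<cdot>\<^sub>v u \<xi>"
  have \<phi>u: "?u \<in> Fd.VF" by (rule Fd.VF_smult[OF \<phi>(1) u \<phi>AE(1)])
  have \<phi>Au: "(\<lambda>\<xi>. \<phi> \<xi> \<cdot>\<^sub>v A u \<xi>) \<in> Fd.VF" by (rule Fd.VF_smult[OF \<phi>(1) A_mem[OF u] \<phi>AE(1)])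
  show ?thesis
  proof (rule Fd.VF_eq_if_bounded_orthogonal[OF A_mem[OF \<phi>u] \<phi>Au])
    fix w :: "('g \<Rightarrow> complex) \<Rightarrow> complex Matrix.vec" and B' assume w: "w \<in> Fd.VF" "\<And>\<xi>. \<xi> \<in> space \<omega> \<Longrightarrow> vsq (w \<xi>) \<le> B'"
    let ?w = "\<lambda>\<xi>. cnj (\<phi> \<xi>) \<cdot>\<^sub>v w \<xi>"
    have \<phi>w: "?w \<in> Fd.VF" by (rule Fd.VF_smult[OF c\<phi> w(1) \<phi>AE(2)])
    have "AE \<xi> in \<omega>. B ?w \<xi> = cnj (\<phi> \<xi>) \<cdot>\<^sub>v B w \<xi>"
      by (rule character_covariant_bounded[of B A w B' "\<lambda>\<xi>. cnj (\<phi> \<xi>)" b, OF B_mem A_mem adj' cov w(1) _ c\<phi>])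
        (use w(2) \<phi>(2) in auto)
    hence e: "AE \<xi> in \<omega>. ?u \<xi> \<bullet>c B w \<xi> = u \<xi> \<bullet>c B ?w \<xi>"
      using AE_space
    proof eventually_elim
      case (elim \<xi>)
      show ?case unfolding elim(1)
        using smult_cscalar_prod[OF Fd.VF_carrier[OF u elim(2)] Fd.VF_carrier[OF B_mem[OF w(1)] elim(2)]] by simp
    qed
    have "(\<integral>\<xi>. A ?u \<xi> \<bullet>c w \<xi> \<partial>\<omega>) = (\<integral>\<xi>. ?u \<xi> \<bullet>c B w \<xi> \<partial>\<omega>)" by (rule adj[OF \<phi>u w(1)])
    also have "\<dots> = (\<integral>\<xi>. u \<xi> \<bullet>c B ?w \<xi> \<partial>\<omega>)"
      by (intro integral_cong_AE borel_measurable_integrable Fd.VF_inner_integrable B_mem \<phi>u \<phi>w u w(1) e)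
    also have "\<dots> = (\<integral>\<xi>. A u \<xi> \<bullet>c ?w \<xi> \<partial>\<omega>)" by (rule adj[OF u \<phi>w, symmetric])
    also have "\<dots> = (\<integral>\<xi>. (\<phi> \<xi> \<cdot>\<^sub>v A u \<xi>) \<bullet>c w \<xi> \<partial>\<omega>)"
    proof (rule Bochner_Integration.integral_cong[OF refl])
      fix \<xi> assume \<xi>: "\<xi> \<in> space \<omega>"
      show "A u \<xi> \<bullet>c ?w \<xi> = (\<phi> \<xi> \<cdot>\<^sub>v A u \<xi>) \<bullet>c w \<xi>"
        using smult_cscalar_prod[OF Fd.VF_carrier[OF A_mem[OF u] \<xi>] Fd.VF_carrier[OF w(1) \<xi>]] by simp
    qed
    finally show "(\<integral>\<xi>. A ?u \<xi> \<bullet>c w \<xi> \<partial>\<omega>) = (\<integral>\<xi>. (\<phi> \<xi> \<cdot>\<^sub>v A u \<xi>) \<bullet>c w \<xi> \<partial>\<omega>)" .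
  qed
qed

end

section \<open>The isomorphism\<close>

context translation_setting
begin

lemma compressed_translation_eq: "f \<in> H \<Longrightarrow> compressed_translation \<nu> lam H a f = translation \<nu> lam a f"
  by (simp add: compressed_translation_def K.projection_ident[OF H_closed H_invariant])

text \<open>On the invariant space \<open>H\<close> the compressions act as the translations
  themselves, and translation by \<open>- a\<close> is adjoint to translation by
  \<open>a\<close>.\<close>

sublocale C: adjoint_closed Hs "range (compressed_translation \<nu> lam H)"
proof unfold_locales
  fix S :: "('g \<times> 'y \<Rightarrow> complex) set \<Rightarrow> ('g \<times> 'y \<Rightarrow> complex) set"
  assume "S \<in> range (compressed_translation \<nu> lam H)"
  then obtain a where S: "S = compressed_translation \<nu> lam H a" by blast
  show "S f \<in> pts Hs" if "f \<in> pts Hs" for f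
    using that H_invariant by (simp add: S compressed_translation_eq)
  show "\<exists>S'\<in>range (compressed_translation \<nu> lam H). \<forall>x\<in>pts Hs. \<forall>y\<in>pts Hs. inner Hs (S x) y = inner Hs x (S' y)"
    by (rule bexI[of _ "compressed_translation \<nu> lam H (- a)"])
      (simp_all add: S compressed_translation_eq translation_adjoint H_sub)
qed

abbreviation "V \<equiv> translation_invariant_operators \<nu> lam H"

lemma V_eq: "V = commutant Hs (range (compressed_translation \<nu> lam H))"
  by (simp add: translation_invariant_operators_def)

lemma V_translation: "\<lbrakk>S \<in> pts V; f \<in> H\<rbrakk> \<Longrightarrow> S (translation \<nu> lam a f) = translation \<nu> lam a (S f)"
  and V_mem: "\<lbrakk>S \<in> pts V; f \<in> H\<rbrakk> \<Longrightarrow> S f \<in> H"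
proof -
  show m: "S f \<in> H" if "S \<in> pts V" "f \<in> H" for S f
    using linear_mapD(1)[OF C.V_lin] that unfolding V_eq by simp
  assume S: "S \<in> pts V" and f: "f \<in> H"
  have "compressed_translation \<nu> lam H a (S f) = S (compressed_translation \<nu> lam H a f)"
    by (rule C.V_commute) (use S f in \<open>simp_all add: V_eq\<close>)
  thus "S (translation \<nu> lam a f) = translation \<nu> lam a (S f)"
    using m[OF S f] f by (simp add: compressed_translation_eq)
qed

abbreviation "Ri \<equiv> adjoint Hs Fd.X R"

lemma Ri_R: "f \<in> H \<Longrightarrow> Ri (R f) = f"
  and Ri_mem: "a \<in> pts Fd.X \<Longrightarrow> Ri a \<in> H"
  and R_Ri: "a \<in> pts Fd.X \<Longrightarrow> R (Ri a) = a"
  and R_mem: "f \<in> H \<Longrightarrow> R f \<in> pts Fd.X"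
  using Hs.adjoint_unitary[OF R_unitary] linear_mapD(1)[OF R_linear] by simp_all

lemma R_injD: "\<lbrakk>R f = R g; f \<in> H; g \<in> H\<rbrakk> \<Longrightarrow> f = g"
  by (metis Ri_R)

lemma rep_R: "f \<in> H \<Longrightarrow> rep (R f) \<in> Fd.VF"
  by (rule Fd.rep_VF[OF R_mem])

lemma R_rep: "f \<in> H \<Longrightarrow> Fd.vcl (rep (R f)) = R f"
  by (rule Fd.X_class_rep[OF R_mem])

lemma inner_R: "\<lbrakk>f \<in> H; g \<in> H\<rbrakk> \<Longrightarrow> inner K f g = (\<integral>\<xi>. rep (R f) \<xi> \<bullet>c rep (R g) \<xi> \<partial>\<omega>)"
  unfolding R_inner[symmetric] by (rule Fd.X_inner_rep)

lemma R_norm: "f \<in> H \<Longrightarrow> hnorm Fd.X (R f) = hnorm K f"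
  by (simp add: hnorm_def R_inner)

lemma norm_R: "f \<in> H \<Longrightarrow> (hnorm K f)\<^sup>2 = (\<integral>\<xi>. vsq (rep (R f) \<xi>) \<partial>\<omega>)"
  using Fd.X_norm[OF rep_R] R_norm by (simp add: R_rep)

lemma R_translation_rep:
  assumes f: "f \<in> H" shows "R (translation \<nu> lam a f) = Fd.vcl (\<lambda>\<xi>. cnj (\<xi> a) \<cdot>\<^sub>v rep (R f) \<xi>)"
  unfolding R_translation[OF f]
proof (rule ae_class_cong)
  show "AE \<xi> in \<omega>. cnj (\<xi> a) \<cdot>\<^sub>v cf (FI f) \<xi> = cnj (\<xi> a) \<cdot>\<^sub>v rep (R f) \<xi>"
    using Fd.vcl_rep_AE[OF cf_VF[OF f]] unfolding R_cf[OF f] by eventually_elim simp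
qed

abbreviation "\<Lambda> \<equiv> Lambda_map \<nu> lam \<nu>' Phat q FI H"

lemma
  assumes s: "s \<in> Fd.MF" and f: "f \<in> H"
  shows R_Lambda: "R (\<Lambda> (Fd.mcl s) f) = Fd.vcl (\<lambda>\<xi>. s \<xi> *\<^sub>v rep (R f) \<xi>)"
    and Lambda_mem: "\<Lambda> (Fd.mcl s) f \<in> H"
proof -
  have "mult_op \<omega> dm (Fd.mcl s) (R f) = Fd.vcl (\<lambda>\<xi>. s \<xi> *\<^sub>v rep (R f) \<xi>)"
    using Fd.mult_op_class[OF s rep_R[OF f]] unfolding R_rep[OF f] .
  hence e: "\<Lambda> (Fd.mcl s) f = Ri (Fd.vcl (\<lambda>\<xi>. s \<xi> *\<^sub>v rep (R f) \<xi>))"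
    using f by (simp add: Lambda_map_def Xspace_X)
  have m: "Fd.vcl (\<lambda>\<xi>. s \<xi> *\<^sub>v rep (R f) \<xi>) \<in> pts Fd.X"
    by (rule Fd.X_class_mem[OF Fd.MF_mult_VF[OF s rep_R[OF f]]])
  show "R (\<Lambda> (Fd.mcl s) f) = Fd.vcl (\<lambda>\<xi>. s \<xi> *\<^sub>v rep (R f) \<xi>)" unfolding e by (rule R_Ri[OF m])
  show "\<Lambda> (Fd.mcl s) f \<in> H" unfolding e by (rule Ri_mem[OF m])
qed

lemma rep_R_Lambda:
  assumes s: "s \<in> Fd.MF" and f: "f \<in> H"
  shows "AE \<xi> in \<omega>. rep (R (\<Lambda> (Fd.mcl s) f)) \<xi> = s \<xi> *\<^sub>v rep (R f) \<xi>"
  unfolding R_Lambda[OF s f] by (rule Fd.vcl_rep_AE[OF Fd.MF_mult_VF[OF s rep_R[OF f]]])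

text \<open>Identities between vectors of \<open>H\<close> are verified after applying
  \<open>R\<close>, almost everywhere on representatives.\<close>

lemma R_eqI:
  assumes "f \<in> H" "g \<in> H" "AE \<xi> in \<omega>. rep (R f) \<xi> = rep (R g) \<xi>" shows "f = g"
proof (rule R_injD)
  show "R f = R g" using ae_class_cong[OF assms(3), of Fd.VF] R_rep[OF assms(1)] R_rep[OF assms(2)] by simp
qed (rule assms)+

lemma rep_R_add:
  assumes f: "f \<in> H" and g: "g \<in> H"
  shows "AE \<xi> in \<omega>. rep (R (vadd K f g)) \<xi> = rep (R f) \<xi> + rep (R g) \<xi>"
proof -
  have "R (vadd K f g) = vadd Fd.X (Fd.vcl (rep (R f))) (Fd.vcl (rep (R g)))"
    using linear_mapD(2)[OF R_linear, of f g] f g by (simp add: R_rep)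
  thus ?thesis unfolding Fd.X_add[OF rep_R[OF f] rep_R[OF g]]
    using Fd.vcl_rep_AE[OF Fd.VF_add[OF rep_R[OF f] rep_R[OF g]]] by (elim ssubst)
qed

lemma rep_R_scale:
  assumes f: "f \<in> H"
  shows "AE \<xi> in \<omega>. rep (R (vscale K c f)) \<xi> = c \<cdot>\<^sub>v rep (R f) \<xi>"
proof -
  have "R (vscale K c f) = vscale Fd.X c (Fd.vcl (rep (R f)))"
    using linear_mapD(3)[OF R_linear, of f c] f by (simp add: R_rep)
  thus ?thesis unfolding Fd.X_scale[OF rep_R[OF f]]
    using Fd.vcl_rep_AE[OF Fd.VF_scale[OF rep_R[OF f]]] by (elim ssubst)
qed

lemma rep_R_translation:
  assumes f: "f \<in> H"
  shows "AE \<xi> in \<omega>. rep (R (translation \<nu> lam a f)) \<xi> = cnj (\<xi> a) \<cdot>\<^sub>v rep (R f) \<xi>"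
  unfolding R_translation_rep[OF f] by (rule Fd.vcl_rep_AE[OF VF_char[OF rep_R[OF f]]])

lemma rep_R_zero: "AE \<xi> in \<omega>. rep (R (vzero K)) \<xi> = 0\<^sub>v (dm \<xi>)"
proof -
  have z: "vzero K \<in> H" by (rule closed_subspaceD(2)[OF H_closed])
  have "vscale K 0 (vzero K) = vzero K" by (rule K.vec_eqI) auto
  hence "AE \<xi> in \<omega>. rep (R (vzero K)) \<xi> = 0 \<cdot>\<^sub>v rep (R (vzero K)) \<xi>" using rep_R_scale[OF z, of 0] by simp
  thus ?thesis using AE_space
  proof eventually_elim
    case (elim \<xi>)
    have c: "rep (R (vzero K)) \<xi> \<in> carrier_vec (dm \<xi>)" by (rule Fd.VF_carrier[OF rep_R[OF z] elim(2)])
    show ?case by (subst elim(1)) (use c in auto)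
  qed
qed

lemmas H_add = closed_subspaceD(3)[OF H_closed] and H_scale = closed_subspaceD(4)[OF H_closed]
  and H_zero = closed_subspaceD(2)[OF H_closed]

lemma Lambda_norm_le:
  assumes s: "s \<in> Fd.MF" and f: "f \<in> H" and C: "0 \<le> C" "AE \<xi> in \<omega>. mat_norm (s \<xi>) \<le> C"
  shows "hnorm K (\<Lambda> (Fd.mcl s) f) \<le> C * hnorm K f"
proof -
  have "(hnorm K (\<Lambda> (Fd.mcl s) f))\<^sup>2 = (hnorm Fd.X (Fd.vcl (\<lambda>\<xi>. s \<xi> *\<^sub>v rep (R f) \<xi>)))\<^sup>2"
    using R_norm[OF Lambda_mem[OF s f]] R_Lambda[OF s f] by simp
  also have "\<dots> = (\<integral>\<xi>. vsq (s \<xi> *\<^sub>v rep (R f) \<xi>) \<partial>\<omega>)"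
    by (simp add: Fd.X_norm[OF Fd.MF_mult_VF[OF s rep_R[OF f]]])
  also have "\<dots> \<le> C\<^sup>2 * (hnorm K f)\<^sup>2"
    unfolding norm_R[OF f] by (rule Fd.VF_mult(2)[OF Fd.MF_mmeas[OF s] rep_R[OF f] C(2)])
  finally have "(hnorm K (\<Lambda> (Fd.mcl s) f))\<^sup>2 \<le> (C * hnorm K f)\<^sup>2" by (simp add: power_mult_distrib)
  thus ?thesis by (rule power2_le_imp_le) (use C(1) H_sub[OF f] in simp)
qed

text \<open>A matrix acts linearly in each fiber, so it commutes with multiplication by the scalars
  \<open>cnj (\<xi> a)\<close> into which \<open>R\<close> turns translations.\<close>

lemma Lambda_V:
  assumes s: "s \<in> Fd.MF" shows "\<Lambda> (Fd.mcl s) \<in> pts V"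
proof -
  let ?L = "\<Lambda> (Fd.mcl s)"
  note mem = Lambda_mem[OF s] and rp = rep_R_Lambda[OF s]
  have sc: "s \<xi> \<in> carrier_mat (dm \<xi>) (dm \<xi>)" if "\<xi> \<in> space \<omega>" for \<xi> by (rule Fd.MF_carrier[OF s that])
  have "linear_map Hs Hs ?L"
    unfolding linear_map_def
  proof (intro conjI ballI allI)
    fix f assume "f \<in> pts Hs" hence f: "f \<in> H" by simp
    show "?L f \<in> pts Hs" using mem[OF f] by simp
    have "?L (vscale K c f) = vscale K c (?L f)" for c
    proof (rule R_eqI[OF mem[OF H_scale[OF f]] H_scale[OF mem[OF f]]])
      show "AE \<xi> in \<omega>. rep (R (?L (vscale K c f))) \<xi> = rep (R (vscale K c (?L f))) \<xi>"
        using rp[OF H_scale[OF f, of c]] rep_R_scale[OF mem[OF f], of c] rp[OF f] rep_R_scale[OF f, of c] AE_space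
      proof eventually_elim
        case (elim \<xi>)
        show ?case unfolding elim(1-4) by (rule mult_mat_vec[OF sc[OF elim(5)] Fd.VF_carrier[OF rep_R[OF f] elim(5)]])
      qed
    qed
    thus "?L (vscale Hs c f) = vscale Hs c (?L f)" for c by simp
    fix g assume "g \<in> pts Hs" hence g: "g \<in> H" by simp
    have "?L (vadd K f g) = vadd K (?L f) (?L g)"
    proof (rule R_eqI[OF mem[OF H_add[OF f g]] H_add[OF mem[OF f] mem[OF g]]])
      show "AE \<xi> in \<omega>. rep (R (?L (vadd K f g))) \<xi> = rep (R (vadd K (?L f) (?L g))) \<xi>"
        using rp[OF H_add[OF f g]] rep_R_add[OF mem[OF f] mem[OF g]] rp[OF f] rp[OF g] rep_R_add[OF f g] AE_space
      proof eventually_elim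
        case (elim \<xi>)
        show ?case unfolding elim(1-5)
          by (rule mult_add_distrib_mat_vec[OF sc[OF elim(6)] Fd.VF_carrier[OF rep_R[OF f] elim(6)] Fd.VF_carrier[OF rep_R[OF g] elim(6)]])
      qed
    qed
    thus "?L (vadd Hs f g) = vadd Hs (?L f) (?L g)" by simp
  qed
  moreover have "hnorm Hs (?L f) \<le> nrm Fd.Z (Fd.mcl s) * hnorm Hs f" if "f \<in> pts Hs" for f
    using Lambda_norm_le[OF s _ Fd.nrm_Z_nonneg[OF s] Fd.nrm_Z_AE[OF s], of f] that by (simp add: hnorm_def)
  moreover have "?L (translation \<nu> lam a f) = translation \<nu> lam a (?L f)" if f: "f \<in> H" for a f
  proof (rule R_eqI[OF mem[OF H_invariant[OF f]] H_invariant[OF mem[OF f]]])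
    show "AE \<xi> in \<omega>. rep (R (?L (translation \<nu> lam a f))) \<xi> = rep (R (translation \<nu> lam a (?L f))) \<xi>"
      using rp[OF H_invariant[OF f, of a]] rep_R_translation[OF mem[OF f], of a] rp[OF f] rep_R_translation[OF f, of a] AE_space
    proof eventually_elim
      case (elim \<xi>)
      show ?case unfolding elim(1-4) by (rule mult_mat_vec[OF sc[OF elim(5)] Fd.VF_carrier[OF rep_R[OF f] elim(5)]])
    qed
  qed
  moreover have "?L \<in> extensional (pts Hs)" by (simp add: Lambda_map_def)
  ultimately show ?thesis
    unfolding V_eq C.V_iff bounded_op_def using mem
    by (auto simp: compressed_translation_eq H_invariant)
qed

lemma V_eqI: "\<lbrakk>S \<in> pts V; T \<in> pts V; \<And>f. f \<in> H \<Longrightarrow> S f = T f\<rbrakk> \<Longrightarrow> S = T"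
  unfolding V_eq by (rule C.V_eqI) simp_all

lemma Lambda_ops:
  assumes s: "s \<in> Fd.MF" and t: "t \<in> Fd.MF"
  shows Lambda_add: "\<Lambda> (Fd.mcl (\<lambda>\<xi>. s \<xi> + t \<xi>)) = vadd V (\<Lambda> (Fd.mcl s)) (\<Lambda> (Fd.mcl t))"
    and Lambda_scale: "\<Lambda> (Fd.mcl (\<lambda>\<xi>. c \<cdot>\<^sub>m s \<xi>)) = vscale V c (\<Lambda> (Fd.mcl s))"
    and Lambda_mult: "\<Lambda> (Fd.mcl (\<lambda>\<xi>. s \<xi> * t \<xi>)) = mult V (\<Lambda> (Fd.mcl s)) (\<Lambda> (Fd.mcl t))"
    and Lambda_star: "\<Lambda> (Fd.mcl (\<lambda>\<xi>. mat_adjoint (s \<xi>))) = star V (\<Lambda> (Fd.mcl s))"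
proof -
  note V = Lambda_V[OF s, unfolded V_eq] Lambda_V[OF t, unfolded V_eq]
  note rs = rep_R_Lambda[OF s] and rt = rep_R_Lambda[OF t] and ms = Lambda_mem[OF s] and mt = Lambda_mem[OF t]
  have cs: "s \<xi> \<in> carrier_mat (dm \<xi>) (dm \<xi>)" and ct: "t \<xi> \<in> carrier_mat (dm \<xi>) (dm \<xi>)" if "\<xi> \<in> space \<omega>" for \<xi>
    by (rule Fd.MF_carrier[OF s that] Fd.MF_carrier[OF t that])+
  show "\<Lambda> (Fd.mcl (\<lambda>\<xi>. s \<xi> + t \<xi>)) = vadd V (\<Lambda> (Fd.mcl s)) (\<Lambda> (Fd.mcl t))"
  proof (rule V_eqI[OF Lambda_V[OF Fd.MF_add[OF s t]]])
    show "vadd V (\<Lambda> (Fd.mcl s)) (\<Lambda> (Fd.mcl t)) \<in> pts V" unfolding V_eq by (rule C.V_add_mem[OF V])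
    fix f assume f: "f \<in> H"
    have "\<Lambda> (Fd.mcl (\<lambda>\<xi>. s \<xi> + t \<xi>)) f = vadd K (\<Lambda> (Fd.mcl s) f) (\<Lambda> (Fd.mcl t) f)"
    proof (rule R_eqI[OF Lambda_mem[OF Fd.MF_add[OF s t] f] H_add[OF ms[OF f] mt[OF f]]])
      show "AE \<xi> in \<omega>. rep (R (\<Lambda> (Fd.mcl (\<lambda>\<xi>. s \<xi> + t \<xi>)) f)) \<xi> = rep (R (vadd K (\<Lambda> (Fd.mcl s) f) (\<Lambda> (Fd.mcl t) f))) \<xi>"
        using rep_R_Lambda[OF Fd.MF_add[OF s t] f] rep_R_add[OF ms[OF f] mt[OF f]] rs[OF f] rt[OF f] AE_space
      proof eventually_elim
        case (elim \<xi>)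
        show ?case unfolding elim(1-4)
          by (rule add_mult_distrib_mat_vec[OF cs ct Fd.VF_carrier[OF rep_R[OF f]]]) (rule elim(5))+
      qed
    qed
    thus "\<Lambda> (Fd.mcl (\<lambda>\<xi>. s \<xi> + t \<xi>)) f = vadd V (\<Lambda> (Fd.mcl s)) (\<Lambda> (Fd.mcl t)) f"
      using f unfolding V_eq by simp
  qed
  show "\<Lambda> (Fd.mcl (\<lambda>\<xi>. c \<cdot>\<^sub>m s \<xi>)) = vscale V c (\<Lambda> (Fd.mcl s))"
  proof (rule V_eqI[OF Lambda_V[OF Fd.MF_scale[OF s]]])
    show "vscale V c (\<Lambda> (Fd.mcl s)) \<in> pts V" unfolding V_eq by (rule C.V_scale_mem[OF V(1)])
    fix f assume f: "f \<in> H"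
    have "\<Lambda> (Fd.mcl (\<lambda>\<xi>. c \<cdot>\<^sub>m s \<xi>)) f = vscale K c (\<Lambda> (Fd.mcl s) f)"
    proof (rule R_eqI[OF Lambda_mem[OF Fd.MF_scale[OF s] f] H_scale[OF ms[OF f]]])
      show "AE \<xi> in \<omega>. rep (R (\<Lambda> (Fd.mcl (\<lambda>\<xi>. c \<cdot>\<^sub>m s \<xi>)) f)) \<xi> = rep (R (vscale K c (\<Lambda> (Fd.mcl s) f))) \<xi>"
        using rep_R_Lambda[OF Fd.MF_scale[OF s, of c] f] rep_R_scale[OF ms[OF f], of c] rs[OF f] AE_space
      proof eventually_elim
        case (elim \<xi>)
        show ?case unfolding elim(1-3)
          using cs[OF elim(4)] Fd.VF_carrier[OF rep_R[OF f] elim(4)] by (intro eq_vecI) auto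
      qed
    qed
    thus "\<Lambda> (Fd.mcl (\<lambda>\<xi>. c \<cdot>\<^sub>m s \<xi>)) f = vscale V c (\<Lambda> (Fd.mcl s)) f"
      using f unfolding V_eq by simp
  qed
  show "\<Lambda> (Fd.mcl (\<lambda>\<xi>. s \<xi> * t \<xi>)) = mult V (\<Lambda> (Fd.mcl s)) (\<Lambda> (Fd.mcl t))"
  proof (rule V_eqI[OF Lambda_V[OF Fd.MF_mult[OF s t]]])
    show "mult V (\<Lambda> (Fd.mcl s)) (\<Lambda> (Fd.mcl t)) \<in> pts V" unfolding V_eq by (rule C.V_mult_mem[OF V])
    fix f assume f: "f \<in> H"
    have "\<Lambda> (Fd.mcl (\<lambda>\<xi>. s \<xi> * t \<xi>)) f = \<Lambda> (Fd.mcl s) (\<Lambda> (Fd.mcl t) f)"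
    proof (rule R_eqI[OF Lambda_mem[OF Fd.MF_mult[OF s t] f] ms[OF mt[OF f]]])
      show "AE \<xi> in \<omega>. rep (R (\<Lambda> (Fd.mcl (\<lambda>\<xi>. s \<xi> * t \<xi>)) f)) \<xi> = rep (R (\<Lambda> (Fd.mcl s) (\<Lambda> (Fd.mcl t) f))) \<xi>"
        using rep_R_Lambda[OF Fd.MF_mult[OF s t] f] rs[OF mt[OF f]] rt[OF f] AE_space
      proof eventually_elim
        case (elim \<xi>)
        show ?case unfolding elim(1-3)
          by (rule assoc_mult_mat_vec[OF cs ct Fd.VF_carrier[OF rep_R[OF f]]]) (rule elim(4))+
      qed
    qed
    thus "\<Lambda> (Fd.mcl (\<lambda>\<xi>. s \<xi> * t \<xi>)) f = mult V (\<Lambda> (Fd.mcl s)) (\<Lambda> (Fd.mcl t)) f"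
      using f unfolding V_eq by simp
  qed
  have sa: "(\<lambda>\<xi>. mat_adjoint (s \<xi>)) \<in> Fd.MF" by (rule Fd.MF_adjoint[OF s])
  have "star V (\<Lambda> (Fd.mcl s)) = \<Lambda> (Fd.mcl (\<lambda>\<xi>. mat_adjoint (s \<xi>)))"
    unfolding V_eq
  proof (rule C.V_star_eqI[OF Lambda_V[OF sa, unfolded V_eq] V(1)])
    fix f g assume "f \<in> pts Hs" "g \<in> pts Hs"
    hence f: "f \<in> H" and g: "g \<in> H" by simp_all
    have "AE \<xi> in \<omega>. rep (R (\<Lambda> (Fd.mcl (\<lambda>\<xi>. mat_adjoint (s \<xi>))) f)) \<xi> \<bullet>c rep (R g) \<xi> =
        rep (R f) \<xi> \<bullet>c rep (R (\<Lambda> (Fd.mcl s) g)) \<xi>"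
      using rep_R_Lambda[OF sa f] rs[OF g] AE_space
    proof eventually_elim
      case (elim \<xi>)
      show ?case unfolding elim(1,2)
        by (rule mat_adjoint_inner[OF cs Fd.VF_carrier[OF rep_R[OF f]] Fd.VF_carrier[OF rep_R[OF g]]]) (rule elim(3))+
    qed
    hence "inner K (\<Lambda> (Fd.mcl (\<lambda>\<xi>. mat_adjoint (s \<xi>))) f) g = inner K f (\<Lambda> (Fd.mcl s) g)"
      unfolding inner_R[OF Lambda_mem[OF sa f] g] inner_R[OF f ms[OF g]]
      by (intro integral_cong_AE borel_measurable_integrable Fd.VF_inner_integrable rep_R f g ms Lambda_mem[OF sa])
    thus "inner Hs (\<Lambda> (Fd.mcl (\<lambda>\<xi>. mat_adjoint (s \<xi>))) f) g = inner Hs f (\<Lambda> (Fd.mcl s) g)" by simp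
  qed
  thus "\<Lambda> (Fd.mcl (\<lambda>\<xi>. mat_adjoint (s \<xi>))) = star V (\<Lambda> (Fd.mcl s))" by (rule sym)
qed

lemma Lambda_unit: "\<Lambda> (unit Fd.Z) = unit V"
proof (rule V_eqI)
  show "\<Lambda> (unit Fd.Z) \<in> pts V" unfolding Fd.Z_consts by (rule Lambda_V[OF Fd.MF_one])
  show "unit V \<in> pts V" unfolding V_eq by (rule C.V_unit_mem)
  fix f assume f: "f \<in> H"
  have "\<Lambda> (unit Fd.Z) f = f"
    unfolding Fd.Z_consts
  proof (rule R_eqI[OF Lambda_mem[OF Fd.MF_one f] f])
    show "AE \<xi> in \<omega>. rep (R (\<Lambda> (Fd.mcl (\<lambda>\<xi>. 1\<^sub>m (dm \<xi>))) f)) \<xi> = rep (R f) \<xi>"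
      using rep_R_Lambda[OF Fd.MF_one f] AE_space
    proof eventually_elim
      case (elim \<xi>)
      show ?case unfolding elim(1) by (rule one_mult_mat_vec[OF Fd.VF_carrier[OF rep_R[OF f] elim(2)]])
    qed
  qed
  thus "\<Lambda> (unit Fd.Z) f = unit V f" using f unfolding V_eq by simp
qed

lemma Lambda_zero: "\<Lambda> (vzero Fd.Z) = vzero V"
proof (rule V_eqI)
  show "\<Lambda> (vzero Fd.Z) \<in> pts V" unfolding Fd.Z_consts by (rule Lambda_V[OF Fd.MF_zero])
  show "vzero V \<in> pts V" unfolding V_eq by (rule C.V_zero_mem)
  fix f assume f: "f \<in> H"
  have "\<Lambda> (vzero Fd.Z) f = vzero K"
    unfolding Fd.Z_consts
  proof (rule R_eqI[OF Lambda_mem[OF Fd.MF_zero f] H_zero])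
    show "AE \<xi> in \<omega>. rep (R (\<Lambda> (Fd.mcl (\<lambda>\<xi>. 0\<^sub>m (dm \<xi>) (dm \<xi>))) f)) \<xi> = rep (R (vzero K)) \<xi>"
      using rep_R_Lambda[OF Fd.MF_zero f] rep_R_zero AE_space
    proof eventually_elim
      case (elim \<xi>)
      show ?case unfolding elim(1,2) using Fd.VF_carrier[OF rep_R[OF f] elim(3)] by (intro eq_vecI) auto
    qed
  qed
  thus "\<Lambda> (vzero Fd.Z) f = vzero V f" using f unfolding V_eq by simp
qed

text \<open>One inequality integrates the pointwise matrix bound. For the other, \<open>R\<close> is
  onto, so the operator bound holds for every square-integrable field and can be localised by
  \<open>mat_norm_AE_le_if_bounded\<close>.\<close>

lemma Lambda_nrm:
  assumes s: "s \<in> Fd.MF" shows "nrm V (\<Lambda> (Fd.mcl s)) = nrm Fd.Z (Fd.mcl s)"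
proof (rule antisym)
  let ?L = "\<Lambda> (Fd.mcl s)"
  note LV = Lambda_V[OF s, unfolded V_eq]
  have n: "hnorm Hs f = hnorm K f" for f by (simp add: hnorm_def)
  show "nrm V ?L \<le> nrm Fd.Z (Fd.mcl s)"
    unfolding V_eq
    by (rule C.V_norm_le) (use Lambda_norm_le[OF s _ Fd.nrm_Z_nonneg[OF s] Fd.nrm_Z_AE[OF s]] Fd.nrm_Z_nonneg[OF s] in \<open>simp_all add: n\<close>)
  have C: "0 \<le> nrm V ?L" unfolding V_eq by (rule C.V_norm_nonneg[OF LV])
  have "AE \<xi> in \<omega>. mat_norm (s \<xi>) \<le> nrm V ?L"
  proof (rule Fd.mat_norm_AE_le_if_bounded[OF s C])
    fix h assume h: "h \<in> Fd.VF"
    let ?f = "Ri (Fd.vcl h)"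
    have f: "?f \<in> H" and Rf: "R ?f = Fd.vcl h" using Ri_mem R_Ri h by simp_all
    have "(\<integral>\<xi>. vsq (s \<xi> *\<^sub>v h \<xi>) \<partial>\<omega>) = (hnorm Fd.X (Fd.vcl (\<lambda>\<xi>. s \<xi> *\<^sub>v h \<xi>)))\<^sup>2"
      by (simp add: Fd.X_norm[OF Fd.MF_mult_VF[OF s h]])
    also have "Fd.vcl (\<lambda>\<xi>. s \<xi> *\<^sub>v h \<xi>) = R (?L ?f)"
      unfolding R_Lambda[OF s f] Rf
    proof (rule ae_class_cong)
      show "AE \<xi> in \<omega>. s \<xi> *\<^sub>v h \<xi> = s \<xi> *\<^sub>v rep (Fd.vcl h) \<xi>"
        using Fd.vcl_rep_AE[OF h] by eventually_elim simp
    qed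
    also have "(hnorm Fd.X (R (?L ?f)))\<^sup>2 = (hnorm K (?L ?f))\<^sup>2" by (simp add: R_norm[OF Lambda_mem[OF s f]])
    also have "\<dots> \<le> (nrm V ?L * hnorm K ?f)\<^sup>2"
      using C.V_norm[OF LV, of ?f] f K.norm_nonneg[OF H_sub[OF Lambda_mem[OF s f]]]
      by (intro power_mono) (simp_all add: n flip: V_eq)
    also have "\<dots> = (nrm V ?L)\<^sup>2 * (hnorm Fd.X (Fd.vcl h))\<^sup>2" using R_norm[OF f] unfolding Rf by (simp add: power_mult_distrib)
    also have "\<dots> = (nrm V ?L)\<^sup>2 * (\<integral>\<xi>. vsq (h \<xi>) \<partial>\<omega>)" by (simp add: Fd.X_norm[OF h])
    finally show "(\<integral>\<xi>. vsq (s \<xi> *\<^sub>v h \<xi>) \<partial>\<omega>) \<le> (nrm V ?L)\<^sup>2 * (\<integral>\<xi>. vsq (h \<xi>) \<partial>\<omega>)" .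
  qed
  thus "nrm Fd.Z (Fd.mcl s) \<le> nrm V ?L" by (rule Fd.nrm_Z_le[OF s C])
qed

text \<open>Linearity and the equality of norms are applied to the difference of the two fields,
  whose matrices then have norm zero almost everywhere.\<close>

lemma Lambda_inj:
  assumes s: "s \<in> Fd.MF" and t: "t \<in> Fd.MF" and eq: "\<Lambda> (Fd.mcl s) = \<Lambda> (Fd.mcl t)"
  shows "Fd.mcl s = Fd.mcl t"
proof (rule ae_class_cong)
  define u where "u \<xi> = s \<xi> + (-1) \<cdot>\<^sub>m t \<xi>" for \<xi>
  have t': "(\<lambda>\<xi>. (-1) \<cdot>\<^sub>m t \<xi>) \<in> Fd.MF" by (rule Fd.MF_scale[OF t])
  have u: "u \<in> Fd.MF" unfolding u_def[abs_def] by (rule Fd.MF_add[OF s t'])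
  have "\<Lambda> (Fd.mcl u) = vadd V (\<Lambda> (Fd.mcl t)) (vscale V (-1) (\<Lambda> (Fd.mcl t)))"
    unfolding u_def[abs_def] Lambda_add[OF s t'] Lambda_scale[OF t t] eq ..
  also have "\<dots> = vzero V"
    by (rule complex_space.add_inverse) (use Lambda_V[OF t] wstar_algebra.axioms(1)[OF C.commutant_wstar] cstar_algebra.axioms(1) in \<open>auto simp: V_eq\<close>)
  finally have "nrm Fd.Z (Fd.mcl u) = nrm V (vzero V)" using Lambda_nrm[OF u] by simp
  also have "\<dots> \<le> 0" unfolding V_eq by (rule C.V_norm_le) (auto simp: hnorm_def)
  finally have n: "nrm Fd.Z (Fd.mcl u) \<le> 0" .
  show "AE \<xi> in \<omega>. s \<xi> = t \<xi>"
    using Fd.nrm_Z_AE[OF u] AE_space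
  proof eventually_elim
    case (elim \<xi>)
    have c: "s \<xi> \<in> carrier_mat (dm \<xi>) (dm \<xi>)" "t \<xi> \<in> carrier_mat (dm \<xi>) (dm \<xi>)" "u \<xi> \<in> carrier_mat (dm \<xi>) (dm \<xi>)"
      by (rule Fd.MF_carrier[OF s elim(2)] Fd.MF_carrier[OF t elim(2)] Fd.MF_carrier[OF u elim(2)])+
    have z: "u \<xi> = 0\<^sub>m (dm \<xi>) (dm \<xi>)" by (rule mat_norm_zero_iff[OF c(3)]) (use elim(1) n in linarith)
    show ?case
    proof (rule eq_matI)
      fix i j assume "i < dim_row (t \<xi>)" "j < dim_col (t \<xi>)"
      moreover have "u \<xi> $$ (i, j) = 0\<^sub>m (dm \<xi>) (dm \<xi>) $$ (i, j)" by (simp only: z)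
      ultimately show "s \<xi> $$ (i, j) = t \<xi> $$ (i, j)" using c by (simp add: u_def)
    qed (use c in auto)
  qed
qed

end

section \<open>Surjectivity and the final isomorphism\<close>

context translation_setting
begin

text \<open>\<open>S\<close> carried over to vector fields as a map between functions rather than
  classes, the form in which the covariance arguments are stated. Its value depends on the class of
  \<open>u\<close> alone.\<close>

definition transfer :: "(('g \<times> 'y \<Rightarrow> complex) set \<Rightarrow> ('g \<times> 'y \<Rightarrow> complex) set) \<Rightarrow>
    (('g \<Rightarrow> complex) \<Rightarrow> complex Matrix.vec) \<Rightarrow> ('g \<Rightarrow> complex) \<Rightarrow> complex Matrix.vec" where
  "transfer S u = rep (R (S (Ri (Fd.vcl u))))"

lemma
  assumes u: "u \<in> Fd.VF"
  shows Ri_vcl: "Ri (Fd.vcl u) \<in> H" and R_Ri_vcl: "R (Ri (Fd.vcl u)) = Fd.vcl u"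
  using Ri_mem R_Ri Fd.X_class_mem[OF u] by auto

lemma transfer_VF: "\<lbrakk>S \<in> pts V; u \<in> Fd.VF\<rbrakk> \<Longrightarrow> transfer S u \<in> Fd.VF"
  unfolding transfer_def by (rule rep_R[OF V_mem[OF _ Ri_vcl]])

lemma transfer_adjoint:
  assumes S: "S \<in> pts V" "S' \<in> pts V" and adj: "\<And>f g. \<lbrakk>f \<in> H; g \<in> H\<rbrakk> \<Longrightarrow> inner K (S f) g = inner K f (S' g)"
    and u: "u \<in> Fd.VF" and w: "w \<in> Fd.VF"
  shows "(\<integral>\<xi>. transfer S u \<xi> \<bullet>c w \<xi> \<partial>\<omega>) = (\<integral>\<xi>. u \<xi> \<bullet>c transfer S' w \<xi> \<partial>\<omega>)"
proof -
  let ?f = "Ri (Fd.vcl u)" and ?g = "Ri (Fd.vcl w)"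
  note f = Ri_vcl[OF u] and g = Ri_vcl[OF w]
  have "inner Fd.X (R (S ?f)) (R ?g) = inner Fd.X (R ?f) (R (S' ?g))"
    unfolding R_inner[OF V_mem[OF S(1) f] g] R_inner[OF f V_mem[OF S(2) g]] by (rule adj[OF f g])
  hence "inner Fd.X (Fd.vcl (transfer S u)) (Fd.vcl w) = inner Fd.X (Fd.vcl u) (Fd.vcl (transfer S' w))"
    unfolding transfer_def R_rep[OF V_mem[OF S(1) f]] R_rep[OF V_mem[OF S(2) g]] R_Ri_vcl[OF u] R_Ri_vcl[OF w] .
  thus ?thesis unfolding Fd.X_inner[OF transfer_VF[OF S(1) u] w] Fd.X_inner[OF u transfer_VF[OF S(2) w]] .
qed

text \<open>Under \<open>R\<close>, modulation by a character corresponds to a translation, with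
  which \<open>S\<close> commutes.\<close>

lemma transfer_character:
  assumes S: "S \<in> pts V" and u: "u \<in> Fd.VF"
  shows "AE \<xi> in \<omega>. transfer S (\<lambda>\<xi>. cnj (\<xi> a) \<cdot>\<^sub>v u \<xi>) \<xi> = cnj (\<xi> a) \<cdot>\<^sub>v transfer S u \<xi>"
proof -
  let ?f = "Ri (Fd.vcl u)"
  note f = Ri_vcl[OF u]
  have "Fd.vcl (\<lambda>\<xi>. cnj (\<xi> a) \<cdot>\<^sub>v u \<xi>) = R (translation \<nu> lam a ?f)"
    unfolding R_translation_rep[OF f] R_Ri_vcl[OF u]
  proof (rule ae_class_cong)
    show "AE \<xi> in \<omega>. cnj (\<xi> a) \<cdot>\<^sub>v u \<xi> = cnj (\<xi> a) \<cdot>\<^sub>v rep (Fd.vcl u) \<xi>"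
      using Fd.vcl_rep_AE[OF u] by eventually_elim simp
  qed
  hence "transfer S (\<lambda>\<xi>. cnj (\<xi> a) \<cdot>\<^sub>v u \<xi>) = rep (R (translation \<nu> lam a (S ?f)))"
    unfolding transfer_def by (simp add: Ri_R[OF H_invariant[OF f]] V_translation[OF S f])
  thus ?thesis unfolding transfer_def using rep_R_translation[OF V_mem[OF S f]] by simp
qed

lemma Lambda_surj:
  assumes S: "S \<in> pts V" shows "\<exists>s\<in>Fd.MF. \<Lambda> (Fd.mcl s) = S"
proof -
  note SV = S[unfolded V_eq]
  have S': "star V S \<in> pts V" unfolding V_eq by (rule C.V_star_mem[OF SV])
  have adj: "inner K (star V S f) g = inner K f (S g)" if "f \<in> H" "g \<in> H" for f g
    using C.V_star_inner[OF SV, of f g] that by (simp add: V_eq)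
  have adj': "inner K (S f) g = inner K f (star V S g)" if "f \<in> H" "g \<in> H" for f g
    using C.V_star_inner'[OF SV, of f g] that by (simp add: V_eq)
  note lin = C.V_lin[OF SV]
  define T where "T a = R (S (Ri a))" for a
  have T_R: "T (R f) = R (S f)" if "f \<in> H" for f by (simp add: T_def Ri_R[OF that])
  have "linear_map Fd.X Fd.X T"
    unfolding linear_map_def
  proof (intro conjI ballI allI)
    fix a assume a: "a \<in> pts Fd.X"
    obtain f where f: "f \<in> H" "a = R f" using R_surj[OF a] by blast
    show "T a \<in> pts Fd.X" unfolding f(2) T_R[OF f(1)] by (rule R_mem[OF V_mem[OF S f(1)]])
    fix c
    have "vscale Fd.X c a = R (vscale K c f)" using linear_mapD(3)[OF R_linear, of f c] f by simp
    hence "T (vscale Fd.X c a) = R (vscale K c (S f))"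
      using T_R[OF H_scale[OF f(1)]] linear_mapD(3)[OF lin, of f c] f(1) by simp
    thus "T (vscale Fd.X c a) = vscale Fd.X c (T a)"
      using linear_mapD(3)[OF R_linear, of "S f" c] V_mem[OF S f(1)] unfolding f(2) T_R[OF f(1)] by simp
    fix b assume b: "b \<in> pts Fd.X"
    obtain g where g: "g \<in> H" "b = R g" using R_surj[OF b] by blast
    have "vadd Fd.X a b = R (vadd K f g)" using linear_mapD(2)[OF R_linear, of f g] f g by simp
    hence "T (vadd Fd.X a b) = R (vadd K (S f) (S g))"
      using T_R[OF H_add[OF f(1) g(1)]] linear_mapD(2)[OF lin, of f g] f(1) g(1) by simp
    thus "T (vadd Fd.X a b) = vadd Fd.X (T a) (T b)"
      using linear_mapD(2)[OF R_linear, of "S f" "S g"] V_mem[OF S f(1)] V_mem[OF S g(1)]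
      unfolding f(2) g(2) T_R[OF f(1)] T_R[OF g(1)] by simp
  qed
  moreover have "hnorm Fd.X (T a) \<le> nrm V S * hnorm Fd.X a" if a: "a \<in> pts Fd.X" for a
  proof -
    obtain f where f: "f \<in> H" "a = R f" using R_surj[OF a] by blast
    have "hnorm Hs (S f) \<le> nrm V S * hnorm Hs f" using C.V_norm[OF SV, of f] f(1) by (simp add: V_eq)
    thus ?thesis unfolding f(2) T_R[OF f(1)] R_norm[OF f(1)] R_norm[OF V_mem[OF S f(1)]] by (simp add: hnorm_def)
  qed
  moreover have "0 \<le> nrm V S" unfolding V_eq by (rule C.V_norm_nonneg[OF SV])
  moreover have "T (Fd.vcl (\<lambda>\<xi>. \<phi> \<xi> \<cdot>\<^sub>v h \<xi>)) = Fd.vcl (\<lambda>\<xi>. \<phi> \<xi> \<cdot>\<^sub>v rep (T (Fd.vcl h)) \<xi>)"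
    if \<phi>: "\<phi> \<in> borel_measurable \<omega>" "\<And>\<xi>. \<xi> \<in> space \<omega> \<Longrightarrow> cmod (\<phi> \<xi>) \<le> b" and h: "h \<in> Fd.VF" for \<phi> h b
  proof -
    have \<phi>h: "(\<lambda>\<xi>. \<phi> \<xi> \<cdot>\<^sub>v h \<xi>) \<in> Fd.VF" by (rule Fd.VF_smult[OF \<phi>(1) h AE_I2]) (rule \<phi>(2))
    have "T (Fd.vcl (\<lambda>\<xi>. \<phi> \<xi> \<cdot>\<^sub>v h \<xi>)) = Fd.vcl (transfer S (\<lambda>\<xi>. \<phi> \<xi> \<cdot>\<^sub>v h \<xi>))"
      unfolding T_def transfer_def by (rule R_rep[OF V_mem[OF S Ri_vcl[OF \<phi>h]], symmetric])
    also have "\<dots> = Fd.vcl (\<lambda>\<xi>. \<phi> \<xi> \<cdot>\<^sub>v transfer S h \<xi>)"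
    proof (rule ae_class_cong)
      \<comment> \<open>The criterion is applied to the transfers of \<open>S\<close> and of its
        adjoint. Covariance is demanded of the latter, and holds because the adjoint also lies in
        the commutant.\<close>
      show "AE \<xi> in \<omega>. transfer S (\<lambda>\<xi>. \<phi> \<xi> \<cdot>\<^sub>v h \<xi>) \<xi> = \<phi> \<xi> \<cdot>\<^sub>v transfer S h \<xi>"
        by (rule character_covariant_decomposable[OF transfer_VF[OF S] transfer_VF[OF S'] transfer_adjoint[OF S S' adj']
              transfer_adjoint[OF S' S adj] transfer_character[OF S'] h \<phi>(1), of b])
          (use \<phi>(2) in simp_all)
    qed
    finally show ?thesis unfolding T_def transfer_def .
  qed
  ultimately obtain s where s: "s \<in> Fd.MF" "\<And>a. a \<in> pts Fd.X \<Longrightarrow> T a = mult_op \<omega> dm (Fd.mcl s) a"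
    using Fd.decomposable[of T "nrm V S"] by blast
  have "\<Lambda> (Fd.mcl s) = S"
  proof (rule V_eqI[OF Lambda_V[OF s(1)] S])
    fix f assume f: "f \<in> H"
    have "R (S f) = mult_op \<omega> dm (Fd.mcl s) (Fd.vcl (rep (R f)))"
      using s(2)[OF R_mem[OF f]] unfolding T_R[OF f] R_rep[OF f] .
    hence "R (\<Lambda> (Fd.mcl s) f) = R (S f)"
      unfolding R_Lambda[OF s(1) f] Fd.mult_op_class[OF s(1) rep_R[OF f]] by (rule sym)
    thus "\<Lambda> (Fd.mcl s) f = S f" by (rule R_injD[OF _ Lambda_mem[OF s(1) f] V_mem[OF S f]])
  qed
  thus ?thesis using s(1) by blast
qed

theorem Lambda_isomorphism: "isometric_wstar_isomorphism (Zalgebra \<nu>' lam Phat) V \<Lambda>"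
proof -
  have W: "wstar_algebra V" unfolding V_eq by (rule C.commutant_wstar)
  have lin: "linear_map Fd.Z V \<Lambda>"
    unfolding linear_map_def
  proof (intro conjI ballI allI)
    fix a assume "a \<in> pts Fd.Z"
    then obtain s where s: "s \<in> Fd.MF" "a = Fd.mcl s" unfolding Fd.Z_pts by blast
    show "\<Lambda> a \<in> pts V" unfolding s(2) by (rule Lambda_V[OF s(1)])
    show "\<Lambda> (vscale Fd.Z c a) = vscale V c (\<Lambda> a)" for c
      unfolding s(2) Fd.Z_ops[OF s(1) s(1)] by (rule Lambda_scale[OF s(1) s(1)])
    fix b assume "b \<in> pts Fd.Z"
    then obtain t where t: "t \<in> Fd.MF" "b = Fd.mcl t" unfolding Fd.Z_pts by blast
    show "\<Lambda> (vadd Fd.Z a b) = vadd V (\<Lambda> a) (\<Lambda> b)"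
      unfolding s(2) t(2) Fd.Z_ops[OF s(1) t(1)] by (rule Lambda_add[OF s(1) t(1)])
  qed
  have bij: "bij_betw \<Lambda> (pts Fd.Z) (pts V)"
  proof (rule bij_betw_imageI)
    show "inj_on \<Lambda> (pts Fd.Z)"
    proof (rule inj_onI)
      fix a b assume "a \<in> pts Fd.Z" "b \<in> pts Fd.Z" and eq: "\<Lambda> a = \<Lambda> b"
      then obtain s t where s: "s \<in> Fd.MF" "a = Fd.mcl s" and t: "t \<in> Fd.MF" "b = Fd.mcl t" unfolding Fd.Z_pts by blast
      show "a = b" using eq unfolding s(2) t(2) by (rule Lambda_inj[OF s(1) t(1)])
    qed
    show "\<Lambda> ` pts Fd.Z = pts V"
    proof (rule equalityI)
      show "\<Lambda> ` pts Fd.Z \<subseteq> pts V" using linear_mapD(1)[OF lin] by blast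
      show "pts V \<subseteq> \<Lambda> ` pts Fd.Z"
      proof
        fix S assume "S \<in> pts V"
        from Lambda_surj[OF this] obtain s where s: "s \<in> Fd.MF" "\<Lambda> (Fd.mcl s) = S" by blast
        show "S \<in> \<Lambda> ` pts Fd.Z" unfolding s(2)[symmetric] by (rule imageI[OF Fd.Z_class_mem[OF s(1)]])
      qed
    qed
  qed
  have iso: "isometric_star_isomorphism Fd.Z V \<Lambda>"
    unfolding isometric_star_isomorphism_def
  proof (intro conjI ballI lin bij Lambda_unit)
    fix a assume "a \<in> pts Fd.Z"
    then obtain s where s: "s \<in> Fd.MF" "a = Fd.mcl s" unfolding Fd.Z_pts by blast
    show "\<Lambda> (star Fd.Z a) = star V (\<Lambda> a)" unfolding s(2) Fd.Z_ops[OF s(1) s(1)] by (rule Lambda_star[OF s(1) s(1)])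
    show "nrm V (\<Lambda> a) = nrm Fd.Z a" unfolding s(2) by (rule Lambda_nrm[OF s(1)])
    fix b assume "b \<in> pts Fd.Z"
    then obtain t where t: "t \<in> Fd.MF" "b = Fd.mcl t" unfolding Fd.Z_pts by blast
    show "\<Lambda> (mult Fd.Z a b) = mult V (\<Lambda> a) (\<Lambda> b)"
      unfolding s(2) t(2) Fd.Z_ops[OF s(1) t(1)] by (rule Lambda_mult[OF s(1) t(1)])
  qed
  interpret B: wstar_algebra V by (rule W)
  \<comment> \<open>Beyond the isomorphism it remains to check that the carrier of the matrix fields
    is closed under the operations and that zero is mapped to zero; the axioms and the predual are
    then pulled back.\<close>
  interpret Tr: star_transport V Fd.Z \<Lambda>
  proof (unfold_locales, rule iso)
    fix a b c assume "a \<in> pts Fd.Z" "b \<in> pts Fd.Z"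
    then obtain s t where s: "s \<in> Fd.MF" "a = Fd.mcl s" and t: "t \<in> Fd.MF" "b = Fd.mcl t" unfolding Fd.Z_pts by blast
    show "vadd Fd.Z a b \<in> pts Fd.Z" "mult Fd.Z a b \<in> pts Fd.Z"
      unfolding s(2) t(2) Fd.Z_ops[OF s(1) t(1)] by (rule Fd.Z_class_mem Fd.MF_add[OF s(1) t(1)] Fd.MF_mult[OF s(1) t(1)])+
  next
    fix a c assume "a \<in> pts Fd.Z"
    then obtain s where s: "s \<in> Fd.MF" "a = Fd.mcl s" unfolding Fd.Z_pts by blast
    show "vscale Fd.Z c a \<in> pts Fd.Z" "star Fd.Z a \<in> pts Fd.Z"
      unfolding s(2) Fd.Z_ops[OF s(1) s(1)] by (rule Fd.Z_class_mem Fd.MF_scale[OF s(1)] Fd.MF_adjoint[OF s(1)])+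
  next
    show "vzero Fd.Z \<in> pts Fd.Z" "unit Fd.Z \<in> pts Fd.Z" unfolding Fd.Z_consts by simp_all
    show "\<Lambda> (vzero Fd.Z) = vzero V" by (rule Lambda_zero)
  qed
  show ?thesis
    unfolding isometric_wstar_isomorphism_def Zalgebra_def using Tr.wstar W iso by (intro conjI)
qed

end

theorem theorem8p4:
  fixes \<nu> :: "'g::topological_ab_group_add measure"
    and lam :: "'y measure"
    and \<nu>' :: "('g \<Rightarrow> complex) measure"
    and F :: "('g \<Rightarrow> complex) set \<Rightarrow> (('g \<Rightarrow> complex) \<Rightarrow> complex) set"
    and FI :: "('g \<times> 'y \<Rightarrow> complex) set \<Rightarrow> (('g \<Rightarrow> complex) \<times> 'y \<Rightarrow> complex) set"
    and H :: "('g \<times> 'y \<Rightarrow> complex) set set"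
    and Phat :: "('g \<Rightarrow> complex) \<Rightarrow> ('y \<Rightarrow> complex) set \<Rightarrow> ('y \<Rightarrow> complex) set"
    and q :: "nat \<Rightarrow> ('g \<Rightarrow> complex) \<Rightarrow> 'y \<Rightarrow> complex"
  assumes "locally_compact_space (euclidean :: 'g topology)"
    and "sigma_compact_space (euclidean :: 'g topology)"
    and "metrizable_space (euclidean :: 'g topology)"
    and "haar_measure euclidean (+) \<nu>"
    and "sigma_finite_measure lam"
    and "separable_hspace (L2 \<nu>)"
    and "separable_hspace (L2 lam)"
    and "haar_measure dual_topology dual_mult \<nu>'"
    and "fourier_plancherel \<nu> \<nu>' F"
    and "is_tensor_op \<nu> lam \<nu>' lam F (\<lambda>b. b) FI"
    and "closed_subspace (L2 (\<nu> \<Otimes>\<^sub>M lam)) H"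
    and "\<forall>a. \<forall>f\<in>H. translation \<nu> lam a f \<in> H"
    and "\<forall>\<xi>\<in>dual_group. is_orthogonal_projection (L2 lam) (Phat \<xi>)"
    and "is_direct_integral_of \<nu>' lam (hat_projection \<nu> lam \<nu>' FI H) Phat"
    and "is_fiber_basis \<nu>' lam Phat q"
    and "\<forall>\<xi>\<in>Omega \<nu>' lam Phat. fiber_dim lam Phat \<xi> < \<infinity>"
  shows "isometric_wstar_isomorphism (Zalgebra \<nu>' lam Phat)
           (translation_invariant_operators \<nu> lam H)
           (Lambda_map \<nu> lam \<nu>' Phat q FI H)"
proof -
  interpret translation_setting \<nu> \<nu>' F lam FI H Phat q
    by (rule translation_setting.intro[OF lca_group_dual.intro[OF lca_group.intro lca_group_dual_axioms.intro]
          translation_setting_axioms.intro])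
      (use assms in simp_all)
  show ?thesis by (rule Lambda_isomorphism)
qed

end
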